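(* Let $\Omega\subset\mathbb R^d$ ($d=2,3$) be a bounded Lipschitz domain and suppose that $\varphi_0^\varepsilon\in H^1(\Omega)$ with $\mathcal J_\varepsilon(\varphi_0^\varepsilon)\le C_0$ for some $\varepsilon$-independent constant $C_0$. Say that a weak solution $(p,\mu,\varphi)$ of the Darcy-Cahn-Hilliard problem with initial datum $\varphi_0^\varepsilon$ belongs to the function class $\mathcal F$ if it satisfies the additional regularity conditions $\nabla p+\gamma\varphi\nabla\mu\in L^{\frac{12}{6-d}}((0,T);\mathbf L^2(\Omega))$, $\mu\in L^{\frac{12}{6-d}}((0,T);H^1(\Omega))$ and $\varphi_t\in L^2((0,T);(H^1(\Omega))^* )$. Then weak solutions in the class $\mathcal F$ are unique: any two weak solutions with initial datum $\varphi_0^\varepsilon$ that both belong to $\mathcal F$ coincide.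
   Context: Fix $T>0$, $\gamma>0$, $0<\varepsilon<1$. $F(\varphi)=\frac14(\varphi^2-1)^2$, $f=F'$, i.e. $f(\varphi)=\varphi^3-\varphi$; $\mathcal J_\varepsilon(\varphi):=\int_\Omega[\frac\varepsilon2|\nabla\varphi|^2+\frac1\varepsilon F(\varphi)]dx$. $(\cdot,\cdot)$ is the $L^2(\Omega)$ inner product, $\langle\cdot,\cdot\rangle$ the pairing between $(H^1(\Omega))^*$ and $H^1(\Omega)$, $L_0^2(\Omega)$ the zero-mean functions in $L^2(\Omega)$, $\mathbf L^2(\Omega)=L^2(\Omega)^d$. Weak solution: given $\varphi_0^\varepsilon\in H^1(\Omega)$, a triple $(p,\mu,\varphi)$ is a weak solution of the Darcy-Cahn-Hilliard problem if $p\in L^{4/3}((0,T);H^1(\Omega)\cap L^2_0(\Omega))$, $\mu\in L^2((0,T);H^1(\Omega))$, $\nabla p+\gamma\varphi\nabla\mu\in L^2((0,T);\mathbf L^2(\Omega))$, $\varphi\in L^\infty((0,T);H^1(\Omega))\cap L^4((0,T);L^\infty(\Omega))$, $\varphi_t\in L^{4/3}((0,T);(H^1(\Omega))^* )$, and for almost all $t\in(0,T)$ $(\nabla p+\gamma\varphi\nabla\mu,\nabla q)=0$ for all $q\in H^1(\Omega)$; $\langle\varphi_t,\nu\rangle+\varepsilon(\nabla\mu,\nabla\nu)+(\varphi[\nabla p+\gamma\varphi\nabla\mu],\nabla\nu)=0$ for all $\nu\in H^1(\Omega)$; $(\mu,\psi)-\varepsilon(\nabla\varphi,\nabla\psi)-\frac1\varepsilon(f(\varphi),\psi)=0$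 for all $\psi\in H^1(\Omega)$; with $\varphi(0)=\varphi_0^\varepsilon$ (meaningful since $\varphi\in C^0([0,T];L^2(\Omega))$). *)

theory Defs
  imports "HOL-Analysis.Analysis" "HOL-Probability.Essential_Supremum"
begin

text \<open>
  Elements of Lebesgue, Sobolev and Bochner spaces are represented by functions, not by
  equivalence classes: all the norms below are seminorms on functions that vanish exactly on
  the representatives of zero, and equality of classes is equality almost everywhere.
\<close>

section \<open>Bounded Lipschitz domains\<close>

text \<open>
  Near each boundary point, \<open>\<Omega>\<close> is the strict epigraph of a Lipschitz function over a
  hyperplane \<open>e\<^sup>\<bottom>\<close>; the unit vector \<open>e\<close> takes the place of a rotation of the coordinates.
\<close>

definition lipschitz_boundary :: "'a::euclidean_space set \<Rightarrow> bool" where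
  "lipschitz_boundary \<Omega> \<longleftrightarrow>
     (\<forall>x\<in>frontier \<Omega>. \<exists>r>0. \<exists>e. norm e = 1 \<and>
        (\<exists>L g. L-lipschitz_on {z. z \<bullet> e = 0} g \<and>
           \<Omega> \<inter> ball x r = {y \<in> ball x r. (g (y - (y \<bullet> e) *\<^sub>R e) :: real) < y \<bullet> e}))"

definition bounded_lipschitz_domain :: "'a::euclidean_space set \<Rightarrow> bool" where
  "bounded_lipschitz_domain \<Omega> \<longleftrightarrow>
     open \<Omega> \<and> connected \<Omega> \<and> \<Omega> \<noteq> {} \<and> bounded \<Omega> \<and> lipschitz_boundary \<Omega>"

section \<open>Lebesgue and Sobolev spaces on a domain\<close>

definition L2 :: "'a::euclidean_space set \<Rightarrow> ('a \<Rightarrow> 'b::euclidean_space) set" where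
  "L2 \<Omega> = {u \<in> borel_measurable (lebesgue_on \<Omega>). integrable (lebesgue_on \<Omega>) (\<lambda>x. (norm (u x))\<^sup>2)}"

definition L2_inner ::
    "'a::euclidean_space set \<Rightarrow> ('a \<Rightarrow> 'b::euclidean_space) \<Rightarrow> ('a \<Rightarrow> 'b) \<Rightarrow> real" where
  "L2_inner \<Omega> u v = (LINT x|lebesgue_on \<Omega>. u x \<bullet> v x)"

definition L2_norm :: "'a::euclidean_space set \<Rightarrow> ('a \<Rightarrow> 'b::euclidean_space) \<Rightarrow> real" where
  "L2_norm \<Omega> u = sqrt (L2_inner \<Omega> u u)"

definition L2_zero_mean :: "'a::euclidean_space set \<Rightarrow> ('a \<Rightarrow> real) set" where
  "L2_zero_mean \<Omega> = {u \<in> L2 \<Omega>. (LINT x|lebesgue_on \<Omega>. u x) = 0}"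

text \<open>The library's \<open>esssup\<close> of a non-measurable function is \<open>\<infinity>\<close>.\<close>

definition Linf :: "'a::euclidean_space set \<Rightarrow> ('a \<Rightarrow> real) set" where
  "Linf \<Omega> = {u \<in> borel_measurable (lebesgue_on \<Omega>). esssup (lebesgue_on \<Omega>) (\<lambda>x. ereal \<bar>u x\<bar>) < \<infinity>}"

definition Linf_norm :: "'a::euclidean_space set \<Rightarrow> ('a \<Rightarrow> real) \<Rightarrow> real" where
  "Linf_norm \<Omega> u = real_of_ereal (esssup (lebesgue_on \<Omega>) (\<lambda>x. ereal \<bar>u x\<bar>))"

primrec C_k :: "nat \<Rightarrow> ('a::euclidean_space \<Rightarrow> real) \<Rightarrow> bool" where
  "C_k 0 \<psi> \<longleftrightarrow> continuous_on UNIV \<psi>"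
| "C_k (Suc k) \<psi> \<longleftrightarrow>
     (\<forall>x. \<psi> differentiable (at x)) \<and> (\<forall>i\<in>Basis. C_k k (\<lambda>x. frechet_derivative \<psi> (at x) i))"

text \<open>Test functions in $C_c^\infty(\Omega)$, extended by zero to the whole space.\<close>

definition test_function :: "'a::euclidean_space set \<Rightarrow> ('a \<Rightarrow> real) \<Rightarrow> bool" where
  "test_function \<Omega> \<psi> \<longleftrightarrow>
     (\<forall>k. C_k k \<psi>) \<and> compact (closure {x. \<psi> x \<noteq> 0}) \<and> closure {x. \<psi> x \<noteq> 0} \<subseteq> \<Omega>"

definition is_weak_grad :: "'a::euclidean_space set \<Rightarrow> ('a \<Rightarrow> real) \<Rightarrow> ('a \<Rightarrow> 'a) \<Rightarrow> bool" where
  "is_weak_grad \<Omega> u G \<longleftrightarrow>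
     (\<forall>\<psi>. test_function \<Omega> \<psi> \<longrightarrow> (\<forall>i\<in>Basis.
        (LINT x|lebesgue_on \<Omega>. u x * frechet_derivative \<psi> (at x) i) =
        - (LINT x|lebesgue_on \<Omega>. (G x \<bullet> i) * \<psi> x)))"

definition H1 :: "'a::euclidean_space set \<Rightarrow> ('a \<Rightarrow> real) set" where
  "H1 \<Omega> = {u \<in> L2 \<Omega>. \<exists>G\<in>L2 \<Omega>. is_weak_grad \<Omega> u G}"

text \<open>A representative of the (almost everywhere unique) weak gradient.\<close>

definition grad :: "'a::euclidean_space set \<Rightarrow> ('a \<Rightarrow> real) \<Rightarrow> 'a \<Rightarrow> 'a" where
  "grad \<Omega> u = (SOME G. G \<in> L2 \<Omega> \<and> is_weak_grad \<Omega> u G)"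

lemma grad_H1:
  assumes "u \<in> H1 \<Omega>"
  shows "grad \<Omega> u \<in> L2 \<Omega>" "is_weak_grad \<Omega> u (grad \<Omega> u)"
proof -
  have "\<exists>G. G \<in> L2 \<Omega> \<and> is_weak_grad \<Omega> u G"
    using assms by (auto simp: H1_def)
  then have "grad \<Omega> u \<in> L2 \<Omega> \<and> is_weak_grad \<Omega> u (grad \<Omega> u)"
    unfolding grad_def by (rule someI_ex)
  then show "grad \<Omega> u \<in> L2 \<Omega>" "is_weak_grad \<Omega> u (grad \<Omega> u)" by auto
qed

definition H1_norm :: "'a::euclidean_space set \<Rightarrow> ('a \<Rightarrow> real) \<Rightarrow> real" where
  "H1_norm \<Omega> u = sqrt ((L2_norm \<Omega> u)\<^sup>2 + (L2_norm \<Omega> (grad \<Omega> u))\<^sup>2)"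

text \<open>
  The dual of \<open>H1\<close>. The values of a functional outside \<open>H1 \<Omega>\<close> are irrelevant, and boundedness
  makes it respect equality almost everywhere. The pairing is function application.
\<close>

definition H1_dual :: "'a::euclidean_space set \<Rightarrow> (('a \<Rightarrow> real) \<Rightarrow> real) set" where
  "H1_dual \<Omega> =
     {l. (\<forall>u\<in>H1 \<Omega>. \<forall>v\<in>H1 \<Omega>. \<forall>a b. l (\<lambda>x. a * u x + b * v x) = a * l u + b * l v) \<and>
         (\<exists>C. \<forall>u\<in>H1 \<Omega>. \<bar>l u\<bar> \<le> C * H1_norm \<Omega> u)}"

definition H1_dual_norm :: "'a::euclidean_space set \<Rightarrow> (('a \<Rightarrow> real) \<Rightarrow> real) \<Rightarrow> real" where
  "H1_dual_norm \<Omega> l = (SUP u\<in>{u \<in> H1 \<Omega>. H1_norm \<Omega> u \<le> 1}. \<bar>l u\<bar>)"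

section \<open>Bochner spaces\<close>

text \<open>
  Strong (Bochner) measurability on \<open>(0,T)\<close> with values in a space with carrier \<open>X\<close> and
  seminorm \<open>N\<close>. Subtraction on the value type, always a type of functions here, is pointwise.
\<close>

definition bochner_measurable ::
    "real \<Rightarrow> 'b::minus set \<Rightarrow> ('b \<Rightarrow> real) \<Rightarrow> (real \<Rightarrow> 'b) \<Rightarrow> bool" where
  "bochner_measurable T X N u \<longleftrightarrow>
     (AE t in lebesgue_on {0<..<T}. u t \<in> X) \<and>
     (\<exists>s. (\<forall>n. simple_function (lebesgue_on {0<..<T}) (s n) \<and> s n ` {0<..<T} \<subseteq> X) \<and>
          (AE t in lebesgue_on {0<..<T}. (\<lambda>n. N (u t - s n t)) \<longlonglongrightarrow> 0))"

definition bochner_Lp ::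
    "real \<Rightarrow> real \<Rightarrow> 'b::minus set \<Rightarrow> ('b \<Rightarrow> real) \<Rightarrow> (real \<Rightarrow> 'b) set" where
  "bochner_Lp p T X N =
     {u. bochner_measurable T X N u \<and> integrable (lebesgue_on {0<..<T}) (\<lambda>t. N (u t) powr p)}"

definition bochner_Linf ::
    "real \<Rightarrow> 'b::minus set \<Rightarrow> ('b \<Rightarrow> real) \<Rightarrow> (real \<Rightarrow> 'b) set" where
  "bochner_Linf T X N =
     {u. bochner_measurable T X N u \<and> esssup (lebesgue_on {0<..<T}) (\<lambda>t. ereal (N (u t))) < \<infinity>}"

text \<open>
  The distributional time derivative in the dual of \<open>H1\<close>, where \<open>u t\<close> is identified with
  the functional \<open>v \<mapsto> (u t, v)\<close>. The identity between Bochner integrals in the dual space is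
  written after pairing with an arbitrary \<open>v\<close>, which commutes with the Bochner integral.
\<close>

definition is_time_deriv ::
    "'a::euclidean_space set \<Rightarrow> real \<Rightarrow> (real \<Rightarrow> 'a \<Rightarrow> real) \<Rightarrow> (real \<Rightarrow> ('a \<Rightarrow> real) \<Rightarrow> real) \<Rightarrow> bool"
  where
  "is_time_deriv \<Omega> T u u' \<longleftrightarrow>
     (\<forall>v\<in>H1 \<Omega>. \<forall>\<eta>. test_function {0<..<T} \<eta> \<longrightarrow>
        (LINT t|lebesgue_on {0<..<T}. u' t v * \<eta> t) =
        - (LINT t|lebesgue_on {0<..<T}. L2_inner \<Omega> (u t) v * deriv \<eta> t))"

text \<open>
  \<open>u(0) = u\<^sub>0\<close> is a statement about the representative of \<open>u\<close> that is continuous on \<open>[0,T]\<close> with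
  values in \<open>L2\<close>.
\<close>

definition has_initial_value ::
    "'a::euclidean_space set \<Rightarrow> real \<Rightarrow> (real \<Rightarrow> 'a \<Rightarrow> real) \<Rightarrow> ('a \<Rightarrow> real) \<Rightarrow> bool" where
  "has_initial_value \<Omega> T u u\<^sub>0 \<longleftrightarrow>
     (\<exists>w. (\<forall>t\<in>{0..T}. w t \<in> L2 \<Omega> \<and> ((\<lambda>s. L2_norm \<Omega> (w s - w t)) \<longlongrightarrow> 0) (at t within {0..T})) \<and>
          (AE t in lebesgue_on {0<..<T}. AE x in lebesgue_on \<Omega>. w t x = u t x) \<and>
          (AE x in lebesgue_on \<Omega>. w 0 x = u\<^sub>0 x))"

section \<open>The Darcy-Cahn-Hilliard problem\<close>

definition F_pot :: "real \<Rightarrow> real" where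
  "F_pot s = 1/4 * (s\<^sup>2 - 1)\<^sup>2"

definition f_pot :: "real \<Rightarrow> real" where
  "f_pot s = s ^ 3 - s"

lemma F_pot_has_derivative: "(F_pot has_real_derivative f_pot s) (at s)"
  unfolding F_pot_def [abs_def] f_pot_def
  by (auto intro!: derivative_eq_intros simp: algebra_simps power2_eq_square power3_eq_cube)

text \<open>
  In dimension at most three \<open>H1\<close> embeds into $L^4$ on a bounded Lipschitz domain, so the
  integrand is integrable for every \<open>u \<in> H1 \<Omega>\<close> and the integral has its intended value.
\<close>

definition energy :: "'a::euclidean_space set \<Rightarrow> real \<Rightarrow> ('a \<Rightarrow> real) \<Rightarrow> real" where
  "energy \<Omega> \<epsilon> u =
     (LINT x|lebesgue_on \<Omega>. \<epsilon> / 2 * (norm (grad \<Omega> u x))\<^sup>2 + 1 / \<epsilon> * F_pot (u x))"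

definition flux ::
    "'a::euclidean_space set \<Rightarrow> real \<Rightarrow> (real \<Rightarrow> 'a \<Rightarrow> real) \<Rightarrow> (real \<Rightarrow> 'a \<Rightarrow> real) \<Rightarrow>
     (real \<Rightarrow> 'a \<Rightarrow> real) \<Rightarrow> real \<Rightarrow> 'a \<Rightarrow> 'a" where
  "flux \<Omega> \<gamma> p \<mu> \<phi> t = (\<lambda>x. grad \<Omega> (p t) x + (\<gamma> * \<phi> t x) *\<^sub>R grad \<Omega> (\<mu> t) x)"

definition weak_solution ::
    "'a::euclidean_space set \<Rightarrow> real \<Rightarrow> real \<Rightarrow> real \<Rightarrow> ('a \<Rightarrow> real) \<Rightarrow>
     (real \<Rightarrow> 'a \<Rightarrow> real) \<Rightarrow> (real \<Rightarrow> 'a \<Rightarrow> real) \<Rightarrow> (real \<Rightarrow> 'a \<Rightarrow> real) \<Rightarrow> bool" where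
  "weak_solution \<Omega> T \<gamma> \<epsilon> \<phi>\<^sub>0 p \<mu> \<phi> \<longleftrightarrow>
     p \<in> bochner_Lp (4/3) T (H1 \<Omega> \<inter> L2_zero_mean \<Omega>) (H1_norm \<Omega>) \<and>
     \<mu> \<in> bochner_Lp 2 T (H1 \<Omega>) (H1_norm \<Omega>) \<and>
     flux \<Omega> \<gamma> p \<mu> \<phi> \<in> bochner_Lp 2 T (L2 \<Omega>) (L2_norm \<Omega>) \<and>
     \<phi> \<in> bochner_Linf T (H1 \<Omega>) (H1_norm \<Omega>) \<and>
     \<phi> \<in> bochner_Lp 4 T (Linf \<Omega>) (Linf_norm \<Omega>) \<and>
     (\<exists>\<phi>\<^sub>t. is_time_deriv \<Omega> T \<phi> \<phi>\<^sub>t \<and>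
        \<phi>\<^sub>t \<in> bochner_Lp (4/3) T (H1_dual \<Omega>) (H1_dual_norm \<Omega>) \<and>
        (AE t in lebesgue_on {0<..<T}.
           (\<forall>q\<in>H1 \<Omega>. L2_inner \<Omega> (flux \<Omega> \<gamma> p \<mu> \<phi> t) (grad \<Omega> q) = 0) \<and>
           (\<forall>\<nu>\<in>H1 \<Omega>.
              \<phi>\<^sub>t t \<nu> + \<epsilon> * L2_inner \<Omega> (grad \<Omega> (\<mu> t)) (grad \<Omega> \<nu>)
                + L2_inner \<Omega> (\<lambda>x. \<phi> t x *\<^sub>R flux \<Omega> \<gamma> p \<mu> \<phi> t x) (grad \<Omega> \<nu>) = 0) \<and>
           (\<forall>\<psi>\<in>H1 \<Omega>.
              L2_inner \<Omega> (\<mu> t) \<psi> - \<epsilon> * L2_inner \<Omega> (grad \<Omega> (\<phi> t)) (grad \<Omega> \<psi>)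
                - 1 / \<epsilon> * L2_inner \<Omega> (\<lambda>x. f_pot (\<phi> t x)) \<psi> = 0))) \<and>
     has_initial_value \<Omega> T \<phi> \<phi>\<^sub>0"

definition class_F ::
    "'a::euclidean_space set \<Rightarrow> real \<Rightarrow> real \<Rightarrow> real \<Rightarrow> ('a \<Rightarrow> real) \<Rightarrow>
     (real \<Rightarrow> 'a \<Rightarrow> real) \<Rightarrow> (real \<Rightarrow> 'a \<Rightarrow> real) \<Rightarrow> (real \<Rightarrow> 'a \<Rightarrow> real) \<Rightarrow> bool" where
  "class_F \<Omega> T \<gamma> \<epsilon> \<phi>\<^sub>0 p \<mu> \<phi> \<longleftrightarrow>
     weak_solution \<Omega> T \<gamma> \<epsilon> \<phi>\<^sub>0 p \<mu> \<phi> \<and>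
     flux \<Omega> \<gamma> p \<mu> \<phi> \<in> bochner_Lp (12 / (6 - real DIM('a))) T (L2 \<Omega>) (L2_norm \<Omega>) \<and>
     \<mu> \<in> bochner_Lp (12 / (6 - real DIM('a))) T (H1 \<Omega>) (H1_norm \<Omega>) \<and>
     (\<exists>\<phi>\<^sub>t. is_time_deriv \<Omega> T \<phi> \<phi>\<^sub>t \<and> \<phi>\<^sub>t \<in> bochner_Lp 2 T (H1_dual \<Omega>) (H1_dual_norm \<Omega>))"

end

theory Submission
 imports Defs
begin

text \<open>
 Uniqueness is a Gronwall argument for an energy of the difference of two solutions. At almost
 every time let \<open>\<phi> = \<phi>1 - \<phi>2\<close>, \<open>m = \<mu>1 - \<mu>2\<close>, let \<open>u1\<close>, \<open>u2\<close> be the fluxes \<open>\<nabla>p + \<gamma> \<phi> \<nabla>\<mu>\<close> and \<open>u\<close> their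
 difference, and write \<open>|.|\<close> for the norm of \<open>L2\<close>. Put \<open>P = |\<phi>| + |\<nabla>\<phi>|\<close>, \<open>A = |\<nabla>m|\<close>, \<open>J = |u|\<close>, let
 \<open>k\<close> be \<open>1\<close> plus the norms of \<open>\<nabla>\<mu>1\<close>, \<open>\<nabla>\<mu>2\<close>, \<open>u1\<close>, \<open>u2\<close>, and \<open>d\<close> the dimension. The energy is
 \<open>E = \<epsilon>/2 |\<nabla>\<phi>|^2 + 1/2 |\<phi>|^2\<close>, comparable with \<open>P^2\<close>. Formally its derivative is the pairing of
 \<open>\<phi>\<^sub>t\<close> with \<open>z + \<phi>\<close>, where \<open>z = - \<epsilon> \<Delta>\<phi> = m - (f(\<phi>1) - f(\<phi>2)) / \<epsilon>\<close>.

 Since the fluxes are orthogonal to gradients, the pairing of \<open>\<phi>\<^sub>t\<close> with \<open>m\<close> is at most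
 \<open>- \<epsilon> A^2 - J^2 / \<gamma> + X k (A + J)\<close>, where \<open>X\<close> bounds \<open>|\<phi>(x)|\<close>; the rest \<open>z + \<phi> - m\<close> of the test
 function consists of \<open>\<phi>\<close> and the nonlinear terms, whose gradient is bounded by \<open>X\<close>, \<open>P\<close> and \<open>k\<close>
 (\<open>state_estimate\<close>). The decisive estimate is \<open>X^2 = K (k P^2 + P A / k^(3 - d))\<close>
 (\<open>slice_sup_estimate\<close>). It comes from the elliptic equation
 \<open>- \<epsilon> \<Delta>\<phi> + (f(\<phi>1) - f(\<phi>2)) / \<epsilon> = m\<close> by Moser iteration, where the monotonicity of \<open>s^3\<close> makes the
 nonlinearity harmless. The iteration rests on a Gagliardo--Nirenberg inequality in which the scale
 is a free parameter (\<open>GN_L4\<close>), proved by averaging over cones contained in the Lipschitz domain.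
 Young's inequality absorbs \<open>A\<close> and \<open>J\<close> into the dissipation and leaves \<open>E' \<le> C k^(d+1) E\<close>
 (\<open>rate_arith\<close>). As \<open>d + 1 = 12 / (6 - d)\<close> for \<open>d = 2, 3\<close>, the integrability that defines the class of
 solutions makes the factor integrable in time, and \<open>E = 0\<close> follows (\<open>energy_zero\<close>).

 The formula for \<open>E'\<close> is made rigorous with backward differences: by convexity
 \<open>E(t) - E(t - h)\<close> is at most the inner product of \<open>\<phi>(t) - \<phi>(t - h)\<close> and \<open>z(t) + \<phi>(t)\<close>, and against a fixed
 element of \<open>H1\<close> the increment is the integral of the time derivative. To have only finitely many
 such elements, \<open>m\<close> is approximated by simple functions of time; one lets first \<open>h\<close> and then the error
 of approximation tend to zero. Once \<open>\<phi>1 = \<phi>2\<close>, the potentials agree by their equation, the pressure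
 gradients because the fluxes are orthogonal to gradients, and the pressures because the domain is
 connected and the mean is zero.

 Square-integrable functions on the domain, called \<open>U\<close> in the lemmas, are replaced by Borel functions on
 the whole space that vanish outside it, so that averages and mollifications are integrals with
 respect to \<open>lborel\<close>. The same lemmas on averages serve the mollifier, the cones and the differences in time.
\<close>

section \<open>Smooth functions\<close>

abbreviation fdiff :: "('a::real_normed_vector \<Rightarrow> 'b::real_normed_vector) \<Rightarrow> 'a \<Rightarrow> 'a \<Rightarrow> 'b"
 where "fdiff f x \<equiv> frechet_derivative f (at x)"

abbreviation dtime :: "real \<Rightarrow> real measure" where "dtime T \<equiv> lebesgue_on {0<..<T}"

lemma C_k_Suc_imp: "C_k (Suc k) \<psi> \<Longrightarrow> C_k k \<psi>"
proof (induction k arbitrary: \<psi>)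
 case 0
 then show ?case
  by (auto simp: continuous_on_eq_continuous_at intro!: differentiable_imp_continuous_within)
next
 case (Suc k)
 then show ?case by auto
qed

lemma C_k_continuous: "C_k k \<psi> \<Longrightarrow> continuous_on UNIV \<psi>"
 by (induction k) (auto dest: C_k_Suc_imp simp del: C_k.simps(2))

lemma C_k_const [simp]: "C_k k (\<lambda>x::'a::euclidean_space. c)"
 by (induction k arbitrary: c) (auto simp: frechet_derivative_const)

lemma C_k_add: "C_k k f \<Longrightarrow> C_k k g \<Longrightarrow> C_k k (\<lambda>x. f x + g x)"
proof (induction k arbitrary: f g)
 case (Suc k)
 have "frechet_derivative (\<lambda>x. f x + g x) (at x) = (\<lambda>h. fdiff f x h + fdiff g x h)" for x
  using Suc.prems by (intro frechet_derivative_at[symmetric] has_derivative_add)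
    (auto simp: frechet_derivative_works[symmetric])
 then show ?case using Suc.prems by (simp add: Suc.IH)
qed (auto intro: continuous_intros)

lemma C_k_mult: "C_k k f \<Longrightarrow> C_k k g \<Longrightarrow> C_k k (\<lambda>x. f x * g x)"
proof (induction k arbitrary: f g)
 case (Suc k)
 have "frechet_derivative (\<lambda>x. f x * g x) (at x) = (\<lambda>h. f x * fdiff g x h + fdiff f x h * g x)" for x
  using Suc.prems by (intro frechet_derivative_at[symmetric] has_derivative_mult)
    (auto simp: frechet_derivative_works[symmetric])
 moreover have "C_k k f" "C_k k g" using Suc.prems C_k_Suc_imp by blast+
 ultimately show ?case using Suc.prems by (simp add: Suc.IH C_k_add)
qed (auto intro: continuous_intros)

lemma C_k_inner: "C_k k (\<lambda>x. x \<bullet> a)"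
proof (cases k)
 case (Suc n)
 have "((\<lambda>x. x \<bullet> a) has_derivative (\<lambda>h. h \<bullet> a)) (at x)" for x
  by (auto intro!: derivative_eq_intros)
 then have "frechet_derivative (\<lambda>x. x \<bullet> a) (at x) = (\<lambda>h. h \<bullet> a)" for x
  by (rule frechet_derivative_at[symmetric])
 with Suc show ?thesis by auto
qed (auto intro: continuous_intros)

lemma C_k_sum: "(\<And>i. i \<in> I \<Longrightarrow> C_k k (f i)) \<Longrightarrow> C_k k (\<lambda>x. \<Sum>i\<in>I. f i x)"
 by (induction I rule: infinite_finite_induct) (auto intro!: C_k_add)

lemma C_k_affine:
 "C_k k f \<Longrightarrow> C_k k (\<lambda>x. f (c *\<^sub>R x + a))"
proof (induction k arbitrary: f)
 case 0
 have "continuous_on UNIV (\<lambda>x. c *\<^sub>R x + a)" by (auto intro!: continuous_intros)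
 from continuous_on_compose2[OF _ this, of UNIV f] 0 show ?case by auto
next
 case (Suc k)
 have d: "((\<lambda>x. f (c *\<^sub>R x + a)) has_derivative (\<lambda>h. c * frechet_derivative f (at (c *\<^sub>R x + a)) h)) (at x)" for x
 proof -
  have f: "(f has_derivative frechet_derivative f (at (c *\<^sub>R x + a))) (at (c *\<^sub>R x + a))"
   using Suc.prems by (auto simp: frechet_derivative_works[symmetric])
  have "((\<lambda>x. f (c *\<^sub>R x + a)) has_derivative (\<lambda>h. frechet_derivative f (at (c *\<^sub>R x + a)) (c *\<^sub>R h))) (at x)"
   by (rule has_derivative_compose[of "\<lambda>x. c *\<^sub>R x + a", OF _ f]) (auto intro!: derivative_eq_intros)
  then show ?thesis
   using has_derivative_bounded_linear[OF f] by (simp add: linear_simps)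
 qed
 have "frechet_derivative (\<lambda>x. f (c *\<^sub>R x + a)) (at x) = (\<lambda>h. c * frechet_derivative f (at (c *\<^sub>R x + a)) h)" for x
  by (rule frechet_derivative_at[OF d, symmetric])
 moreover have "(\<lambda>x. f (c *\<^sub>R x + a)) differentiable (at x)" for x using d by (auto simp: differentiable_def)
 ultimately show ?case using Suc.prems Suc.IH[of "\<lambda>x. fdiff f x i" for i] by (simp add: C_k_mult)
qed

text \<open>Division by powers of \<open>s\<close> makes the family closed under differentiation up to linear combinations,
 so that a single induction over all \<open>n\<close> proves smoothness.\<close>

definition hexp :: "nat \<Rightarrow> real \<Rightarrow> real" where
 "hexp n s = (if s > 0 then exp (- 1 / s) / s ^ n else 0)"

lemma hexp_deriv: "(hexp n has_real_derivative (hexp (n + 2) s - n * hexp (Suc n) s)) (at s)"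
proof -
 consider "s > 0" | "s < 0" | "s = 0" by linarith
 then show ?thesis
 proof cases
  case 1
  have "((\<lambda>s. exp (- 1 / s) / s ^ n) has_real_derivative (hexp (n + 2) s - n * hexp (Suc n) s)) (at s)"
  proof -
   have "((\<lambda>s. exp (- 1 / s) * inverse s ^ n) has_real_derivative
     exp (- 1 / s) * (1 / s^2) * inverse s ^ n + exp (- 1 / s) * (n * inverse s ^ (n - 1) * (- (1 / s^2)))) (at s)"
    using 1 by (auto intro!: derivative_eq_intros simp: power2_eq_square divide_inverse)
   moreover have "exp (- 1 / s) * (1 / s^2) * inverse s ^ n + exp (- 1 / s) * (n * inverse s ^ (n - 1) * (- (1 / s^2)))
     = hexp (n + 2) s - n * hexp (Suc n) s"
   proof (cases n)
    case (Suc m)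
    have "exp (- 1 / s) * (1 / s^2) * inverse s ^ n = exp (- 1 / s) / s ^ (n + 2)"
     by (simp add: power_add power2_eq_square field_simps)
    moreover have "inverse s ^ (n - 1) * (1 / s^2) = 1 / s ^ Suc n"
     using Suc by (simp add: power2_eq_square field_simps)
    ultimately show ?thesis using 1 by (simp add: hexp_def algebra_simps)
   qed (use 1 in \<open>simp add: hexp_def power2_eq_square\<close>)
   ultimately show ?thesis by (simp add: divide_inverse power_inverse)
  qed
  moreover have "\<forall>\<^sub>F x in nhds s. exp (- 1 / x) / x ^ n = hexp n x"
   using eventually_nhds_in_open[of "{0<..}" s] 1 by (auto elim!: eventually_mono simp: hexp_def)
  ultimately show ?thesis by (subst (asm) DERIV_cong_ev[OF refl _ refl])
 next
  case 2
  have "\<forall>\<^sub>F x in nhds s. 0 = hexp n x"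
   using eventually_nhds_in_open[of "{..<0}" s] 2 by (auto elim!: eventually_mono simp: hexp_def)
  then have "(hexp n has_real_derivative 0) (at s)"
   using DERIV_const[of 0 "at s"] by (subst (asm) DERIV_cong_ev[OF refl _ refl])
  then show ?thesis using 2 by (simp add: hexp_def)
 next
  case 3
  have "((\<lambda>h. inverse h ^ Suc n / exp (inverse h)) \<longlongrightarrow> (0::real)) (at_right 0)"
   by (rule filterlim_compose[OF tendsto_power_div_exp_0 filterlim_inverse_at_top_right])
  then have "((\<lambda>h. hexp n h / h) \<longlongrightarrow> 0) (at_right 0)"
   by (rule Lim_transform_eventually)
    (auto simp: hexp_def eventually_at_filter exp_minus field_simps)
  moreover have "((\<lambda>h. hexp n h / h) \<longlongrightarrow> 0) (at_left 0)"
   by (rule tendsto_eventually) (auto simp: hexp_def eventually_at_filter)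
  ultimately have "((\<lambda>h. hexp n h / h) \<longlongrightarrow> 0) (at 0)"
   by (simp add: filterlim_at_split)
  then show ?thesis using 3 by (simp add: DERIV_def hexp_def)
 qed
qed

lemma C_k_hexp: "C_k k (\<lambda>x::'a::euclidean_space. hexp n (1 - x \<bullet> x))"
proof (induction k arbitrary: n)
 case 0
 have "continuous_on UNIV (hexp n)"
  by (rule DERIV_continuous_on) (rule DERIV_subset[OF hexp_deriv], simp)
 from continuous_on_compose2[OF this, of UNIV "\<lambda>x::'a. 1 - x \<bullet> x"] show ?case
  by (simp add: continuous_intros)
next
 case (Suc k)
 let ?D = "\<lambda>x. hexp (n + 2) (1 - x \<bullet> x) - n * hexp (Suc n) (1 - x \<bullet> x)"
 have d: "((\<lambda>x::'a. hexp n (1 - x \<bullet> x)) has_derivative (\<lambda>h. (- 2 * (x \<bullet> h)) * ?D x)) (at x)" for x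
 proof -
  have "((\<lambda>x::'a. 1 - x \<bullet> x) has_derivative (\<lambda>h. - 2 * (x \<bullet> h))) (at x)"
   by (auto intro!: derivative_eq_intros simp: inner_commute)
  from DERIV_compose_FDERIV[OF hexp_deriv this] show ?thesis .
 qed
 have eq: "frechet_derivative (\<lambda>x::'a. hexp n (1 - x \<bullet> x)) (at x) = (\<lambda>h. (- 2 * (x \<bullet> h)) * ?D x)" for x
  by (rule frechet_derivative_at[OF d, symmetric])
 have "C_k k (\<lambda>x::'a. (- 2 * (x \<bullet> i)) * (hexp (n + 2) (1 - x \<bullet> x) + (- real n) * hexp (Suc n) (1 - x \<bullet> x)))" for i
  by (intro C_k_mult C_k_add C_k_const C_k_inner Suc.IH)
 then have "C_k k (\<lambda>x::'a. (- 2 * (x \<bullet> i)) * ?D x)" for i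
  by (simp only: minus_mult_left[symmetric] add_uminus_conv_diff)
 moreover have "(\<lambda>x::'a. hexp n (1 - x \<bullet> x)) differentiable (at x)" for x
  using d unfolding differentiable_def by blast
 ultimately show ?case unfolding C_k.simps eq by blast
qed

lemma test_function_mult:
 assumes f: "\<And>k. C_k k f" and psi: "test_function U \<psi>"
 shows "test_function U (\<lambda>x. f x * \<psi> x)"
proof -
 have sub: "closure {x. f x * \<psi> x \<noteq> 0} \<subseteq> closure {x. \<psi> x \<noteq> 0}"
  by (rule closure_mono) auto
 have "compact (closure {x. \<psi> x \<noteq> 0} \<inter> closure {x. f x * \<psi> x \<noteq> 0})"
  using psi by (intro compact_Int_closed) (auto simp: test_function_def)
 then have "compact (closure {x. f x * \<psi> x \<noteq> 0})"
  using sub by (simp add: Int_absorb1)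
 then show ?thesis using f psi sub C_k_mult[of _ f \<psi>] unfolding test_function_def by blast
qed

lemma test_function_continuous: "test_function U \<psi> \<Longrightarrow> continuous_on UNIV \<psi>"
 unfolding test_function_def using C_k_continuous by blast

lemma test_function_has_derivative:
 assumes "test_function U \<psi>"
 shows "(\<psi> has_derivative fdiff \<psi> x) (at x)"
proof -
 have "C_k (Suc 0) \<psi>" using assms unfolding test_function_def by blast
 then show ?thesis by (simp add: frechet_derivative_works[symmetric])
qed

lemma test_function_partial:
 assumes "test_function U \<psi>" "i \<in> Basis"
 shows "test_function U (\<lambda>x. fdiff \<psi> x i)"
proof -
 let ?S = "closure {x. \<psi> x \<noteq> 0}"
 have "{x. fdiff \<psi> x i \<noteq> 0} \<subseteq> ?S"
 proof safe
  fix x assume nz: "fdiff \<psi> x i \<noteq> 0"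
  show "x \<in> ?S"
  proof (rule ccontr)
   assume "x \<notin> ?S"
   then have "\<forall>\<^sub>F y in nhds x. y \<in> - ?S" by (intro eventually_nhds_in_open) auto
   then have ev: "\<forall>\<^sub>F y in nhds x. 0 = \<psi> y"
    using closure_subset[of "{x. \<psi> x \<noteq> 0}"] by (auto elim!: eventually_mono)
   have "(\<psi> has_derivative (\<lambda>h. 0)) (at x)"
    by (rule has_derivative_transform_eventually[OF has_derivative_const])
     (use ev eventually_nhds_x_imp_x[OF ev] in \<open>auto simp: eventually_at_filter elim: eventually_mono\<close>)
   then have "fdiff \<psi> x = (\<lambda>h. 0)" by (rule frechet_derivative_at[symmetric])
   with nz show False by simp
  qed
 qed
 then have sub: "closure {x. fdiff \<psi> x i \<noteq> 0} \<subseteq> ?S"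
  by (simp add: closure_minimal)
 have "compact (?S \<inter> closure {x. fdiff \<psi> x i \<noteq> 0})"
  using assms by (intro compact_Int_closed) (auto simp: test_function_def)
 then have "compact (closure {x. fdiff \<psi> x i \<noteq> 0})"
  using sub by (simp add: Int_absorb1)
 moreover have "C_k k (\<lambda>x. fdiff \<psi> x i)" for k
  using assms C_k.simps(2)[of k \<psi>] unfolding test_function_def by blast
 ultimately show ?thesis using sub assms unfolding test_function_def by blast
qed

lemma test_function_bounded:
 assumes "test_function U \<psi>"
 obtains B where "B > 0" "\<And>x. \<bar>\<psi> x\<bar> \<le> B"
proof -
 have "compact (\<psi> ` closure {x. \<psi> x \<noteq> 0})"
  using assms test_function_continuous[OF assms]
  by (intro compact_continuous_image) (auto simp: test_function_def intro: continuous_on_subset)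
 then have "bounded (\<psi> ` closure {x. \<psi> x \<noteq> 0})" by (rule compact_imp_bounded)
 then obtain B where B: "\<And>x. x \<in> closure {x. \<psi> x \<noteq> 0} \<Longrightarrow> \<bar>\<psi> x\<bar> \<le> B" unfolding bounded_iff by auto
 show ?thesis
 proof (rule that[of "max B 1"])
  fix x show "\<bar>\<psi> x\<bar> \<le> max B 1"
   using B[of x] closure_subset[of "{x. \<psi> x \<noteq> 0}"] by (cases "\<psi> x = 0") (auto simp: le_max_iff_disj)
 qed simp
qed

lemma test_function_borel [measurable_dest]:
 "test_function U \<psi> \<Longrightarrow> \<psi> \<in> borel_measurable borel"
 by (intro borel_measurable_continuous_onI test_function_continuous)

text \<open>The unnormalised standard mollifier.\<close>

definition bump :: "'a::euclidean_space \<Rightarrow> real" where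
 "bump x = hexp 0 (1 - x \<bullet> x)"

lemma bump_eq: "bump x = (if norm x < 1 then exp (- 1 / (1 - x \<bullet> x)) else 0)"
 using power2_norm_eq_inner[of x] abs_square_less_1[of "norm x"] by (auto simp: bump_def hexp_def)

lemma bump_nonneg: "0 \<le> bump x"
 by (simp add: bump_eq)

lemma bump_le_1: "bump x \<le> 1"
 using power2_norm_eq_inner[of x] abs_square_less_1[of "norm x"] by (auto simp: bump_eq)

lemma test_function_bump: "test_function UNIV (bump :: 'a::euclidean_space \<Rightarrow> real)"
proof -
 have "{x::'a. bump x \<noteq> 0} \<subseteq> cball 0 1" by (auto simp: bump_eq split: if_splits)
 then have "closure {x::'a. bump x \<noteq> 0} \<subseteq> cball 0 1" by (simp add: closure_minimal)
 then have "compact (closure {x::'a. bump x \<noteq> 0})"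
  by (meson bounded_cball bounded_subset closed_closure compact_eq_bounded_closed)
 then show ?thesis
  unfolding test_function_def bump_def[abs_def] using C_k_hexp by auto
qed

section \<open>Averages of square-integrable functions\<close>

lemma Cauchy_Schwarz_integral:
 fixes f g :: "'a \<Rightarrow> real"
 assumes [measurable]: "f \<in> borel_measurable M" "g \<in> borel_measurable M"
  and f2: "integrable M (\<lambda>x. (f x)^2)" and g2: "integrable M (\<lambda>x. (g x)^2)"
 shows "integrable M (\<lambda>x. f x * g x)"
  and "(\<integral>x. f x * g x \<partial>M)^2 \<le> (\<integral>x. (f x)^2 \<partial>M) * (\<integral>x. (g x)^2 \<partial>M)"
  and "(\<integral>x. \<bar>f x\<bar> * \<bar>g x\<bar> \<partial>M)^2 \<le> (\<integral>x. (f x)^2 \<partial>M) * (\<integral>x. (g x)^2 \<partial>M)"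
proof -
 have b: "\<bar>f x * g x\<bar> \<le> (f x)^2 + (g x)^2" for x
 proof -
  have "0 \<le> \<bar>f x\<bar> * \<bar>g x\<bar>" by simp
  with sum_squares_bound[of "\<bar>f x\<bar>" "\<bar>g x\<bar>"] show ?thesis unfolding abs_mult by (simp only: power2_abs mult.assoc)
 qed
 show i: "integrable M (\<lambda>x. f x * g x)"
  by (rule Bochner_Integration.integrable_bound[OF Bochner_Integration.integrable_add[OF f2 g2]]) (use b in auto)
 then have i': "integrable M (\<lambda>x. \<bar>f x\<bar> * \<bar>g x\<bar>)" by (subst abs_mult[symmetric]) (rule integrable_abs)
 have "(\<integral>\<^sup>+x. ennreal \<bar>f x\<bar> * ennreal \<bar>g x\<bar> \<partial>M)^2
   \<le> (\<integral>\<^sup>+x. ennreal \<bar>f x\<bar> ^ 2 \<partial>M) * (\<integral>\<^sup>+x. ennreal \<bar>g x\<bar> ^ 2 \<partial>M)"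
  by (rule Cauchy_Schwarz_nn_integral) auto
 also have "(\<integral>\<^sup>+x. ennreal \<bar>f x\<bar> * ennreal \<bar>g x\<bar> \<partial>M) = ennreal (\<integral>x. \<bar>f x\<bar> * \<bar>g x\<bar> \<partial>M)"
  using i' by (subst nn_integral_eq_integral[symmetric]) (auto simp: ennreal_mult')
 also have "(\<integral>\<^sup>+x. ennreal \<bar>f x\<bar> ^ 2 \<partial>M) = ennreal (\<integral>x. (f x)^2 \<partial>M)"
  using f2 by (subst nn_integral_eq_integral[symmetric]) (auto simp: ennreal_power)
 also have "(\<integral>\<^sup>+x. ennreal \<bar>g x\<bar> ^ 2 \<partial>M) = ennreal (\<integral>x. (g x)^2 \<partial>M)"
  using g2 by (subst nn_integral_eq_integral[symmetric]) (auto simp: ennreal_power)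
 finally show *: "(\<integral>x. \<bar>f x\<bar> * \<bar>g x\<bar> \<partial>M)^2 \<le> (\<integral>x. (f x)^2 \<partial>M) * (\<integral>x. (g x)^2 \<partial>M)"
  by (simp add: ennreal_power flip: ennreal_mult)
 have "\<bar>\<integral>x. f x * g x \<partial>M\<bar> \<le> (\<integral>x. \<bar>f x\<bar> * \<bar>g x\<bar> \<partial>M)"
  using integral_abs_bound[of M "\<lambda>x. f x * g x"] by (simp add: abs_mult)
 then have "(\<integral>x. f x * g x \<partial>M)^2 \<le> (\<integral>x. \<bar>f x\<bar> * \<bar>g x\<bar> \<partial>M)^2"
  by (subst abs_le_square_iff[symmetric]) auto
 with * show "(\<integral>x. f x * g x \<partial>M)^2 \<le> (\<integral>x. (f x)^2 \<partial>M) * (\<integral>x. (g x)^2 \<partial>M)" by linarith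
qed

text \<open>Functions on the whole space and not classes on a domain, so that translates and convolution-type integrals
 are defined at every point.\<close>

definition sqint :: "('a::euclidean_space \<Rightarrow> real) \<Rightarrow> bool" where
 "sqint w \<longleftrightarrow> w \<in> borel_measurable borel \<and> integrable lborel (\<lambda>x. (w x)^2)"

lemma sqint_borel [measurable_dest]: "sqint w \<Longrightarrow> w \<in> borel_measurable borel"
 by (simp add: sqint_def)

lemma sqint_integrable: "sqint w \<Longrightarrow> integrable lborel (\<lambda>x. (w x)^2)"
 by (simp add: sqint_def)

lemma sqint_mult_integrable: "sqint f \<Longrightarrow> sqint g \<Longrightarrow> integrable lborel (\<lambda>x. f x * g x)"
 using Cauchy_Schwarz_integral(1)[of f lborel g] by (simp add: sqint_def)

lemma sqint_cmult: "sqint f \<Longrightarrow> sqint (\<lambda>x. c * f x)"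
 by (auto simp: sqint_def power_mult_distrib)

lemma sqint_add: assumes "sqint f" "sqint g" shows "sqint (\<lambda>x. f x + g x)"
 using assms sqint_mult_integrable[OF assms]
 by (auto simp: sqint_def power2_sum mult.assoc intro!: Bochner_Integration.integrable_add)

lemma sqint_diff: assumes "sqint f" "sqint g" shows "sqint (\<lambda>x. f x - g x)"
 using sqint_add[OF assms(1) sqint_cmult[OF assms(2), of "-1"]] by simp

lemma sqint_bounded_mult:
 assumes f: "sqint f" and [measurable]: "g \<in> borel_measurable borel" and b: "\<And>x. \<bar>g x\<bar> \<le> K"
 shows "sqint (\<lambda>x. g x * f x)"
proof -
 note [measurable] = sqint_borel[OF f]
 have "(g x)^2 \<le> K^2" for x using b[of x] by (metis abs_ge_zero power2_abs power_mono)
 then have "integrable lborel (\<lambda>x. (g x * f x)^2)"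
  by (intro Bochner_Integration.integrable_bound[OF integrable_mult_right[OF sqint_integrable[OF f], of "K^2"]])
   (auto simp: power_mult_distrib intro!: mult_right_mono)
 then show ?thesis by (simp add: sqint_def)
qed

lemma nn_integral_scale:
 fixes f :: "'a::euclidean_space \<Rightarrow> ennreal"
 assumes [measurable]: "f \<in> borel_measurable borel" and "t \<noteq> 0"
 shows "(\<integral>\<^sup>+x. f x \<partial>lborel) = ennreal (\<bar>t\<bar> ^ DIM('a)) * (\<integral>\<^sup>+z. f (a + t *\<^sub>R z) \<partial>lborel)"
 by (subst lborel_affine[OF \<open>t \<noteq> 0\<close>, of a])
   (simp add: nn_integral_density nn_integral_distr nn_integral_cmult)

lemma sqint_scale:
 fixes w :: "'a::euclidean_space \<Rightarrow> real"
 assumes w: "sqint w" and t: "t > 0"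
 shows "sqint (\<lambda>z. w (a + t *\<^sub>R z))"
  and "(LBINT z. (w (a + t *\<^sub>R z))^2) = (LBINT x. (w x)^2) / t ^ DIM('a)"
proof -
 note [measurable] = sqint_borel[OF w]
 have e: "ennreal (LBINT x. (w x)^2) = ennreal (t ^ DIM('a)) * (\<integral>\<^sup>+z. ennreal ((w (a + t *\<^sub>R z))^2) \<partial>lborel)"
  using nn_integral_scale[of "\<lambda>x. ennreal ((w x)^2)" t a] t sqint_integrable[OF w]
  by (simp add: nn_integral_eq_integral)
 have fin: "(\<integral>\<^sup>+z. ennreal ((w (a + t *\<^sub>R z))^2) \<partial>lborel) < \<infinity>"
 proof (rule ccontr)
  assume "\<not> ?thesis"
  then have "(\<integral>\<^sup>+z. ennreal ((w (a + t *\<^sub>R z))^2) \<partial>lborel) = \<infinity>" by (simp add: less_top[symmetric])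
  with e t show False by (simp add: ennreal_mult_top)
 qed
 then have i: "integrable lborel (\<lambda>z. (w (a + t *\<^sub>R z))^2)"
  by (intro integrableI_nonneg) auto
 then show "sqint (\<lambda>z. w (a + t *\<^sub>R z))" by (simp add: sqint_def)
 have "ennreal (LBINT x. (w x)^2) = ennreal (t ^ DIM('a) * (LBINT z. (w (a + t *\<^sub>R z))^2))"
  using e i t by (simp add: nn_integral_eq_integral ennreal_mult)
 then have "(LBINT x. (w x)^2) = t ^ DIM('a) * (LBINT z. (w (a + t *\<^sub>R z))^2)"
  using t by (subst (asm) ennreal_inj) (auto intro!: mult_nonneg_nonneg)
 then show "(LBINT z. (w (a + t *\<^sub>R z))^2) = (LBINT x. (w x)^2) / t ^ DIM('a)"
  using t by (simp add: field_simps)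
qed

lemma integrable_cball: "integrable lborel (\<lambda>x::'a::euclidean_space. (c::real) * indicator (cball a r) x)"
 using emeasure_lborel_cball_finite[of a r]
 by (intro integrable_mult_right integrable_real_indicator) auto

lemma sqint_truncation_approx:
 fixes w :: "'a::euclidean_space \<Rightarrow> real"
 assumes w: "sqint w"
 shows "(\<lambda>k. LBINT x. (w x - indicator (cball 0 (real k)) x * max (- real k) (min (real k) (w x)))^2) \<longlonglongrightarrow> 0"
proof -
 let ?d = "\<lambda>k x. w x - indicator (cball 0 (real k)) x * max (- real k) (min (real k) (w x))"
 note [measurable] = sqint_borel[OF w]
 have [measurable]: "cball (0::'a) r \<in> sets borel" for r by simp
 have "(\<lambda>k. LBINT x. (?d k x)^2) \<longlonglongrightarrow> integral\<^sup>L lborel (\<lambda>x::'a. 0)"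
 proof (rule integral_dominated_convergence[OF _ _ sqint_integrable[OF w]])
  show "AE x in lborel. (\<lambda>k. (?d k x)^2) \<longlonglongrightarrow> 0"
  proof (rule AE_I2)
   fix x
   have "\<forall>\<^sub>F k in sequentially. k \<ge> nat \<lceil>norm x\<rceil> + nat \<lceil>\<bar>w x\<bar>\<rceil>" by (rule eventually_ge_at_top)
   then have "\<forall>\<^sub>F k in sequentially. 0 = (?d k x)^2"
   proof (rule eventually_mono)
    fix k assume "k \<ge> nat \<lceil>norm x\<rceil> + nat \<lceil>\<bar>w x\<bar>\<rceil>"
    then have "norm x \<le> real k" "\<bar>w x\<bar> \<le> real k" by linarith+
    then show "0 = (?d k x)^2" by auto
   qed
   then show "(\<lambda>k. (?d k x)^2) \<longlonglongrightarrow> 0"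
    by (rule Lim_transform_eventually[OF tendsto_const])
  qed
  show "AE x in lborel. norm ((?d k x)^2) \<le> (w x)^2" for k
   by (rule AE_I2) (auto simp: abs_le_square_iff[symmetric] indicator_def)
  show "(\<lambda>x. (?d k x)^2) \<in> borel_measurable lborel" for k
   by measurable
 qed simp
 then show ?thesis by simp
qed

lemma bounded_continuous_approx:
 fixes v :: "'a::euclidean_space \<Rightarrow> real"
 assumes [measurable]: "v \<in> borel_measurable borel"
  and v0: "\<And>x. norm x > K \<Longrightarrow> v x = 0" and vK: "\<And>x. \<bar>v x\<bar> \<le> K" and e: "e > 0"
 obtains g where "continuous_on UNIV g" "\<And>x. norm x > K + 1 \<Longrightarrow> g x = 0"
  "\<And>x. \<bar>g x\<bar> \<le> K" "(LBINT x. (v x - g x)^2) < e"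
proof -
 have K: "K \<ge> 0" using vK[of 0] by linarith
 have "v measurable_on UNIV"
  by (intro lebesgue_measurable_imp_measurable_on) (auto intro!: measurable_completion)
 then obtain N h where N: "negligible N" and h: "\<And>n. continuous_on UNIV (h n)"
  and lim: "\<And>x. x \<notin> N \<Longrightarrow> (\<lambda>n. h n x) \<longlonglongrightarrow> v x"
  unfolding measurable_on_def by auto
 define c where "c x = max 0 (min 1 (K + 1 - norm x))" for x :: 'a
 have c01: "0 \<le> c x" "c x \<le> 1" for x by (auto simp: c_def)
 define g where "g n x = c x * max (- K) (min K (h n x))" for n x
 have cont: "continuous_on UNIV (g n)" for n
  unfolding g_def c_def by (intro continuous_intros h)
 note [measurable] = borel_measurable_continuous_onI[OF cont]
 have g0: "g n x = 0" if "norm x > K + 1" for n x using that by (auto simp: g_def c_def)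
 have gK: "\<bar>g n x\<bar> \<le> K" for n x
 proof -
  have "\<bar>max (- K) (min K (h n x))\<bar> \<le> K" using K by auto
  then have "\<bar>c x\<bar> * \<bar>max (- K) (min K (h n x))\<bar> \<le> 1 * K" using c01[of x] by (intro mult_mono) auto
  then show ?thesis by (simp add: g_def abs_mult)
 qed
 have "(\<lambda>n. LBINT x. (v x - g n x)^2) \<longlonglongrightarrow> integral\<^sup>L lborel (\<lambda>x::'a. 0)"
 proof (rule integral_dominated_convergence)
  show "integrable lborel (\<lambda>x::'a. (2 * K)^2 * indicator (cball 0 (K + 1)) x)"
   by (rule integrable_cball)
  show "AE x in lborel. norm ((v x - g n x)^2) \<le> (2 * K)^2 * indicator (cball 0 (K + 1)) x" for n
  proof (rule AE_I2)
   fix x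
   have "\<bar>v x - g n x\<bar> \<le> 2 * K" using vK[of x] gK[of n x] by linarith
   then have "(v x - g n x)^2 \<le> (2 * K)^2" by (subst abs_le_square_iff[symmetric]) auto
   then show "norm ((v x - g n x)^2) \<le> (2 * K)^2 * indicator (cball 0 (K + 1)) x"
    using v0[of x] g0[of x n] by (cases "norm x > K + 1") (auto simp: indicator_def)
  qed
  have "AE x in lebesgue. x \<notin> N" using N by (auto simp: negligible_iff_null_sets dest: AE_not_in)
  then have "AE x in lebesgue. (\<lambda>n. (v x - g n x)^2) \<longlonglongrightarrow> 0"
  proof eventually_elim
   case (elim x)
   have "(\<lambda>n. (v x - g n x)^2) \<longlonglongrightarrow> (v x - c x * max (- K) (min K (v x)))^2"
    unfolding g_def by (intro tendsto_intros lim elim)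
   moreover have "c x * max (- K) (min K (v x)) = v x"
    using vK[of x] v0[of x] by (cases "norm x > K") (auto simp: c_def)
   ultimately show ?case by simp
  qed
  then show "AE x in lborel. (\<lambda>n. (v x - g n x)^2) \<longlonglongrightarrow> 0" by (simp only: AE_completion_iff)
 qed auto
 then have "\<forall>\<^sub>F n in sequentially. (LBINT x. (v x - g n x)^2) < e"
  using e by (intro order_tendstoD(2)) auto
 then obtain n where "(LBINT x. (v x - g n x)^2) < e"
  by (meson eventually_happens trivial_limit_sequentially)
 with that[of "g n"] cont g0 gK show ?thesis by blast
qed

lemma sqint_continuous:
 fixes g :: "'a::euclidean_space \<Rightarrow> real"
 assumes c: "continuous_on UNIV g" and g0: "\<And>x. norm x > K \<Longrightarrow> g x = 0" and gK: "\<And>x. \<bar>g x\<bar> \<le> M"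
 shows "sqint g"
proof -
 note [measurable] = borel_measurable_continuous_onI[OF c]
 have "integrable lborel (\<lambda>x. (g x)^2)"
 proof (rule Bochner_Integration.integrable_bound)
  show "integrable lborel (\<lambda>x::'a. M^2 * indicator (cball 0 K) x)"
   by (rule integrable_cball)
  show "AE x in lborel. norm ((g x)^2) \<le> norm (M^2 * indicator (cball 0 K) x)"
  proof (rule AE_I2)
   fix x show "norm ((g x)^2) \<le> norm (M^2 * indicator (cball 0 K) x)"
    using g0[of x] gK[of x] by (cases "norm x > K") (auto simp: abs_le_square_iff[symmetric])
  qed
 qed auto
 then show ?thesis by (simp add: sqint_def)
qed

lemma sqint_continuous_approx:
 fixes w :: "'a::euclidean_space \<Rightarrow> real"
 assumes w: "sqint w" and e: "e > 0"
 obtains g K M where "continuous_on UNIV g" "\<And>x. norm x > K \<Longrightarrow> g x = 0" "\<And>x. \<bar>g x\<bar> \<le> M"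
  "(LBINT x. (w x - g x)^2) < e"
proof -
 note [measurable] = sqint_borel[OF w]
 define v where "v k x = indicator (cball 0 (real k)) x * max (- real k) (min (real k) (w x))" for k x
 have [measurable]: "cball (0::'a) r \<in> sets borel" for r by simp
 have [measurable]: "v k \<in> borel_measurable borel" for k unfolding v_def by measurable
 have "\<forall>\<^sub>F k in sequentially. (LBINT x. (w x - v k x)^2) < e / 4"
  using sqint_truncation_approx[OF w] e unfolding v_def by (intro order_tendstoD(2)) auto
 then obtain k where k: "(LBINT x. (w x - v k x)^2) < e / 4"
  by (meson eventually_happens trivial_limit_sequentially)
 obtain g where g: "continuous_on UNIV g" "\<And>x. norm x > real k + 1 \<Longrightarrow> g x = 0"
  "\<And>x. \<bar>g x\<bar> \<le> real k" "(LBINT x. (v k x - g x)^2) < e / 4"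
 proof (rule bounded_continuous_approx[of "v k" "real k" "e / 4"])
  show "norm x > real k \<Longrightarrow> v k x = 0" "\<bar>v k x\<bar> \<le> real k" for x by (auto simp: v_def indicator_def)
 qed (use e in auto)
 have sg: "sqint g" by (rule sqint_continuous[OF g(1,2,3)])
 have "\<bar>v k x\<bar> \<le> \<bar>w x\<bar>" for x by (auto simp: v_def indicator_def)
 then have "integrable lborel (\<lambda>x. (v k x)^2)"
  by (intro Bochner_Integration.integrable_bound[OF sqint_integrable[OF w]]) (auto simp: abs_le_square_iff[symmetric])
 then have sv: "sqint (v k)" by (simp add: sqint_def)
 have "(LBINT x. (w x - g x)^2) \<le> (LBINT x. 2 * (w x - v k x)^2 + 2 * (v k x - g x)^2)"
 proof (rule integral_mono)
  show "integrable lborel (\<lambda>x. (w x - g x)^2)"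
   "integrable lborel (\<lambda>x. 2 * (w x - v k x)^2 + 2 * (v k x - g x)^2)"
   by (intro Bochner_Integration.integrable_add integrable_mult_right sqint_integrable sqint_diff w sg sv)+
  show "(w x - g x)^2 \<le> 2 * (w x - v k x)^2 + 2 * (v k x - g x)^2" for x
   using sum_squares_bound[of "w x - v k x" "v k x - g x"] power2_sum[of "w x - v k x" "v k x - g x"] by simp
 qed
 also have "\<dots> = 2 * (LBINT x. (w x - v k x)^2) + 2 * (LBINT x. (v k x - g x)^2)"
  by (subst Bochner_Integration.integral_add) (auto intro!: sqint_integrable sqint_diff w sg sv)
 also have "\<dots> < e" using k g(4) by linarith
 finally show ?thesis using that[OF g(1,2,3)] by blast
qed

text \<open>Three kernels occur: the mollifier, the normalised indicator of a ball away from the origin, whose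
 dilates sweep out a cone, and the indicator of \<open>[-1, 0]\<close>, which gives means over past times.\<close>

locale averaging_kernel =
 fixes \<rho> :: "'a::euclidean_space \<Rightarrow> real" and B R :: real
 assumes borel [measurable]: "\<rho> \<in> borel_measurable borel"
  and nonneg: "0 \<le> \<rho> z" and le_B: "\<rho> z \<le> B"
  and supp: "R < norm z \<Longrightarrow> \<rho> z = 0"
  and total: "(LBINT z. \<rho> z) = 1"
begin

definition avg :: "real \<Rightarrow> ('a \<Rightarrow> real) \<Rightarrow> 'a \<Rightarrow> real" where
 "avg t w x = (LBINT z. \<rho> z * w (x + t *\<^sub>R z))"

lemma B_nonneg: "0 \<le> B" using nonneg le_B order_trans by blast

lemma integrable: "integrable lborel \<rho>"
 using total not_integrable_integral_eq by fastforce

lemma nn_total: "(\<integral>\<^sup>+z. ennreal (\<rho> z) \<partial>lborel) = 1"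
 using nn_integral_eq_integral[OF integrable] nonneg total by simp

lemma sqint_kernel: "sqint \<rho>"
proof -
 have "integrable lborel (\<lambda>z. (\<rho> z)^2)"
  by (rule Bochner_Integration.integrable_bound[OF integrable_mult_right[OF integrable, of B]])
    (use nonneg le_B in \<open>auto simp: power2_eq_square B_nonneg intro!: mult_right_mono\<close>)
 then show ?thesis by (simp add: sqint_def)
qed

lemma avg_integrable: "sqint w \<Longrightarrow> t > 0 \<Longrightarrow> integrable lborel (\<lambda>z. \<rho> z * w (x + t *\<^sub>R z))"
 by (intro sqint_mult_integrable sqint_kernel sqint_scale)

lemma avg_borel [measurable]:
 assumes [measurable]: "w \<in> borel_measurable borel" shows "avg t w \<in> borel_measurable borel"
 unfolding avg_def[abs_def] by measurable

lemma avg_diff: "sqint u \<Longrightarrow> sqint v \<Longrightarrow> t > 0 \<Longrightarrow> avg t (\<lambda>x. u x - v x) x = avg t u x - avg t v x"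
 unfolding avg_def by (simp add: avg_integrable right_diff_distrib)

lemma avg_square_integrable:
 assumes "sqint w" "t > 0" shows "integrable lborel (\<lambda>z. \<rho> z * (w (x + t *\<^sub>R z))^2)"
proof -
 note [measurable] = sqint_borel[OF assms(1)]
 show ?thesis
  by (rule Bochner_Integration.integrable_bound[OF integrable_mult_right[OF sqint_integrable[OF sqint_scale(1)[OF assms, of x]], of B]])
   (auto simp: nonneg le_B B_nonneg abs_mult intro!: mult_right_mono)
qed

lemma avg_Jensen:
 assumes w: "sqint w" and t: "t > 0"
 shows "(avg t w x)^2 \<le> avg t (\<lambda>x. (w x)^2) x"
proof -
 note [measurable] = sqint_borel[OF w]
 have "(LBINT z. sqrt (\<rho> z) * (sqrt (\<rho> z) * w (x + t *\<^sub>R z)))^2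
   \<le> (LBINT z. (sqrt (\<rho> z))^2) * (LBINT z. (sqrt (\<rho> z) * w (x + t *\<^sub>R z))^2)"
  using integrable avg_square_integrable[OF assms, of x]
  by (intro Cauchy_Schwarz_integral(2)) (auto simp: nonneg power_mult_distrib)
 then show ?thesis by (simp add: nonneg power_mult_distrib total avg_def flip: mult.assoc)
qed

lemma avg_sup:
 assumes w: "sqint w" and t: "t > 0"
 shows "(avg t w x)^2 \<le> B * (LBINT x. (w x)^2) / t ^ DIM('a)"
proof -
 have "(avg t w x)^2 \<le> avg t (\<lambda>x. (w x)^2) x" by (rule avg_Jensen[OF assms])
 also have "\<dots> \<le> (LBINT z. B * (w (x + t *\<^sub>R z))^2)"
  unfolding avg_def using sqint_integrable[OF sqint_scale(1)[OF assms, of x]]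
  by (intro integral_mono avg_square_integrable assms) (auto simp: le_B intro!: mult_right_mono)
 finally show ?thesis by (simp add: sqint_scale(2)[OF assms])
qed

lemma avg_L2:
 assumes w: "sqint w" and t: "t > 0"
 shows "sqint (avg t w)" and "(LBINT x. (avg t w x)^2) \<le> (LBINT x. (w x)^2)"
proof -
 note [measurable] = sqint_borel[OF w]
 have "(\<integral>\<^sup>+x. ennreal ((avg t w x)^2) \<partial>lborel) \<le> (\<integral>\<^sup>+x. (\<integral>\<^sup>+z. ennreal (\<rho> z * (w (x + t *\<^sub>R z))^2) \<partial>lborel) \<partial>lborel)"
 proof (rule nn_integral_mono)
  fix x
  have "ennreal ((avg t w x)^2) \<le> ennreal (avg t (\<lambda>x. (w x)^2) x)"
   by (rule ennreal_leI[OF avg_Jensen[OF assms]])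
  also have "\<dots> = (\<integral>\<^sup>+z. ennreal (\<rho> z * (w (x + t *\<^sub>R z))^2) \<partial>lborel)"
   unfolding avg_def by (rule nn_integral_eq_integral[symmetric]) (auto simp: nonneg avg_square_integrable assms)
  finally show "ennreal ((avg t w x)^2) \<le> (\<integral>\<^sup>+z. ennreal (\<rho> z * (w (x + t *\<^sub>R z))^2) \<partial>lborel)" .
 qed
 also have "\<dots> = (\<integral>\<^sup>+z. (\<integral>\<^sup>+x. ennreal (\<rho> z * (w (x + t *\<^sub>R z))^2) \<partial>lborel) \<partial>lborel)"
  by (rule lborel_pair.Fubini') measurable
 also have "\<dots> = (\<integral>\<^sup>+z. ennreal (\<rho> z) * ennreal (LBINT x. (w x)^2) \<partial>lborel)"
 proof (rule nn_integral_cong)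
  fix z
  have "(\<integral>\<^sup>+x. ennreal ((w x)^2) \<partial>lborel) = (\<integral>\<^sup>+x. ennreal ((w (x + t *\<^sub>R z))^2) \<partial>lborel)"
   using nn_integral_scale[of "\<lambda>x. ennreal ((w x)^2)" 1 "t *\<^sub>R z"] by (simp add: add.commute)
  then show "(\<integral>\<^sup>+x. ennreal (\<rho> z * (w (x + t *\<^sub>R z))^2) \<partial>lborel) = ennreal (\<rho> z) * ennreal (LBINT x. (w x)^2)"
   using sqint_integrable[OF w] by (simp add: ennreal_mult' nonneg nn_integral_cmult nn_integral_eq_integral)
 qed
 also have "\<dots> = ennreal (LBINT x. (w x)^2)" by (simp add: nn_integral_multc nn_total)
 finally have *: "(\<integral>\<^sup>+x. ennreal ((avg t w x)^2) \<partial>lborel) \<le> ennreal (LBINT x. (w x)^2)" .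
 then have i: "integrable lborel (\<lambda>x. (avg t w x)^2)"
  by (intro integrableI_nonneg) (auto simp: order_le_less_trans)
 then show "sqint (avg t w)" by (simp add: sqint_def)
 show "(LBINT x. (avg t w x)^2) \<le> (LBINT x. (w x)^2)"
  using * i by (simp add: nn_integral_eq_integral)
qed

lemma R_nonneg: "0 \<le> R"
proof (rule ccontr)
 assume "\<not> 0 \<le> R"
 then have "\<rho> z = 0" for z using supp[of z] by (meson le_less_trans norm_ge_zero not_le order_less_le_trans)
 with total show False by simp
qed

lemma avg_close_at_point:
 assumes y: "sqint y" and t: "t > 0" and d: "\<And>z. norm z \<le> R \<Longrightarrow> \<bar>y (x + t *\<^sub>R z) - y x\<bar> \<le> \<delta>"
 shows "\<bar>avg t y x - y x\<bar> \<le> \<delta>"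
proof -
 have "avg t y x - y x = (LBINT z. \<rho> z * y (x + t *\<^sub>R z) - \<rho> z * y x)"
  unfolding avg_def using avg_integrable[OF y t, of x] integrable by (simp add: total)
 also have "\<bar>\<dots>\<bar> \<le> (LBINT z. \<bar>\<rho> z * y (x + t *\<^sub>R z) - \<rho> z * y x\<bar>)" by (rule integral_abs_bound)
 also have "\<dots> \<le> (LBINT z. \<rho> z * \<delta>)"
 proof (rule integral_mono)
  show "integrable lborel (\<lambda>z. \<bar>\<rho> z * y (x + t *\<^sub>R z) - \<rho> z * y x\<bar>)"
   by (intro integrable_abs Bochner_Integration.integrable_diff avg_integrable y t integrable_mult_left integrable)
  show "integrable lborel (\<lambda>z. \<rho> z * \<delta>)" by (intro integrable_mult_left integrable)
  fix z
  show "\<bar>\<rho> z * y (x + t *\<^sub>R z) - \<rho> z * y x\<bar> \<le> \<rho> z * \<delta>"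
  proof (cases "norm z > R")
   case False
   then have "\<rho> z * \<bar>y (x + t *\<^sub>R z) - y x\<bar> \<le> \<rho> z * \<delta>" by (intro mult_left_mono nonneg d) simp
   then show ?thesis using nonneg[of z] by (simp add: abs_mult flip: right_diff_distrib)
  qed (simp add: supp)
 qed
 also have "\<dots> = \<delta>" using integrable by (simp add: total)
 finally show ?thesis .
qed

lemma avg_tendsto_at_continuity_point:
 assumes y: "sqint y" and c: "isCont y x"
 shows "((\<lambda>t. avg t y x) \<longlongrightarrow> y x) (at_right 0)"
proof (rule tendstoI)
 fix e :: real assume e: "e > 0"
 obtain d where d: "d > 0" "\<And>x'. dist x' x < d \<Longrightarrow> dist (y x') (y x) < e / 2"
  using c e unfolding continuous_at_eps_delta by (metis half_gt_zero)
 have "\<forall>\<^sub>F t in at_right 0. 0 < t \<and> t < d / (R + 1)"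
  using d R_nonneg by (intro eventually_at_rightI[of 0 "d / (R + 1)"]) auto
 then show "\<forall>\<^sub>F t in at_right 0. dist (avg t y x) (y x) < e"
 proof eventually_elim
  case (elim t)
  have "\<bar>avg t y x - y x\<bar> \<le> e / 2"
  proof (rule avg_close_at_point[OF y])
   fix z :: 'a assume "norm z \<le> R"
   then have "t * norm z \<le> t * (R + 1)" using elim by (intro mult_left_mono) auto
   also have "\<dots> < d" using elim R_nonneg by (simp add: field_simps)
   finally show "\<bar>y (x + t *\<^sub>R z) - y x\<bar> \<le> e / 2" using elim d(2)[of "x + t *\<^sub>R z"] by (simp add: dist_norm)
  qed (use elim in simp)
  then show ?case using e by (simp add: dist_real_def)
 qed
qed

lemma avg_continuous_tendsto:
 assumes c: "continuous_on UNIV g" and g0: "\<And>x. norm x > K \<Longrightarrow> g x = 0" and gK: "\<And>x. \<bar>g x\<bar> \<le> M"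
 shows "((\<lambda>t. LBINT x. (avg t g x - g x)^2) \<longlongrightarrow> 0) (at_right 0)"
 unfolding tendsto_at_iff_sequentially
proof (intro allI impI)
 fix X :: "nat \<Rightarrow> real" assume "\<forall>i. X i \<in> {0<..} - {0}" and X: "X \<longlonglongrightarrow> 0"
 then have X0: "X i > 0" for i by simp
 obtain a where a: "\<And>i. \<bar>X i\<bar> \<le> a" using convergent_imp_Bseq[OF convergentI[OF X]] by (auto simp: Bseq_def)
 have sg: "sqint g" by (rule sqint_continuous[OF assms])
 note [measurable] = sqint_borel[OF sg]
 have "(\<lambda>i. LBINT x. (avg (X i) g x - g x)^2) \<longlonglongrightarrow> integral\<^sup>L lborel (\<lambda>x::'a. 0)"
 proof (rule integral_dominated_convergence)
  show "integrable lborel (\<lambda>x::'a. (2 * M)^2 * indicator (cball 0 (K + a * R)) x)" by (rule integrable_cball)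
  show "AE x in lborel. norm ((avg (X i) g x - g x)^2) \<le> (2 * M)^2 * indicator (cball 0 (K + a * R)) x" for i
  proof (rule AE_I2)
   fix x
   have "\<bar>g u - g v\<bar> \<le> 2 * M" for u v using gK[of u] gK[of v] by linarith
   then have "\<bar>avg (X i) g x - g x\<bar> \<le> 2 * M" by (intro avg_close_at_point[OF sg X0])
   then have b: "(avg (X i) g x - g x)^2 \<le> (2 * M)^2" by (intro abs_le_square_iff[THEN iffD1] order_trans[OF _ abs_ge_self])
   have "avg (X i) g x - g x = 0" if x: "norm x > K + a * R"
   proof -
    have aR: "0 \<le> a * R" using a[of i] R_nonneg by (intro mult_nonneg_nonneg) auto
    have "\<bar>g (x + X i *\<^sub>R z) - g x\<bar> \<le> 0" if "norm z \<le> R" for z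
    proof -
     have "norm (X i *\<^sub>R z) \<le> a * R" using a[of i] that by (auto intro!: mult_mono)
     then have "norm (x + X i *\<^sub>R z) > K" "norm x > K" using x aR norm_diff_ineq[of x "X i *\<^sub>R z"] by linarith+
     then show ?thesis by (simp add: g0)
    qed
    then show ?thesis using avg_close_at_point[OF sg X0, of x i 0] by simp
   qed
   then show "norm ((avg (X i) g x - g x)^2) \<le> (2 * M)^2 * indicator (cball 0 (K + a * R)) x"
    using b by (cases "norm x > K + a * R") (auto simp: indicator_def)
  qed
  have "filterlim X (at_right 0) sequentially" using X X0 less_imp_neq[OF X0] by (auto simp: filterlim_at intro!: always_eventually)
  then have "(\<lambda>i. (avg (X i) g x - g x)^2) \<longlonglongrightarrow> (g x - g x)^2" for x
   using c by (intro tendsto_intros filterlim_compose[OF avg_tendsto_at_continuity_point[OF sg]]) (simp add: continuous_on_eq_continuous_at)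
  then show "AE x in lborel. (\<lambda>i. (avg (X i) g x - g x)^2) \<longlonglongrightarrow> 0" by simp
 qed auto
 then show "((\<lambda>t. LBINT x. (avg t g x - g x)^2) \<circ> X) \<longlonglongrightarrow> 0" by (simp add: comp_def)
qed

text \<open>Averaging is a contraction of \<open>L2\<close>, so it suffices to treat the dense class of continuous functions of bounded support.\<close>

lemma avg_tendsto_L2:
 assumes w: "sqint w"
 shows "((\<lambda>t. LBINT x. (avg t w x - w x)^2) \<longlongrightarrow> 0) (at_right 0)"
proof (rule tendstoI)
 fix e :: real assume e: "e > 0"
 obtain g K M where g: "continuous_on UNIV g" "\<And>x. norm x > K \<Longrightarrow> g x = 0" "\<And>x. \<bar>g x\<bar> \<le> M"
  "(LBINT x. (w x - g x)^2) < e / 12"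
  using sqint_continuous_approx[OF w, of "e / 12"] e by auto
 have sg: "sqint g" by (rule sqint_continuous[OF g(1-3)])
 have "((\<lambda>t. LBINT x. (avg t g x - g x)^2) \<longlongrightarrow> 0) (at_right 0)" by (rule avg_continuous_tendsto[OF g(1-3)])
 then have "\<forall>\<^sub>F t in at_right 0. (LBINT x. (avg t g x - g x)^2) < e / 12"
  by (rule order_tendstoD(2)) (use e in simp)
 moreover have "\<forall>\<^sub>F t in at_right 0. (t::real) > 0" by (simp add: eventually_at_filter)
 ultimately show "\<forall>\<^sub>F t in at_right 0. dist (LBINT x. (avg t w x - w x)^2) 0 < e"
 proof eventually_elim
  case (elim t)
  note sq = sqint_diff w sg avg_L2(1) elim(2)
  have "(LBINT x. (avg t w x - w x)^2)
   \<le> (LBINT x. 3 * (avg t (\<lambda>x. w x - g x) x)^2 + (3 * (avg t g x - g x)^2 + 3 * (w x - g x)^2))"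
  proof (rule integral_mono)
   show "integrable lborel (\<lambda>x. (avg t w x - w x)^2)"
    "integrable lborel (\<lambda>x. 3 * (avg t (\<lambda>x. w x - g x) x)^2 + (3 * (avg t g x - g x)^2 + 3 * (w x - g x)^2))"
    by (intro Bochner_Integration.integrable_add integrable_mult_right sqint_integrable sq)+
   fix x
   have "avg t w x - w x = avg t (\<lambda>x. w x - g x) x + (avg t g x - g x) - (w x - g x)"
    by (simp add: avg_diff sq)
   note eq = this
   have ineq: "(a + b - c)^2 \<le> 3 * a^2 + (3 * b^2 + 3 * c^2)" for a b c :: real
    using zero_le_power2[of "a - b"] zero_le_power2[of "a + c"] zero_le_power2[of "b + c"]
    by (simp add: power2_eq_square algebra_simps)
   show "(avg t w x - w x)^2 \<le> 3 * (avg t (\<lambda>x. w x - g x) x)^2 + (3 * (avg t g x - g x)^2 + 3 * (w x - g x)^2)"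
    unfolding eq by (rule ineq)
  qed
  also have "\<dots> = 3 * (LBINT x. (avg t (\<lambda>x. w x - g x) x)^2) + (3 * (LBINT x. (avg t g x - g x)^2) + 3 * (LBINT x. (w x - g x)^2))"
   by (subst Bochner_Integration.integral_add, (intro Bochner_Integration.integrable_add integrable_mult_right sqint_integrable sq)+)+ simp
  also have "\<dots> \<le> 3 * (e / 12) + (3 * (e / 12) + 3 * (e / 12))"
   using avg_L2(2)[OF sqint_diff[OF w sg] elim(2)] elim(1) g(4) by linarith
  also have "\<dots> < e" using e by simp
  finally show ?case by (simp add: dist_real_def)
 qed
qed

lemma avg_tendsto_inner:
 assumes w: "sqint w" and v: "sqint v"
 shows "((\<lambda>t. LBINT x. avg t w x * v x) \<longlongrightarrow> (LBINT x. w x * v x)) (at_right 0)"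
proof -
 let ?b = "\<lambda>t. sqrt ((LBINT x. (avg t w x - w x)^2) * (LBINT x. (v x)^2))" and ?d = "\<lambda>t. (LBINT x. avg t w x * v x) - (LBINT x. w x * v x)"
 have "((\<lambda>t. ?b t) \<longlongrightarrow> sqrt (0 * (LBINT x. (v x)^2))) (at_right 0)"
  by (intro tendsto_intros avg_tendsto_L2 w)
 then have l: "((\<lambda>t. ?b t) \<longlongrightarrow> 0) (at_right 0)" by simp
 have "((\<lambda>t. ?d t) \<longlongrightarrow> 0) (at_right 0)"
 proof (rule Lim_null_comparison[OF _ l])
  have "\<forall>\<^sub>F t in at_right 0. (t::real) > 0" by (simp add: eventually_at_filter)
  then show "\<forall>\<^sub>F t in at_right 0. norm (?d t)
    \<le> ?b t"
  proof eventually_elim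
   case (elim t)
   have sq: "sqint (\<lambda>x. avg t w x - w x)" by (intro sqint_diff avg_L2 w elim)
   have "?d t = (LBINT x. (avg t w x - w x) * v x)"
    using sqint_mult_integrable[OF avg_L2(1)[OF w elim] v] sqint_mult_integrable[OF w v] by (simp add: left_diff_distrib)
   moreover have "(LBINT x. (avg t w x - w x) * v x)^2 \<le> (LBINT x. (avg t w x - w x)^2) * (LBINT x. (v x)^2)"
    using sq v by (intro Cauchy_Schwarz_integral(2)) (auto simp: sqint_def)
   ultimately show ?case using real_le_rsqrt by (simp add: real_sqrt_abs[symmetric] del: real_sqrt_abs real_sqrt_mult)
  qed
 qed
 then show ?thesis by (rule LIM_zero_cancel)
qed

lemma avg_AE_subseq:
 assumes w: "sqint w" and T: "\<And>n. T n > 0" "T \<longlonglongrightarrow> 0"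
 obtains r where "strict_mono r" "AE x in lborel. (\<lambda>n. avg (T (r n)) w x) \<longlonglongrightarrow> w x"
proof -
 have "filterlim T (at_right 0) sequentially"
  using T(2) less_imp_neq[OF T(1)] T(1) by (auto simp: filterlim_at intro!: always_eventually)
 then have "(\<lambda>n. LBINT x. norm ((avg (T n) w x - w x)^2)) \<longlonglongrightarrow> 0"
  using filterlim_compose[OF avg_tendsto_L2[OF w]] by simp
 moreover have "integrable lborel (\<lambda>x. (avg (T n) w x - w x)^2)" for n
  by (intro sqint_integrable sqint_diff avg_L2 w T)
 ultimately obtain r where r: "strict_mono r" "AE x in lborel. (\<lambda>n. (avg (T (r n)) w x - w x)^2) \<longlonglongrightarrow> 0"
  using tendsto_L1_AE_subseq[of lborel "\<lambda>n x. (avg (T n) w x - w x)^2"] by auto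
 have "AE x in lborel. (\<lambda>n. avg (T (r n)) w x) \<longlonglongrightarrow> w x"
  using r(2)
 proof eventually_elim
  case (elim x)
  then have "(\<lambda>n. \<bar>avg (T (r n)) w x - w x\<bar>) \<longlonglongrightarrow> 0" using tendsto_real_sqrt[OF elim] by simp
  then show ?case by (simp add: LIM_zero_iff tendsto_rabs_zero_iff)
 qed
 with r(1) that show ?thesis by blast
qed

end

section \<open>Mollification\<close>

lemma integral_scale:
 fixes f :: "'a::euclidean_space \<Rightarrow> real"
 assumes [measurable]: "f \<in> borel_measurable borel" and t: "t > 0"
 shows "(LBINT z. f (a + t *\<^sub>R z)) = (LBINT x. f x) / t ^ DIM('a)"
proof -
 have "(LBINT x. f x) = (LBINT z. t ^ DIM('a) * f (a + t *\<^sub>R z))"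
  using t by (subst lborel_affine[of t a]) (auto simp: integral_density integral_distr)
 then show ?thesis using t by simp
qed

definition std_kernel :: "'a::euclidean_space \<Rightarrow> real" where
 "std_kernel x = bump x / integral\<^sup>L lborel (bump :: 'a \<Rightarrow> real)"

lemma bump_borel [measurable]: "bump \<in> borel_measurable borel"
 using test_function_borel[OF test_function_bump] .

lemma bump_integrable: "integrable lborel (bump :: 'a::euclidean_space \<Rightarrow> real)"
proof (rule Bochner_Integration.integrable_bound[OF integrable_cball[of 1 0 1]])
 show "AE x in lborel. norm (bump x) \<le> norm (1 * indicat_real (cball (0::'a) 1) x)"
 proof (rule AE_I2)
  fix x :: 'a show "norm (bump x) \<le> norm (1 * indicat_real (cball (0::'a) 1) x)"
   using bump_le_1[of x] bump_nonneg[of x] bump_eq[of x] by (cases "norm x < 1") auto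
 qed
qed simp

lemma bump_integral_pos: "0 < integral\<^sup>L lborel (bump :: 'a::euclidean_space \<Rightarrow> real)"
proof -
 have "integral\<^sup>L lborel (bump :: 'a \<Rightarrow> real) \<noteq> 0"
 proof
  assume "integral\<^sup>L lborel (bump :: 'a \<Rightarrow> real) = 0"
  then have "AE z::'a in lborel. bump z = 0"
   using integral_nonneg_eq_0_iff_AE[OF bump_integrable] bump_nonneg by auto
  then have "emeasure lborel {z::'a. bump z \<noteq> 0} = 0"
   by (subst (asm) AE_iff_measurable[OF _ refl]) auto
  moreover have "emeasure lborel (ball (0::'a) 1) \<le> emeasure lborel {z::'a. bump z \<noteq> 0}"
   by (rule emeasure_mono) (auto simp: bump_eq)
  moreover have "emeasure lborel (ball (0::'a) 1) \<noteq> 0"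
   using content_ball_pos[of 1 "0::'a"] by (auto simp: Sigma_Algebra.measure_def)
  ultimately show False by auto
 qed
 then show ?thesis using Bochner_Integration.integral_nonneg[of lborel "bump :: 'a \<Rightarrow> real"] bump_nonneg by (metis order_le_less)
qed

lemma test_function_cmult: "test_function U \<psi> \<Longrightarrow> test_function U (\<lambda>x. c * \<psi> x)"
 by (rule test_function_mult) simp

lemma test_function_std_kernel: "test_function UNIV std_kernel"
 using test_function_cmult[OF test_function_bump, of "1 / (LBINT z. bump z)"]
 by (simp add: std_kernel_def[abs_def])

interpretation std: averaging_kernel "std_kernel :: 'a::euclidean_space \<Rightarrow> real" "1 / integral\<^sup>L lborel (bump :: 'a::euclidean_space \<Rightarrow> real)" 1
proof
 show "(std_kernel :: 'a \<Rightarrow> real) \<in> borel_measurable borel" by (simp add: std_kernel_def[abs_def])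
 show "0 \<le> std_kernel z" for z :: 'a using bump_integral_pos[where 'a='a] bump_nonneg[of z] by (simp add: std_kernel_def)
 show "std_kernel z \<le> 1 / integral\<^sup>L lborel (bump :: 'a \<Rightarrow> real)" for z :: 'a
  using bump_integral_pos[where 'a='a] bump_le_1[of z] by (simp add: std_kernel_def divide_right_mono)
 show "std_kernel z = 0" if "1 < norm z" for z :: 'a using that by (simp add: std_kernel_def bump_eq)
 show "integral\<^sup>L lborel (std_kernel :: 'a \<Rightarrow> real) = 1"
  using bump_integral_pos[where 'a='a] by (simp add: std_kernel_def[abs_def])
qed

text \<open>Unlike in an average, \<open>x\<close> occurs here only in the smooth factor, which may be differentiated under the integral.\<close>

definition xcorr :: "('a::euclidean_space \<Rightarrow> real) \<Rightarrow> ('a \<Rightarrow> real) \<Rightarrow> 'a \<Rightarrow> real" where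
 "xcorr \<theta> w x = (LBINT y. \<theta> (y - x) * w y)"

lemma frechet_expand:
 fixes f :: "'a::euclidean_space \<Rightarrow> real"
 assumes "(f has_derivative f') F"
 shows "f' h = (\<Sum>i\<in>Basis. (h \<bullet> i) * f' i)"
proof -
 interpret bounded_linear f' using assms by (rule has_derivative_bounded_linear)
 have "f' h = f' (\<Sum>i\<in>Basis. (h \<bullet> i) *\<^sub>R i)" by (simp add: euclidean_representation)
 then show ?thesis by (simp add: sum scaleR)
qed

lemma test_function_derivative_bound:
 assumes "test_function U \<theta>"
 obtains L where "L \<ge> 0" "\<And>x h. \<bar>fdiff \<theta> x h\<bar> \<le> L * norm h" "\<And>x y. \<bar>\<theta> x - \<theta> y\<bar> \<le> L * norm (x - y)"
proof -
 have "\<exists>B. \<forall>x. \<bar>fdiff \<theta> x i\<bar> \<le> B" if "i \<in> Basis" for i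
  using test_function_bounded[OF test_function_partial[OF assms that]] by metis
 then obtain B where B: "\<And>i x. i \<in> Basis \<Longrightarrow> \<bar>fdiff \<theta> x i\<bar> \<le> B i" by metis
 have B0: "0 \<le> B i" if "i \<in> Basis" for i using B[OF that] abs_ge_zero order_trans by blast
 define L where "L = (\<Sum>i\<in>Basis. B i)"
 have D: "\<bar>fdiff \<theta> x h\<bar> \<le> L * norm h" for x h
 proof -
  have "\<bar>fdiff \<theta> x h\<bar> \<le> (\<Sum>i\<in>Basis. \<bar>(h \<bullet> i) * fdiff \<theta> x i\<bar>)"
   by (subst frechet_expand[OF test_function_has_derivative[OF assms]]) (rule sum_abs)
  also have "\<dots> \<le> (\<Sum>i\<in>Basis. norm h * B i)"
   by (intro sum_mono) (auto simp: abs_mult Basis_le_norm intro!: mult_mono B B0)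
  finally show ?thesis by (simp add: L_def sum_distrib_left mult.commute)
 qed
 have "\<bar>\<theta> x - \<theta> y\<bar> \<le> L * norm (x - y)" for x y
 proof -
  have "norm (\<theta> x - \<theta> y) \<le> L * norm (x - y)"
   by (rule differentiable_bound[of UNIV \<theta> "\<lambda>x. fdiff \<theta> x"])
    (use D test_function_has_derivative[OF assms] in \<open>auto intro!: onorm_le\<close>)
  then show ?thesis by simp
 qed
 moreover have "L \<ge> 0" unfolding L_def by (intro sum_nonneg B0)
 ultimately show ?thesis using that D by blast
qed

lemma test_function_sqint:
 assumes "test_function U \<psi>" shows "sqint \<psi>"
proof -
 obtain B where B: "\<And>x. \<bar>\<psi> x\<bar> \<le> B" using test_function_bounded[OF assms] by blast
 have "bounded (closure {x. \<psi> x \<noteq> 0})" using assms by (auto simp: test_function_def compact_imp_bounded)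
 then obtain K where "\<And>x. x \<in> closure {x. \<psi> x \<noteq> 0} \<Longrightarrow> norm x \<le> K" unfolding bounded_iff by auto
 then have "\<psi> x = 0" if "norm x > K" for x
  using that closure_subset[of "{x. \<psi> x \<noteq> 0}"] by force
 then show ?thesis using B test_function_continuous[OF assms] by (intro sqint_continuous)
qed

lemma xcorr_integrable:
 assumes "test_function U \<theta>" "sqint w"
 shows "integrable lborel (\<lambda>y. \<theta> (y - x) * w y)"
 using sqint_mult_integrable[OF sqint_scale(1)[OF test_function_sqint[OF assms(1)], of 1 "- x"] assms(2)] by (simp add: add.commute)

lemma sqint_indicator_cball: "sqint (\<lambda>x::'a::euclidean_space. c * indicator (cball a r) x)"
proof -
 have "(c * indicat_real (cball a r) x)^2 = c^2 * indicator (cball a r) x" for x :: 'a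
  by (simp add: indicator_def)
 then show ?thesis using integrable_cball[of "c^2" a r] by (auto simp: sqint_def)
qed

text \<open>The error is quadratic uniformly in \<open>a\<close>; this replaces dominated convergence in the differentiation of \<open>xcorr\<close>.\<close>

lemma test_function_Taylor:
 assumes \<theta>: "test_function U \<theta>"
 obtains C where "C \<ge> 0" "\<And>a h. \<bar>\<theta> (a + h) - \<theta> a - fdiff \<theta> a h\<bar> \<le> C * (norm h)^2"
proof -
 let ?D = "\<lambda>x. fdiff \<theta> x"
 note der = test_function_has_derivative[OF \<theta>]
 have "\<exists>L\<ge>0. \<forall>x y. \<bar>?D x i - ?D y i\<bar> \<le> L * norm (x - y)" if "i \<in> Basis" for i
  using test_function_derivative_bound[OF test_function_partial[OF \<theta> that]] by metis
 then obtain L where L: "\<And>i. i \<in> Basis \<Longrightarrow> L i \<ge> 0" "\<And>i x y. i \<in> Basis \<Longrightarrow> \<bar>?D x i - ?D y i\<bar> \<le> L i * norm (x - y)" by metis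
 define C where "C = (\<Sum>i\<in>Basis. L i)"
 have C: "C \<ge> 0" unfolding C_def by (intro sum_nonneg L)
 have D: "\<bar>?D x k - ?D a k\<bar> \<le> C * norm (x - a) * norm k" for x a k
 proof -
  have "?D x k - ?D a k = (\<Sum>i\<in>Basis. (k \<bullet> i) * (?D x i - ?D a i))"
   unfolding frechet_expand[OF der, of x k] frechet_expand[OF der, of a k] by (simp add: sum_subtractf right_diff_distrib)
  also have "\<bar>\<dots>\<bar> \<le> (\<Sum>i\<in>Basis. norm k * (L i * norm (x - a)))"
   by (rule order_trans[OF sum_abs]) (auto simp: abs_mult Basis_le_norm intro!: sum_mono mult_mono L)
  finally show ?thesis by (simp add: C_def sum_distrib_left sum_distrib_right mult_ac)
 qed
 have "\<bar>\<theta> (a + h) - \<theta> a - ?D a h\<bar> \<le> C * (norm h)^2" for a h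
 proof -
  have "norm (\<theta> (a + h) - \<theta> a - ?D a (a + h - a)) \<le> norm (a + h - a) * (C * norm h)"
  proof (rule differentiable_bound_linearization[of a "a + h" "cball a (norm h)" \<theta> ?D])
   show "onorm (?D x - ?D a) \<le> C * norm h" if "x \<in> cball a (norm h)" for x
   proof (rule onorm_le)
    fix k
    have "norm ((?D x - ?D a) k) \<le> C * norm (x - a) * norm k" using D[of x k a] by simp
    also have "\<dots> \<le> C * norm h * norm k" using that C by (intro mult_right_mono mult_left_mono) (auto simp: dist_norm norm_minus_commute)
    finally show "norm ((?D x - ?D a) k) \<le> C * norm h * norm k" .
   qed
  qed (auto intro: has_derivative_at_withinI der simp: dist_norm mult_left_le_one_le)
  then show ?thesis by (simp add: power2_eq_square mult_ac)
 qed
 then show ?thesis using that C by blast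
qed

lemma xcorr_has_derivative:
 fixes w :: "'a::euclidean_space \<Rightarrow> real"
 assumes \<theta>: "test_function U \<theta>" and w: "sqint w"
 shows "(xcorr \<theta> w has_derivative (\<lambda>h. \<Sum>i\<in>Basis. (h \<bullet> i) * (- xcorr (\<lambda>x. fdiff \<theta> x i) w x))) (at x)"
  (is "(_ has_derivative ?F) _")
proof -
 let ?D = "\<lambda>x. fdiff \<theta> x"
 note der = test_function_has_derivative[OF \<theta>]
 obtain C where C: "C \<ge> 0" "\<And>a h. \<bar>\<theta> (a + h) - \<theta> a - ?D a h\<bar> \<le> C * (norm h)^2" using test_function_Taylor[OF \<theta>] by blast
 have "bounded (closure {x. \<theta> x \<noteq> 0})" using \<theta> by (auto simp: test_function_def compact_imp_bounded)
 then obtain K where "\<And>x. x \<in> closure {x. \<theta> x \<noteq> 0} \<Longrightarrow> norm x \<le> K" unfolding bounded_iff by auto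
 then have "\<theta> x = 0" if "norm x > K" for x using that closure_subset[of "{x. \<theta> x \<noteq> 0}"] by force
 then have K: "\<theta> x = 0" if "norm x > max K 0" for x using that by simp
 define r where "r h y = \<theta> (y - x - h) - \<theta> (y - x) + ?D (y - x) h" for h y
 have F: "?F h = (LBINT y. - ?D (y - x) h * w y)" and Fi: "integrable lborel (\<lambda>y. - ?D (y - x) h * w y)" for h
 proof -
  have i: "integrable lborel (\<lambda>y. ?D (y - x) i * w y)" if "i \<in> Basis" for i
   using xcorr_integrable[OF test_function_partial[OF \<theta> that] w] .
  have e: "(\<Sum>i\<in>Basis. (h \<bullet> i) * (- (?D (y - x) i * w y))) = - ?D (y - x) h * w y" for y
   unfolding frechet_expand[OF der, of "y - x" h] by (simp add: sum_negf sum_distrib_right mult.assoc)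
  have "?F h = (LBINT y. \<Sum>i\<in>Basis. (h \<bullet> i) * (- (?D (y - x) i * w y)))"
   using i by (subst Bochner_Integration.integral_sum) (auto simp: xcorr_def)
  then show "?F h = (LBINT y. - ?D (y - x) h * w y)" by (simp only: e)
  have "integrable lborel (\<lambda>y. \<Sum>i\<in>Basis. (h \<bullet> i) * (- (?D (y - x) i * w y)))"
   using i by (intro Bochner_Integration.integrable_sum) auto
  then show "integrable lborel (\<lambda>y. - ?D (y - x) h * w y)" by (simp only: e)
 qed
 have rem: "xcorr \<theta> w (x + h) - xcorr \<theta> w x - ?F h = (LBINT y. r h y * w y)" and ri: "integrable lborel (\<lambda>y. r h y * w y)" for h
 proof -
  have e: "r h y * w y = \<theta> (y - (x + h)) * w y - \<theta> (y - x) * w y - (- ?D (y - x) h * w y)" for y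
   by (simp add: r_def diff_diff_eq algebra_simps)
  note i = xcorr_integrable[OF \<theta> w]
  show "xcorr \<theta> w (x + h) - xcorr \<theta> w x - ?F h = (LBINT y. r h y * w y)"
   unfolding F unfolding e xcorr_def Bochner_Integration.integral_diff[OF Bochner_Integration.integrable_diff[OF i i] Fi]
    Bochner_Integration.integral_diff[OF i i] ..
  show "integrable lborel (\<lambda>y. r h y * w y)" unfolding e by (intro Bochner_Integration.integrable_diff i Fi)
 qed
 let ?B = "\<lambda>y. indicator (cball x (max K 0 + 1)) y :: real"
 have rb: "\<bar>r h y\<bar> \<le> C * (norm h)^2 * ?B y" if "norm h < 1" for h y
 proof (cases "norm (y - x) > max K 0 + 1")
  case True
  have "norm (y - x - h) > max K 0" using True that norm_triangle_ineq2[of "y - x" h] by linarith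
  moreover have "norm (y - x) > max K 0" using True by linarith
  moreover have "?D (y - x) h = 0"
  proof -
   have "\<forall>\<^sub>F z in nhds (y - x). z \<in> - cball 0 (max K 0)"
    using True by (intro eventually_nhds_in_open) auto
   then have ev: "\<forall>\<^sub>F z in nhds (y - x). 0 = \<theta> z" by (rule eventually_mono) (rule K[symmetric], auto simp: not_le)
   have "(\<theta> has_derivative (\<lambda>h. 0)) (at (y - x))"
    by (rule has_derivative_transform_eventually[OF has_derivative_const])
     (use ev eventually_nhds_x_imp_x[OF ev] in \<open>auto simp: eventually_at_filter elim: eventually_mono\<close>)
   then show ?thesis by (simp flip: frechet_derivative_at)
  qed
  ultimately show ?thesis using C(1) by (simp add: r_def K)
 next
  case False
  have "?D (y - x) (- h) = - ?D (y - x) h" using has_derivative_bounded_linear[OF der, of "y - x"] by (simp add: linear_simps)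
  then show ?thesis using C(2)[of "y - x" "- h"] False by (auto simp: r_def dist_norm norm_minus_commute)
 qed
 define M where "M = (LBINT y. \<bar>?B y * w y\<bar>)"
 have Mi: "integrable lborel (\<lambda>y. \<bar>?B y * w y\<bar>)"
  using sqint_mult_integrable[OF sqint_indicator_cball[of 1] w] by simp
 have bd: "\<bar>xcorr \<theta> w (x + h) - xcorr \<theta> w x - ?F h\<bar> \<le> C * (norm h)^2 * M" if "norm h < 1" for h
 proof -
  have "\<bar>LBINT y. r h y * w y\<bar> \<le> (LBINT y. \<bar>r h y * w y\<bar>)" by (rule integral_abs_bound)
  also have "\<dots> \<le> (LBINT y. C * (norm h)^2 * \<bar>?B y * w y\<bar>)"
  proof (rule integral_mono)
   show "\<bar>r h y * w y\<bar> \<le> C * (norm h)^2 * \<bar>?B y * w y\<bar>" for y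
    using mult_right_mono[OF rb[OF that, of y], of "\<bar>w y\<bar>"] by (simp add: abs_mult mult.assoc)
  qed (intro integrable_abs ri integrable_mult_right Mi)+
  finally show ?thesis unfolding rem by (simp add: M_def)
 qed
 show ?thesis
 proof (rule has_derivativeI_sandwich[of 1 _ _ _ _ "\<lambda>y. C * M * norm (y - x)"])
  define c where "c i = - xcorr (\<lambda>x. ?D x i) w x" for i
  have "(\<lambda>h. \<Sum>i\<in>Basis. (h \<bullet> i) * c i) = (\<lambda>h. h \<bullet> (\<Sum>i\<in>Basis. c i *\<^sub>R i))"
   by (simp add: inner_sum_right mult.commute)
  then show "bounded_linear ?F" unfolding c_def by (simp only: bounded_linear_inner_left)
  show "norm (xcorr \<theta> w y - xcorr \<theta> w x - ?F (y - x)) / norm (y - x) \<le> C * M * norm (y - x)" if "y \<noteq> x" "dist y x < 1" for y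
  proof -
   have "norm (y - x) < 1" using that by (simp add: dist_norm)
   from bd[OF this] have "norm (xcorr \<theta> w y - xcorr \<theta> w x - ?F (y - x)) \<le> C * M * norm (y - x) * norm (y - x)"
    by (simp add: power2_eq_square mult_ac)
   then show ?thesis using that by (simp add: divide_le_eq)
  qed
  have "((\<lambda>y. C * M * norm (y - x)) \<longlongrightarrow> C * M * norm (x - x)) (at x)" by (intro tendsto_intros)
  then show "((\<lambda>y. C * M * norm (y - x)) \<longlongrightarrow> 0) (at x)" by simp
 qed simp
qed

lemma xcorr_C_k:
 assumes "test_function U \<theta>" and w: "sqint w"
 shows "C_k k (xcorr \<theta> w)"
 using assms(1)
proof (induction k arbitrary: \<theta>)
 case 0
 have "isCont (xcorr \<theta> w) x" for x by (rule has_derivative_continuous[OF xcorr_has_derivative[OF 0 w]])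
 then show ?case by (simp add: continuous_on_eq_continuous_at)
next
 case (Suc k)
 have d: "frechet_derivative (xcorr \<theta> w) (at x) = (\<lambda>h. \<Sum>i\<in>Basis. (h \<bullet> i) * (- xcorr (\<lambda>x. fdiff \<theta> x i) w x))" for x
  by (rule frechet_derivative_at[OF xcorr_has_derivative[OF Suc.prems w], symmetric])
 have "C_k k (\<lambda>x. \<Sum>i\<in>Basis. (j \<bullet> i) * (- 1 * xcorr (\<lambda>x. fdiff \<theta> x i) w x))" for j
  by (intro C_k_sum C_k_mult C_k_const Suc.IH test_function_partial Suc.prems)
 then show ?case using xcorr_has_derivative[OF Suc.prems w] by (auto simp: d differentiable_def)
qed

section \<open>Weak gradients\<close>

definition scaled_kernel :: "real \<Rightarrow> 'a::euclidean_space \<Rightarrow> real" where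
 "scaled_kernel t y = std_kernel (y /\<^sub>R t) / t ^ DIM('a)"

lemma scaled_kernel_supp:
 assumes "t > 0" "norm y > t" shows "scaled_kernel t y = 0"
proof -
 have "norm (y /\<^sub>R t) > 1" using assms by (simp add: divide_simps)
 then show ?thesis by (simp add: scaled_kernel_def std.supp)
qed

lemma test_function_scaled_kernel:
 assumes t: "t > 0" and x: "cball x t \<subseteq> U"
 shows "test_function U (\<lambda>y. scaled_kernel t (y - x))"
proof -
 let ?f = "\<lambda>y::'a. scaled_kernel t (y - x)"
 have e: "?f y = (1 / t ^ DIM('a)) * std_kernel (inverse t *\<^sub>R y + (- (inverse t *\<^sub>R x)))" for y
  by (simp add: scaled_kernel_def scaleR_diff_right)
 have "C_k k std_kernel" for k :: nat using test_function_std_kernel by (auto simp: test_function_def)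
 then have C: "C_k k ?f" for k unfolding e by (intro C_k_mult C_k_const C_k_affine)
 have "{y. ?f y \<noteq> 0} \<subseteq> cball x t"
 proof safe
  fix y assume "?f y \<noteq> 0"
  then have "\<not> norm (y - x) > t" using scaled_kernel_supp[OF t, of "y - x"] by auto
  then show "y \<in> cball x t" by (simp add: dist_norm norm_minus_commute)
 qed
 then have sub: "closure {y. ?f y \<noteq> 0} \<subseteq> cball x t" by (simp add: closure_minimal)
 then have "compact (closure {y. ?f y \<noteq> 0})"
  by (meson bounded_cball bounded_subset closed_closure compact_eq_bounded_closed)
 with C sub x show ?thesis by (auto simp: test_function_def)
qed

lemma test_function_scaled_kernel_UNIV: "t > 0 \<Longrightarrow> test_function UNIV (scaled_kernel t)"
 using test_function_scaled_kernel[of t 0 UNIV] by simp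

lemma std_avg_eq_xcorr:
 fixes w :: "'a::euclidean_space \<Rightarrow> real"
 assumes [measurable]: "w \<in> borel_measurable borel" and t: "t > 0"
 shows "std.avg t w x = xcorr (scaled_kernel t) w x"
proof -
 have [measurable]: "scaled_kernel t \<in> borel_measurable borel"
  using test_function_borel[OF test_function_scaled_kernel_UNIV[OF t]] .
 have "(LBINT z. scaled_kernel t ((x + t *\<^sub>R z) - x) * w (x + t *\<^sub>R z)) = xcorr (scaled_kernel t) w x / t ^ DIM('a)"
  unfolding xcorr_def by (rule integral_scale[OF _ t]) measurable
 moreover have "scaled_kernel t ((x + t *\<^sub>R z) - x) * w (x + t *\<^sub>R z) = std_kernel z * w (x + t *\<^sub>R z) / t ^ DIM('a)" for z
  using t by (simp add: scaled_kernel_def)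
 ultimately show ?thesis using t by (simp add: std.avg_def)
qed

text \<open>The form that a weak gradient on \<open>U\<close> takes for representatives on the whole space; outside \<open>U\<close> the two
 functions are unrelated.\<close>

definition weak_pair :: "'a::euclidean_space set \<Rightarrow> ('a \<Rightarrow> real) \<Rightarrow> ('a \<Rightarrow> 'a) \<Rightarrow> bool" where
 "weak_pair U u G \<longleftrightarrow> sqint u \<and> (\<forall>i\<in>Basis. sqint (\<lambda>x. G x \<bullet> i)) \<and>
   (\<forall>\<psi>. test_function U \<psi> \<longrightarrow> (\<forall>i\<in>Basis.
    (LBINT x. u x * fdiff \<psi> x i) = - (LBINT x. (G x \<bullet> i) * \<psi> x)))"

lemma std_avg_C_k:
 assumes "sqint u" "t > 0" shows "C_k k (std.avg t u)"
proof -
 have "std.avg t u = xcorr (scaled_kernel t) u"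
  using std_avg_eq_xcorr[OF sqint_borel[OF assms(1)] assms(2)] by auto
 then show ?thesis using xcorr_C_k[OF test_function_scaled_kernel_UNIV[OF assms(2)] assms(1)] by simp
qed

lemma frechet_derivative_shift:
 fixes f :: "'a::euclidean_space \<Rightarrow> real"
 assumes "f differentiable (at (y - x))"
 shows "frechet_derivative (\<lambda>y. f (y - x)) (at y) = frechet_derivative f (at (y - x))"
proof -
 have "((\<lambda>y. f (y - x)) has_derivative frechet_derivative f (at (y - x))) (at y)"
  by (rule has_derivative_compose[of "\<lambda>y. y - x" "\<lambda>h. h", OF _ frechet_derivative_works[THEN iffD1, OF assms]])
   (auto intro!: derivative_eq_intros)
 then show ?thesis by (rule frechet_derivative_at[symmetric])
qed

text \<open>The kernel moved to \<open>x\<close> is a test function on \<open>U\<close> when \<open>U\<close> contains the ball of radius \<open>t\<close> about \<open>x\<close>.\<close>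

lemma std_avg_has_derivative:
 assumes uG: "weak_pair U u G" and t: "t > 0" and x: "cball x t \<subseteq> U"
 shows "(std.avg t u has_derivative (\<lambda>h. \<Sum>i\<in>Basis. (h \<bullet> i) * std.avg t (\<lambda>y. G y \<bullet> i) x)) (at x)"
proof -
 have u: "sqint u" and G: "\<And>i. i \<in> Basis \<Longrightarrow> sqint (\<lambda>x. G x \<bullet> i)" using uG by (auto simp: weak_pair_def)
 note K = test_function_scaled_kernel_UNIV[OF t]
 have "- xcorr (\<lambda>x. frechet_derivative (scaled_kernel t) (at x) i) u x = std.avg t (\<lambda>y. G y \<bullet> i) x" if i: "i \<in> Basis" for i
 proof -
  have "scaled_kernel t differentiable (at z)" for z :: 'a
   using test_function_has_derivative[OF K] by (auto simp: differentiable_def)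
  then have "frechet_derivative (\<lambda>y. scaled_kernel t (y - x)) (at y) i = frechet_derivative (scaled_kernel t) (at (y - x)) i" for y
   by (simp add: frechet_derivative_shift)
  moreover have "(LBINT y. u y * frechet_derivative (\<lambda>y. scaled_kernel t (y - x)) (at y) i) = - (LBINT y. (G y \<bullet> i) * scaled_kernel t (y - x))"
   using uG i test_function_scaled_kernel[OF t x] by (auto simp: weak_pair_def)
  ultimately show ?thesis
   by (simp add: std_avg_eq_xcorr[OF sqint_borel[OF G[OF i]] t] xcorr_def mult.commute)
 qed
 then have "(\<lambda>h. \<Sum>i\<in>Basis. (h \<bullet> i) * (- xcorr (\<lambda>x. frechet_derivative (scaled_kernel t) (at x) i) u x))
   = (\<lambda>h. \<Sum>i\<in>Basis. (h \<bullet> i) * std.avg t (\<lambda>y. G y \<bullet> i) x)" by simp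
 moreover have "std.avg t u = xcorr (scaled_kernel t) u"
  using std_avg_eq_xcorr[OF sqint_borel[OF u] t] by auto
 ultimately show ?thesis using xcorr_has_derivative[OF K u, of x] by simp
qed

lemma AE_zero_if_test_zero:
 assumes g: "sqint g" and U: "open U"
  and z: "\<And>\<psi>. test_function U \<psi> \<Longrightarrow> (LBINT x. g x * \<psi> x) = 0"
 shows "AE x in lborel. x \<in> U \<longrightarrow> g x = 0"
proof -
 have T: "(\<lambda>n. 1 / real (Suc n)) \<longlonglongrightarrow> 0" by (rule LIMSEQ_inverse_real_of_nat[unfolded inverse_eq_divide])
 obtain r where r: "strict_mono r" "AE x in lborel. (\<lambda>n. std.avg (1 / real (Suc (r n))) g x) \<longlonglongrightarrow> g x"
  using std.avg_AE_subseq[OF g _ T] by auto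
 show ?thesis using r(2)
 proof eventually_elim
  case (elim x)
  show ?case
  proof
   assume "x \<in> U"
   then obtain e where e: "e > 0" "cball x e \<subseteq> U" using U open_contains_cball by blast
   have "\<forall>\<^sub>F n in sequentially. 1 / real (Suc (r n)) < e"
    using LIMSEQ_subseq_LIMSEQ[OF T r(1)] e(1) by (intro order_tendstoD(2)) (auto simp: comp_def)
   then have "\<forall>\<^sub>F n in sequentially. 0 = std.avg (1 / real (Suc (r n))) g x"
   proof eventually_elim
    case (elim n)
    then have "cball x (1 / real (Suc (r n))) \<subseteq> U" using e by (meson order_trans less_imp_le subset_cball)
    then show ?case
     using z[OF test_function_scaled_kernel, of "1 / real (Suc (r n))" x]
     by (simp add: std_avg_eq_xcorr[OF sqint_borel[OF g]] xcorr_def mult.commute)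
   qed
   then have "(\<lambda>n. std.avg (1 / real (Suc (r n))) g x) \<longlonglongrightarrow> 0" by (rule Lim_transform_eventually[OF tendsto_const])
   with elim show "g x = 0" by (rule LIMSEQ_unique)
  qed
 qed
qed

lemma test_function_margin:
 assumes "test_function U \<psi>" "open U"
 obtains d where "d > 0" "\<And>x. x \<in> closure {x. \<psi> x \<noteq> 0} \<Longrightarrow> cball x d \<subseteq> U"
proof -
 obtain d where d: "d > 0" "(\<Union>x\<in>closure {x. \<psi> x \<noteq> 0}. cball x d) \<subseteq> U"
  using compact_subset_open_imp_cball_epsilon_subset[of "closure {x. \<psi> x \<noteq> 0}" U] assms
  by (auto simp: test_function_def)
 then show ?thesis using that by blast
qed

text \<open>If \<open>v\<close> were smooth, \<open>v \<psi>\<close> would be a test function in the definition of the weak gradient of \<open>u\<close>. So \<open>v\<close> is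
 mollified, and the mollification is removed by the weak continuity of averages in \<open>L2\<close>.\<close>

lemma weak_product_rule:
 assumes uG: "weak_pair U u G" and vH: "weak_pair U v H" and U: "open U"
  and \<psi>: "test_function U \<psi>" and i: "i \<in> Basis"
 shows "(LBINT x. u x * v x * fdiff \<psi> x i) = - (LBINT x. (u x * (H x \<bullet> i) + v x * (G x \<bullet> i)) * \<psi> x)"
proof -
 have u: "sqint u" and G: "sqint (\<lambda>x. G x \<bullet> i)" and v: "sqint v" and H: "sqint (\<lambda>x. H x \<bullet> i)"
  using uG vH i by (auto simp: weak_pair_def)
 obtain d where d: "d > 0" "\<And>x. x \<in> closure {x. \<psi> x \<noteq> 0} \<Longrightarrow> cball x d \<subseteq> U"
  using test_function_margin[OF \<psi> U] by blast
 let ?D = "\<lambda>x. fdiff \<psi> x i"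
 have bounded_sq: "sqint (\<lambda>x. \<theta> x * f x)" if f: "sqint f" and \<theta>: "test_function U \<theta>" for f \<theta>
 proof -
  obtain B where "\<And>x. \<bar>\<theta> x\<bar> \<le> B" using test_function_bounded[OF \<theta>] by blast
  then show ?thesis by (rule sqint_bounded_mult[OF f test_function_borel[OF \<theta>]])
 qed
 note psi_sq = bounded_sq[OF _ \<psi>]
 note D_sq = bounded_sq[OF _ test_function_partial[OF \<psi> i]]
 define I where "I t = (LBINT x. std.avg t v x * (?D x * u x)) + (LBINT x. std.avg t (\<lambda>x. H x \<bullet> i) x * (\<psi> x * u x))
   + (LBINT x. std.avg t v x * (\<psi> x * (G x \<bullet> i)))" for t
 have "(I \<longlongrightarrow> (LBINT x. v x * (?D x * u x)) + (LBINT x. (H x \<bullet> i) * (\<psi> x * u x))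
   + (LBINT x. v x * (\<psi> x * (G x \<bullet> i)))) (at_right 0)"
  unfolding I_def by (intro tendsto_add std.avg_tendsto_inner v H psi_sq D_sq u G)
 moreover have "\<forall>\<^sub>F t in at_right 0. 0 = I t"
 proof -
  have "\<forall>\<^sub>F t in at_right 0. t < d" using d(1) by (intro eventually_at_rightI[of 0 d]) auto
  moreover have "\<forall>\<^sub>F t in at_right 0. (t::real) > 0" by (simp add: eventually_at_filter)
  ultimately show ?thesis
  proof eventually_elim
   case (elim t)
   let ?v = "std.avg t v"
   have tf: "test_function U (\<lambda>x. ?v x * \<psi> x)"
    by (rule test_function_mult[OF std_avg_C_k[OF v elim(2)] \<psi>])
   have der: "frechet_derivative (\<lambda>x. ?v x * \<psi> x) (at x) i = ?v x * ?D x + std.avg t (\<lambda>y. H y \<bullet> i) x * \<psi> x" for x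
   proof -
    obtain v' where v': "(?v has_derivative v') (at x)"
     using std_avg_C_k[OF v elim(2), of "Suc 0"] by (auto simp: differentiable_def)
    have "frechet_derivative (\<lambda>x. ?v x * \<psi> x) (at x) = (\<lambda>h. ?v x * fdiff \<psi> x h + v' h * \<psi> x)"
     by (rule frechet_derivative_at[symmetric, OF has_derivative_mult[OF v' test_function_has_derivative[OF \<psi>]]])
    moreover have "v' i = std.avg t (\<lambda>y. H y \<bullet> i) x" if "\<psi> x \<noteq> 0"
    proof -
     have "x \<in> closure {x. \<psi> x \<noteq> 0}" using that closure_subset by fastforce
     then have "cball x t \<subseteq> U" using d(2) elim(1) by (meson less_imp_le order_trans subset_cball)
     from has_derivative_unique[OF v' std_avg_has_derivative[OF vH elim(2) this]]
     have "v' i = (\<Sum>j\<in>Basis. (i \<bullet> j) * std.avg t (\<lambda>y. H y \<bullet> j) x)" by simp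
     also have "\<dots> = (\<Sum>j\<in>Basis. if j = i then std.avg t (\<lambda>y. H y \<bullet> j) x else 0)"
      using i by (intro sum.cong) (auto simp: inner_Basis)
     finally show ?thesis using i by simp
    qed
    ultimately show ?thesis by (cases "\<psi> x = 0") auto
   qed
   have "(LBINT x. u x * frechet_derivative (\<lambda>x. ?v x * \<psi> x) (at x) i) = - (LBINT x. (G x \<bullet> i) * (?v x * \<psi> x))"
    using uG tf i by (auto simp: weak_pair_def)
   also have "(LBINT x. u x * frechet_derivative (\<lambda>x. ?v x * \<psi> x) (at x) i)
    = (LBINT x. ?v x * (?D x * u x) + std.avg t (\<lambda>y. H y \<bullet> i) x * (\<psi> x * u x))"
    unfolding der by (simp add: algebra_simps)
   also have "\<dots> = (LBINT x. ?v x * (?D x * u x)) + (LBINT x. std.avg t (\<lambda>y. H y \<bullet> i) x * (\<psi> x * u x))"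
    by (intro Bochner_Integration.integral_add sqint_mult_integrable std.avg_L2 v H D_sq psi_sq u elim)
   finally show ?case by (simp add: I_def mult_ac)
  qed
 qed
 then have "(I \<longlongrightarrow> 0) (at_right 0)" by (rule Lim_transform_eventually[OF tendsto_const])
 ultimately have "(LBINT x. v x * (?D x * u x)) + (LBINT x. (H x \<bullet> i) * (\<psi> x * u x))
   + (LBINT x. v x * (\<psi> x * (G x \<bullet> i))) = 0"
  by (intro tendsto_unique[of "at_right (0::real)"]) auto
 moreover have "(LBINT x. (u x * (H x \<bullet> i) + v x * (G x \<bullet> i)) * \<psi> x) = (LBINT x. (H x \<bullet> i) * (\<psi> x * u x)) + (LBINT x. v x * (\<psi> x * (G x \<bullet> i)))"
 proof (subst Bochner_Integration.integral_add[symmetric])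
  show "(LBINT x. (u x * (H x \<bullet> i) + v x * (G x \<bullet> i)) * \<psi> x) = (LBINT x. (H x \<bullet> i) * (\<psi> x * u x) + v x * (\<psi> x * (G x \<bullet> i)))"
   by (simp add: algebra_simps)
 qed (intro sqint_mult_integrable psi_sq u v G H)+
 ultimately show ?thesis by (simp add: mult_ac)
qed

section \<open>Square-integrable functions on a domain\<close>

text \<open>The passage from \<open>lebesgue_on U\<close> to \<open>lborel\<close>.\<close>

definition rep :: "'a::euclidean_space set \<Rightarrow> ('a \<Rightarrow> 'b::euclidean_space) \<Rightarrow> ('a \<Rightarrow> 'b) \<Rightarrow> bool" where
 "rep U f f' \<longleftrightarrow> f \<in> borel_measurable (lebesgue_on U) \<and> f' \<in> borel_measurable borel \<and>
   (\<forall>x. x \<notin> U \<longrightarrow> f' x = 0) \<and> (AE x in lebesgue_on U. f x = f' x)"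

lemma AE_lebesgue_on_iff:
 assumes "U \<in> sets borel"
 shows "(AE x in lebesgue_on U. P x) \<longleftrightarrow> (AE x in lborel. x \<in> U \<longrightarrow> P x)"
 using assms by (subst AE_restrict_space_iff) (auto simp: AE_completion_iff)

lemma borel_measurable_lebesgue_on_borel:
 "f \<in> borel_measurable borel \<Longrightarrow> f \<in> borel_measurable (lebesgue_on U)"
 by (intro measurable_restrict_space1 measurable_completion) simp

lemma rep_exists_real:
 fixes f :: "'a::euclidean_space \<Rightarrow> real"
 assumes U: "U \<in> sets borel" and f: "f \<in> borel_measurable (lebesgue_on U)"
 shows "\<exists>f'. rep U f f'"
proof -
 have "(\<lambda>x. if x \<in> U then f x else 0) \<in> borel_measurable lebesgue"
  using f U by (intro borel_measurable_if_I) auto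
 then obtain g where g: "g \<in> borel_measurable lborel" "AE x in lborel. (if x \<in> U then f x else 0) = g x"
  using completion_ex_borel_measurable_real by blast
 have "(\<lambda>x. indicator U x * g x) \<in> borel_measurable borel" using g(1) U by auto
 moreover have "AE x in lborel. x \<in> U \<longrightarrow> f x = indicator U x * g x"
  using g(2) by eventually_elim auto
 ultimately have "rep U f (\<lambda>x. indicator U x * g x)"
  using f AE_lebesgue_on_iff[OF U] by (auto simp: rep_def)
 then show ?thesis by blast
qed

lemma rep_exists:
 fixes f :: "'a::euclidean_space \<Rightarrow> 'b::euclidean_space"
 assumes U: "U \<in> sets borel" and f: "f \<in> borel_measurable (lebesgue_on U)"
 obtains f' where "rep U f f'"
proof -
 have "\<exists>g. rep U (\<lambda>x. f x \<bullet> i) g" for i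
  using f by (intro rep_exists_real[OF U]) auto
 then obtain g where g: "\<And>i. rep U (\<lambda>x. f x \<bullet> i) (g i)" by metis
 define f' where "f' x = (\<Sum>i\<in>Basis. g i x *\<^sub>R i)" for x
 have "AE x in lebesgue_on U. \<forall>i\<in>Basis. f x \<bullet> i = g i x"
  using g by (intro AE_finite_allI) (auto simp: rep_def)
 then have "AE x in lebesgue_on U. f x = f' x"
 proof eventually_elim
  case (elim x)
  have "f x = (\<Sum>i\<in>Basis. (f x \<bullet> i) *\<^sub>R i)" by (simp only: euclidean_representation)
  with elim show ?case by (simp add: f'_def)
 qed
 moreover have "f' \<in> borel_measurable borel" unfolding f'_def
  using g by (intro borel_measurable_sum borel_measurable_scaleR borel_measurable_const) (simp add: rep_def)
 moreover have "f' x = 0" if "x \<notin> U" for x using that g by (auto simp: f'_def rep_def)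
 ultimately have "rep U f f'" using f by (auto simp: rep_def)
 then show ?thesis by (rule that)
qed

lemma rep_integral:
 fixes f :: "'a::euclidean_space \<Rightarrow> real"
 assumes U: "U \<in> sets borel" and r: "rep U f f'"
 shows "integral\<^sup>L (lebesgue_on U) f = integral\<^sup>L lborel f'"
  and "integrable (lebesgue_on U) f \<longleftrightarrow> integrable lborel f'"
proof -
 have [measurable]: "f \<in> borel_measurable (lebesgue_on U)" "f' \<in> borel_measurable (lebesgue_on U)" "f' \<in> borel_measurable lborel"
  and ae: "AE x in lebesgue_on U. f x = f' x" and z: "\<And>x. x \<notin> U \<Longrightarrow> f' x = 0"
  using r borel_measurable_lebesgue_on_borel by (auto simp: rep_def)
 have e: "(\<lambda>x. indicat_real U x *\<^sub>R f' x) = f'"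
  using z by (intro ext) (auto simp: indicator_def)
 have "integral\<^sup>L (lebesgue_on U) f = integral\<^sup>L (lebesgue_on U) f'"
  by (rule integral_cong_AE) (use ae in auto)
 also have "\<dots> = integral\<^sup>L lebesgue f'"
  using integral_restrict_space[of U lebesgue f'] U unfolding e by simp
 finally show "integral\<^sup>L (lebesgue_on U) f = integral\<^sup>L lborel f'"
  by (simp add: integral_completion)
 have "integrable (lebesgue_on U) f \<longleftrightarrow> integrable (lebesgue_on U) f'"
  by (rule integrable_cong_AE) (use ae in auto)
 also have "\<dots> \<longleftrightarrow> integrable lebesgue f'"
  using integrable_restrict_space[of U lebesgue f'] U unfolding e by simp
 finally show "integrable (lebesgue_on U) f \<longleftrightarrow> integrable lborel f'"
  by (simp add: integrable_completion)
qed

lemma rep_compose2: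
 assumes "rep U f f'" "rep U g g'" and c: "continuous_on UNIV (\<lambda>p. h (fst p) (snd p))" and "h 0 0 = 0"
 shows "rep U (\<lambda>x. h (f x) (g x)) (\<lambda>x. h (f' x) (g' x))"
proof -
 have h: "case_prod h \<in> borel_measurable borel"
  using borel_measurable_continuous_onI[OF c] by (simp add: split_beta')
 have "(\<lambda>x. case_prod h (f x, g x)) \<in> borel_measurable (lebesgue_on U)"
  using assms by (intro measurable_compose[OF _ h]) (auto simp: rep_def intro: borel_measurable_Pair)
 moreover have "(\<lambda>x. case_prod h (f' x, g' x)) \<in> borel_measurable borel"
  using assms by (intro measurable_compose[OF _ h]) (auto simp: rep_def intro: borel_measurable_Pair)
 moreover have "AE x in lebesgue_on U. f x = f' x" "AE x in lebesgue_on U. g x = g' x"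
  using assms by (auto simp: rep_def)
 then have "AE x in lebesgue_on U. h (f x) (g x) = h (f' x) (g' x)" by eventually_elim simp
 ultimately show ?thesis using assms by (auto simp: rep_def)
qed

lemma rep_compose:
 assumes "rep U f f'" and h: "h \<in> borel_measurable borel" and "h 0 = 0"
 shows "rep U (\<lambda>x. h (f x)) (\<lambda>x. h (f' x))"
proof -
 have "(\<lambda>x. h (f x)) \<in> borel_measurable (lebesgue_on U)" "(\<lambda>x. h (f' x)) \<in> borel_measurable borel"
  using assms measurable_compose[OF _ h] by (auto simp: rep_def)
 moreover have "AE x in lebesgue_on U. f x = f' x" using assms by (auto simp: rep_def)
 then have "AE x in lebesgue_on U. h (f x) = h (f' x)" by eventually_elim simp
 ultimately show ?thesis using assms by (auto simp: rep_def)
qed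

lemma rep_mult_borel:
 fixes f :: "'a::euclidean_space \<Rightarrow> real"
 assumes "rep U f f'" and g: "g \<in> borel_measurable borel"
 shows "rep U (\<lambda>x. f x * g x) (\<lambda>x. f' x * g x)"
proof -
 have "AE x in lebesgue_on U. f x = f' x" using assms by (auto simp: rep_def)
 then have "AE x in lebesgue_on U. f x * g x = f' x * g x" by eventually_elim simp
 then show ?thesis using assms borel_measurable_lebesgue_on_borel[OF g] by (auto simp: rep_def)
qed

lemma norm_sq_sum: "(norm (x::'b::euclidean_space))^2 = (\<Sum>i\<in>Basis. (x \<bullet> i)^2)"
 unfolding power2_norm_eq_inner by (subst euclidean_inner) (simp add: power2_eq_square)

lemma L2_rep_iff:
 assumes U: "U \<in> sets borel" and r: "rep U f f'"
 shows "f \<in> L2 U \<longleftrightarrow> (\<forall>i\<in>Basis. sqint (\<lambda>x. f' x \<bullet> i))"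
proof -
 have [measurable]: "f' \<in> borel_measurable borel" using r by (simp add: rep_def)
 have "f \<in> L2 U \<longleftrightarrow> integrable lborel (\<lambda>x. (norm (f' x))^2)"
  using r rep_integral(2)[OF U rep_compose[OF r, of "\<lambda>y. (norm y)^2"]] by (auto simp: L2_def rep_def)
 also have "\<dots> \<longleftrightarrow> (\<forall>i\<in>Basis. integrable lborel (\<lambda>x. (f' x \<bullet> i)^2))"
 proof
  assume *: "integrable lborel (\<lambda>x. (norm (f' x))^2)"
  show "\<forall>i\<in>Basis. integrable lborel (\<lambda>x. (f' x \<bullet> i)^2)"
  proof
   fix i :: 'b assume "i \<in> Basis"
   then show "integrable lborel (\<lambda>x. (f' x \<bullet> i)^2)"
    by (intro Bochner_Integration.integrable_bound[OF *])
     (auto simp: Basis_le_norm power2_norm_eq_inner[symmetric] abs_le_square_iff[symmetric])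
  qed
 qed (auto simp: norm_sq_sum)
 finally show ?thesis by (auto simp: sqint_def)
qed

lemma L2_rep_real_iff:
 fixes f :: "'a::euclidean_space \<Rightarrow> real"
 assumes "U \<in> sets borel" and "rep U f f'"
 shows "f \<in> L2 U \<longleftrightarrow> sqint f'"
 using L2_rep_iff[OF assms] by simp

lemma L2_borel: "f \<in> L2 U \<Longrightarrow> f \<in> borel_measurable (lebesgue_on U)"
 by (simp add: L2_def)

lemma L2_integrable: "f \<in> L2 U \<Longrightarrow> integrable (lebesgue_on U) (\<lambda>x. (norm (f x))^2)"
 by (simp add: L2_def)

lemma L2_inner_integrable:
 assumes f: "f \<in> L2 U" and g: "g \<in> L2 U"
 shows "integrable (lebesgue_on U) (\<lambda>x. f x \<bullet> g x)"
  and "integrable (lebesgue_on U) (\<lambda>x. norm (f x) * norm (g x))"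
proof -
 note [measurable] = L2_borel[OF f] L2_borel[OF g]
 show i: "integrable (lebesgue_on U) (\<lambda>x. norm (f x) * norm (g x))"
  by (rule Cauchy_Schwarz_integral(1)) (use L2_integrable[OF f] L2_integrable[OF g] in auto)
 show "integrable (lebesgue_on U) (\<lambda>x. f x \<bullet> g x)"
  by (rule Bochner_Integration.integrable_bound[OF i]) (auto simp: Cauchy_Schwarz_ineq2)
qed

lemma L2_norm_nonneg: "0 \<le> L2_norm U f"
 by (auto simp: L2_norm_def L2_inner_def intro!: Bochner_Integration.integral_nonneg)

lemma L2_norm_sq: "(L2_norm U f)^2 = (LINT x|lebesgue_on U. (norm (f x))^2)"
 unfolding L2_norm_def L2_inner_def
 by (subst real_sqrt_pow2) (auto simp: power2_norm_eq_inner intro!: Bochner_Integration.integral_nonneg)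

lemma L2_inner_self: "L2_inner U f f = (L2_norm U f)^2"
 by (simp add: L2_norm_sq L2_inner_def power2_norm_eq_inner)

lemma L2_Cauchy_Schwarz:
 assumes f: "f \<in> L2 U" and g: "g \<in> L2 U"
 shows "(LINT x|lebesgue_on U. norm (f x) * norm (g x)) \<le> L2_norm U f * L2_norm U g"
  and "\<bar>L2_inner U f g\<bar> \<le> L2_norm U f * L2_norm U g"
proof -
 note [measurable] = L2_borel[OF f] L2_borel[OF g]
 have "(LINT x|lebesgue_on U. \<bar>norm (f x)\<bar> * \<bar>norm (g x)\<bar>)^2 \<le> (L2_norm U f)^2 * (L2_norm U g)^2"
  unfolding L2_norm_sq
  by (rule Cauchy_Schwarz_integral(3)) (use L2_integrable[OF f] L2_integrable[OF g] in auto)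
 then show 1: "(LINT x|lebesgue_on U. norm (f x) * norm (g x)) \<le> L2_norm U f * L2_norm U g"
  using L2_norm_nonneg[of U f] L2_norm_nonneg[of U g]
  by (simp add: power_mult_distrib[symmetric] abs_le_square_iff[symmetric] abs_mult)
 have "\<bar>L2_inner U f g\<bar> \<le> (LINT x|lebesgue_on U. \<bar>f x \<bullet> g x\<bar>)"
  unfolding L2_inner_def by (rule integral_abs_bound)
 also have "\<dots> \<le> (LINT x|lebesgue_on U. norm (f x) * norm (g x))"
  by (intro integral_mono integrable_abs L2_inner_integrable f g Cauchy_Schwarz_ineq2)
 finally show "\<bar>L2_inner U f g\<bar> \<le> L2_norm U f * L2_norm U g" using 1 by linarith
qed

lemma L2_scaleR: "f \<in> L2 U \<Longrightarrow> (\<lambda>x. c *\<^sub>R f x) \<in> L2 U"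
 by (auto simp: L2_def power_mult_distrib)

lemma L2_add: assumes f: "f \<in> L2 U" and g: "g \<in> L2 U" shows "(\<lambda>x. f x + g x) \<in> L2 U"
proof -
 note [measurable] = L2_borel[OF f] L2_borel[OF g]
 have "integrable (lebesgue_on U) (\<lambda>x. (norm (f x))^2 + 2 * (f x \<bullet> g x) + (norm (g x))^2)"
  by (intro Bochner_Integration.integrable_add integrable_mult_right L2_integrable L2_inner_integrable f g)
 then have "integrable (lebesgue_on U) (\<lambda>x. (norm (f x + g x))^2)"
  by (rule back_subst[of "integrable _"]) (auto simp: power2_norm_eq_inner inner_add inner_commute)
 then show ?thesis by (auto simp: L2_def)
qed

lemma L2_diff: "f \<in> L2 U \<Longrightarrow> g \<in> L2 U \<Longrightarrow> (\<lambda>x. f x - g x) \<in> L2 U"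
 using L2_add[of f U "\<lambda>x. (-1) *\<^sub>R g x"] L2_scaleR[of g U "-1"] by simp

lemma L2_zero [simp]: "(\<lambda>x. 0) \<in> L2 U" by (simp add: L2_def)

lemma L2_norm_zero [simp]: "L2_norm U (\<lambda>x. 0) = 0" by (simp add: L2_norm_def L2_inner_def)

lemma L2_inner_commute: "L2_inner U f g = L2_inner U g f"
 by (simp add: L2_inner_def inner_commute)

lemma L2_inner_add_left: "f \<in> L2 U \<Longrightarrow> g \<in> L2 U \<Longrightarrow> h \<in> L2 U \<Longrightarrow>
  L2_inner U (\<lambda>x. f x + g x) h = L2_inner U f h + L2_inner U g h"
 by (simp add: L2_inner_def inner_add_left L2_inner_integrable)

lemma L2_inner_diff_left: "f \<in> L2 U \<Longrightarrow> g \<in> L2 U \<Longrightarrow> h \<in> L2 U \<Longrightarrow>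
  L2_inner U (\<lambda>x. f x - g x) h = L2_inner U f h - L2_inner U g h"
 by (simp add: L2_inner_def inner_diff_left L2_inner_integrable)

lemma L2_inner_scaleR_left: "L2_inner U (\<lambda>x. c *\<^sub>R f x) g = c * L2_inner U f g"
 by (simp add: L2_inner_def)

lemma L2_inner_add_right: "f \<in> L2 U \<Longrightarrow> g \<in> L2 U \<Longrightarrow> h \<in> L2 U \<Longrightarrow>
  L2_inner U h (\<lambda>x. f x + g x) = L2_inner U h f + L2_inner U h g"
 by (simp add: L2_inner_def inner_add_right L2_inner_integrable)

lemma L2_inner_diff_right: "f \<in> L2 U \<Longrightarrow> g \<in> L2 U \<Longrightarrow> h \<in> L2 U \<Longrightarrow>
  L2_inner U h (\<lambda>x. f x - g x) = L2_inner U h f - L2_inner U h g"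
 by (simp add: L2_inner_def inner_diff_right L2_inner_integrable)

lemma L2_inner_scaleR_right: "L2_inner U g (\<lambda>x. c *\<^sub>R f x) = c * L2_inner U g f"
 by (simp add: L2_inner_def)

lemma L2_inner_cong_AE:
 assumes "f \<in> L2 U" "f' \<in> L2 U" "g \<in> L2 U" "g' \<in> L2 U"
  and ae: "AE x in lebesgue_on U. f x = f' x" "AE x in lebesgue_on U. g x = g' x"
 shows "L2_inner U f g = L2_inner U f' g'"
proof -
 note [measurable] = assms(1-4)[THEN L2_borel]
 show ?thesis unfolding L2_inner_def
  by (rule integral_cong_AE) (use ae in \<open>auto elim!: eventually_elim2\<close>)
qed

lemma L2_norm_triangle:
 assumes f: "f \<in> L2 U" and g: "g \<in> L2 U"
 shows "L2_norm U (\<lambda>x. f x + g x) \<le> L2_norm U f + L2_norm U g"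
proof -
 have "(L2_norm U (\<lambda>x. f x + g x))^2 = (L2_norm U f)^2 + 2 * L2_inner U f g + (L2_norm U g)^2"
  using L2_inner_commute[of U g f]
  by (simp add: L2_inner_self[symmetric] L2_inner_add_left L2_inner_add_right L2_add f g)
 also have "\<dots> \<le> (L2_norm U f + L2_norm U g)^2"
  using L2_Cauchy_Schwarz(2)[OF f g] by (simp add: power2_sum)
 finally show ?thesis
  by (rule power2_le_imp_le) (simp add: L2_norm_nonneg)
qed

lemma L2_norm_scaleR: "L2_norm U (\<lambda>x. c *\<^sub>R f x) = \<bar>c\<bar> * L2_norm U f"
 by (simp add: L2_norm_def L2_inner_scaleR_left L2_inner_scaleR_right real_sqrt_mult flip: mult.assoc)

lemma L2_norm_diff_commute: "L2_norm U (\<lambda>x. f x - g x) = L2_norm U (\<lambda>x. g x - f x)"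
 using L2_norm_scaleR[of U "-1" "\<lambda>x. f x - g x"] by simp

lemma L2_norm_diff_triangle:
 assumes f: "f \<in> L2 U" and g: "g \<in> L2 U"
 shows "L2_norm U (\<lambda>x. f x - g x) \<le> L2_norm U f + L2_norm U g"
 using L2_norm_triangle[OF f L2_scaleR[OF g, of "-1"]] L2_norm_scaleR[of U "-1" g] by simp

lemma L2_norm_cong_AE:
 assumes "f \<in> L2 U" "g \<in> L2 U" "AE x in lebesgue_on U. f x = g x"
 shows "L2_norm U f = L2_norm U g"
 using L2_inner_cong_AE[of f U g f g] assms by (simp add: L2_norm_def)

lemma L2_norm_mono:
 assumes f: "f \<in> borel_measurable (lebesgue_on U)" and g: "g \<in> L2 U"
  and ae: "AE x in lebesgue_on U. norm (f x) \<le> K * norm (g x)" and K: "0 \<le> K"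
 shows "f \<in> L2 U" "L2_norm U f \<le> K * L2_norm U g"
proof -
 note [measurable] = f L2_borel[OF g]
 have le: "AE x in lebesgue_on U. (norm (f x))^2 \<le> K^2 * (norm (g x))^2"
  using ae by eventually_elim (metis norm_ge_zero power_mono power_mult_distrib)
 have ig: "integrable (lebesgue_on U) (\<lambda>x. K^2 * (norm (g x))^2)" using L2_integrable[OF g] by simp
 have i: "integrable (lebesgue_on U) (\<lambda>x. (norm (f x))^2)"
  by (rule Bochner_Integration.integrable_bound[OF ig]) (use le in auto)
 then show "f \<in> L2 U" by (simp add: L2_def)
 have "(L2_norm U f)^2 \<le> (K * L2_norm U g)^2"
  unfolding L2_norm_sq power_mult_distrib
  using integral_mono_AE[OF i ig le] by simp
 then show "L2_norm U f \<le> K * L2_norm U g"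
  by (rule power2_le_imp_le) (simp add: L2_norm_nonneg K)
qed

lemma L2_bounded_scaleR:
 assumes a: "a \<in> borel_measurable (lebesgue_on U)" and K: "AE x in lebesgue_on U. \<bar>a x\<bar> \<le> K" "0 \<le> K"
  and f: "f \<in> L2 U"
 shows "(\<lambda>x. a x *\<^sub>R f x) \<in> L2 U" "L2_norm U (\<lambda>x. a x *\<^sub>R f x) \<le> K * L2_norm U f"
proof -
 note [measurable] = a L2_borel[OF f]
 have m: "(\<lambda>x. a x *\<^sub>R f x) \<in> borel_measurable (lebesgue_on U)" by measurable
 have "AE x in lebesgue_on U. norm (a x *\<^sub>R f x) \<le> K * norm (f x)"
  using K(1) by eventually_elim (auto intro!: mult_right_mono)
 from L2_norm_mono[OF m f this K(2)]
 show "(\<lambda>x. a x *\<^sub>R f x) \<in> L2 U" "L2_norm U (\<lambda>x. a x *\<^sub>R f x) \<le> K * L2_norm U f" by auto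
qed

lemma L2_norm_eq_0_AE:
 assumes "f \<in> L2 U" "L2_norm U f = 0" shows "AE x in lebesgue_on U. f x = 0"
proof -
 have "(LINT x|lebesgue_on U. (norm (f x))^2) = 0" using assms L2_norm_sq[of U f] by simp
 then have "AE x in lebesgue_on U. (norm (f x))^2 = 0"
  using integral_nonneg_eq_0_iff_AE[OF L2_integrable[OF assms(1)]] by simp
 then show ?thesis by eventually_elim simp
qed

section \<open>Calculus of weak gradients\<close>

text \<open>Carries the gradient along explicitly, because \<open>grad\<close> picks an unspecified representative, for which the
 rules of calculus hold only almost everywhere.\<close>

definition has_grad :: "'a::euclidean_space set \<Rightarrow> ('a \<Rightarrow> real) \<Rightarrow> ('a \<Rightarrow> 'a) \<Rightarrow> bool" where
 "has_grad U u G \<longleftrightarrow> u \<in> L2 U \<and> G \<in> L2 U \<and> is_weak_grad U u G"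

lemma has_grad_grad: "u \<in> H1 U \<Longrightarrow> has_grad U u (grad U u)"
 using grad_H1[of u U] by (auto simp: has_grad_def H1_def)

lemma has_grad_H1: "has_grad U u G \<Longrightarrow> u \<in> H1 U"
 by (auto simp: has_grad_def H1_def)

lemma is_weak_grad_rep_iff:
 assumes U: "U \<in> sets borel" and u: "rep U u u'" and G: "rep U G G'"
 shows "is_weak_grad U u G \<longleftrightarrow> (\<forall>\<psi>. test_function U \<psi> \<longrightarrow> (\<forall>i\<in>Basis.
    (LBINT x. u' x * fdiff \<psi> x i) = - (LBINT x. (G' x \<bullet> i) * \<psi> x)))"
proof -
 have "(LINT x|lebesgue_on U. u x * fdiff \<psi> x i) = (LBINT x. u' x * fdiff \<psi> x i)"
   "(LINT x|lebesgue_on U. (G x \<bullet> i) * \<psi> x) = (LBINT x. (G' x \<bullet> i) * \<psi> x)"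
  if \<psi>: "test_function U \<psi>" and i: "i \<in> Basis" for \<psi> i
 proof -
  show "(LINT x|lebesgue_on U. u x * fdiff \<psi> x i) = (LBINT x. u' x * fdiff \<psi> x i)"
   by (rule rep_integral(1)[OF U rep_mult_borel[OF u test_function_borel[OF test_function_partial[OF \<psi> i]]]])
  have "rep U (\<lambda>x. G x \<bullet> i) (\<lambda>x. G' x \<bullet> i)" by (rule rep_compose[OF G]) auto
  then show "(LINT x|lebesgue_on U. (G x \<bullet> i) * \<psi> x) = (LBINT x. (G' x \<bullet> i) * \<psi> x)"
   by (intro rep_integral(1)[OF U rep_mult_borel[OF _ test_function_borel[OF \<psi>]]])
 qed
 then show ?thesis unfolding is_weak_grad_def by simp
qed

lemma has_grad_rep_iff:
 assumes "U \<in> sets borel" "rep U u u'" "rep U G G'"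
 shows "has_grad U u G \<longleftrightarrow> weak_pair U u' G'"
 using is_weak_grad_rep_iff[OF assms] L2_rep_real_iff[OF assms(1,2)] L2_rep_iff[OF assms(1,3)]
 by (auto simp: has_grad_def weak_pair_def)

lemma has_grad_rep:
 assumes U: "U \<in> sets borel" and h: "has_grad U u G"
 obtains u' G' where "rep U u u'" "rep U G G'" "weak_pair U u' G'"
proof -
 obtain u' where u': "rep U u u'"
  using rep_exists[OF U, of u] h by (auto simp: has_grad_def L2_borel)
 obtain G' where G': "rep U G G'"
  using rep_exists[OF U, of G] h by (auto simp: has_grad_def L2_borel)
 show ?thesis using that[OF u' G'] has_grad_rep_iff[OF U u' G'] h by blast
qed

lemma sqint_test_integrable:
 assumes "sqint f" "test_function U \<psi>" shows "integrable lborel (\<lambda>x. f x * \<psi> x)"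
 using sqint_mult_integrable[OF assms(1) test_function_sqint[OF assms(2)]] .

lemma has_grad_lincomb:
 assumes U: "U \<in> sets borel" and u: "has_grad U u G" and v: "has_grad U v H"
 shows "has_grad U (\<lambda>x. a * u x + b * v x) (\<lambda>x. a *\<^sub>R G x + b *\<^sub>R H x)"
proof -
 obtain u' G' where u': "rep U u u'" "rep U G G'" "weak_pair U u' G'" using has_grad_rep[OF U u] .
 obtain v' H' where v': "rep U v v'" "rep U H H'" "weak_pair U v' H'" using has_grad_rep[OF U v] .
 have r1: "rep U (\<lambda>x. a * u x + b * v x) (\<lambda>x. a * u' x + b * v' x)"
  by (rule rep_compose2[OF u'(1) v'(1)]) (auto intro!: continuous_intros)
 have r2: "rep U (\<lambda>x. a *\<^sub>R G x + b *\<^sub>R H x) (\<lambda>x. a *\<^sub>R G' x + b *\<^sub>R H' x)"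
  by (rule rep_compose2[OF u'(2) v'(2)]) (auto intro!: continuous_intros)
 have "weak_pair U (\<lambda>x. a * u' x + b * v' x) (\<lambda>x. a *\<^sub>R G' x + b *\<^sub>R H' x)"
  unfolding weak_pair_def
 proof (intro conjI allI impI ballI)
  show "sqint (\<lambda>x. a * u' x + b * v' x)"
   using u' v' by (intro sqint_add sqint_cmult) (auto simp: weak_pair_def)
  show "sqint (\<lambda>x. (a *\<^sub>R G' x + b *\<^sub>R H' x) \<bullet> i)" if "i \<in> Basis" for i
   using u' v' that unfolding inner_add_left inner_scaleR_left
   by (intro sqint_add sqint_cmult) (auto simp: weak_pair_def)
  fix \<psi> :: "'a \<Rightarrow> real" and i :: 'a assume \<psi>: "test_function U \<psi>" and i: "i \<in> Basis"
  have sq: "sqint u'" "sqint v'" "sqint (\<lambda>x. G' x \<bullet> i)" "sqint (\<lambda>x. H' x \<bullet> i)"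
   using u' v' i by (auto simp: weak_pair_def)
  note int = sq[THEN sqint_test_integrable[OF _ \<psi>]] sq[THEN sqint_test_integrable[OF _ test_function_partial[OF \<psi> i]]]
  have "(LBINT x. u' x * fdiff \<psi> x i) = - (LBINT x. (G' x \<bullet> i) * \<psi> x)"
   "(LBINT x. v' x * fdiff \<psi> x i) = - (LBINT x. (H' x \<bullet> i) * \<psi> x)"
   using u' v' \<psi> i by (auto simp: weak_pair_def)
  then show "(LBINT x. (a * u' x + b * v' x) * fdiff \<psi> x i) = - (LBINT x. ((a *\<^sub>R G' x + b *\<^sub>R H' x) \<bullet> i) * \<psi> x)"
   using int by (simp add: distrib_right inner_add_left mult.assoc)
 qed
 then show ?thesis using has_grad_rep_iff[OF U r1 r2] by blast
qed

lemma has_grad_add: "U \<in> sets borel \<Longrightarrow> has_grad U u G \<Longrightarrow> has_grad U v H \<Longrightarrow> has_grad U (\<lambda>x. u x + v x) (\<lambda>x. G x + H x)"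
 using has_grad_lincomb[of U u G v H 1 1] by simp

lemma has_grad_diff: "U \<in> sets borel \<Longrightarrow> has_grad U u G \<Longrightarrow> has_grad U v H \<Longrightarrow> has_grad U (\<lambda>x. u x - v x) (\<lambda>x. G x - H x)"
 using has_grad_lincomb[of U u G v H 1 "-1"] by simp

lemma has_grad_cmult: "U \<in> sets borel \<Longrightarrow> has_grad U u G \<Longrightarrow> has_grad U (\<lambda>x. c * u x) (\<lambda>x. c *\<^sub>R G x)"
 using has_grad_lincomb[of U u G u G c 0] by simp

lemma has_grad_zero: "has_grad U (\<lambda>x. 0) (\<lambda>x. 0)"
 by (auto simp: has_grad_def is_weak_grad_def)

lemma has_grad_cong_AE:
 assumes U: "U \<in> sets borel" and u: "has_grad U u G" and m: "v \<in> L2 U" "H \<in> L2 U"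
  and ae: "AE x in lebesgue_on U. u x = v x" "AE x in lebesgue_on U. G x = H x"
 shows "has_grad U v H"
proof -
 obtain u' G' where u': "rep U u u'" "rep U G G'" "weak_pair U u' G'" using has_grad_rep[OF U u] .
 have "AE x in lebesgue_on U. u x = u' x" "AE x in lebesgue_on U. G x = G' x"
  using u'(1,2) by (auto simp: rep_def)
 with ae have "AE x in lebesgue_on U. v x = u' x \<and> H x = G' x" by eventually_elim simp
 then have "AE x in lebesgue_on U. v x = u' x" "AE x in lebesgue_on U. H x = G' x" by auto
 then have "rep U v u'" "rep U H G'"
  using u'(1,2) m[THEN L2_borel] by (simp_all add: rep_def)
 then show ?thesis using has_grad_rep_iff[OF U] u'(3) by blast
qed

lemma has_grad_unique:
 assumes U: "open U" and u: "has_grad U u G" and v: "has_grad U v H"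
  and ae: "AE x in lebesgue_on U. u x = v x"
 shows "AE x in lebesgue_on U. G x = H x"
proof -
 have Ub: "U \<in> sets borel" using U by simp
 obtain u' G' where u': "rep U u u'" "rep U G G'" "weak_pair U u' G'" using has_grad_rep[OF Ub u] .
 obtain v' H' where v': "rep U v v'" "rep U H H'" "weak_pair U v' H'" using has_grad_rep[OF Ub v] .
 have "AE x in lebesgue_on U. u x = u' x" "AE x in lebesgue_on U. v x = v' x"
  using u'(1) v'(1) by (auto simp: rep_def)
 with ae have "AE x in lebesgue_on U. u' x = v' x" by eventually_elim simp
 then have uv: "AE x in lborel. u' x = v' x"
  unfolding AE_lebesgue_on_iff[OF Ub]
 proof eventually_elim
  case (elim x)
  then show ?case using u'(1) v'(1) by (cases "x \<in> U") (auto simp: rep_def)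
 qed
 have "AE x in lborel. x \<in> U \<longrightarrow> G' x \<bullet> i - H' x \<bullet> i = 0" if i: "i \<in> Basis" for i
 proof (rule AE_zero_if_test_zero[OF _ U])
  have sq: "sqint u'" "sqint v'" "sqint (\<lambda>x. G' x \<bullet> i)" "sqint (\<lambda>x. H' x \<bullet> i)"
   using u' v' i by (auto simp: weak_pair_def)
  show "sqint (\<lambda>x. G' x \<bullet> i - H' x \<bullet> i)" by (intro sqint_diff sq)
  fix \<psi> :: "'a \<Rightarrow> real" assume \<psi>: "test_function U \<psi>"
  note [measurable] = sq[THEN sqint_borel] test_function_borel[OF \<psi>] test_function_borel[OF test_function_partial[OF \<psi> i]]
  have "(LBINT x. u' x * fdiff \<psi> x i) = (LBINT x. v' x * fdiff \<psi> x i)"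
   by (rule integral_cong_AE) (use uv in auto)
  then show "(LBINT x. (G' x \<bullet> i - H' x \<bullet> i) * \<psi> x) = 0"
   using u'(3) v'(3) \<psi> i sq[THEN sqint_test_integrable[OF _ \<psi>]] by (auto simp: weak_pair_def left_diff_distrib)
 qed
 then have "AE x in lborel. \<forall>i\<in>Basis. x \<in> U \<longrightarrow> G' x \<bullet> i - H' x \<bullet> i = 0"
  by (intro AE_finite_allI) auto
 then have "AE x in lborel. x \<in> U \<longrightarrow> G' x = H' x"
 proof (rule eventually_mono)
  fix x assume a: "\<forall>i\<in>Basis. x \<in> U \<longrightarrow> G' x \<bullet> i - H' x \<bullet> i = 0"
  show "x \<in> U \<longrightarrow> G' x = H' x"
  proof
   assume "x \<in> U"
   then show "G' x = H' x" using a by (subst euclidean_eq_iff) auto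
  qed
 qed
 then have "AE x in lebesgue_on U. G' x = H' x" by (simp only: AE_lebesgue_on_iff[OF Ub])
 moreover have "AE x in lebesgue_on U. G x = G' x" "AE x in lebesgue_on U. H x = H' x"
  using u'(2) v'(2) by (auto simp: rep_def)
 ultimately show ?thesis by eventually_elim simp
qed

lemma grad_AE:
 assumes U: "open U" and u: "has_grad U u G"
 shows "AE x in lebesgue_on U. grad U u x = G x"
 by (rule has_grad_unique[OF U has_grad_grad[OF has_grad_H1[OF u]] u]) simp

lemma has_grad_mult:
 assumes U: "open U" and u: "has_grad U u G" and v: "has_grad U v H"
  and K: "AE x in lebesgue_on U. \<bar>u x\<bar> \<le> K" and L: "AE x in lebesgue_on U. \<bar>v x\<bar> \<le> L" and "0 \<le> K" "0 \<le> L"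
 shows "has_grad U (\<lambda>x. u x * v x) (\<lambda>x. u x *\<^sub>R H x + v x *\<^sub>R G x)"
proof -
 have Ub: "U \<in> sets borel" using U by simp
 obtain u' G' where u': "rep U u u'" "rep U G G'" "weak_pair U u' G'" using has_grad_rep[OF Ub u] .
 obtain v' H' where v': "rep U v v'" "rep U H H'" "weak_pair U v' H'" using has_grad_rep[OF Ub v] .
 have r1: "rep U (\<lambda>x. u x * v x) (\<lambda>x. u' x * v' x)"
  by (rule rep_compose2[OF u'(1) v'(1)]) (auto intro!: continuous_intros)
 have r2: "rep U (\<lambda>x. u x *\<^sub>R H x + v x *\<^sub>R G x) (\<lambda>x. u' x *\<^sub>R H' x + v' x *\<^sub>R G' x)"
  by (rule rep_compose2[where h="\<lambda>a b. a + b", OF rep_compose2[where h="\<lambda>a b. a *\<^sub>R b", OF u'(1) v'(2)] rep_compose2[where h="\<lambda>a b. a *\<^sub>R b", OF v'(1) u'(2)]]) (auto intro!: continuous_intros)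
 have "(\<lambda>x. u x *\<^sub>R v x) \<in> L2 U"
  using u v K \<open>0 \<le> K\<close> by (intro L2_bounded_scaleR) (auto simp: has_grad_def L2_borel)
 moreover have "(\<lambda>x. u x *\<^sub>R H x + v x *\<^sub>R G x) \<in> L2 U"
  by (intro L2_add L2_bounded_scaleR(1)[OF _ K \<open>0 \<le> K\<close>] L2_bounded_scaleR(1)[OF _ L \<open>0 \<le> L\<close>])
   (use u v in \<open>auto simp: has_grad_def L2_borel\<close>)
 moreover have "is_weak_grad U (\<lambda>x. u x * v x) (\<lambda>x. u x *\<^sub>R H x + v x *\<^sub>R G x)"
  unfolding is_weak_grad_rep_iff[OF Ub r1 r2]
  using weak_product_rule[OF u'(3) v'(3) U] by (simp add: inner_add_left)
 ultimately show ?thesis by (simp add: has_grad_def)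
qed

lemma has_grad_power:
 assumes U: "open U" and u: "has_grad U u G" and K: "AE x in lebesgue_on U. \<bar>u x\<bar> \<le> K" "0 \<le> K"
 shows "has_grad U (\<lambda>x. u x ^ Suc n) (\<lambda>x. (real (Suc n) * u x ^ n) *\<^sub>R G x)"
proof (induction n)
 case 0 then show ?case using u by simp
next
 case (Suc n)
 have "AE x in lebesgue_on U. \<bar>u x ^ Suc n\<bar> \<le> K ^ Suc n"
  using K(1)
 proof eventually_elim
  case (elim x)
  then show ?case using power_mono[OF elim, of "Suc n"] by (simp only: power_abs abs_ge_zero)
 qed
 from has_grad_mult[OF U u Suc K(1) this] K(2)
 have "has_grad U (\<lambda>x. u x * u x ^ Suc n) (\<lambda>x. u x *\<^sub>R ((real (Suc n) * u x ^ n) *\<^sub>R G x) + (u x ^ Suc n) *\<^sub>R G x)" by simp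
 moreover have "u x *\<^sub>R ((real (Suc n) * u x ^ n) *\<^sub>R G x) + (u x ^ Suc n) *\<^sub>R G x = (real (Suc (Suc n)) * u x ^ Suc n) *\<^sub>R G x" for x
 proof -
  have "u x * (real (Suc n) * u x ^ n) + u x ^ Suc n = real (Suc (Suc n)) * u x ^ Suc n" by (simp add: algebra_simps)
  then show ?thesis by (simp only: scaleR_scaleR scaleR_add_left[symmetric])
 qed
 ultimately show ?case by simp
qed

lemma AE_not_in_ball:
 fixes x :: "'a::euclidean_space"
 assumes "AE y in lborel. y \<notin> ball x r" shows "r \<le> 0"
proof (rule ccontr)
 assume "\<not> r \<le> 0"
 have "emeasure lborel (ball x r) = 0"
  using assms by (subst (asm) AE_iff_measurable[of "ball x r"]) auto
 with \<open>\<not> r \<le> 0\<close> content_ball_pos[of r x] show False by (auto simp: Sigma_Algebra.measure_def)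
qed

text \<open>The mollifications have vanishing classical derivative on the ball and are constant there; a
 subsequence of them converges to \<open>u\<close> almost everywhere.\<close>

lemma has_grad_zero_locally_constant:
 assumes U: "open U" and u: "weak_pair U u (\<lambda>x. 0)" and x: "cball x r \<subseteq> U" and r: "r > 0"
 obtains c where "AE y in lborel. y \<in> ball x (r / 2) \<longrightarrow> u y = c"
proof -
 have sq: "sqint u" using u by (simp add: weak_pair_def)
 have T: "(\<lambda>n. r / 2 / real (Suc n)) \<longlonglongrightarrow> 0"
  using tendsto_mult[OF tendsto_const[of "r / 2"] LIMSEQ_inverse_real_of_nat]
  by (simp only: divide_inverse[symmetric] mult_zero_right)
 have Tp: "r / 2 / real (Suc n) > 0" for n using r by simp
 obtain k where k: "strict_mono k" "AE x in lborel. (\<lambda>n. std.avg (r / 2 / real (Suc (k n))) u x) \<longlonglongrightarrow> u x"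
  using std.avg_AE_subseq[OF sq Tp T] by blast
 have const: "std.avg (r / 2 / real (Suc n)) u y = std.avg (r / 2 / real (Suc n)) u z"
  if yz: "y \<in> ball x (r / 2)" "z \<in> ball x (r / 2)" for n y z
 proof -
  let ?t = "r / 2 / real (Suc n)"
  have "(std.avg ?t u has_derivative (\<lambda>h. 0)) (at a within ball x (r / 2))" if a: "a \<in> ball x (r / 2)" for a
  proof -
   have tr: "?t \<le> r / 2" using r by (simp add: divide_simps)
   have "cball a ?t \<subseteq> cball x r"
   proof
    fix b assume "b \<in> cball a ?t"
    then have "dist a b \<le> r / 2" using tr by (simp only: mem_cball)
    moreover have "dist x a < r / 2" using a by simp
    ultimately show "b \<in> cball x r" using dist_triangle[of x b a] by simp
   qed
   then have "cball a ?t \<subseteq> U" using x by blast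
   from std_avg_has_derivative[OF u Tp this]
   have "(std.avg ?t u has_derivative (\<lambda>h. 0)) (at a)" by (simp add: std.avg_def)
   then show ?thesis by (rule has_derivative_at_withinI)
  qed
  then obtain c where "\<And>a. a \<in> ball x (r / 2) \<Longrightarrow> std.avg ?t u a = c"
   using has_derivative_zero_constant[of "ball x (r / 2)" "std.avg ?t u"] by auto
  with yz show ?thesis by simp
 qed
 have "\<exists>y\<in>ball x (r / 2). (\<lambda>n. std.avg (r / 2 / real (Suc (k n))) u y) \<longlonglongrightarrow> u y"
 proof (rule ccontr)
  assume "\<not> ?thesis"
  then have "AE y in lborel. y \<notin> ball x (r / 2)" using k(2) by (auto elim!: eventually_mono)
  then show False using AE_not_in_ball[of x "r / 2"] r by simp
 qed
 then obtain y where y: "y \<in> ball x (r / 2)" "(\<lambda>n. std.avg (r / 2 / real (Suc (k n))) u y) \<longlonglongrightarrow> u y" by blast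
 have "AE z in lborel. z \<in> ball x (r / 2) \<longrightarrow> u z = u y"
  using k(2)
 proof eventually_elim
  case (elim z)
  show ?case
  proof
   assume "z \<in> ball x (r / 2)"
   then have "(\<lambda>n. std.avg (r / 2 / real (Suc (k n))) u y) \<longlonglongrightarrow> u z" using elim const[OF y(1)] by simp
   then show "u z = u y" using y(2) by (rule LIMSEQ_unique)
  qed
 qed
 then show ?thesis by (rule that)
qed

text \<open>The local constants form a locally constant function on the connected set \<open>U\<close>, which countably many of the
 balls cover.\<close>

lemma has_grad_zero_constant:
 assumes U: "open U" "connected U" and u: "has_grad U u (\<lambda>x. 0)"
 obtains c where "AE x in lebesgue_on U. u x = c"
proof (cases "U = {}")
 case True
 then have "AE x in lebesgue_on U. u x = 0" by (intro AE_I2) simp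
 then show ?thesis by (rule that)
next
 case False
 have Ub: "U \<in> sets borel" using U by simp
 have r0: "rep U (\<lambda>x. 0) (\<lambda>x. 0 :: 'a)" by (simp add: rep_def)
 obtain u' where u': "rep U u u'"
  using rep_exists[OF Ub, of u] u by (auto simp: has_grad_def L2_borel)
 have wp: "weak_pair U u' (\<lambda>x. 0)" using has_grad_rep_iff[OF Ub u' r0] u by blast
 have "\<exists>c r. r > 0 \<and> ball x r \<subseteq> U \<and> (AE y in lborel. y \<in> ball x r \<longrightarrow> u' y = c)" if x: "x \<in> U" for x
 proof -
  obtain r where r: "r > 0" "cball x r \<subseteq> U" using x U open_contains_cball by blast
  obtain c where c: "AE y in lborel. y \<in> ball x (r / 2) \<longrightarrow> u' y = c"
   using has_grad_zero_locally_constant[OF U(1) wp r(2,1)] .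
  have "ball x (r / 2) \<subseteq> cball x r" using r(1) by (intro order_trans[OF ball_subset_cball] subset_cball) auto
  then have "r / 2 > 0" "ball x (r / 2) \<subseteq> U" using r by auto
  with c show ?thesis by blast
 qed
 then obtain k r where k: "\<And>x. x \<in> U \<Longrightarrow> r x > 0 \<and> ball x (r x) \<subseteq> U \<and> (AE y in lborel. y \<in> ball x (r x) \<longrightarrow> u' y = k x)"
  by metis
 have "k y = k x" if x: "x \<in> U" and y: "y \<in> ball x (r x)" for x y
 proof (rule ccontr)
  assume kd: "k y \<noteq> k x"
  have yU: "y \<in> U" using k[OF x] y by blast
  have "AE z in lborel. z \<notin> ball y (min (r y) (r x - dist x y))"
   using k[OF x, THEN conjunct2, THEN conjunct2] k[OF yU, THEN conjunct2, THEN conjunct2]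
  proof eventually_elim
   case (elim z)
   show ?case using elim kd dist_triangle[of x z y] by force
  qed
  then have "min (r y) (r x - dist x y) \<le> 0" by (rule AE_not_in_ball)
  then show False using k[OF yU] y by (auto simp: min_le_iff_disj)
 qed
 then have "k constant_on U"
 proof (intro locally_constant_imp_constant[OF U(2)] exI conjI ballI)
  fix x assume x: "x \<in> U"
  show "openin (top_of_set U) (ball x (r x))" using k[OF x] by (intro open_subset) auto
  show "x \<in> ball x (r x)" using k[OF x] by simp
 qed
 then obtain c where "\<And>x. x \<in> U \<Longrightarrow> k x = c" by (auto simp: constant_on_def)
 with k have r: "\<And>x. x \<in> U \<Longrightarrow> r x > 0 \<and> ball x (r x) \<subseteq> U \<and> (AE y in lborel. y \<in> ball x (r x) \<longrightarrow> u' y = c)" by auto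
 obtain F where F: "F \<subseteq> (\<lambda>x. ball x (r x)) ` U" "countable F" "\<Union>F = (\<Union>x\<in>U. ball x (r x))"
  using Lindelof[of "(\<lambda>x. ball x (r x)) ` U"] by auto
 have "AE y in lborel. \<forall>B\<in>F. y \<in> B \<longrightarrow> u' y = c"
  by (subst AE_ball_countable[OF F(2)]) (use F(1) r in blast)
 moreover have "U \<subseteq> \<Union>F" using r unfolding F(3) by (auto intro!: bexI)
 ultimately have "AE y in lborel. y \<in> U \<longrightarrow> u' y = c" by (auto elim!: eventually_mono)
 then have "AE y in lebesgue_on U. u' y = c" by (simp only: AE_lebesgue_on_iff[OF Ub])
 moreover have "AE y in lebesgue_on U. u y = u' y" using u' by (simp add: rep_def)
 ultimately have "AE y in lebesgue_on U. u y = c" by eventually_elim simp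
 then show ?thesis by (rule that)
qed

section \<open>A Gagliardo--Nirenberg inequality on Lipschitz domains\<close>

lemma integral_std_avg_bound:
 assumes G: "\<And>i. i \<in> Basis \<Longrightarrow> sqint (\<lambda>x. G x \<bullet> i)" and g: "sqint (\<lambda>x. norm (G x))" and t: "t > 0"
 shows "\<bar>\<Sum>i\<in>Basis. (z \<bullet> i) * std.avg t (\<lambda>y. G y \<bullet> i) x\<bar> \<le> norm z * std.avg t (\<lambda>y. norm (G y)) x"
proof -
 have i1: "integrable lborel (\<lambda>y. std_kernel y * (z \<bullet> G (x + t *\<^sub>R y)))"
 proof -
  have "integrable lborel (\<lambda>y. \<Sum>i\<in>Basis. (z \<bullet> i) * (std_kernel y * (G (x + t *\<^sub>R y) \<bullet> i)))"
   by (intro Bochner_Integration.integrable_sum integrable_mult_right std.avg_integrable G t)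
  then show ?thesis
   by (subst euclidean_inner) (simp add: sum_distrib_left mult_ac)
 qed
 have "(\<Sum>i\<in>Basis. (z \<bullet> i) * std.avg t (\<lambda>y. G y \<bullet> i) x)
   = (LBINT y. (\<Sum>i\<in>Basis. (z \<bullet> i) * (std_kernel y * (G (x + t *\<^sub>R y) \<bullet> i))))"
  unfolding std.avg_def
  by (subst Bochner_Integration.integral_sum) (auto intro!: integrable_mult_right std.avg_integrable G t)
 also have "\<dots> = (LBINT y. std_kernel y * (z \<bullet> G (x + t *\<^sub>R y)))"
  by (subst (3) euclidean_inner) (simp add: sum_distrib_left mult_ac)
 also have "\<bar>\<dots>\<bar> \<le> (LBINT y. \<bar>std_kernel y * (z \<bullet> G (x + t *\<^sub>R y))\<bar>)" by (rule integral_abs_bound)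
 also have "\<dots> \<le> (LBINT y. norm z * (std_kernel y * norm (G (x + t *\<^sub>R y))))"
 proof (rule integral_mono)
  show "integrable lborel (\<lambda>y. \<bar>std_kernel y * (z \<bullet> G (x + t *\<^sub>R y))\<bar>)" using i1 by (rule integrable_abs)
  show "integrable lborel (\<lambda>y. norm z * (std_kernel y * norm (G (x + t *\<^sub>R y))))"
   by (intro integrable_mult_right std.avg_integrable g t)
  show "\<bar>std_kernel y * (z \<bullet> G (x + t *\<^sub>R y))\<bar> \<le> norm z * (std_kernel y * norm (G (x + t *\<^sub>R y)))" for y
   using mult_left_mono[OF Cauchy_Schwarz_ineq2[of z "G (x + t *\<^sub>R y)"] std.nonneg[of y]] std.nonneg[of y]
   by (simp add: abs_mult mult_ac)
 qed
 also have "\<dots> = norm z * std.avg t (\<lambda>y. norm (G y)) x" by (simp add: std.avg_def)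
 finally show ?thesis .
qed

text \<open>The fundamental theorem of calculus; \<open>U\<close> has to contain the \<open>d\<close>-neighbourhood of the segment, on which the
 mollification is differentiable.\<close>

lemma std_avg_segment:
 fixes u :: "'a::euclidean_space \<Rightarrow> real"
 assumes uG: "weak_pair U u G" and g: "sqint (\<lambda>x. norm (G x))" and d: "d > 0" and s: "s \<le> \<tau>"
  and x: "\<And>t. t \<in> {s..\<tau>} \<Longrightarrow> cball (x + t *\<^sub>R z) d \<subseteq> U"
 shows "ennreal \<bar>std.avg d u (x + \<tau> *\<^sub>R z) - std.avg d u (x + s *\<^sub>R z)\<bar>
  \<le> (\<integral>\<^sup>+t. ennreal (norm z * std.avg d (\<lambda>y. norm (G y)) (x + t *\<^sub>R z)) * indicator {s..\<tau>} t \<partial>lborel)"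
proof -
 have u: "sqint u" and G: "\<And>i. i \<in> Basis \<Longrightarrow> sqint (\<lambda>x. G x \<bullet> i)" using uG by (auto simp: weak_pair_def)
 define f where "f t = (\<Sum>i\<in>Basis. (z \<bullet> i) * std.avg d (\<lambda>y. G y \<bullet> i) (x + t *\<^sub>R z))" for t
 have der: "((\<lambda>t. std.avg d u (x + t *\<^sub>R z)) has_vector_derivative f t) (at t within {s..\<tau>})" if t: "t \<in> {s..\<tau>}" for t
 proof -
  have "((\<lambda>t. std.avg d u (x + t *\<^sub>R z)) has_derivative (\<lambda>h. \<Sum>i\<in>Basis. ((h *\<^sub>R z) \<bullet> i) * std.avg d (\<lambda>y. G y \<bullet> i) (x + t *\<^sub>R z))) (at t)"
   by (rule has_derivative_compose[of "\<lambda>t. x + t *\<^sub>R z", OF _ std_avg_has_derivative[OF uG d x[OF t]]])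
    (auto intro!: derivative_eq_intros)
  moreover have "(\<lambda>h. \<Sum>i\<in>Basis. ((h *\<^sub>R z) \<bullet> i) * std.avg d (\<lambda>y. G y \<bullet> i) (x + t *\<^sub>R z)) = (\<lambda>h. h *\<^sub>R f t)"
   by (simp add: f_def sum_distrib_left mult.assoc)
  ultimately show ?thesis
   unfolding has_vector_derivative_def by (auto intro: has_derivative_at_withinI)
 qed
 have cont: "continuous_on UNIV (std.avg d w)" if "sqint w" for w :: "'a \<Rightarrow> real"
  using std_avg_C_k[OF that d, of 0] by simp
 have cl: "continuous_on UNIV (\<lambda>t. x + t *\<^sub>R z)" by (intro continuous_intros)
 have gc: "continuous_on UNIV (\<lambda>t. std.avg d (\<lambda>y. norm (G y)) (x + t *\<^sub>R z))"
  by (rule continuous_on_compose2[OF cont[OF g] cl]) auto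
 let ?g = "\<lambda>t. norm z * std.avg d (\<lambda>y. norm (G y)) (x + t *\<^sub>R z)"
 have fi: "(f has_integral (std.avg d u (x + \<tau> *\<^sub>R z) - std.avg d u (x + s *\<^sub>R z))) {s..\<tau>}"
  by (rule fundamental_theorem_of_calculus[OF s der])
 have gi: "?g integrable_on {s..\<tau>}"
  by (intro integrable_continuous_real continuous_on_mult_left continuous_on_subset[OF gc]) auto
 have fg: "\<bar>f t\<bar> \<le> ?g t" for t
  unfolding f_def by (rule integral_std_avg_bound[OF G g d])
 have g0: "0 \<le> ?g t" for t using fg[of t] abs_ge_zero order_trans by blast
 have "\<bar>integral {s..\<tau>} f\<bar> \<le> integral {s..\<tau>} ?g"
  using integral_norm_bound_integral[of f "{s..\<tau>}" ?g] fi gi fg by auto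
 then have "\<bar>std.avg d u (x + \<tau> *\<^sub>R z) - std.avg d u (x + s *\<^sub>R z)\<bar> \<le> integral {s..\<tau>} ?g"
  using fi by (simp add: integral_unique)
 then have "ennreal \<bar>std.avg d u (x + \<tau> *\<^sub>R z) - std.avg d u (x + s *\<^sub>R z)\<bar> \<le> ennreal (integral {s..\<tau>} ?g)"
  by (rule ennreal_leI)
 also have "ennreal (integral {s..\<tau>} ?g) = (\<integral>\<^sup>+t. ennreal (?g t) * indicator {s..\<tau>} t \<partial>lborel)"
  by (rule nn_integral_has_integral_lebesgue'[symmetric, OF g0 integrable_integral[OF gi]])
 finally show ?thesis .
qed

context averaging_kernel begin

lemma avg_close:
 assumes "sqint v" "sqint w" "t > 0"
 shows "\<bar>avg t v x - avg t w x\<bar> \<le> sqrt (B * (LBINT x. (v x - w x)^2) / t ^ DIM('a))"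
 using avg_sup[OF sqint_diff[OF assms(1,2)] assms(3), of x]
 by (simp add: avg_diff[OF assms] real_le_rsqrt real_sqrt_abs[symmetric] del: real_sqrt_abs)

lemma avg_nonneg: "(\<And>x. 0 \<le> w x) \<Longrightarrow> 0 \<le> avg t w x"
 unfolding avg_def by (intro Bochner_Integration.integral_nonneg mult_nonneg_nonneg nonneg)

text \<open>As \<open>t\<close> changes, each point \<open>x + t z\<close> runs along a segment; the increments along these segments are
 averaged over \<open>z\<close>. If \<open>\<rho>\<close> is supported in a ball away from the origin, the segments fill a cone at \<open>x\<close>.\<close>

lemma avg_increment_mollified:
 fixes u :: "'a \<Rightarrow> real"
 assumes uG: "weak_pair U u G" and g: "sqint (\<lambda>x. norm (G x))" and d: "d > 0" and s: "0 < s" "s \<le> \<tau>"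
  and x: "\<And>t z. t \<in> {s..\<tau>} \<Longrightarrow> \<rho> z \<noteq> 0 \<Longrightarrow> cball (x + t *\<^sub>R z) d \<subseteq> U"
 shows "ennreal \<bar>avg \<tau> (std.avg d u) x - avg s (std.avg d u) x\<bar>
  \<le> (\<integral>\<^sup>+t. ennreal (R * avg t (std.avg d (\<lambda>y. norm (G y))) x) * indicator {s..\<tau>} t \<partial>lborel)"
proof -
 have u: "sqint u" using uG by (simp add: weak_pair_def)
 let ?u = "std.avg d u" and ?g = "std.avg d (\<lambda>y. norm (G y))"
 let ?d = "\<lambda>z. \<rho> z * (?u (x + \<tau> *\<^sub>R z) - ?u (x + s *\<^sub>R z))" and ?f = "\<lambda>t z. R * (\<rho> z * ?g (x + t *\<^sub>R z))" and ?i = "\<lambda>t. indicator {s..\<tau>} t :: ennreal"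
 have su: "sqint ?u" and sg: "sqint ?g" by (intro std.avg_L2 u g d)+
 note [measurable] = sqint_borel[OF su] sqint_borel[OF sg]
 have g0: "0 \<le> ?g y" for y by (rule std.avg_nonneg) simp
 have \<tau>: "\<tau> > 0" using s by simp
 have "avg \<tau> ?u x - avg s ?u x = (LBINT z. ?d z)"
  unfolding avg_def using avg_integrable[OF su \<tau>, of x] avg_integrable[OF su s(1), of x] by (simp add: right_diff_distrib)
 then have "ennreal \<bar>avg \<tau> ?u x - avg s ?u x\<bar> \<le> (\<integral>\<^sup>+z. ennreal (norm (?d z)) \<partial>lborel)"
 proof -
  have "integrable lborel (\<lambda>z. ?d z)"
   using avg_integrable[OF su \<tau>, of x] avg_integrable[OF su s(1), of x] by (simp add: right_diff_distrib)
  from integral_norm_bound_ennreal[OF this] show ?thesis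
   by (simp add: \<open>avg \<tau> ?u x - avg s ?u x = _\<close>)
 qed
 also have "\<dots> \<le> (\<integral>\<^sup>+z. (\<integral>\<^sup>+t. ennreal (?f t z) * ?i t \<partial>lborel) \<partial>lborel)"
 proof (rule nn_integral_mono)
  fix z
  show "ennreal (norm (?d z))
   \<le> (\<integral>\<^sup>+t. ennreal (?f t z) * ?i t \<partial>lborel)"
  proof (cases "\<rho> z = 0")
   case False
   then have zR: "norm z \<le> R" using supp[of z] by force
   have "ennreal (norm (?d z)) = ennreal (\<rho> z) * ennreal \<bar>?u (x + \<tau> *\<^sub>R z) - ?u (x + s *\<^sub>R z)\<bar>"
    by (simp add: abs_mult nonneg ennreal_mult')
   also have "\<dots> \<le> ennreal (\<rho> z) * (\<integral>\<^sup>+t. ennreal (norm z * ?g (x + t *\<^sub>R z)) * ?i t \<partial>lborel)"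
    by (intro mult_left_mono std_avg_segment[OF uG g d s(2)] x False) auto
   also have "\<dots> = (\<integral>\<^sup>+t. ennreal (\<rho> z) * (ennreal (norm z * ?g (x + t *\<^sub>R z)) * ?i t) \<partial>lborel)"
    by (rule nn_integral_cmult[symmetric]) measurable
   also have "\<dots> \<le> (\<integral>\<^sup>+t. ennreal (?f t z) * ?i t \<partial>lborel)"
   proof (rule nn_integral_mono)
    fix t
    have "\<rho> z * (norm z * ?g (x + t *\<^sub>R z)) \<le> ?f t z"
     using mult_right_mono[OF zR, of "\<rho> z * ?g (x + t *\<^sub>R z)"] nonneg g0 by (simp add: mult_ac)
    then show "ennreal (\<rho> z) * (ennreal (norm z * ?g (x + t *\<^sub>R z)) * ?i t) \<le> ennreal (?f t z) * ?i t"
     by (auto simp: indicator_def ennreal_mult'[symmetric] nonneg intro!: ennreal_leI)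
   qed
   finally show ?thesis .
  qed simp
 qed
 also have "\<dots> = (\<integral>\<^sup>+t. (\<integral>\<^sup>+z. ennreal (?f t z) * ?i t \<partial>lborel) \<partial>lborel)"
  by (rule lborel_pair.Fubini') measurable
 also have "\<dots> = (\<integral>\<^sup>+t. ennreal (R * avg t ?g x) * ?i t \<partial>lborel)"
 proof (rule nn_integral_cong)
  fix t
  show "(\<integral>\<^sup>+z. ennreal (?f t z) * ?i t \<partial>lborel) = ennreal (R * avg t ?g x) * ?i t"
  proof (cases "t \<in> {s..\<tau>}")
   case True
   then have "t > 0" using s by simp
   then have "(\<integral>\<^sup>+z. ennreal (?f t z) \<partial>lborel) = ennreal (R * avg t ?g x)"
    using R_nonneg nonneg g0 avg_integrable[OF sg, of t x]
    by (subst nn_integral_eq_integral) (auto simp: avg_def)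
   then show ?thesis using True by simp
  qed simp
 qed
 finally show ?thesis .
qed

text \<open>The mollification is removed: by \<open>avg_close\<close> the averages of the mollified functions converge uniformly for
 \<open>t \<ge> s > 0\<close>.\<close>

lemma avg_increment:
 fixes u :: "'a \<Rightarrow> real"
 assumes uG: "weak_pair U u G" and g: "sqint (\<lambda>x. norm (G x))" and d: "d > 0" and s: "0 < s" "s \<le> \<tau>"
  and x: "\<And>t z. t \<in> {s..\<tau>} \<Longrightarrow> \<rho> z \<noteq> 0 \<Longrightarrow> cball (x + t *\<^sub>R z) d \<subseteq> U"
 shows "ennreal \<bar>avg \<tau> u x - avg s u x\<bar>
  \<le> (\<integral>\<^sup>+t. ennreal (R * avg t (\<lambda>y. norm (G y)) x) * indicator {s..\<tau>} t \<partial>lborel)" (is "_ \<le> ?I")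
proof -
 have u: "sqint u" using uG by (simp add: weak_pair_def)
 note [measurable] = sqint_borel[OF u] sqint_borel[OF g]
 have \<tau>: "\<tau> > 0" using s by simp
 define \<eta> where "\<eta> e = sqrt (B * (LBINT y. (std.avg e (\<lambda>y. norm (G y)) y - norm (G y))^2) / s ^ DIM('a))" for e
 have \<eta>_lim: "(\<eta> \<longlongrightarrow> 0) (at_right 0)"
 proof -
  have "(\<eta> \<longlongrightarrow> sqrt (B * 0 / s ^ DIM('a))) (at_right 0)"
   unfolding \<eta>_def using s by (intro tendsto_intros std.avg_tendsto_L2 g) auto
  then show ?thesis by simp
 qed
 have lim_u: "((\<lambda>e. avg t (std.avg e u) x) \<longlongrightarrow> avg t u x) (at_right 0)" if t: "t > 0" for t
 proof -
  have "((\<lambda>e. sqrt (B * (LBINT y. (std.avg e u y - u y)^2) / t ^ DIM('a))) \<longlongrightarrow> sqrt (B * 0 / t ^ DIM('a))) (at_right 0)"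
   using t by (intro tendsto_intros std.avg_tendsto_L2 u) auto
  then have l: "((\<lambda>e. sqrt (B * (LBINT y. (std.avg e u y - u y)^2) / t ^ DIM('a))) \<longlongrightarrow> 0) (at_right 0)" by simp
  have "((\<lambda>e. avg t (std.avg e u) x - avg t u x) \<longlongrightarrow> 0) (at_right 0)"
  proof (rule Lim_null_comparison[OF _ l])
   show "\<forall>\<^sub>F e in at_right 0. norm (avg t (std.avg e u) x - avg t u x) \<le> sqrt (B * (LBINT y. (std.avg e u y - u y)^2) / t ^ DIM('a))"
    using avg_close[OF std.avg_L2(1)[OF u] u t, of _ x] by (auto simp: eventually_at_filter)
  qed
  then show ?thesis by (rule LIM_zero_cancel)
 qed
 have L: "((\<lambda>e. ennreal \<bar>avg \<tau> (std.avg e u) x - avg s (std.avg e u) x\<bar>) \<longlongrightarrow> ennreal \<bar>avg \<tau> u x - avg s u x\<bar>) (at_right 0)"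
  by (intro tendsto_ennrealI tendsto_intros lim_u \<tau> s)
 have Rr: "((\<lambda>e. ?I + ennreal (R * \<eta> e * (\<tau> - s))) \<longlongrightarrow> ?I + ennreal (R * 0 * (\<tau> - s))) (at_right 0)"
  by (intro tendsto_add tendsto_const tendsto_ennrealI tendsto_intros \<eta>_lim)
 have "\<forall>\<^sub>F e in at_right 0. ennreal \<bar>avg \<tau> (std.avg e u) x - avg s (std.avg e u) x\<bar> \<le> ?I + ennreal (R * \<eta> e * (\<tau> - s))"
 proof -
  have "\<forall>\<^sub>F e in at_right 0. e < d" using d by (intro eventually_at_rightI[of 0 d]) auto
  moreover have "\<forall>\<^sub>F e in at_right 0. (e::real) > 0" by (simp add: eventually_at_filter)
  ultimately show ?thesis
  proof eventually_elim
   case (elim e)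
   let ?g = "std.avg e (\<lambda>y. norm (G y))"
   have sg: "sqint ?g" by (intro std.avg_L2 g elim)
   have \<eta>0: "0 \<le> \<eta> e" unfolding \<eta>_def using B_nonneg s by (auto intro!: divide_nonneg_nonneg mult_nonneg_nonneg Bochner_Integration.integral_nonneg)
   have "cball (x + t *\<^sub>R z) e \<subseteq> U" if "t \<in> {s..\<tau>}" "\<rho> z \<noteq> 0" for t z
    using x[OF that] elim by (meson less_imp_le order_trans subset_cball)
   then have "ennreal \<bar>avg \<tau> (std.avg e u) x - avg s (std.avg e u) x\<bar>
    \<le> (\<integral>\<^sup>+t. ennreal (R * avg t ?g x) * indicator {s..\<tau>} t \<partial>lborel)"
    by (intro avg_increment_mollified[OF uG g elim(2) s])
   also have "\<dots> \<le> (\<integral>\<^sup>+t. ennreal (R * avg t (\<lambda>y. norm (G y)) x) * indicator {s..\<tau>} t + ennreal (R * \<eta> e) * indicator {s..\<tau>} t \<partial>lborel)"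
   proof (rule nn_integral_mono)
    fix t
    show "ennreal (R * avg t ?g x) * indicator {s..\<tau>} t \<le> ennreal (R * avg t (\<lambda>y. norm (G y)) x) * indicator {s..\<tau>} t + ennreal (R * \<eta> e) * indicator {s..\<tau>} t"
    proof (cases "t \<in> {s..\<tau>}")
     case True
     then have t: "t > 0" "s \<le> t" using s by auto
     have "avg t ?g x \<le> avg t (\<lambda>y. norm (G y)) x + sqrt (B * (LBINT y. (?g y - norm (G y))^2) / t ^ DIM('a))"
      using avg_close[OF sg g t(1), of x] by linarith
     also have "sqrt (B * (LBINT y. (?g y - norm (G y))^2) / t ^ DIM('a)) \<le> \<eta> e"
      unfolding \<eta>_def using t s B_nonneg
      by (intro real_sqrt_le_mono divide_left_mono mult_nonneg_nonneg power_mono Bochner_Integration.integral_nonneg) auto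
     finally have "R * avg t ?g x \<le> R * avg t (\<lambda>y. norm (G y)) x + R * \<eta> e"
      using R_nonneg by (simp add: mult_left_mono flip: distrib_left)
     then have "ennreal (R * avg t ?g x) \<le> ennreal (R * avg t (\<lambda>y. norm (G y)) x) + ennreal (R * \<eta> e)"
      using R_nonneg \<eta>0 avg_nonneg[of "\<lambda>y. norm (G y)" t x] by (simp add: ennreal_leI flip: ennreal_plus)
     then show ?thesis using True by simp
    qed simp
   qed
   also have "\<dots> = ?I + (\<integral>\<^sup>+t. ennreal (R * \<eta> e) * indicator {s..\<tau>} t \<partial>lborel)"
    unfolding avg_def by (rule nn_integral_add) measurable
   also have "(\<integral>\<^sup>+t. ennreal (R * \<eta> e) * indicator {s..\<tau>} t \<partial>lborel) = ennreal (R * \<eta> e * (\<tau> - s))"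
    using s R_nonneg \<eta>0 by (simp add: nn_integral_cmult_indicator ennreal_mult)
   finally show ?case .
  qed
 qed
 from tendsto_le[OF _ Rr L this] show ?thesis by simp
qed

text \<open>The averages over shrinking pieces of the cone at \<open>x\<close> tend to \<open>u x\<close> for almost every \<open>x\<close>, so \<open>s\<close> may tend to \<open>0\<close>.\<close>

lemma avg_pointwise:
 fixes u :: "'a \<Rightarrow> real"
 assumes uG: "weak_pair U u G" and g: "sqint (\<lambda>x. norm (G x))" and \<tau>: "\<tau> > 0"
  and S: "\<And>x s. x \<in> S \<Longrightarrow> 0 < s \<Longrightarrow> s \<le> \<tau> \<Longrightarrow> \<exists>d>0. \<forall>t\<in>{s..\<tau>}. \<forall>z. \<rho> z \<noteq> 0 \<longrightarrow> cball (x + t *\<^sub>R z) d \<subseteq> U"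
 shows "AE x in lborel. x \<in> S \<longrightarrow> ennreal \<bar>u x\<bar> \<le> ennreal \<bar>avg \<tau> u x\<bar> +
  (\<integral>\<^sup>+t. ennreal (R * avg t (\<lambda>y. norm (G y)) x) * indicator {0<..\<tau>} t \<partial>lborel)"
proof -
 have u: "sqint u" using uG by (simp add: weak_pair_def)
 have T: "(\<lambda>n. \<tau> / real (Suc n)) \<longlonglongrightarrow> 0"
  using tendsto_mult[OF tendsto_const[of \<tau>] LIMSEQ_inverse_real_of_nat]
  by (simp only: divide_inverse[symmetric] mult_zero_right)
 have Tp: "\<tau> / real (Suc n) > 0" for n using \<tau> by simp
 obtain k where k: "strict_mono k" "AE x in lborel. (\<lambda>n. avg (\<tau> / real (Suc (k n))) u x) \<longlonglongrightarrow> u x"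
  using avg_AE_subseq[OF u Tp T] by blast
 show ?thesis using k(2)
 proof eventually_elim
  case (elim x)
  show ?case
  proof
   assume x: "x \<in> S"
   let ?I = "\<integral>\<^sup>+t. ennreal (R * avg t (\<lambda>y. norm (G y)) x) * indicator {0<..\<tau>} t \<partial>lborel"
   have b: "ennreal \<bar>avg (\<tau> / real (Suc (k n))) u x\<bar> \<le> ennreal \<bar>avg \<tau> u x\<bar> + ?I" for n
   proof -
    let ?s = "\<tau> / real (Suc (k n))"
    have s: "0 < ?s" "?s \<le> \<tau>" using \<tau> by (auto simp: divide_simps)
    obtain d where d: "d > 0" "\<And>t z. t \<in> {?s..\<tau>} \<Longrightarrow> \<rho> z \<noteq> 0 \<Longrightarrow> cball (x + t *\<^sub>R z) d \<subseteq> U"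
     using S[OF x s] by blast
    have "ennreal \<bar>avg ?s u x\<bar> \<le> ennreal (\<bar>avg \<tau> u x\<bar> + \<bar>avg \<tau> u x - avg ?s u x\<bar>)" by (intro ennreal_leI) linarith
    also have "\<dots> = ennreal \<bar>avg \<tau> u x\<bar> + ennreal \<bar>avg \<tau> u x - avg ?s u x\<bar>" by simp
    also have "ennreal \<bar>avg \<tau> u x - avg ?s u x\<bar> \<le> (\<integral>\<^sup>+t. ennreal (R * avg t (\<lambda>y. norm (G y)) x) * indicator {?s..\<tau>} t \<partial>lborel)"
     by (rule avg_increment[OF uG g d(1) s d(2)])
    also have "\<dots> \<le> ?I"
     using s(1) by (intro nn_integral_mono mult_left_mono) (auto simp: indicator_def)
    finally show ?thesis by (simp add: add_left_mono)
   qed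
   have "(\<lambda>n. ennreal \<bar>avg (\<tau> / real (Suc (k n))) u x\<bar>) \<longlonglongrightarrow> ennreal \<bar>u x\<bar>"
    by (intro tendsto_ennrealI tendsto_rabs elim)
   then show "ennreal \<bar>u x\<bar> \<le> ennreal \<bar>avg \<tau> u x\<bar> + ?I"
    by (rule LIMSEQ_le_const2) (use b in blast)
  qed
 qed
qed

text \<open>Interpolation between the supremum bound \<open>avg_sup\<close> and the contraction \<open>avg_L2\<close>.\<close>

lemma avg_L4:
 assumes w: "sqint w" and t: "t > 0"
 shows "(\<integral>\<^sup>+x. ennreal ((avg t w x)^4) \<partial>lborel) \<le> ennreal (B * (LBINT x. (w x)^2)^2 / t ^ DIM('a))"
proof -
 let ?W = "LBINT x. (w x)^2"
 have W: "0 \<le> ?W" by simp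
 note [measurable] = sqint_borel[OF avg_L2(1)[OF assms]]
 have "(\<integral>\<^sup>+x. ennreal ((avg t w x)^4) \<partial>lborel) \<le> (\<integral>\<^sup>+x. ennreal (B * ?W / t ^ DIM('a)) * ennreal ((avg t w x)^2) \<partial>lborel)"
 proof (rule nn_integral_mono)
  fix x
  have "(avg t w x)^4 = (avg t w x)^2 * (avg t w x)^2" by (simp add: power2_eq_square power4_eq_xxxx)
  also have "\<dots> \<le> B * ?W / t ^ DIM('a) * (avg t w x)^2" by (intro mult_right_mono avg_sup[OF assms]) simp
  finally show "ennreal ((avg t w x)^4) \<le> ennreal (B * ?W / t ^ DIM('a)) * ennreal ((avg t w x)^2)"
   using B_nonneg W t by (simp add: ennreal_leI flip: ennreal_mult)
 qed
 also have "\<dots> = ennreal (B * ?W / t ^ DIM('a)) * (\<integral>\<^sup>+x. ennreal ((avg t w x)^2) \<partial>lborel)" by (rule nn_integral_cmult) measurable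
 also have "(\<integral>\<^sup>+x. ennreal ((avg t w x)^2) \<partial>lborel) = ennreal (LBINT x. (avg t w x)^2)"
  by (intro nn_integral_eq_integral sqint_integrable avg_L2 assms) simp
 also have "ennreal (B * ?W / t ^ DIM('a)) * \<dots> \<le> ennreal (B * ?W / t ^ DIM('a)) * ennreal ?W"
  by (intro mult_left_mono ennreal_leI avg_L2 assms) simp
 also have "\<dots> = ennreal (B * ?W^2 / t ^ DIM('a))"
  using B_nonneg W t by (simp add: power2_eq_square mult.assoc flip: ennreal_mult)
 finally show ?thesis .
qed

text \<open>With the weight \<open>m t = t powr (- d/4)\<close>, integrable at \<open>0\<close> since \<open>d < 4\<close>, the supremum bound reads
 \<open>avg t g x \<le> b (m t)^2\<close>. Two applications of the Cauchy--Schwarz inequality in \<open>t\<close>, each with the weight \<open>m\<close>, bound the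
 fourth power of the integral by the integral of \<open>m t (avg t g x)^2\<close>, to which \<open>avg_L2\<close> applies.\<close>

lemma avg_time_integral_L4:
 assumes g: "sqint g" and g0: "\<And>x. 0 \<le> g x" and \<tau>: "\<tau> > 0" and dim: "DIM('a) < 4"
 defines "Z \<equiv> \<tau> powr (1 - DIM('a) / 4) / (1 - DIM('a) / 4)"
 shows "(\<integral>\<^sup>+x. (\<integral>\<^sup>+t. ennreal (avg t g x) * indicator {0<..\<tau>} t \<partial>lborel)^4 \<partial>lborel) \<le> ennreal (B * (LBINT x. (g x)^2)^2 * Z^4)"
proof -
 let ?W = "LBINT x. (g x)^2"
 note [measurable] = sqint_borel[OF g]
 have W: "0 \<le> ?W" by simp
 define b where "b = sqrt (B * ?W)"
 have b0: "0 \<le> b" using B_nonneg W by (simp add: b_def)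
 have b2: "b^2 = B * ?W" using B_nonneg W by (simp add: b_def)
 define m where "m t = t powr (- (DIM('a) / 4))" for t :: real
 have m0: "0 \<le> m t" for t by (simp add: m_def)
 have [measurable]: "m \<in> borel_measurable borel" unfolding m_def by measurable
 have Z: "Z > 0" using \<tau> dim by (simp add: Z_def)
 have mZ: "(\<integral>\<^sup>+t. ennreal (m t) * indicator {0<..\<tau>} t \<partial>lborel) = ennreal Z"
 proof -
  have "(m has_integral \<tau> powr (- (DIM('a) / 4) + 1) / (- (DIM('a) / 4) + 1)) {0..\<tau>}"
   unfolding m_def using dim \<tau> by (intro has_integral_powr_from_0) auto
  then have "(m has_integral Z) {0..\<tau>}" by (simp add: Z_def add.commute)
  from nn_integral_has_integral_lebesgue'[OF m0 this]
  have "(\<integral>\<^sup>+t. ennreal (m t) * indicator {0..\<tau>} t \<partial>lborel) = ennreal Z" .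
  moreover have "(\<integral>\<^sup>+t. ennreal (m t) * indicator {0..\<tau>} t \<partial>lborel) = (\<integral>\<^sup>+t. ennreal (m t) * indicator {0<..\<tau>} t \<partial>lborel)"
   by (intro nn_integral_cong_AE AE_I[of _ _ "{0}"]) (auto simp: indicator_def)
  ultimately show ?thesis by simp
 qed
 have ab: "avg t g x \<le> b * (m t)^2" if t: "t > 0" for t x
 proof -
  have "(avg t g x)^2 \<le> b^2 / t ^ DIM('a)" using avg_sup[OF g t, of x] b2 by simp
  also have "\<dots> = (b * (m t)^2)^2"
  proof -
   have "((m t)^2)^2 = t powr (- real DIM('a))"
   proof -
    have "m t > 0" using t by (simp add: m_def)
    then have "((m t)^2)^2 = m t powr real 4" by (subst powr_realpow) (simp_all flip: power_mult)
    also have "\<dots> = t powr (- real DIM('a))" unfolding m_def by (subst powr_powr) simp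
    finally show ?thesis .
   qed
   also have "\<dots> = 1 / t ^ DIM('a)" unfolding powr_minus powr_realpow[OF t] by (rule inverse_eq_divide)
   finally show ?thesis by (simp add: power_mult_distrib)
  qed
  finally show ?thesis by (rule power2_le_imp_le) (simp add: b0)
 qed
 have a0: "0 \<le> avg t g x" for t x by (rule avg_nonneg[OF g0])
 have [measurable]: "(\<lambda>t. avg t g x) \<in> borel_measurable borel" for x unfolding avg_def by measurable
 let ?ind = "\<lambda>t. indicator {0<..\<tau>} t :: ennreal"
 let ?Q = "\<lambda>x. \<integral>\<^sup>+t. ennreal (m t * (avg t g x)^2) * ?ind t \<partial>lborel"
 have pt: "(\<integral>\<^sup>+t. ennreal (avg t g x) * ?ind t \<partial>lborel)^4 \<le> ennreal (Z^3 * b^2) * ?Q x" for x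
 proof -
  let ?I = "\<integral>\<^sup>+t. ennreal (avg t g x) * ?ind t \<partial>lborel"
  let ?J = "\<integral>\<^sup>+t. ennreal (m t * avg t g x) * ?ind t \<partial>lborel"
  let ?K = "?Q x"
  have sm: "(\<integral>\<^sup>+t. (ennreal (sqrt (m t)) * ?ind t)^2 \<partial>lborel) = ennreal Z"
   unfolding mZ[symmetric] by (intro nn_integral_cong) (auto simp: indicator_def ennreal_power m0)
  have "?I^2 \<le> ennreal Z * (ennreal b * ?J)"
  proof -
   have "?I = (\<integral>\<^sup>+t. (ennreal (sqrt (m t)) * ?ind t) * (ennreal (avg t g x / sqrt (m t)) * ?ind t) \<partial>lborel)"
   proof (intro nn_integral_cong)
    fix t show "ennreal (avg t g x) * ?ind t = (ennreal (sqrt (m t)) * ?ind t) * (ennreal (avg t g x / sqrt (m t)) * ?ind t)"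
    proof (cases "t \<in> {0<..\<tau>}")
     case True
     then have "m t > 0" by (simp add: m_def)
     then show ?thesis using True a0 by (simp flip: ennreal_mult')
    qed simp
   qed
   then have "?I^2 \<le> (\<integral>\<^sup>+t. (ennreal (sqrt (m t)) * ?ind t)^2 \<partial>lborel) * (\<integral>\<^sup>+t. (ennreal (avg t g x / sqrt (m t)) * ?ind t)^2 \<partial>lborel)"
    by (simp only:) (rule Cauchy_Schwarz_nn_integral; measurable)
   also have "(\<integral>\<^sup>+t. (ennreal (avg t g x / sqrt (m t)) * ?ind t)^2 \<partial>lborel) \<le> (\<integral>\<^sup>+t. ennreal b * (ennreal (m t * avg t g x) * ?ind t) \<partial>lborel)"
   proof (intro nn_integral_mono)
    fix t show "(ennreal (avg t g x / sqrt (m t)) * ?ind t)^2 \<le> ennreal b * (ennreal (m t * avg t g x) * ?ind t)"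
    proof (cases "t \<in> {0<..\<tau>}")
     case True
     then have m: "m t > 0" "t > 0" by (auto simp: m_def)
     have "(avg t g x)^2 \<le> (b * (m t)^2) * avg t g x"
      using mult_right_mono[OF ab[OF m(2), of x] a0[of t x]] by (simp add: power2_eq_square)
     then have "(avg t g x / sqrt (m t))^2 \<le> b * (m t * avg t g x)"
      using m by (simp add: power_divide divide_simps power2_eq_square mult_ac)
     then show ?thesis using True a0[of t x] m b0 by (simp add: ennreal_power ennreal_leI flip: ennreal_mult')
    qed simp
   qed
   also have "\<dots> = ennreal b * ?J" by (rule nn_integral_cmult) measurable
   finally show ?thesis using sm by (simp add: mult_left_mono)
  qed
  then have "(?I^2)^2 \<le> (ennreal Z * (ennreal b * ?J))^2" by (rule power_mono) simp
  also have "\<dots> = ennreal (Z^2 * b^2) * ?J^2"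
   using Z b0 by (simp add: power_mult_distrib ennreal_power ennreal_mult mult.assoc)
  also have "?J^2 \<le> ennreal Z * ?K"
  proof -
   have "?J = (\<integral>\<^sup>+t. (ennreal (sqrt (m t)) * ?ind t) * (ennreal (sqrt (m t) * avg t g x) * ?ind t) \<partial>lborel)"
    by (intro nn_integral_cong) (auto simp: indicator_def m0 a0 simp flip: ennreal_mult' mult.assoc)
   then have "?J^2 \<le> (\<integral>\<^sup>+t. (ennreal (sqrt (m t)) * ?ind t)^2 \<partial>lborel) * (\<integral>\<^sup>+t. (ennreal (sqrt (m t) * avg t g x) * ?ind t)^2 \<partial>lborel)"
    by (simp only:) (rule Cauchy_Schwarz_nn_integral; measurable)
   also have "(\<integral>\<^sup>+t. (ennreal (sqrt (m t) * avg t g x) * ?ind t)^2 \<partial>lborel) = ?K"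
    by (intro nn_integral_cong) (auto simp: indicator_def ennreal_power m0 a0 power_mult_distrib)
   finally show ?thesis by (simp add: sm)
  qed
  finally have "(?I^2)^2 \<le> ennreal (Z^2 * b^2) * (ennreal Z * ?K)" by (simp add: mult_left_mono)
  moreover have "ennreal (Z^2 * b^2) * (ennreal Z * ?K) = ennreal (Z^3 * b^2) * ?K"
  proof -
   have "Z^3 * b^2 = (Z^2 * b^2) * Z" by (simp add: power2_eq_square power3_eq_cube)
   then have "ennreal (Z^3 * b^2) = ennreal (Z^2 * b^2) * ennreal Z" using Z by (simp only: ennreal_mult'' less_imp_le)
   then show ?thesis by (simp only: mult.assoc)
  qed
  ultimately show ?thesis by (simp flip: power_mult)
 qed
 have "(\<integral>\<^sup>+x. (\<integral>\<^sup>+t. ennreal (avg t g x) * ?ind t \<partial>lborel)^4 \<partial>lborel)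
   \<le> (\<integral>\<^sup>+x. ennreal (Z^3 * b^2) * ?Q x \<partial>lborel)"
  by (intro nn_integral_mono pt)
 also have "\<dots> = ennreal (Z^3 * b^2) * (\<integral>\<^sup>+x. ?Q x \<partial>lborel)"
  unfolding avg_def by (rule nn_integral_cmult) measurable
 also have "(\<integral>\<^sup>+x. ?Q x \<partial>lborel) = (\<integral>\<^sup>+t. (\<integral>\<^sup>+x. ennreal (m t * (avg t g x)^2) * ?ind t \<partial>lborel) \<partial>lborel)"
  unfolding avg_def by (rule lborel_pair.Fubini'[symmetric]) measurable
 also have "\<dots> \<le> (\<integral>\<^sup>+t. ennreal ?W * (ennreal (m t) * ?ind t) \<partial>lborel)"
 proof (rule nn_integral_mono)
  fix t
  show "(\<integral>\<^sup>+x. ennreal (m t * (avg t g x)^2) * ?ind t \<partial>lborel) \<le> ennreal ?W * (ennreal (m t) * ?ind t)"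
  proof (cases "t \<in> {0<..\<tau>}")
   case True
   then have t: "t > 0" by simp
   have "(\<integral>\<^sup>+x. ennreal (m t * (avg t g x)^2) \<partial>lborel) = ennreal (m t * (LBINT x. (avg t g x)^2))"
    by (subst nn_integral_eq_integral) (auto intro!: integrable_mult_right sqint_integrable avg_L2 g t simp: m0)
   also have "\<dots> \<le> ennreal (m t * ?W)" by (intro ennreal_leI mult_left_mono avg_L2 g t m0)
   finally show ?thesis using True W by (simp add: ennreal_mult' m0 mult.commute)
  qed simp
 qed
 also have "\<dots> = ennreal ?W * ennreal Z" by (subst nn_integral_cmult) (auto simp: mZ)
 also have "ennreal (Z^3 * b^2) * (ennreal ?W * ennreal Z) = ennreal (B * ?W^2 * Z^4)"
 proof -
  have e: "B * ?W^2 * Z^4 = (Z^3 * b^2) * (?W * Z)"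
   unfolding b2 by (simp add: power2_eq_square power3_eq_cube power4_eq_xxxx)
  have "0 \<le> Z" "0 \<le> ?W * Z" using Z W by auto
  then show ?thesis unfolding e by (simp only: ennreal_mult'')
 qed
 finally show ?thesis by (simp add: mult_left_mono)
qed

end

lemma ennreal_power4_sum: "(p + q :: ennreal)^4 \<le> 8 * p^4 + 8 * q^4"
proof (cases "p = top \<or> q = top")
 case True
 then show ?thesis by (auto simp: ennreal_mult_top)
next
 case False
 then obtain a b where ab: "p = ennreal a" "0 \<le> a" "q = ennreal b" "0 \<le> b"
  by (metis ennreal_cases)
 have "(a + b)^2 \<le> 2 * a^2 + 2 * b^2" using sum_squares_bound[of a b] by (simp add: power2_sum)
 then have "((a + b)^2)^2 \<le> (2 * a^2 + 2 * b^2)^2" by (intro power_mono) auto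
 also have "\<dots> \<le> 8 * (a^2)^2 + 8 * (b^2)^2"
  using sum_squares_bound[of "a^2" "b^2"] by (simp add: power2_sum power_mult_distrib)
 finally have "(a + b)^4 \<le> 8 * a^4 + 8 * b^4" by (simp flip: power_mult)
 then have "ennreal ((a + b)^4) \<le> ennreal (8 * a^4 + 8 * b^4)" by (rule ennreal_leI)
 then show ?thesis using ab by (simp add: ennreal_mult' flip: ennreal_power)
qed

lemma ennreal_lincomb8:
 assumes "0 \<le> a" "0 \<le> b" "0 \<le> c"
 shows "8 * ennreal a + 8 * ennreal c * ennreal b = ennreal (8 * a + 8 * c * b)"
 using assms by (simp add: ennreal_mult ennreal_plus)

text \<open>The cones at all points of \<open>U\<close> near \<open>x0\<close> have a common height and a common set \<open>cball c \<kappa>\<close> of directions.\<close>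

definition has_cone :: "'a::euclidean_space set \<Rightarrow> 'a \<Rightarrow> bool" where
 "has_cone U x0 \<longleftrightarrow> (\<exists>r>0. \<exists>h>0. \<exists>c. \<exists>\<kappa>>0. \<forall>x\<in>U \<inter> ball x0 r. \<forall>t\<in>{0<..h}. \<forall>z\<in>cball c \<kappa>. x + t *\<^sub>R z \<in> U)"

lemma interior_has_cone:
 assumes "open U" "x0 \<in> U" shows "has_cone U x0"
proof -
 obtain r where r: "r > 0" "ball x0 r \<subseteq> U" using assms open_contains_ball by blast
 have "x + t *\<^sub>R z \<in> U" if "x \<in> U \<inter> ball x0 (r / 2)" "t \<in> {0<..r / 2}" "z \<in> cball 0 (1/2)" for x t z
 proof -
  have "t * norm z \<le> (r / 2) * (1/2)" using that r(1) by (intro mult_mono) auto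
  then have "norm (t *\<^sub>R z) \<le> (r / 2) * (1/2)" using that by simp
  moreover have "dist x0 x < r / 2" using that by simp
  ultimately have "dist x0 (x + t *\<^sub>R z) < r"
   using dist_triangle[of x0 "x + t *\<^sub>R z" x] r(1) by (simp add: dist_norm)
  then show ?thesis using r by auto
 qed
 then show ?thesis unfolding has_cone_def using r(1)
  by (intro exI[of _ "r / 2"] conjI exI[of _ "0::'a"] exI[of _ "1/2"]) auto
qed

lemma boundary_has_cone:
 assumes lip: "lipschitz_boundary U" and x0: "x0 \<in> frontier U"
 shows "has_cone U x0"
proof -
 obtain r e L g where r: "r > 0" and e: "norm e = 1" and g: "L-lipschitz_on {z. z \<bullet> e = 0} g"
  and eq: "U \<inter> ball x0 r = {y \<in> ball x0 r. (g (y - (y \<bullet> e) *\<^sub>R e) :: real) < y \<bullet> e}"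
  using lip x0 unfolding lipschitz_boundary_def by blast
 have L: "0 \<le> L" using g by (rule lipschitz_on_nonneg)
 \<comment> \<open>Along a direction within \<open>\<kappa>\<close> of \<open>e\<close> the height grows at rate at least \<open>1 - \<kappa>\<close> and the graph rises at rate at most \<open>L \<kappa>\<close>.\<close>
 define \<kappa> where "\<kappa> = 1 / (2 * (1 + L))"
 have \<kappa>: "0 < \<kappa>" "\<kappa> \<le> 1/2" "\<kappa> * (1 + L) = 1/2" using L by (auto simp: \<kappa>_def divide_simps)
 have ee: "e \<bullet> e = 1" using e by (simp add: norm_eq_1)
 define P where "P y = y - (y \<bullet> e) *\<^sub>R e" for y
 have P0: "P y \<in> {z. z \<bullet> e = 0}" for y by (simp add: P_def inner_diff_left ee)
 have Pn: "norm (P y) \<le> norm y" for y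
 proof -
  have "P y \<bullet> P y = y \<bullet> y - (y \<bullet> e) * (y \<bullet> e)"
   by (simp add: P_def inner_diff_left inner_diff_right ee inner_commute)
  then have "(norm (P y))^2 = (norm y)^2 - (y \<bullet> e)^2"
   unfolding power2_norm_eq_inner by (simp only: power2_eq_square)
  then have "(norm (P y))^2 \<le> (norm y)^2" by simp
  then show ?thesis by (rule power2_le_imp_le) simp
 qed
 have "x + t *\<^sub>R z \<in> U" if x: "x \<in> U \<inter> ball x0 (r / 2)" and t: "t \<in> {0<..r / 4}" and z: "z \<in> cball e \<kappa>" for x t z
 proof -
  have ze: "norm (z - e) \<le> \<kappa>" using z by (simp add: dist_norm norm_minus_commute)
  have "norm z \<le> 3/2" using norm_triangle_sub[of z e] ze \<kappa> e by linarith
  then have "t * norm z \<le> (r / 4) * (3/2)" using t r(1) by (intro mult_mono) auto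
  then have "norm (t *\<^sub>R z) \<le> (r / 4) * (3/2)" using t by simp
  moreover have "dist x0 x < r / 2" using x by simp
  ultimately have in_ball: "x + t *\<^sub>R z \<in> ball x0 r"
   using dist_triangle[of x0 "x + t *\<^sub>R z" x] r(1) by (simp add: dist_norm)
  have "x \<in> U \<inter> ball x0 r" using x r by auto
  then have gx: "g (P x) < x \<bullet> e" using eq by (auto simp: P_def)
  have Pz: "P z = P (z - e)" by (simp add: P_def inner_diff_left ee algebra_simps)
  have Pl: "P (x + t *\<^sub>R z) = P x + t *\<^sub>R P z" by (simp add: P_def inner_add_left algebra_simps)
  have "\<bar>g (P (x + t *\<^sub>R z)) - g (P x)\<bar> \<le> L * norm (t *\<^sub>R P z)"
   using lipschitz_onD[OF g P0 P0, of "x + t *\<^sub>R z" x] by (simp add: dist_norm Pl)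
  also have "\<dots> \<le> L * (t * \<kappa>)"
   using t L Pn[of "z - e"] ze by (auto simp: Pz intro!: mult_left_mono)
  finally have "g (P (x + t *\<^sub>R z)) \<le> g (P x) + t * (L * \<kappa>)" by (simp add: mult_ac)
  also have "\<dots> < x \<bullet> e + t * (L * \<kappa>)" using gx by simp
  also have "\<dots> \<le> x \<bullet> e + t * (z \<bullet> e)"
  proof -
   have "\<bar>(z - e) \<bullet> e\<bar> \<le> \<kappa>" using Cauchy_Schwarz_ineq2[of "z - e" e] ze e by simp
   then have "z \<bullet> e \<ge> 1 - \<kappa>" by (simp add: inner_diff_left ee)
   moreover have "L * \<kappa> \<le> 1 - \<kappa>" using \<kappa> by (simp add: algebra_simps)
   ultimately have "L * \<kappa> \<le> z \<bullet> e" by linarith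
   then show ?thesis using t by (simp add: mult_left_mono)
  qed
  also have "\<dots> = (x + t *\<^sub>R z) \<bullet> e" by (simp add: inner_add_left)
  finally show ?thesis using eq in_ball by (auto simp: P_def)
 qed
 then show ?thesis unfolding has_cone_def using r \<kappa>(1)
  by (intro exI[of _ "r / 2"] conjI exI[of _ "r / 4"] exI[of _ e] exI[of _ \<kappa>]) auto
qed

lemma lipschitz_domain_has_cone:
 assumes "bounded_lipschitz_domain U" "x0 \<in> closure U" shows "has_cone U x0"
proof (cases "x0 \<in> U")
 case True then show ?thesis using assms interior_has_cone by (auto simp: bounded_lipschitz_domain_def)
next
 case False
 then have "x0 \<in> frontier U" using assms by (simp add: frontier_def bounded_lipschitz_domain_def interior_open)
 then show ?thesis using assms boundary_has_cone by (auto simp: bounded_lipschitz_domain_def)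
qed

lemma ball_kernel:
 fixes c :: "'a::euclidean_space"
 assumes \<kappa>: "\<kappa> > 0"
 defines "V \<equiv> measure lborel (cball c \<kappa>)"
 shows "averaging_kernel (\<lambda>z. indicator (cball c \<kappa>) z / V) (1 / V) (norm c + \<kappa>)"
proof
 have V: "V > 0" using content_cball_pos[of \<kappa> c] \<kappa> by (simp add: V_def)
 have [measurable]: "cball c \<kappa> \<in> sets borel" by simp
 show "(\<lambda>z. indicat_real (cball c \<kappa>) z / V) \<in> borel_measurable borel" by measurable
 show "0 \<le> indicat_real (cball c \<kappa>) z / V" "indicat_real (cball c \<kappa>) z / V \<le> 1 / V" for z
  using V by (auto simp: divide_right_mono)
 show "indicat_real (cball c \<kappa>) z / V = 0" if "norm c + \<kappa> < norm z" for z
  using that norm_triangle_sub[of z c] by (auto simp: indicator_def dist_norm norm_minus_commute)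
 show "(LBINT z. indicat_real (cball c \<kappa>) z / V) = 1"
  using V by (simp add: V_def)
qed

lemma cone_margin:
 fixes x c :: "'a::euclidean_space"
 assumes "open U" and "\<And>t z. t \<in> {0<..h} \<Longrightarrow> z \<in> cball c \<kappa> \<Longrightarrow> x + t *\<^sub>R z \<in> U" and "0 < s" "s \<le> \<tau>" "\<tau> \<le> h"
 shows "\<exists>d>0. \<forall>t\<in>{s..\<tau>}. \<forall>z\<in>cball c \<kappa>. cball (x + t *\<^sub>R z) d \<subseteq> U"
proof -
 let ?C = "(\<lambda>p. x + fst p *\<^sub>R snd p) ` ({s..\<tau>} \<times> cball c \<kappa>)"
 have "compact ?C"
  by (intro compact_continuous_image compact_Times compact_Icc compact_cball continuous_intros)
 moreover have "?C \<subseteq> U" using assms by auto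
 ultimately obtain d where d: "d > 0" "(\<Union>y\<in>?C. cball y d) \<subseteq> U"
  using compact_subset_open_imp_cball_epsilon_subset[of ?C U] assms(1) by metis
 have "cball (x + t *\<^sub>R z) d \<subseteq> U" if "t \<in> {s..\<tau>}" "z \<in> cball c \<kappa>" for t z
 proof -
  have "x + t *\<^sub>R z \<in> ?C" using that by (intro image_eqI[of _ _ "(t, z)"]) auto
  then show ?thesis using d(2) by blast
 qed
 then show ?thesis using d(1) by blast
qed

text \<open>At scale \<open>\<tau>\<close>, \<open>u\<close> is bounded by its average over the cone of height \<open>\<tau>\<close> and the integral up to \<open>\<tau>\<close> of averages of
 its gradient; \<open>avg_L4\<close> and \<open>avg_time_integral_L4\<close> bound the two contributions in \<open>L4\<close>.\<close>

lemma local_GN: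
 fixes U :: "'a::euclidean_space set"
 assumes dim: "DIM('a) < 4" and U: "open U" and cone: "has_cone U x0"
 shows "\<exists>r>0. \<exists>h>0. \<exists>C\<ge>0. \<forall>u G \<tau>. weak_pair U u G \<longrightarrow> sqint (\<lambda>x. norm (G x)) \<longrightarrow> 0 < \<tau> \<longrightarrow> \<tau> \<le> h \<longrightarrow>
   (\<integral>\<^sup>+x. ennreal ((u x)^4) * indicator (U \<inter> ball x0 r) x \<partial>lborel) \<le>
   ennreal (C * ((LBINT x. (u x)^2)^2 / \<tau> ^ DIM('a) + \<tau> ^ (4 - DIM('a)) * (LBINT x. (norm (G x))^2)^2))"
proof -
 obtain r h c \<kappa> where r: "r > 0" and h: "h > 0" and \<kappa>: "\<kappa> > 0"
  and cn: "\<And>x t z. x \<in> U \<inter> ball x0 r \<Longrightarrow> t \<in> {0<..h} \<Longrightarrow> z \<in> cball c \<kappa> \<Longrightarrow> x + t *\<^sub>R z \<in> U"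
  using cone unfolding has_cone_def by blast
 define V where "V = measure lborel (cball c \<kappa>)"
 define \<rho> where "\<rho> z = indicat_real (cball c \<kappa>) z / V" for z
 define B where "B = 1 / V"
 define R where "R = norm c + \<kappa>"
 interpret averaging_kernel \<rho> B R
  using ball_kernel[OF \<kappa>, of c] unfolding V_def[symmetric] \<rho>_def[symmetric] B_def R_def .
 define k where "k = (1 - DIM('a) / 4)^4"
 have k: "k > 0" using dim by (simp add: k_def)
 define C where "C = 8 * B + 8 * R^4 * B / k"
 have C0: "0 \<le> C" "8 * B \<le> C" "8 * R^4 * B / k \<le> C" using B_nonneg k by (auto simp: C_def)
 have "(\<integral>\<^sup>+x. ennreal ((u x)^4) * indicator (U \<inter> ball x0 r) x \<partial>lborel) \<le>
   ennreal (C * ((LBINT x. (u x)^2)^2 / \<tau> ^ DIM('a) + \<tau> ^ (4 - DIM('a)) * (LBINT x. (norm (G x))^2)^2))"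
  if uG: "weak_pair U u G" and g: "sqint (\<lambda>x. norm (G x))" and \<tau>: "0 < \<tau>" "\<tau> \<le> h" for u G \<tau>
 proof -
  have u: "sqint u" using uG by (simp add: weak_pair_def)
  note [measurable] = sqint_borel[OF u] sqint_borel[OF g]
  let ?g = "\<lambda>y. norm (G y)"
  let ?U = "(LBINT x. (u x)^2)" and ?W = "(LBINT x. (?g x)^2)"
  let ?I = "\<lambda>x. \<integral>\<^sup>+t. ennreal (avg t ?g x) * indicator {0<..\<tau>} t \<partial>lborel"
  have ae: "AE x in lborel. x \<in> U \<inter> ball x0 r \<longrightarrow> ennreal \<bar>u x\<bar> \<le> ennreal \<bar>avg \<tau> u x\<bar> +
   (\<integral>\<^sup>+t. ennreal (R * avg t ?g x) * indicator {0<..\<tau>} t \<partial>lborel)"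
  proof (rule avg_pointwise[OF uG g \<tau>(1)])
   fix x s assume x: "x \<in> U \<inter> ball x0 r" and s: "0 < s" "s \<le> \<tau>"
   obtain d where "d > 0" "\<forall>t\<in>{s..\<tau>}. \<forall>z\<in>cball c \<kappa>. cball (x + t *\<^sub>R z) d \<subseteq> U"
    using cone_margin[OF U cn[OF x] s \<tau>(2)] by blast
   then show "\<exists>d>0. \<forall>t\<in>{s..\<tau>}. \<forall>z. \<rho> z \<noteq> 0 \<longrightarrow> cball (x + t *\<^sub>R z) d \<subseteq> U"
    by (intro exI[of _ d]) (auto simp: \<rho>_def indicator_def)
  qed
  have RI: "(\<integral>\<^sup>+t. ennreal (R * avg t ?g x) * indicator {0<..\<tau>} t \<partial>lborel) = ennreal R * ?I x" for x
   unfolding avg_def using R_nonneg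
   by (subst nn_integral_cmult[symmetric]) (auto simp: ennreal_mult' mult.assoc)
  have "(\<integral>\<^sup>+x. ennreal ((u x)^4) * indicator (U \<inter> ball x0 r) x \<partial>lborel)
   \<le> (\<integral>\<^sup>+x. 8 * ennreal ((avg \<tau> u x)^4) + 8 * ennreal (R^4) * (?I x)^4 \<partial>lborel)"
  proof (rule nn_integral_mono_AE)
   show "AE x in lborel. ennreal ((u x)^4) * indicator (U \<inter> ball x0 r) x \<le> 8 * ennreal ((avg \<tau> u x)^4) + 8 * ennreal (R^4) * (?I x)^4"
    using ae
   proof eventually_elim
    case (elim x)
    show ?case
    proof (cases "x \<in> U \<inter> ball x0 r")
     case True
     then have "ennreal \<bar>u x\<bar> ^ 4 \<le> (ennreal \<bar>avg \<tau> u x\<bar> + ennreal R * ?I x)^4"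
      using elim RI[of x] by (intro power_mono) auto
     also have "\<dots> \<le> 8 * ennreal \<bar>avg \<tau> u x\<bar>^4 + 8 * (ennreal R * ?I x)^4" by (rule ennreal_power4_sum)
     finally show ?thesis using True R_nonneg by (simp add: ennreal_power power_mult_distrib mult.assoc)
    qed simp
   qed
  qed
  also have "\<dots> = 8 * (\<integral>\<^sup>+x. ennreal ((avg \<tau> u x)^4) \<partial>lborel) + 8 * ennreal (R^4) * (\<integral>\<^sup>+x. (?I x)^4 \<partial>lborel)"
  proof -
   have m1: "(\<lambda>x. ?I x ^ 4) \<in> borel_measurable lborel" unfolding avg_def by measurable
   have m2: "(\<lambda>x. ennreal ((avg \<tau> u x)^4)) \<in> borel_measurable lborel" by measurable
   show ?thesis using m1 m2 by (subst nn_integral_add) (auto simp: nn_integral_cmult)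
  qed
  also have "\<dots> \<le> 8 * ennreal (B * ?U^2 / \<tau> ^ DIM('a)) + 8 * ennreal (R^4) * ennreal (B * ?W^2 * (\<tau> powr (1 - DIM('a) / 4) / (1 - DIM('a) / 4))^4)"
   by (intro add_mono mult_left_mono avg_L4 avg_time_integral_L4 u g \<tau> dim) auto
  also have "(\<tau> powr (1 - DIM('a) / 4) / (1 - DIM('a) / 4))^4 = \<tau> ^ (4 - DIM('a)) / k"
  proof -
   have p: "\<tau> powr (1 - DIM('a) / 4) > 0" using \<tau> by simp
   have "(\<tau> powr (1 - DIM('a) / 4))^4 = (\<tau> powr (1 - DIM('a) / 4)) powr real 4"
    by (rule powr_realpow[OF p, symmetric])
   also have "\<dots> = \<tau> powr (real (4 - DIM('a)))" using dim by (simp add: powr_powr)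
   also have "\<dots> = \<tau> ^ (4 - DIM('a))" by (rule powr_realpow[OF \<tau>(1)])
   finally show ?thesis by (simp add: power_divide k_def)
  qed
  also have "8 * ennreal (B * ?U^2 / \<tau> ^ DIM('a)) + 8 * ennreal (R^4) * ennreal (B * ?W^2 * (\<tau> ^ (4 - DIM('a)) / k))
   = ennreal (8 * B * (?U^2 / \<tau> ^ DIM('a)) + 8 * R^4 * B / k * (\<tau> ^ (4 - DIM('a)) * ?W^2))"
  proof -
   have a: "0 \<le> B * ?U^2 / \<tau> ^ DIM('a)" "0 \<le> B * ?W^2 * (\<tau> ^ (4 - DIM('a)) / k)" "0 \<le> R^4"
    using B_nonneg \<tau> k by auto
   have "8 * ennreal (B * ?U^2 / \<tau> ^ DIM('a)) + 8 * ennreal (R^4) * ennreal (B * ?W^2 * (\<tau> ^ (4 - DIM('a)) / k))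
     = ennreal (8 * (B * ?U^2 / \<tau> ^ DIM('a)) + 8 * R^4 * (B * ?W^2 * (\<tau> ^ (4 - DIM('a)) / k)))"
    by (rule ennreal_lincomb8[OF a])
   then show ?thesis by (simp add: mult_ac)
  qed
  also have "\<dots> \<le> ennreal (C * (?U^2 / \<tau> ^ DIM('a) + \<tau> ^ (4 - DIM('a)) * ?W^2))"
   using \<tau> C0 unfolding distrib_left by (intro ennreal_leI add_mono mult_right_mono) auto
  finally show ?thesis .
 qed
 then show ?thesis using r h C0(1) by blast
qed

abbreviation GN_inequality :: "'a::euclidean_space set \<Rightarrow> real \<Rightarrow> real \<Rightarrow> bool" where
 "GN_inequality U C h \<equiv> \<forall>u G \<tau>. has_grad U u G \<longrightarrow> 0 < \<tau> \<longrightarrow> \<tau> \<le> h \<longrightarrow>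
   integrable (lebesgue_on U) (\<lambda>x. (u x)^4) \<and>
   (LINT x|lebesgue_on U. (u x)^4) \<le> C * ((L2_norm U u)^4 / \<tau> ^ DIM('a) + \<tau> ^ (4 - DIM('a)) * (L2_norm U G)^4)"

text \<open>The closure of the domain is compact, so finitely many of the neighbourhoods of \<open>local_GN\<close> cover it. Minimising over
 \<open>\<tau>\<close> would give the usual multiplicative inequality; the Moser iteration chooses \<open>\<tau>\<close> itself.\<close>

lemma GN_L4:
 fixes U :: "'a::euclidean_space set"
 assumes dim: "DIM('a) < 4" and dom: "bounded_lipschitz_domain U"
 shows "\<exists>C\<ge>0. \<exists>h>0. GN_inequality U C h"
proof -
 have U: "open U" "bounded U" using dom by (auto simp: bounded_lipschitz_domain_def)
 have Ub: "U \<in> sets borel" using U by simp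
 define Q where "Q x r h C \<longleftrightarrow> (\<forall>u G \<tau>. weak_pair U u G \<longrightarrow> sqint (\<lambda>x. norm (G x)) \<longrightarrow> 0 < \<tau> \<longrightarrow> \<tau> \<le> h \<longrightarrow>
   (\<integral>\<^sup>+y. ennreal ((u y)^4) * indicator (U \<inter> ball x r) y \<partial>lborel) \<le>
   ennreal (C * ((LBINT x. (u x)^2)^2 / \<tau> ^ DIM('a) + \<tau> ^ (4 - DIM('a)) * (LBINT x. (norm (G x))^2)^2)))" for x r h C
 have "\<forall>x\<in>closure U. \<exists>r>0. \<exists>h>0. \<exists>C\<ge>0. Q x r h C"
  unfolding Q_def using local_GN[OF dim U(1) lipschitz_domain_has_cone[OF dom]] by blast
 then obtain r h C where rhC: "\<And>x. x \<in> closure U \<Longrightarrow> r x > 0 \<and> h x > 0 \<and> C x \<ge> 0 \<and> Q x (r x) (h x) (C x)" by metis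
 have "compact (closure U)" using U by simp
 then obtain D where D: "D \<subseteq> closure U" "finite D" "closure U \<subseteq> (\<Union>x\<in>D. ball x (r x))"
  by (rule compactE_image[of _ "closure U" "\<lambda>x. ball x (r x)"]) (use rhC in auto)
 define h0 where "h0 = Min (insert 1 (h ` D))"
 define C0 where "C0 = (\<Sum>x\<in>D. C x)"
 have h0: "h0 > 0" "\<And>x. x \<in> D \<Longrightarrow> h0 \<le> h x" unfolding h0_def using D rhC by (auto simp: subset_iff)
 have C0: "C0 \<ge> 0" unfolding C0_def using D rhC by (intro sum_nonneg) auto
 have "integrable (lebesgue_on U) (\<lambda>x. (u x)^4) \<and>
   (LINT x|lebesgue_on U. (u x)^4) \<le> C0 * ((L2_norm U u)^4 / \<tau> ^ DIM('a) + \<tau> ^ (4 - DIM('a)) * (L2_norm U G)^4)"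
  if uG: "has_grad U u G" and \<tau>: "0 < \<tau>" "\<tau> \<le> h0" for u G \<tau>
 proof -
  obtain u' G' where u': "rep U u u'" "rep U G G'" "weak_pair U u' G'" using has_grad_rep[OF Ub uG] .
  have [measurable]: "u' \<in> borel_measurable borel" "G' \<in> borel_measurable borel" using u' by (auto simp: rep_def)
  have rG: "rep U (\<lambda>x. (norm (G x))^2) (\<lambda>x. (norm (G' x))^2)" by (rule rep_compose[OF u'(2)]) auto
  have ru: "rep U (\<lambda>x. (norm (u x))^2) (\<lambda>x. (norm (u' x))^2)" by (rule rep_compose[OF u'(1)]) auto
  have r4: "rep U (\<lambda>x. (u x)^4) (\<lambda>x. (u' x)^4)" by (rule rep_compose[OF u'(1)]) auto
  have g: "sqint (\<lambda>x. norm (G' x))"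
   using rep_integral(2)[OF Ub rG] uG by (auto simp: sqint_def has_grad_def L2_def)
  have p4: "(x::real)^4 = (x^2)^2" for x by (simp flip: power_mult)
  have nu: "(L2_norm U u)^4 = (LBINT x. (u' x)^2)^2"
   using L2_norm_sq[of U u] rep_integral(1)[OF Ub ru] by (simp add: p4)
  have nG: "(L2_norm U G)^4 = (LBINT x. (norm (G' x))^2)^2"
   using L2_norm_sq[of U G] rep_integral(1)[OF Ub rG] by (simp add: p4)
  let ?E = "(L2_norm U u)^4 / \<tau> ^ DIM('a) + \<tau> ^ (4 - DIM('a)) * (L2_norm U G)^4"
  have E0: "0 \<le> ?E" using \<tau> L2_norm_nonneg by (intro add_nonneg_nonneg divide_nonneg_nonneg mult_nonneg_nonneg) auto
  have "(\<integral>\<^sup>+x. ennreal ((u' x)^4) \<partial>lborel) \<le> (\<integral>\<^sup>+y. (\<Sum>x\<in>D. ennreal ((u' y)^4) * indicator (U \<inter> ball x (r x)) y) \<partial>lborel)"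
  proof (rule nn_integral_mono)
   fix y
   show "ennreal ((u' y)^4) \<le> (\<Sum>x\<in>D. ennreal ((u' y)^4) * indicator (U \<inter> ball x (r x)) y)"
   proof (cases "y \<in> U")
    case True
    then obtain x where x: "x \<in> D" "y \<in> ball x (r x)" using D(3) closure_subset by blast
    have "ennreal ((u' y)^4) = ennreal ((u' y)^4) * indicator (U \<inter> ball x (r x)) y" using True x by simp
    also have "\<dots> \<le> (\<Sum>x\<in>D. ennreal ((u' y)^4) * indicator (U \<inter> ball x (r x)) y)"
     using x(1) D(2) by (intro member_le_sum) auto
    finally show ?thesis .
   next
    case False then show ?thesis using u'(1) by (simp add: rep_def)
   qed
  qed
  also have "\<dots> = (\<Sum>x\<in>D. \<integral>\<^sup>+y. ennreal ((u' y)^4) * indicator (U \<inter> ball x (r x)) y \<partial>lborel)"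
  proof (rule nn_integral_sum)
   fix x
   have [measurable]: "U \<inter> ball x (r x) \<in> sets borel" using Ub by auto
   show "(\<lambda>y. ennreal ((u' y)^4) * indicator (U \<inter> ball x (r x)) y) \<in> borel_measurable lborel" by measurable
  qed
  also have "\<dots> \<le> (\<Sum>x\<in>D. ennreal (C x * ?E))"
  proof (rule sum_mono)
   fix x assume x: "x \<in> D"
   then have "Q x (r x) (h x) (C x)" using D(1) rhC by blast
   moreover have "\<tau> \<le> h x" using \<tau> h0(2)[OF x] by simp
   ultimately show "(\<integral>\<^sup>+y. ennreal ((u' y)^4) * indicator (U \<inter> ball x (r x)) y \<partial>lborel) \<le> ennreal (C x * ?E)"
    unfolding Q_def nu nG using u'(3) g \<tau>(1) by blast
  qed
  also have "\<dots> = ennreal (C0 * ?E)"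
   unfolding C0_def sum_distrib_right using D(1) rhC E0 by (intro sum_ennreal) (auto simp: subset_iff)
  finally have *: "(\<integral>\<^sup>+x. ennreal ((u' x)^4) \<partial>lborel) \<le> ennreal (C0 * ?E)" .
  then have i: "integrable lborel (\<lambda>x. (u' x)^4)"
   by (intro integrableI_nonneg) (auto simp: order_le_less_trans)
  have "(LBINT x. (u' x)^4) \<le> C0 * ?E"
   using * i C0 E0 by (simp add: nn_integral_eq_integral)
  then show ?thesis using i rep_integral[OF Ub r4] by simp
 qed
 then show ?thesis using C0 h0(1) by blast
qed

section \<open>Maximum bounds by Moser iteration\<close>

lemma squaring_recursion:
 fixes \<beta> :: "nat \<Rightarrow> real"
 assumes "\<And>k. \<beta> (Suc k) \<le> (\<beta> k)^2" and pos: "\<And>k. 0 \<le> \<beta> k"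
 shows "\<beta> (k + j) \<le> (\<beta> k) ^ (2 ^ j)"
proof (induction j)
 case (Suc j)
 have "\<beta> (k + Suc j) \<le> (\<beta> (k + j))^2" using assms(1)[of "k + j"] by simp
 also have "\<dots> \<le> ((\<beta> k) ^ (2 ^ j))^2" by (intro power_mono Suc.IH pos)
 finally show ?case by (simp add: mult.commute flip: power_mult)
qed simp

text \<open>On the set where \<open>f^4\<close> exceeds \<open>\<beta> q\<close> with \<open>q > 1\<close> the moments would outgrow their bounds by the factor \<open>q^(2^j)\<close>.\<close>

lemma (in finite_measure) AE_bounded_by_moments:
 fixes f :: "'a \<Rightarrow> real"
 assumes [measurable]: "f \<in> borel_measurable M" and int: "\<And>j. integrable M (\<lambda>x. f x ^ (4 * 2 ^ j))"
  and le: "\<And>j. (\<integral>x. f x ^ (4 * 2 ^ j) \<partial>M) \<le> \<beta> ^ (2 ^ j)" and \<beta>: "\<beta> > 0"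
 shows "AE x in M. f x ^ 4 \<le> \<beta>"
proof -
 have "AE x in M. f x ^ 4 < \<beta> * (1 + 1 / real (Suc n))" for n
 proof -
  define q where "q = 1 + 1 / real (Suc n)"
  have q: "q > 1" by (simp add: q_def)
  define A where "A = {x \<in> space M. f x ^ 4 \<ge> \<beta> * q}"
  have [measurable]: "A \<in> sets M" unfolding A_def by measurable
  have b: "q ^ (2 ^ j) * measure M A \<le> 1" for j
  proof -
   have "(\<beta> * q) ^ (2 ^ j) * measure M A = (\<integral>x. (\<beta> * q) ^ (2 ^ j) * indicator A x \<partial>M)" by simp
   also have "\<dots> \<le> (\<integral>x. f x ^ (4 * 2 ^ j) \<partial>M)"
   proof (rule integral_mono[OF _ int])
    show "integrable M (\<lambda>x. (\<beta> * q) ^ (2 ^ j) * indicat_real A x)" by (intro integrable_mult_right integrable_real_indicator) (auto simp: emeasure_finite less_top[symmetric])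
    fix x assume "x \<in> space M"
    have "(\<beta> * q) ^ (2 ^ j) \<le> (f x ^ 4) ^ (2 ^ j)" if "x \<in> A"
     using that \<beta> q by (intro power_mono) (auto simp: A_def)
    then show "(\<beta> * q) ^ (2 ^ j) * indicat_real A x \<le> f x ^ (4 * 2 ^ j)"
     by (auto simp: indicator_def power_mult)
   qed
   also have "\<dots> \<le> \<beta> ^ (2 ^ j)" by (rule le)
   finally show ?thesis using \<beta> by (simp add: power_mult_distrib)
  qed
  have "measure M A = 0"
  proof (rule ccontr)
   assume "measure M A \<noteq> 0"
   then have m: "measure M A > 0" by (simp add: zero_less_measure_iff)
   obtain N where N: "1 / measure M A < q ^ N" using real_arch_pow[OF q] by blast
   have "q ^ N \<le> q ^ (2 ^ N)" using q by (intro power_increasing) (auto intro: less_imp_le less_exp)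
   then have "1 / measure M A < q ^ (2 ^ N)" using N by linarith
   then show False using b[of N] m by (simp add: field_simps)
  qed
  then have "emeasure M A = 0" by (simp add: emeasure_eq_measure)
  then have "AE x in M. x \<notin> A" by (intro AE_not_in) (simp add: null_sets_def)
  then show ?thesis using AE_space by eventually_elim (auto simp: A_def q_def not_le)
 qed
 then have "AE x in M. \<forall>n. f x ^ 4 < \<beta> * (1 + 1 / real (Suc n))" by (simp add: AE_all_countable)
 then show ?thesis
 proof eventually_elim
  case (elim x)
  have "(\<lambda>n. \<beta> * (1 + 1 / real (Suc n))) \<longlonglongrightarrow> \<beta> * (1 + 0)"
   by (intro tendsto_intros) (rule LIMSEQ_inverse_real_of_nat[unfolded inverse_eq_divide])
  then show ?case using elim by (intro LIMSEQ_le_const[of _ \<beta>]) (auto intro: less_imp_le)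
 qed
qed

lemma bounded_integrable:
 assumes "finite_measure M" "f \<in> borel_measurable M" "AE x in M. \<bar>f x :: real\<bar> \<le> K"
 shows "integrable M f"
 by (rule finite_measure.integrable_const_bound[OF assms(1)]) (use assms in auto)

lemma bounded_imp_L2:
 fixes f :: "'a::euclidean_space \<Rightarrow> real"
 assumes "finite_measure (lebesgue_on U)" and f: "f \<in> borel_measurable (lebesgue_on U)" and K: "AE x in lebesgue_on U. \<bar>f x\<bar> \<le> K"
 shows "f \<in> L2 U"
proof -
 have "AE x in lebesgue_on U. \<bar>(norm (f x))^2\<bar> \<le> K^2"
  using K by eventually_elim (simp add: abs_le_square_iff[symmetric])
 from bounded_integrable[OF assms(1) _ this] f show ?thesis by (simp add: L2_def)
qed

text \<open>All constants of the iteration are fixed before the functions, so that the bound is uniform in them. The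
 number \<open>V\<close> is the \<open>L2\<close> norm of the constant function \<open>1\<close>.\<close>

locale moser =
 fixes U :: "'a::euclidean_space set" and C h \<epsilon> \<Lambda> V :: real
 assumes dim: "DIM('a) = 2 \<or> DIM('a) = 3"
  and U: "open U" "finite_measure (lebesgue_on U)"
  and V_def: "V = sqrt (measure (lebesgue_on U) U)"
  and C: "0 \<le> C" and h: "0 < h" and \<epsilon>: "0 < \<epsilon>" and \<Lambda>: "0 \<le> \<Lambda>"
  and GN: "GN_inequality U C h"
begin

lemma V_nonneg: "0 \<le> V" by (simp add: V_def)

definition C1 :: real where "C1 = (V + 1 + \<Lambda> * V) / \<epsilon>"

text \<open>The bound \<open>c0 * (4 * C * C1^2) \<le> 1\<close> lets the gradient term be absorbed in \<open>b_step\<close>.\<close>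

definition c0 :: real where "c0 = min (min h 1) (1 / (4 * C * C1^2 + 1))"

lemma c0: "0 < c0" "c0 \<le> h" "c0 \<le> 1" "c0 * (4 * C * C1^2) \<le> 1"
proof -
 have p: "0 < 4 * C * C1^2 + 1" using C by (simp add: add_nonneg_pos)
 show "0 < c0" using h p by (simp add: c0_def)
 show "c0 \<le> h" "c0 \<le> 1" by (simp_all add: c0_def)
 have "c0 * (4 * C * C1^2) \<le> 1 / (4 * C * C1^2 + 1) * (4 * C * C1^2)"
  using C by (intro mult_right_mono) (auto simp: c0_def)
 also have "\<dots> \<le> 1" using p by (simp add: divide_simps)
 finally show "c0 * (4 * C * C1^2) \<le> 1" .
qed

definition C3 :: real where "C3 = (2 + 2 * C) / c0 ^ DIM('a)"

definition a :: nat where "a = DIM('a) * (DIM('a) - 1)"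

lemma C3_pos: "0 < C3" using C c0(1) by (simp add: C3_def add_pos_nonneg)

definition C4 :: real where "C4 = 1 + C * (1 / h ^ DIM('a) + h ^ (4 - DIM('a)))"

lemma C4_pos: "0 < C4" using C h by (simp add: C4_def add_pos_nonneg)

definition moser_const :: real where "moser_const = C3 * 4 ^ a * C4"

lemma moser_const_pos: "0 < moser_const" using C3_pos C4_pos by (simp add: moser_const_def)

context
 fixes \<phi> f g :: "'a \<Rightarrow> real" and \<Phi> :: "'a \<Rightarrow> 'a" and K l :: real
 assumes \<phi>: "has_grad U \<phi> \<Phi>" and K: "AE x in lebesgue_on U. \<bar>\<phi> x\<bar> \<le> K" "0 \<le> K"
  and f: "f \<in> L2 U" and g: "g \<in> L2 U" and g\<phi>: "AE x in lebesgue_on U. g x * \<phi> x \<ge> - (\<phi> x)\<^sup>2"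
  and eq: "\<And>\<psi> \<Psi>. has_grad U \<psi> \<Psi> \<Longrightarrow> \<epsilon> * L2_inner U \<Phi> \<Psi> = L2_inner U f \<psi> - \<Lambda> * L2_inner U g \<psi>"
  and l: "L2_norm U f \<le> l" "1 \<le> l"
begin

lemma phi_meas [measurable]: "\<phi> \<in> borel_measurable (lebesgue_on U)"
 using \<phi> by (auto simp: has_grad_def L2_borel)

lemma power_bounded: "AE x in lebesgue_on U. \<bar>\<phi> x ^ n\<bar> \<le> K ^ n"
 using K(1) by eventually_elim (metis power_abs power_mono abs_ge_zero)

lemma power_integrable: "integrable (lebesgue_on U) (\<lambda>x. \<phi> x ^ n)"
 by (rule bounded_integrable[OF U(2) _ power_bounded]) measurable

lemma power_L2: "(\<lambda>x. \<phi> x ^ n) \<in> L2 U"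
 by (rule bounded_imp_L2[OF U(2) _ power_bounded]) measurable

text \<open>The equation is tested with \<open>\<phi>^(2n+1)\<close>. This odd power has the sign of \<open>\<phi>\<close>, so the one-sided bound on \<open>g \<phi>\<close>
 controls the nonlinearity whatever its growth.\<close>

lemma power_energy:
 "(L2_norm U (\<lambda>x. (real (Suc n) * \<phi> x ^ n) *\<^sub>R \<Phi> x))^2 \<le> real (Suc n) * l * C1 * (1 + L2_norm U (\<lambda>x. \<phi> x ^ (2 * Suc n)))"
proof -
 let ?m = "Suc n"
 let ?N = "L2_norm U (\<lambda>x. \<phi> x ^ (2 * ?m))"
 let ?p = "\<lambda>x. \<phi> x ^ Suc (2 * n)"
 have N0: "0 \<le> ?N" by (rule L2_norm_nonneg)
 have one: "(\<lambda>x. 1 :: real) \<in> L2 U" "L2_norm U (\<lambda>x. 1 :: real) = V"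
  using power_L2[of 0] by (auto simp: L2_norm_def L2_inner_def V_def)
 have \<Phi>: "\<Phi> \<in> L2 U" using \<phi> by (simp add: has_grad_def)
 have \<psi>: "has_grad U ?p (\<lambda>x. (real (Suc (2 * n)) * \<phi> x ^ (2 * n)) *\<^sub>R \<Phi> x)"
  by (rule has_grad_power[OF U(1) \<phi> K])
 define I where "I = (LINT x|lebesgue_on U. \<phi> x ^ (2 * n) * (\<Phi> x \<bullet> \<Phi> x))"
 have e1: "\<epsilon> * (real (Suc (2 * n)) * I) = L2_inner U f ?p - \<Lambda> * L2_inner U g ?p"
  using eq[OF \<psi>] by (simp add: L2_inner_def I_def mult.assoc)
 have e2: "(L2_norm U (\<lambda>x. (real ?m * \<phi> x ^ n) *\<^sub>R \<Phi> x))^2 = (real ?m)^2 * I"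
  by (simp add: L2_norm_sq I_def power_mult_distrib power2_norm_eq_inner power_mult mult.assoc[symmetric] mult.commute[of 2] del: of_nat_Suc)
    (simp add: mult.assoc)
 have p2: "(\<lambda>x. 1 + \<phi> x ^ (2 * ?m)) \<in> L2 U" by (intro L2_add one power_L2)
 have pw: "\<bar>\<phi> x ^ Suc (2 * n)\<bar> \<le> 1 + \<phi> x ^ (2 * ?m)" for x
 proof -
  have e: "\<bar>\<phi> x ^ Suc (2 * n)\<bar> = \<bar>\<phi> x\<bar> ^ Suc (2 * n)" by (rule power_abs)
  have e2: "\<phi> x ^ (2 * ?m) = \<bar>\<phi> x\<bar> ^ (2 * ?m)" by (simp only: power_even_abs even_mult_iff even_numeral simp_thms)
  have "0 \<le> \<bar>\<phi> x\<bar> ^ (2 * ?m)" by (intro zero_le_power abs_ge_zero)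
  moreover have "\<bar>\<phi> x\<bar> ^ Suc (2 * n) \<le> 1" if "\<bar>\<phi> x\<bar> \<le> 1" using that by (intro power_le_one) auto
  moreover have "\<bar>\<phi> x\<bar> ^ Suc (2 * n) \<le> \<bar>\<phi> x\<bar> ^ (2 * ?m)" if "\<not> \<bar>\<phi> x\<bar> \<le> 1" using that by (intro power_increasing) auto
  ultimately show ?thesis unfolding e e2 by (cases "\<bar>\<phi> x\<bar> \<le> 1") (linarith, force intro: order_trans)
 qed
 have "L2_inner U f ?p \<le> L2_norm U f * L2_norm U ?p"
  using L2_Cauchy_Schwarz(2)[OF f power_L2[of "Suc (2 * n)"]] by linarith
 also have "\<dots> \<le> l * L2_norm U ?p" by (intro mult_right_mono l L2_norm_nonneg)
 also have "L2_norm U ?p \<le> 1 * L2_norm U (\<lambda>x. 1 + \<phi> x ^ (2 * ?m))"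
  by (rule L2_norm_mono[OF _ p2]) (use pw in \<open>auto intro!: AE_I2 intro: order_trans[OF _ abs_ge_self]\<close>)
 also have "\<dots> \<le> V + ?N" using L2_norm_triangle[OF one(1) power_L2[of "2 * ?m"]] one(2) by simp
 finally have b1: "L2_inner U f ?p \<le> l * (V + ?N)" using l by (simp add: mult_left_mono)
 have "- (LINT x|lebesgue_on U. \<phi> x ^ (2 * ?m)) \<le> L2_inner U g ?p"
  unfolding L2_inner_def Bochner_Integration.integral_minus[symmetric]
 proof (rule integral_mono_AE)
  show "integrable (lebesgue_on U) (\<lambda>x. - (\<phi> x ^ (2 * ?m)))" using power_integrable[of "2 * ?m"] by simp
  show "integrable (lebesgue_on U) (\<lambda>x. g x \<bullet> \<phi> x ^ Suc (2 * n))" by (rule L2_inner_integrable(1)[OF g power_L2])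
  show "AE x in lebesgue_on U. - (\<phi> x ^ (2 * ?m)) \<le> g x \<bullet> \<phi> x ^ Suc (2 * n)"
   using g\<phi>
  proof eventually_elim
   case (elim x)
   have "(- ((\<phi> x)^2)) * \<phi> x ^ (2 * n) \<le> (g x * \<phi> x) * \<phi> x ^ (2 * n)"
    using elim by (intro mult_right_mono) (auto simp: power_mult)
   then show ?case by (simp add: power2_eq_square mult_ac)
  qed
 qed
 moreover have "(LINT x|lebesgue_on U. \<phi> x ^ (2 * ?m)) \<le> V * ?N"
  using L2_Cauchy_Schwarz(2)[OF one(1) power_L2[of "2 * ?m"]] one(2) by (simp add: L2_inner_def)
 ultimately have b2: "- L2_inner U g ?p \<le> V * ?N" by linarith
 have "\<epsilon> * (real (Suc (2 * n)) * I) \<le> l * (V + ?N) + \<Lambda> * (V * ?N)"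
  using e1 b1 mult_left_mono[OF b2 \<Lambda>] by simp
 also have "\<dots> \<le> l * (V + 1 + \<Lambda> * V) * (1 + ?N)"
 proof -
  have "\<Lambda> * (V * ?N) \<le> l * (\<Lambda> * (V * ?N))"
   using mult_right_mono[OF l(2), of "\<Lambda> * (V * ?N)"] \<Lambda> V_nonneg N0 by simp
  moreover have "0 \<le> l * (V * ?N)" "0 \<le> l * (\<Lambda> * V)" "0 \<le> l" using l \<Lambda> V_nonneg N0 by auto
  ultimately show ?thesis by (simp add: algebra_simps)
 qed
 finally have "\<epsilon> * (real (Suc (2 * n)) * I) \<le> \<epsilon> * (l * C1 * (1 + ?N))"
  using \<epsilon> by (simp add: C1_def)
 then have I1: "real (Suc (2 * n)) * I \<le> l * C1 * (1 + ?N)" using \<epsilon> by simp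
 have I0: "0 \<le> I" unfolding I_def by (intro Bochner_Integration.integral_nonneg) (simp add: power_mult)
 have "(real ?m)^2 * I \<le> real ?m * (real (Suc (2 * n)) * I)"
  using I0 by (simp add: power2_eq_square mult_right_mono mult_left_mono flip: mult.assoc)
 also have "\<dots> \<le> real ?m * (l * C1 * (1 + ?N))" by (intro mult_left_mono I1) simp
 finally show ?thesis unfolding e2 by (simp only: mult.assoc)
qed

definition b :: "nat \<Rightarrow> real" where "b k = 1 + (LINT x|lebesgue_on U. \<phi> x ^ (2 * 2 ^ k))"

lemma b_ge_1: "1 \<le> b k"
 unfolding b_def by (simp add: power_mult)

text \<open>The Gagliardo--Nirenberg inequality for \<open>\<phi>^m\<close> with \<open>m = 2^k\<close>, at the scale \<open>\<tau> = c0 / (m l)^(d-1)\<close>. By \<open>power_energy\<close> the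
 gradient of \<open>\<phi>^m\<close> contributes the factor \<open>(m l)^2\<close>, which \<open>\<tau>^(4-d)\<close> compensates because \<open>(d - 1) (4 - d) = 2\<close> for \<open>d = 2, 3\<close>.\<close>

lemma b_step: "b (Suc k) \<le> C3 * (2 ^ k * l) ^ a * (b k)^2"
proof -
 define m :: nat where "m = 2 ^ k"
 obtain n where n: "m = Suc n" using not0_implies_Suc[of m] by (auto simp: m_def)
 define N where "N = L2_norm U (\<lambda>x. \<phi> x ^ (2 * m))"
 have N2: "N^2 = (LINT x|lebesgue_on U. (\<phi> x ^ m)^4)"
  by (simp add: N_def L2_norm_sq mult.commute flip: power_mult)
 have bS: "b (Suc k) = 1 + N^2" unfolding N2 b_def m_def by (simp add: mult.commute flip: power_mult)
 have bk: "(L2_norm U (\<lambda>x. \<phi> x ^ m))^2 = b k - 1" unfolding b_def m_def L2_norm_sq by (simp add: mult.commute flip: power_mult)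
 have bk4: "(L2_norm U (\<lambda>x. \<phi> x ^ m))^4 \<le> (b k)^2"
 proof -
  have "(L2_norm U (\<lambda>x. \<phi> x ^ m))^4 = (b k - 1)^2" unfolding bk[symmetric] by (simp flip: power_mult)
  also have "\<dots> \<le> (b k)^2" using b_ge_1[of k] by (intro power_mono) auto
  finally show ?thesis .
 qed
 let ?G = "\<lambda>x. (real m * \<phi> x ^ n) *\<^sub>R \<Phi> x"
 have hg: "has_grad U (\<lambda>x. \<phi> x ^ m) ?G" using has_grad_power[OF U(1) \<phi> K, of n] by (simp add: n)
 have G2: "(L2_norm U ?G)^2 \<le> real m * l * C1 * (1 + N)" using power_energy[of n] by (simp add: n N_def)
 have G4: "(L2_norm U ?G)^4 \<le> (real m * l * C1)^2 * (2 + 2 * N^2)"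
 proof -
  have "(L2_norm U ?G)^4 = ((L2_norm U ?G)^2)^2" by (simp flip: power_mult)
  also have "\<dots> \<le> (real m * l * C1 * (1 + N))^2" by (intro power_mono G2) simp
  also have "\<dots> = (real m * l * C1)^2 * (1 + N)^2" by (simp add: power_mult_distrib)
  also have "\<dots> \<le> (real m * l * C1)^2 * (2 + 2 * N^2)"
   using sum_squares_bound[of 1 N] by (intro mult_left_mono) (auto simp: power2_sum)
  finally show ?thesis .
 qed
 define \<tau> where "\<tau> = c0 / (real m * l) ^ (DIM('a) - 1)"
 have ml: "1 \<le> real m * l" using l(2) mult_mono[of 1 "real m" 1 l] by (simp add: m_def)
 have mlp: "1 \<le> (real m * l) ^ j" for j using ml by (rule one_le_power)
 have \<tau>: "0 < \<tau>" "\<tau> \<le> h"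
 proof -
  show "0 < \<tau>" unfolding \<tau>_def using c0(1) mlp[of "DIM('a) - 1"] by (intro divide_pos_pos) linarith+
  have "\<tau> \<le> c0" unfolding \<tau>_def using c0(1) mlp[of "DIM('a) - 1"] by (simp add: divide_le_eq mult_le_cancel_left1)
  then show "\<tau> \<le> h" using c0(2) by linarith
 qed
 have \<tau>1: "\<tau> ^ (4 - DIM('a)) * (real m * l)^2 \<le> c0"
 proof -
  have e: "(DIM('a) - 1) * (4 - DIM('a)) = 2" using dim by auto
  have "\<tau> ^ (4 - DIM('a)) * (real m * l)^2 = c0 ^ (4 - DIM('a))"
   using ml e l n unfolding \<tau>_def by (simp add: power_divide flip: power_mult)
  also have "\<dots> \<le> c0 ^ 1" using c0 dim by (intro power_decreasing) auto
  finally show ?thesis by simp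
 qed
 have "N^2 \<le> C * ((L2_norm U (\<lambda>x. \<phi> x ^ m))^4 / \<tau> ^ DIM('a) + \<tau> ^ (4 - DIM('a)) * (L2_norm U ?G)^4)"
  unfolding N2 using GN[rule_format, OF hg \<tau>] by blast
 also have "\<dots> \<le> C * ((b k)^2 / \<tau> ^ DIM('a) + \<tau> ^ (4 - DIM('a)) * ((real m * l * C1)^2 * (2 + 2 * N^2)))"
  using \<tau>(1) C by (intro mult_left_mono add_mono divide_right_mono bk4 G4) auto
 also have "\<dots> = C * (b k)^2 / \<tau> ^ DIM('a) + (\<tau> ^ (4 - DIM('a)) * (real m * l)^2) * (C * C1^2 * (2 + 2 * N^2))"
  by (simp add: power_mult_distrib distrib_left mult_ac)
 also have "\<dots> \<le> C * (b k)^2 / \<tau> ^ DIM('a) + c0 * (C * C1^2 * (2 + 2 * N^2))"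
  using C by (intro add_left_mono mult_right_mono \<tau>1 mult_nonneg_nonneg) auto
 also have "c0 * (C * C1^2 * (2 + 2 * N^2)) = c0 * (4 * C * C1^2) * ((1 + N^2) / 2)" by (simp add: field_simps)
 also have "\<dots> \<le> 1 * ((1 + N^2) / 2)" by (intro mult_right_mono c0) simp
 finally have "1 + N^2 \<le> 2 + 2 * C * (b k)^2 / \<tau> ^ DIM('a)" by (simp add: field_simps)
 also have "\<dots> \<le> (2 + 2 * C) * ((b k)^2 / \<tau> ^ DIM('a))"
 proof -
  have "\<tau> \<le> 1" using \<tau>_def c0 mlp[of "DIM('a) - 1"] by (simp add: divide_le_eq)
  then have "\<tau> ^ DIM('a) \<le> 1" using \<tau>(1) by (intro power_le_one) auto
  moreover have "1 \<le> (b k)^2" using b_ge_1[of k] by simp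
  ultimately have "1 \<le> (b k)^2 / \<tau> ^ DIM('a)" using \<tau>(1) by (simp add: le_divide_eq)
  then have "2 + 2 * C * ((b k)^2 / \<tau> ^ DIM('a)) \<le> 2 * ((b k)^2 / \<tau> ^ DIM('a)) + 2 * C * ((b k)^2 / \<tau> ^ DIM('a))" by linarith
  then show ?thesis unfolding distrib_right unfolding times_divide_eq_right .
 qed
 also have "\<dots> = C3 * (real m * l) ^ a * (b k)^2"
 proof -
  have "\<tau> ^ DIM('a) = c0 ^ DIM('a) / (real m * l) ^ a" unfolding \<tau>_def a_def by (simp add: power_divide mult.commute flip: power_mult)
  then show ?thesis by (simp add: C3_def)
 qed
 finally show ?thesis by (simp add: bS m_def)
qed

lemma b_1: assumes "L2_norm U \<phi> \<le> 1" "L2_norm U \<Phi> \<le> 1" shows "b 1 \<le> C4"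
proof -
 have "(LINT x|lebesgue_on U. (\<phi> x)^4) \<le> C * ((L2_norm U \<phi>)^4 / h ^ DIM('a) + h ^ (4 - DIM('a)) * (L2_norm U \<Phi>)^4)"
  using GN[rule_format, OF \<phi> h] by simp
 also have "\<dots> \<le> C * (1 / h ^ DIM('a) + h ^ (4 - DIM('a)) * 1)"
  using h C assms by (intro mult_left_mono add_mono divide_right_mono power_le_one L2_norm_nonneg) auto
 finally show ?thesis by (simp add: b_def C4_def)
qed

lemma normalised_bound:
 assumes "L2_norm U \<phi> \<le> 1" "L2_norm U \<Phi> \<le> 1"
 shows "AE x in lebesgue_on U. (\<phi> x)^4 \<le> moser_const * l ^ a"
proof -
 \<comment> \<open>The factor turns \<open>b_step\<close> into \<open>\<beta> (Suc k) \<le> (\<beta> k)^2\<close>.\<close>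
 define \<beta> where "\<beta> k = C3 * l ^ a * 2 ^ (a * (k + 1)) * b k" for k
 have l0: "0 \<le> l" using l by simp
 have rec: "\<beta> (Suc k) \<le> (\<beta> k)^2" for k
 proof -
  have "\<beta> (Suc k) \<le> C3 * l ^ a * 2 ^ (a * (Suc k + 1)) * (C3 * (2 ^ k * l) ^ a * (b k)^2)"
   unfolding \<beta>_def using C3_pos l0 by (intro mult_left_mono b_step) auto
  also have "\<dots> = (\<beta> k)^2"
   unfolding \<beta>_def by (simp add: power_mult_distrib power2_eq_square power_add algebra_simps flip: power_mult)
  finally show ?thesis .
 qed
 have pos: "0 \<le> \<beta> k" for k unfolding \<beta>_def using C3_pos l0 b_ge_1[of k] by (intro mult_nonneg_nonneg) auto
 have big: "1 \<le> C3 * l ^ a * 2 ^ (a * (k + 1))" for k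
 proof -
  have c: "c0 ^ DIM('a) \<le> 1" using c0 by (intro power_le_one) auto
  have "1 \<le> C3" unfolding C3_def using c c0(1) C by (simp add: le_divide_eq)
  moreover have "1 \<le> l ^ a" "1 \<le> (2::real) ^ (a * (k + 1))" using l by (auto intro!: one_le_power)
  moreover have ge1: "1 \<le> x * y" if "1 \<le> x" "1 \<le> y" for x y :: real using mult_mono[of 1 x 1 y] that by simp
  ultimately show ?thesis by (intro ge1)
 qed
 have "b (1 + j) \<le> (\<beta> 1) ^ (2 ^ j)" for j
 proof -
  have "b (1 + j) \<le> \<beta> (1 + j)"
   using mult_right_mono[OF big[of "1 + j"], of "b (1 + j)"] b_ge_1[of "1 + j"] by (simp add: \<beta>_def)
  also have "\<dots> \<le> (\<beta> 1) ^ (2 ^ j)" by (rule squaring_recursion[of \<beta>, OF rec pos])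
  finally show ?thesis .
 qed
 moreover have "(\<beta> 1) ^ (2 ^ j) \<le> (moser_const * l ^ a) ^ (2 ^ j)" for j
 proof (rule power_mono[OF _ pos])
  have "\<beta> 1 \<le> C3 * l ^ a * 2 ^ (a * (1 + 1)) * C4"
   unfolding \<beta>_def using C3_pos l0 by (intro mult_left_mono b_1 assms) auto
  also have "(2::real) ^ (a * (1 + 1)) = 4 ^ a" using power_mult[of "2::real" 2 a] by (simp add: mult_2)
  finally show "\<beta> 1 \<le> moser_const * l ^ a" by (simp add: moser_const_def mult_ac)
 qed
 moreover have "(LINT x|lebesgue_on U. \<phi> x ^ (4 * 2 ^ j)) \<le> b (1 + j)" for j
  by (simp add: b_def)
 ultimately have "(LINT x|lebesgue_on U. \<phi> x ^ (4 * 2 ^ j)) \<le> (moser_const * l ^ a) ^ (2 ^ j)" for j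
  by (meson order_trans)
 then show ?thesis
  using l moser_const_pos
  by (intro finite_measure.AE_bounded_by_moments[OF U(2) phi_meas power_integrable]) auto
qed

end

end

lemma finite_measure_domain:
 assumes "bounded_lipschitz_domain U" shows "finite_measure (lebesgue_on U)"
 using assms by (intro finite_measure_lebesgue_on) (auto simp: bounded_lipschitz_domain_def lmeasurable_open)

abbreviation sup_inequality :: "'a::euclidean_space set \<Rightarrow> real \<Rightarrow> real \<Rightarrow> real \<Rightarrow> bool" where
 "sup_inequality U \<epsilon> \<Lambda> K0 \<equiv> \<forall>\<phi> \<Phi> f g K. has_grad U \<phi> \<Phi> \<longrightarrow> (AE x in lebesgue_on U. \<bar>\<phi> x\<bar> \<le> K) \<longrightarrow> 0 \<le> K \<longrightarrow> f \<in> L2 U \<longrightarrow> g \<in> L2 U \<longrightarrow>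
  (AE x in lebesgue_on U. g x * \<phi> x \<ge> - (\<phi> x)\<^sup>2) \<longrightarrow>
  (\<forall>\<psi> \<Psi>. has_grad U \<psi> \<Psi> \<longrightarrow> \<epsilon> * L2_inner U \<Phi> \<Psi> = L2_inner U f \<psi> - \<Lambda> * L2_inner U g \<psi>) \<longrightarrow>
  (AE x in lebesgue_on U. (\<phi> x)^2 \<le> K0 * ((L2_norm U f + (L2_norm U \<phi> + L2_norm U \<Phi>)) ^ (DIM('a) - 1) * (L2_norm U \<phi> + L2_norm U \<Phi>) ^ (3 - DIM('a))))"

text \<open>The hypotheses are invariant under multiplication of \<open>\<phi>\<close>, \<open>f\<close>, \<open>g\<close> by a constant, which reduces the claim to
 \<open>normalised_bound\<close>.\<close>

lemma sup_bound:
 fixes U :: "'a::euclidean_space set"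
 assumes dim: "DIM('a) = 2 \<or> DIM('a) = 3" and dom: "bounded_lipschitz_domain U" and \<epsilon>: "0 < \<epsilon>" and \<Lambda>: "0 \<le> \<Lambda>"
 shows "\<exists>K0\<ge>0. sup_inequality U \<epsilon> \<Lambda> K0"
proof -
 have U: "open U" and Ub: "U \<in> sets borel" using dom by (auto simp: bounded_lipschitz_domain_def)
 have dim4: "DIM('a) < 4" using dim by auto
 obtain C h where C: "0 \<le> C" "0 < h" and GN: "GN_inequality U C h"
  using GN_L4[OF dim4 dom] by (elim exE conjE) (rule that)
 interpret moser U C h \<epsilon> \<Lambda> "sqrt (measure (lebesgue_on U) U)"
  by (rule moser.intro[OF dim U finite_measure_domain[OF dom] refl C \<epsilon> \<Lambda> GN])
 define K0 where "K0 = sqrt moser_const"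
 have K0: "0 \<le> K0" "K0^2 = moser_const" using moser_const_pos by (auto simp: K0_def)
 have "AE x in lebesgue_on U. (\<phi> x)^2 \<le> K0 * ((L2_norm U f + (L2_norm U \<phi> + L2_norm U \<Phi>)) ^ (DIM('a) - 1) * (L2_norm U \<phi> + L2_norm U \<Phi>) ^ (3 - DIM('a)))"
  if \<phi>: "has_grad U \<phi> \<Phi>" and K: "AE x in lebesgue_on U. \<bar>\<phi> x\<bar> \<le> K" "0 \<le> K" and f: "f \<in> L2 U" and g: "g \<in> L2 U"
   and g\<phi>: "AE x in lebesgue_on U. g x * \<phi> x \<ge> - (\<phi> x)\<^sup>2"
   and eq: "\<And>\<psi> \<Psi>. has_grad U \<psi> \<Psi> \<Longrightarrow> \<epsilon> * L2_inner U \<Phi> \<Psi> = L2_inner U f \<psi> - \<Lambda> * L2_inner U g \<psi>"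
  for \<phi> \<Phi> f g K
 proof -
  define P where "P = L2_norm U \<phi> + L2_norm U \<Phi>"
  define m where "m = L2_norm U f + P"
  have P0: "0 \<le> P" unfolding P_def by (intro add_nonneg_nonneg L2_norm_nonneg)
  have Pm: "P \<le> m" unfolding m_def using L2_norm_nonneg[of U f] by simp
  have scaled: "AE x in lebesgue_on U. (\<phi> x)^4 \<le> moser_const * S^4 * l ^ a"
   if S: "S > 0" "P \<le> S" and l: "1 \<le> l" "L2_norm U f \<le> l * S" for S l
  proof -
   define c where "c = 1 / S"
   have c: "c > 0" "c * S = 1" using S by (auto simp: c_def)
   have fin: "AE x in lebesgue_on U. (c * \<phi> x)^4 \<le> moser_const * l ^ a"
   proof (rule normalised_bound[where \<Phi>="\<lambda>x. c *\<^sub>R \<Phi> x" and f="\<lambda>x. c * f x" and g="\<lambda>x. c * g x" and K="c * K"])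
    show "has_grad U (\<lambda>x. c * \<phi> x) (\<lambda>x. c *\<^sub>R \<Phi> x)" by (rule has_grad_cmult[OF Ub \<phi>])
    show "AE x in lebesgue_on U. \<bar>c * \<phi> x\<bar> \<le> c * K" using K(1) by eventually_elim (use c in \<open>auto simp: abs_mult\<close>)
    show "0 \<le> c * K" using c K by simp
    show "(\<lambda>x. c * f x) \<in> L2 U" "(\<lambda>x. c * g x) \<in> L2 U" using L2_scaleR[OF f, of c] L2_scaleR[OF g, of c] by simp_all
    show "AE x in lebesgue_on U. c * g x * (c * \<phi> x) \<ge> - (c * \<phi> x)\<^sup>2"
     using g\<phi>
    proof eventually_elim
     case (elim x)
     then have "c^2 * (- (\<phi> x)\<^sup>2) \<le> c^2 * (g x * \<phi> x)" by (rule mult_left_mono) simp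
     then show ?case by (simp add: power_mult_distrib power2_eq_square mult_ac)
    qed
    show "\<epsilon> * L2_inner U (\<lambda>x. c *\<^sub>R \<Phi> x) \<Psi> = L2_inner U (\<lambda>x. c * f x) \<psi> - \<Lambda> * L2_inner U (\<lambda>x. c * g x) \<psi>"
     if "has_grad U \<psi> \<Psi>" for \<psi> \<Psi>
     using arg_cong[OF eq[OF that], of "\<lambda>y. c * y"] L2_inner_scaleR_left[of U c f \<psi>] L2_inner_scaleR_left[of U c g \<psi>]
     by (simp add: L2_inner_scaleR_left right_diff_distrib mult_ac)
    have "L2_norm U (\<lambda>x. c * f x) = c * L2_norm U f" using L2_norm_scaleR[of U c f] c by simp
    also have "\<dots> \<le> c * (l * S)" using c l by (intro mult_left_mono) auto
    also have "c * (l * S) = l" using c(2) by (metis mult.left_commute mult.right_neutral)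
    finally show "L2_norm U (\<lambda>x. c * f x) \<le> l" .
    show "1 \<le> l" by fact
    have "c * P \<le> c * S" using c S by (intro mult_left_mono) auto
    then have cP: "c * P \<le> 1" using c by simp
    have "L2_norm U (\<lambda>x. c * \<phi> x) = c * L2_norm U \<phi>" using L2_norm_scaleR[of U c \<phi>] c by simp
    also have "\<dots> \<le> c * P" using c L2_norm_nonneg[of U \<phi>] L2_norm_nonneg[of U \<Phi>] by (intro mult_left_mono) (auto simp: P_def)
    finally show "L2_norm U (\<lambda>x. c * \<phi> x) \<le> 1" using cP by linarith
    have "L2_norm U (\<lambda>x. c *\<^sub>R \<Phi> x) = c * L2_norm U \<Phi>" using L2_norm_scaleR[of U c \<Phi>] c by simp
    also have "\<dots> \<le> c * P" using c L2_norm_nonneg[of U \<phi>] L2_norm_nonneg[of U \<Phi>] by (intro mult_left_mono) (auto simp: P_def)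
    finally show "L2_norm U (\<lambda>x. c *\<^sub>R \<Phi> x) \<le> 1" using cP by linarith
   qed
   show ?thesis using fin
   proof eventually_elim
    case (elim x)
    have "S^4 * (c * \<phi> x)^4 = (c * S)^4 * (\<phi> x)^4" by (simp add: power_mult_distrib)
    then have "(\<phi> x)^4 = S^4 * (c * \<phi> x)^4" using c by simp
    also have "\<dots> \<le> S^4 * (moser_const * l ^ a)" using elim S by (intro mult_left_mono) auto
    finally show ?case by (simp add: mult_ac)
   qed
  qed
  have "AE x in lebesgue_on U. ((\<phi> x)^2)^2 \<le> (K0 * (m ^ (DIM('a) - 1) * P ^ (3 - DIM('a))))^2"
  proof (cases "P = 0")
   case True
   then have "L2_norm U \<phi> = 0" using L2_norm_nonneg[of U \<phi>] L2_norm_nonneg[of U \<Phi>] by (simp add: P_def)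
   from L2_norm_eq_0_AE[OF _ this] have "AE x in lebesgue_on U. \<phi> x = 0" using \<phi> by (simp add: has_grad_def)
   then show ?thesis by eventually_elim simp
  next
   case False
   then have P: "P > 0" using P0 by simp
   then have m: "m > 0" using Pm by linarith
   show ?thesis using dim
   proof
    \<comment> \<open>Scaling by \<open>P\<close> gives the bound \<open>P^4 (m / P)^2 = (m P)^2\<close> for the fourth power of \<open>\<phi>\<close>.\<close>
    assume d: "DIM('a) = 2"
    have aa: "a = 2" by (simp add: a_def d)
    have "AE x in lebesgue_on U. (\<phi> x)^4 \<le> moser_const * P^4 * (m / P) ^ a"
     by (rule scaled[OF P order_refl]) (use P Pm m_def in \<open>auto simp: divide_simps P0\<close>)
    moreover have "moser_const * P^4 * (m / P) ^ a = (K0 * (m ^ (DIM('a) - 1) * P ^ (3 - DIM('a))))^2"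
     using P by (simp add: aa d K0(2)[unfolded power2_eq_square] power_mult_distrib power_divide power2_eq_square power4_eq_xxxx)
    ultimately show ?thesis by (simp add: power2_eq_square power4_eq_xxxx mult.assoc)
   next
    \<comment> \<open>Scaling by \<open>m\<close> makes \<open>l = 1\<close>, so that the larger exponent \<open>a = 6\<close> does no harm.\<close>
    assume d: "DIM('a) = 3"
    have "AE x in lebesgue_on U. (\<phi> x)^4 \<le> moser_const * m^4 * 1 ^ a"
     by (rule scaled[OF m Pm]) (use P0 m_def in auto)
    moreover have "moser_const * m^4 * 1 ^ a = (K0 * (m ^ (DIM('a) - 1) * P ^ (3 - DIM('a))))^2"
     by (simp add: d K0(2) power_mult_distrib flip: power_mult)
    ultimately show ?thesis by (simp add: power2_eq_square power4_eq_xxxx mult.assoc)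
   qed
  qed
  then show ?thesis
   unfolding P_def[symmetric] m_def[symmetric]
  proof eventually_elim
   case (elim x)
   show ?case by (rule power2_le_imp_le[OF elim]) (use K0 P0 Pm in auto)
  qed
 qed
 then show ?thesis using K0(1) by blast
qed

text \<open>The embedding of \<open>H1\<close> into \<open>L4\<close>, which is \<open>GN_L4\<close> at a fixed scale.\<close>

lemma L4_estimate:
 fixes U :: "'a::euclidean_space set"
 assumes dim: "DIM('a) = 2 \<or> DIM('a) = 3" and dom: "bounded_lipschitz_domain U"
 shows "\<exists>c\<ge>0. \<forall>u G v H. has_grad U u G \<longrightarrow> has_grad U v H \<longrightarrow>
   (\<lambda>x. u x * v x) \<in> L2 U \<and> L2_norm U (\<lambda>x. u x * v x) \<le> c * ((L2_norm U u + L2_norm U G) * (L2_norm U v + L2_norm U H))"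
proof -
 have dim4: "DIM('a) < 4" using dim by auto
 obtain C h where C: "0 \<le> C" "0 < h" and GN: "GN_inequality U C h"
  using GN_L4[OF dim4 dom] by (elim exE conjE) (rule that)
 note Ch = C GN[rule_format]
 define D where "D = C * (1 / h ^ DIM('a) + h ^ (4 - DIM('a)))"
 have D: "0 \<le> D" using Ch by (simp add: D_def)
 have one: "integrable (lebesgue_on U) (\<lambda>x. (u x)^4)" "(LINT x|lebesgue_on U. (u x)^4) \<le> D * (L2_norm U u + L2_norm U G)^4"
  if u: "has_grad U u G" for u G
 proof -
  let ?P = "L2_norm U u + L2_norm U G"
  show "integrable (lebesgue_on U) (\<lambda>x. (u x)^4)" using Ch(3)[OF u Ch(2) order_refl] by blast
  have n: "0 \<le> L2_norm U u" "0 \<le> L2_norm U G" by (rule L2_norm_nonneg)+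
  have "(LINT x|lebesgue_on U. (u x)^4) \<le> C * ((L2_norm U u)^4 / h ^ DIM('a) + h ^ (4 - DIM('a)) * (L2_norm U G)^4)"
   using Ch(3)[OF u Ch(2) order_refl] by blast
  also have "\<dots> \<le> C * (?P^4 / h ^ DIM('a) + h ^ (4 - DIM('a)) * ?P^4)"
   using Ch n by (intro mult_left_mono add_mono divide_right_mono power_mono) auto
  also have "\<dots> = D * ?P^4" by (simp add: D_def algebra_simps)
  finally show "(LINT x|lebesgue_on U. (u x)^4) \<le> D * ?P^4" .
 qed
 have "(\<lambda>x. u x * v x) \<in> L2 U \<and> L2_norm U (\<lambda>x. u x * v x) \<le> sqrt D * ((L2_norm U u + L2_norm U G) * (L2_norm U v + L2_norm U H))"
  if u: "has_grad U u G" and v: "has_grad U v H" for u G v H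
 proof -
  have [measurable]: "u \<in> borel_measurable (lebesgue_on U)" "v \<in> borel_measurable (lebesgue_on U)"
   using u v by (auto simp: has_grad_def L2_borel)
  let ?P = "L2_norm U u + L2_norm U G" and ?Q = "L2_norm U v + L2_norm U H"
  have n: "0 \<le> ?P" "0 \<le> ?Q" by (intro add_nonneg_nonneg L2_norm_nonneg)+
  have i: "integrable (lebesgue_on U) (\<lambda>x. ((u x)^2)^2)" "integrable (lebesgue_on U) (\<lambda>x. ((v x)^2)^2)"
   using one(1)[OF u] one(1)[OF v] by (simp_all flip: power_mult)
  have m: "(\<lambda>x. (u x)^2) \<in> borel_measurable (lebesgue_on U)" "(\<lambda>x. (v x)^2) \<in> borel_measurable (lebesgue_on U)" by measurable
  have L: "(\<lambda>x. u x * v x) \<in> L2 U"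
   using Cauchy_Schwarz_integral(1)[OF m i] by (auto simp: L2_def power_mult_distrib)
  have "((L2_norm U (\<lambda>x. u x * v x))^2)^2 \<le> (LINT x|lebesgue_on U. ((u x)^2)^2) * (LINT x|lebesgue_on U. ((v x)^2)^2)"
   using Cauchy_Schwarz_integral(2)[OF m i] by (simp add: L2_norm_sq power_mult_distrib)
  also have "\<dots> = (LINT x|lebesgue_on U. (u x)^4) * (LINT x|lebesgue_on U. (v x)^4)" by (simp flip: power_mult)
  also have "\<dots> \<le> (D * ?P^4) * (D * ?Q^4)"
   using D n by (intro mult_mono one u v Bochner_Integration.integral_nonneg) auto
  also have "\<dots> = ((sqrt D * (?P * ?Q))^2)^2"
   using D by (simp add: power_mult_distrib flip: power_mult) (simp add: power2_eq_square)
  finally have "(L2_norm U (\<lambda>x. u x * v x))^2 \<le> (sqrt D * (?P * ?Q))^2" by (rule power2_le_imp_le) simp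
  then have "L2_norm U (\<lambda>x. u x * v x) \<le> sqrt D * (?P * ?Q)" by (rule power2_le_imp_le) (use D n in auto)
  with L show ?thesis by blast
 qed
 then show ?thesis using D by (intro exI[of _ "sqrt D"]) auto
qed

section \<open>Estimates for two solutions at a fixed time\<close>

text \<open>The equation for the chemical potential at one time; \<open>\<Phi>\<close> and \<open>N\<close> are the gradients of \<open>\<phi>\<close> and \<open>\<mu>\<close>.\<close>

definition slice :: "'a::euclidean_space set \<Rightarrow> real \<Rightarrow> ('a \<Rightarrow> real) \<Rightarrow> ('a \<Rightarrow> 'a) \<Rightarrow> ('a \<Rightarrow> real) \<Rightarrow> ('a \<Rightarrow> 'a) \<Rightarrow> bool" where
 "slice U \<epsilon> \<phi> \<Phi> \<mu> N \<longleftrightarrow> has_grad U \<phi> \<Phi> \<and> has_grad U \<mu> N \<and> (\<exists>K\<ge>0. AE x in lebesgue_on U. \<bar>\<phi> x\<bar> \<le> K) \<and>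
   (\<forall>\<psi> \<Psi>. has_grad U \<psi> \<Psi> \<longrightarrow>
    L2_inner U \<mu> \<psi> - \<epsilon> * L2_inner U \<Phi> \<Psi> - 1 / \<epsilon> * L2_inner U (\<lambda>x. f_pot (\<phi> x)) \<psi> = 0)"

text \<open>Makes a bound on one solution a special case of a bound on a difference.\<close>

lemma slice_zero: "slice U \<epsilon> (\<lambda>x. 0) (\<lambda>x. 0) (\<lambda>x. 0) (\<lambda>x. 0)"
 by (auto simp: slice_def has_grad_zero L2_inner_def f_pot_def)

lemma f_pot_borel [measurable]: "f_pot \<in> borel_measurable borel"
 unfolding f_pot_def[abs_def] by measurable

lemma f_pot_diff: "f_pot a - f_pot b = (a - b) * (a^2 + a * b + b^2 - 1)"
 by (simp add: f_pot_def power2_eq_square power3_eq_cube algebra_simps)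

lemma quadratic_form_nonneg: "a^2 + a * b + b^2 \<ge> (0::real)"
proof -
 have "a^2 + a * b + b^2 = ((a + b)^2 + a^2 + b^2) / 2" by (simp add: power2_eq_square algebra_simps)
 moreover have "0 \<le> ((a + b)^2 + a^2 + b^2) / 2" by simp
 ultimately show ?thesis by (simp only:)
qed

lemma f_pot_bounded_L2:
 assumes fin: "finite_measure (lebesgue_on U)" and [measurable]: "\<phi> \<in> borel_measurable (lebesgue_on U)"
  and K: "AE x in lebesgue_on U. \<bar>\<phi> x\<bar> \<le> K"
 shows "(\<lambda>x. f_pot (\<phi> x)) \<in> L2 U"
proof (rule bounded_imp_L2[OF fin])
 show "AE x in lebesgue_on U. \<bar>f_pot (\<phi> x)\<bar> \<le> K^3 + K"
  using K
 proof eventually_elim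
  case (elim x)
  then have "\<bar>\<phi> x\<bar>^3 \<le> K^3" by (intro power_mono) auto
  moreover have "\<bar>f_pot (\<phi> x)\<bar> \<le> \<bar>\<phi> x\<bar>^3 + \<bar>\<phi> x\<bar>"
   unfolding f_pot_def power_abs[symmetric] by (rule abs_triangle_ineq4)
  ultimately show ?case using elim by linarith
 qed
qed measurable

definition sup_constant :: "'a::euclidean_space set \<Rightarrow> real \<Rightarrow> real \<Rightarrow> real \<Rightarrow> bool" where
 "sup_constant U \<epsilon> H K \<longleftrightarrow> 0 \<le> K \<and> (\<forall>\<phi>1 \<Phi>1 \<mu>1 N1 \<phi>2 \<Phi>2 \<mu>2 N2 k P A. slice U \<epsilon> \<phi>1 \<Phi>1 \<mu>1 N1 \<longrightarrow> slice U \<epsilon> \<phi>2 \<Phi>2 \<mu>2 N2 \<longrightarrow>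
   L2_norm U \<phi>1 + L2_norm U \<Phi>1 \<le> H \<longrightarrow> L2_norm U \<phi>2 + L2_norm U \<Phi>2 \<le> H \<longrightarrow> 1 \<le> k \<longrightarrow>
   P = L2_norm U (\<lambda>x. \<phi>1 x - \<phi>2 x) + L2_norm U (\<lambda>x. \<Phi>1 x - \<Phi>2 x) \<longrightarrow> A = L2_norm U (\<lambda>x. N1 x - N2 x) \<longrightarrow>
   (AE x in lebesgue_on U. (\<phi>1 x - \<phi>2 x)^2 \<le> K * (k * P^2 + P * A / k ^ (3 - DIM('a)))))"

text \<open>The difference \<open>\<phi>\<close> of the phase fields satisfies \<open>- \<epsilon> \<Delta>\<phi> + g / \<epsilon> = \<mu>\<close> with \<open>g \<phi> \<ge> - \<phi>^2\<close>, as \<open>s^3\<close> is monotone.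
 Hence \<open>sup_bound\<close> gives \<open>\<phi>^2 \<le> K0 (m + P)^(d-1) P^(3-d)\<close>, where \<open>m\<close> is the norm of \<open>\<mu>\<close>. Testing the equation with \<open>\<mu>\<close> itself
 yields \<open>m^2 \<le> const (P A + P^2)\<close>. This is the claim for \<open>d = 3\<close>; for \<open>d = 2\<close> the product \<open>(m + P) P\<close> is split with the weight \<open>k\<close>.\<close>

lemma slice_sup_estimate:
 fixes U :: "'a::euclidean_space set"
 assumes dim: "DIM('a) = 2 \<or> DIM('a) = 3" and dom: "bounded_lipschitz_domain U" and \<epsilon>: "0 < \<epsilon>" and H: "0 \<le> H"
 shows "\<exists>K. sup_constant U \<epsilon> H K"
proof -
 have U: "open U" and Ub: "U \<in> sets borel" using dom by (auto simp: bounded_lipschitz_domain_def)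
 note fin = finite_measure_domain[OF dom]
 have il: "0 \<le> 1 / \<epsilon>" using \<epsilon> by simp
 obtain K0 where K0: "0 \<le> K0" and sup: "sup_inequality U \<epsilon> (1 / \<epsilon>) K0"
  using sup_bound[OF dim dom \<epsilon> il] by (elim exE conjE) (rule that)
 obtain c where c: "0 \<le> c" and L4: "\<forall>u G v H. has_grad U u G \<longrightarrow> has_grad U v H \<longrightarrow>
   (\<lambda>x. u x * v x) \<in> L2 U \<and> L2_norm U (\<lambda>x. u x * v x) \<le> c * ((L2_norm U u + L2_norm U G) * (L2_norm U v + L2_norm U H))"
  using L4_estimate[OF dim dom] by (elim exE conjE) (rule that)
 define V where "V = L2_norm U (\<lambda>x. 1 :: real)"
 have one: "(\<lambda>x. 1 :: real) \<in> L2 U" by (rule bounded_imp_L2[OF fin, of _ 1]) auto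
 have V: "0 \<le> V" by (simp add: V_def L2_norm_nonneg)
 define Q where "Q = 3 * (c * H^2) + V"
 define e2 where "e2 = Q * c / \<epsilon>"
 define e1 where "e1 = \<epsilon> + e2"
 define E where "E = 4 * e1 + 2 * e2^2 + 2"
 have Q0: "0 \<le> Q" using c V H by (simp add: Q_def)
 have e20: "0 \<le> e2" using Q0 c \<epsilon> by (simp add: e2_def)
 have e10: "0 \<le> e1" using e20 \<epsilon> by (simp add: e1_def)
 have E2: "2 \<le> E" using e10 by (simp add: E_def)
 have "AE x in lebesgue_on U. (\<phi>1 x - \<phi>2 x)^2 \<le> (K0 * E) * (k * P^2 + P * A / k ^ (3 - DIM('a)))"
  if s1: "slice U \<epsilon> \<phi>1 \<Phi>1 \<mu>1 N1" and s2: "slice U \<epsilon> \<phi>2 \<Phi>2 \<mu>2 N2"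
   and H1: "L2_norm U \<phi>1 + L2_norm U \<Phi>1 \<le> H" and H2: "L2_norm U \<phi>2 + L2_norm U \<Phi>2 \<le> H" and k: "1 \<le> k"
   and P: "P = L2_norm U (\<lambda>x. \<phi>1 x - \<phi>2 x) + L2_norm U (\<lambda>x. \<Phi>1 x - \<Phi>2 x)" and A: "A = L2_norm U (\<lambda>x. N1 x - N2 x)"
  for \<phi>1 \<Phi>1 \<mu>1 N1 \<phi>2 \<Phi>2 \<mu>2 N2 k P A
 proof -
  have g1: "has_grad U \<phi>1 \<Phi>1" "has_grad U \<mu>1 N1" and g2: "has_grad U \<phi>2 \<Phi>2" "has_grad U \<mu>2 N2"
   using s1 s2 by (auto simp: slice_def)
  obtain K1 K2 where K12: "0 \<le> K1" "AE x in lebesgue_on U. \<bar>\<phi>1 x\<bar> \<le> K1" "0 \<le> K2" "AE x in lebesgue_on U. \<bar>\<phi>2 x\<bar> \<le> K2"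
   using s1 s2 unfolding slice_def by blast
  have l2: "\<phi>1 \<in> L2 U" "\<Phi>1 \<in> L2 U" "\<mu>1 \<in> L2 U" "N1 \<in> L2 U" "\<phi>2 \<in> L2 U" "\<Phi>2 \<in> L2 U" "\<mu>2 \<in> L2 U" "N2 \<in> L2 U"
   using g1 g2 by (auto simp: has_grad_def)
  note [measurable] = l2[THEN L2_borel]
  let ?\<phi> = "\<lambda>x. \<phi>1 x - \<phi>2 x" and ?\<Phi> = "\<lambda>x. \<Phi>1 x - \<Phi>2 x" and ?\<mu> = "\<lambda>x. \<mu>1 x - \<mu>2 x" and ?N = "\<lambda>x. N1 x - N2 x"
  let ?g = "\<lambda>x. f_pot (\<phi>1 x) - f_pot (\<phi>2 x)"
  have fp: "(\<lambda>x. f_pot (\<phi>1 x)) \<in> L2 U" "(\<lambda>x. f_pot (\<phi>2 x)) \<in> L2 U"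
   using f_pot_bounded_L2[OF fin _ K12(2)] f_pot_bounded_L2[OF fin _ K12(4)] by auto
  have g\<phi>: "has_grad U ?\<phi> ?\<Phi>" and g\<mu>: "has_grad U ?\<mu> ?N" by (intro has_grad_diff Ub g1 g2)+
  have \<phi>: "?\<phi> \<in> L2 U" "?\<Phi> \<in> L2 U" "?\<mu> \<in> L2 U" "?N \<in> L2 U" "?g \<in> L2 U" by (intro L2_diff l2 fp)+
  have K: "AE x in lebesgue_on U. \<bar>?\<phi> x\<bar> \<le> K1 + K2" using K12(2,4) by eventually_elim linarith
  have eq: "\<epsilon> * L2_inner U ?\<Phi> \<Psi> = L2_inner U ?\<mu> \<psi> - 1 / \<epsilon> * L2_inner U ?g \<psi>" if h: "has_grad U \<psi> \<Psi>" for \<psi> \<Psi>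
  proof -
   have h2: "\<psi> \<in> L2 U" "\<Psi> \<in> L2 U" using h by (auto simp: has_grad_def)
   have "L2_inner U \<mu>1 \<psi> - \<epsilon> * L2_inner U \<Phi>1 \<Psi> - 1 / \<epsilon> * L2_inner U (\<lambda>x. f_pot (\<phi>1 x)) \<psi> = 0"
    "L2_inner U \<mu>2 \<psi> - \<epsilon> * L2_inner U \<Phi>2 \<Psi> - 1 / \<epsilon> * L2_inner U (\<lambda>x. f_pot (\<phi>2 x)) \<psi> = 0"
    using s1 s2 h unfolding slice_def by blast+
   then show ?thesis by (simp add: L2_inner_diff_left l2 fp h2 right_diff_distrib)
  qed
  have mono: "?g x * ?\<phi> x \<ge> - (?\<phi> x)\<^sup>2" for x
  proof -
   have "(\<phi>1 x)^2 + \<phi>1 x * \<phi>2 x + (\<phi>2 x)^2 \<ge> 0"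
    by (rule quadratic_form_nonneg)
   then have "(?\<phi> x)^2 * (-1) \<le> (?\<phi> x)^2 * ((\<phi>1 x)^2 + \<phi>1 x * \<phi>2 x + (\<phi>2 x)^2 - 1)" by (intro mult_left_mono) auto
   then show ?thesis unfolding f_pot_diff by (simp add: power2_eq_square mult_ac)
  qed
  define m where "m = L2_norm U ?\<mu>"
  have A0: "0 \<le> A" by (simp add: A L2_norm_nonneg)
  have P0: "0 \<le> P" unfolding P by (intro add_nonneg_nonneg L2_norm_nonneg)
  have sb: "AE x in lebesgue_on U. (?\<phi> x)^2 \<le> K0 * ((m + P) ^ (DIM('a) - 1) * P ^ (3 - DIM('a)))"
  proof -
   have "0 \<le> K1 + K2" using K12 by simp
   moreover have "\<forall>\<psi> \<Psi>. has_grad U \<psi> \<Psi> \<longrightarrow> \<epsilon> * L2_inner U ?\<Phi> \<Psi> = L2_inner U ?\<mu> \<psi> - 1 / \<epsilon> * L2_inner U ?g \<psi>" using eq by blast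
   moreover have "AE x in lebesgue_on U. ?g x * ?\<phi> x \<ge> - (?\<phi> x)\<^sup>2" by (rule AE_I2) (rule mono)
   ultimately show ?thesis
    using sup[rule_format, of ?\<phi> ?\<Phi> "K1 + K2" ?\<mu> ?g] g\<phi> K \<phi> unfolding P m_def by blast
  qed
  have gm: "\<bar>L2_inner U ?g ?\<mu>\<bar> \<le> Q * (c * (P * (m + A)))"
  proof -
   let ?q = "\<lambda>x. \<phi>1 x * \<phi>1 x + \<phi>1 x * \<phi>2 x + \<phi>2 x * \<phi>2 x - 1"
   have prods: "(\<lambda>x. \<phi>1 x * \<phi>1 x) \<in> L2 U" "(\<lambda>x. \<phi>1 x * \<phi>2 x) \<in> L2 U" "(\<lambda>x. \<phi>2 x * \<phi>2 x) \<in> L2 U" "(\<lambda>x. ?\<phi> x * ?\<mu> x) \<in> L2 U"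
    using L4 g1 g2 g\<phi> g\<mu> by blast+
   have b: "L2_norm U (\<lambda>x. u x * v x) \<le> c * H^2" if "has_grad U u G" "has_grad U v G'" "L2_norm U u + L2_norm U G \<le> H" "L2_norm U v + L2_norm U G' \<le> H" for u G v G'
   proof -
    have "L2_norm U (\<lambda>x. u x * v x) \<le> c * ((L2_norm U u + L2_norm U G) * (L2_norm U v + L2_norm U G'))" using L4 that by blast
    also have "\<dots> \<le> c * (H * H)" using that c H by (intro mult_left_mono mult_mono add_nonneg_nonneg L2_norm_nonneg) auto
    finally show ?thesis by (simp add: power2_eq_square)
   qed
   have q2: "?q \<in> L2 U" by (intro L2_add L2_diff prods one)
   have "L2_norm U ?q \<le> L2_norm U (\<lambda>x. \<phi>1 x * \<phi>1 x + \<phi>1 x * \<phi>2 x + \<phi>2 x * \<phi>2 x) + V"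
    unfolding V_def by (intro L2_norm_diff_triangle L2_add prods one)
   also have "L2_norm U (\<lambda>x. \<phi>1 x * \<phi>1 x + \<phi>1 x * \<phi>2 x + \<phi>2 x * \<phi>2 x) \<le> L2_norm U (\<lambda>x. \<phi>1 x * \<phi>1 x + \<phi>1 x * \<phi>2 x) + L2_norm U (\<lambda>x. \<phi>2 x * \<phi>2 x)"
    by (intro L2_norm_triangle L2_add prods)
   also have "L2_norm U (\<lambda>x. \<phi>1 x * \<phi>1 x + \<phi>1 x * \<phi>2 x) \<le> L2_norm U (\<lambda>x. \<phi>1 x * \<phi>1 x) + L2_norm U (\<lambda>x. \<phi>1 x * \<phi>2 x)"
    by (intro L2_norm_triangle prods)
   finally have "L2_norm U ?q \<le> Q"
    using b[OF g1(1) g1(1) H1 H1] b[OF g1(1) g2(1) H1 H2] b[OF g2(1) g2(1) H2 H2] by (simp add: Q_def)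
   moreover have "L2_norm U (\<lambda>x. ?\<phi> x * ?\<mu> x) \<le> c * (P * (m + A))" using L4 g\<phi> g\<mu> unfolding P A m_def by blast
   moreover have "L2_inner U ?g ?\<mu> = L2_inner U ?q (\<lambda>x. ?\<phi> x * ?\<mu> x)"
    unfolding L2_inner_def f_pot_diff by (simp add: power2_eq_square mult_ac)
   ultimately show ?thesis
    using L2_Cauchy_Schwarz(2)[OF q2 prods(4)] Q0 L2_norm_nonneg[of U "\<lambda>x. ?\<phi> x * ?\<mu> x"]
     mult_mono[of "L2_norm U ?q" Q "L2_norm U (\<lambda>x. ?\<phi> x * ?\<mu> x)" "c * (P * (m + A))"] by linarith
  qed
  have m2: "m^2 \<le> 2 * e1 * (P * A) + e2^2 * P^2"
  proof -
   have "m^2 = \<epsilon> * L2_inner U ?\<Phi> ?N + 1 / \<epsilon> * L2_inner U ?g ?\<mu>" using eq[OF g\<mu>] by (simp add: m_def L2_inner_self)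
   also have "\<dots> \<le> \<epsilon> * (P * A) + 1 / \<epsilon> * (Q * (c * (P * (m + A))))"
   proof (intro add_mono mult_left_mono)
    have "L2_inner U ?\<Phi> ?N \<le> L2_norm U ?\<Phi> * A" using L2_Cauchy_Schwarz(2)[OF \<phi>(2,4)] unfolding A by linarith
    also have "\<dots> \<le> P * A" unfolding P using A0 L2_norm_nonneg[of U ?\<phi>] by (intro mult_right_mono) auto
    finally show "L2_inner U ?\<Phi> ?N \<le> P * A" .
   qed (use gm \<epsilon> in auto)
   also have "\<dots> = e1 * (P * A) + m * (e2 * P)" using \<epsilon> by (simp add: e1_def e2_def field_simps)
   also have "m * (e2 * P) \<le> m^2 / 2 + (e2 * P)^2 / 2" using sum_squares_bound[of m "e2 * P"] by simp
   finally show ?thesis by (simp add: power_mult_distrib)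
  qed
  have mP: "(m + P)^2 \<le> E * (P * A + P^2)"
  proof -
   have "(m + P)^2 \<le> 2 * m^2 + 2 * P^2" using sum_squares_bound[of m P] by (simp add: power2_sum)
   also have "\<dots> \<le> 4 * e1 * (P * A) + (2 * e2^2 + 2) * P^2" using m2 by (simp add: algebra_simps)
   also have "\<dots> \<le> E * (P * A) + E * P^2"
    unfolding E_def using P0 A0 e10 by (intro add_mono mult_right_mono) auto
   finally show ?thesis by (simp add: distrib_left)
  qed
  have fin_est: "(m + P) ^ (DIM('a) - 1) * P ^ (3 - DIM('a)) \<le> E * (k * P^2 + P * A / k ^ (3 - DIM('a)))"
   using dim
  proof
   assume d: "DIM('a) = 3"
   have "E * (P * A + P^2) \<le> E * (k * P^2 + P * A)" using E2 mult_right_mono[OF k, of "P^2"] by (intro mult_left_mono) auto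
   then show ?thesis using mP by (simp add: d)
  next
   assume d: "DIM('a) = 2"
   have "(m + P) * P \<le> ((m + P)^2 / k + k * P^2) / 2"
   proof -
    have "0 \<le> (m + P - k * P)^2 / k" using k by simp
    also have "\<dots> = (m + P)^2 / k - 2 * ((m + P) * P) + k * P^2" using k by (simp add: power2_eq_square field_simps)
    finally show ?thesis by simp
   qed
   also have "\<dots> \<le> (E * (P * A + P^2) / k + k * P^2) / 2" using mP k by (simp add: divide_right_mono)
   also have "\<dots> \<le> E * (k * P^2 + P * A / k)"
   proof -
    have "P^2 / k \<le> k * P^2"
    proof -
     have "1 * P^2 \<le> (k * k) * P^2" using mult_mono[OF k k] k by (intro mult_right_mono) auto
     then show ?thesis using k by (simp add: divide_le_eq mult_ac)
    qed
    then have i1: "E * (P^2 / k) \<le> E * (k * P^2)" using E2 by (intro mult_left_mono) auto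
    have i2: "2 * (k * P^2) \<le> E * (k * P^2)" using E2 k by (intro mult_right_mono) auto
    have i3: "0 \<le> k * P^2" "0 \<le> E * (P * A / k)" using k E2 P0 A0 by auto
    have e1: "(E * (P * A + P^2) / k + k * P^2) / 2 = (E * (P * A / k) + E * (P^2 / k) + k * P^2) / 2"
     by (simp add: distrib_left add_divide_distrib)
    have e2: "E * (k * P^2 + P * A / k) = E * (k * P^2) + E * (P * A / k)" by (rule distrib_left)
    have "(a + b + c) / 2 \<le> e + a" if "b \<le> e" "2 * c \<le> e" "0 \<le> c" "0 \<le> a" for a b c e :: real
    proof -
     have "b + c \<le> 2 * e" using that by linarith
     then show ?thesis using that by simp
    qed
    from this[OF i1 i2 i3] show ?thesis unfolding e1 e2 .
   qed
   finally show ?thesis by (simp add: d)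
  qed
  show ?thesis using sb
  proof eventually_elim
   case (elim x)
   also have "K0 * ((m + P) ^ (DIM('a) - 1) * P ^ (3 - DIM('a))) \<le> K0 * (E * (k * P^2 + P * A / k ^ (3 - DIM('a))))"
    using K0 by (intro mult_left_mono fin_est)
   finally show ?case by (simp add: mult.assoc)
  qed
 qed
 then show ?thesis using K0 E2 unfolding sup_constant_def by (intro exI[of _ "K0 * E"]) auto
qed

text \<open>All equations at one time: \<open>R\<close> is the gradient of the pressure, \<open>u\<close> the flux and \<open>D\<close> the time derivative of \<open>\<phi>\<close>.\<close>

definition state :: "'a::euclidean_space set \<Rightarrow> real \<Rightarrow> real \<Rightarrow> ('a \<Rightarrow> real) \<Rightarrow> ('a \<Rightarrow> 'a) \<Rightarrow> ('a \<Rightarrow> real) \<Rightarrow> ('a \<Rightarrow> 'a)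
   \<Rightarrow> ('a \<Rightarrow> 'a) \<Rightarrow> ('a \<Rightarrow> 'a) \<Rightarrow> (('a \<Rightarrow> real) \<Rightarrow> real) \<Rightarrow> bool" where
 "state U \<gamma> \<epsilon> \<phi> \<Phi> \<mu> N R u D \<longleftrightarrow> slice U \<epsilon> \<phi> \<Phi> \<mu> N \<and> (\<exists>p. has_grad U p R) \<and> u \<in> L2 U \<and>
   (AE x in lebesgue_on U. u x = R x + (\<gamma> * \<phi> x) *\<^sub>R N x) \<and>
   (\<forall>q G. has_grad U q G \<longrightarrow> L2_inner U u G = 0) \<and>
   (\<forall>\<nu> G. has_grad U \<nu> G \<longrightarrow> D \<nu> = - \<epsilon> * L2_inner U N G - L2_inner U (\<lambda>x. \<phi> x *\<^sub>R u x) G)"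

lemma f_pot_has_grad:
 assumes U: "open U" and \<phi>: "has_grad U \<phi> \<Phi>" and K: "AE x in lebesgue_on U. \<bar>\<phi> x\<bar> \<le> K" "0 \<le> K"
 shows "has_grad U (\<lambda>x. f_pot (\<phi> x)) (\<lambda>x. (3 * (\<phi> x)^2 - 1) *\<^sub>R \<Phi> x)"
proof -
 have Ub: "U \<in> sets borel" using U by simp
 have "has_grad U (\<lambda>x. \<phi> x ^ Suc 2 - \<phi> x) (\<lambda>x. (real (Suc 2) * \<phi> x ^ 2) *\<^sub>R \<Phi> x - \<Phi> x)"
  by (rule has_grad_diff[OF Ub has_grad_power[OF U \<phi> K] \<phi>])
 moreover have "\<phi> x ^ Suc 2 - \<phi> x = f_pot (\<phi> x)" for x by (simp add: f_pot_def numeral_3_eq_3)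
 moreover have "(real (Suc 2) * \<phi> x ^ 2) *\<^sub>R \<Phi> x - \<Phi> x = (3 * (\<phi> x)^2 - 1) *\<^sub>R \<Phi> x" for x
  by (simp add: scaleR_left_diff_distrib)
 ultimately show ?thesis by simp
qed

lemma f_pot_diff_grad_bound:
 assumes U: "open U"
  and g1: "has_grad U \<phi>1 \<Phi>1" and g2: "has_grad U \<phi>2 \<Phi>2"
  and M: "AE x in lebesgue_on U. \<bar>\<phi>1 x\<bar> \<le> M" "AE x in lebesgue_on U. \<bar>\<phi>2 x\<bar> \<le> M" "0 \<le> M"
  and X: "AE x in lebesgue_on U. \<bar>\<phi>1 x - \<phi>2 x\<bar> \<le> X" "0 \<le> X"
 obtains \<Gamma> where "has_grad U (\<lambda>x. f_pot (\<phi>1 x) - f_pot (\<phi>2 x)) \<Gamma>"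
  "L2_norm U \<Gamma> \<le> (3 * M^2 + 1) * L2_norm U (\<lambda>x. \<Phi>1 x - \<Phi>2 x) + 6 * M * X * L2_norm U \<Phi>2"
proof -
 have Ub: "U \<in> sets borel" using U by simp
 have l2: "\<phi>1 \<in> L2 U" "\<phi>2 \<in> L2 U" "\<Phi>1 \<in> L2 U" "\<Phi>2 \<in> L2 U" using g1 g2 by (auto simp: has_grad_def)
 note [measurable] = l2[THEN L2_borel]
 let ?a = "\<lambda>x. 3 * (\<phi>1 x)^2 - 1" and ?b = "\<lambda>x. 3 * ((\<phi>1 x - \<phi>2 x) * (\<phi>1 x + \<phi>2 x))"
 have h: "has_grad U (\<lambda>x. f_pot (\<phi>1 x) - f_pot (\<phi>2 x)) (\<lambda>x. (3 * (\<phi>1 x)^2 - 1) *\<^sub>R \<Phi>1 x - (3 * (\<phi>2 x)^2 - 1) *\<^sub>R \<Phi>2 x)"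
  by (rule has_grad_diff[OF Ub f_pot_has_grad[OF U g1 M(1,3)] f_pot_has_grad[OF U g2 M(2,3)]])
 \<comment> \<open>The difference of the products is split so that the second part is small with \<open>\<phi>1 - \<phi>2\<close>.\<close>
 have e: "(3 * (\<phi>1 x)^2 - 1) *\<^sub>R \<Phi>1 x - (3 * (\<phi>2 x)^2 - 1) *\<^sub>R \<Phi>2 x = ?a x *\<^sub>R (\<Phi>1 x - \<Phi>2 x) + ?b x *\<^sub>R \<Phi>2 x" for x
 proof -
  have "?b x = ?a x - (3 * (\<phi>2 x)^2 - 1)" by (simp add: power2_eq_square algebra_simps)
  moreover have "\<alpha> *\<^sub>R y - \<beta> *\<^sub>R z = \<alpha> *\<^sub>R (y - z) + (\<alpha> - \<beta>) *\<^sub>R z" for \<alpha> \<beta> and y z :: 'a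
   by (simp add: scaleR_diff_left scaleR_diff_right)
  ultimately show ?thesis by (simp only:)
 qed
 have a: "AE x in lebesgue_on U. \<bar>?a x\<bar> \<le> 3 * M^2 + 1"
  using M(1)
 proof eventually_elim
  case (elim x)
  then have "(\<phi>1 x)^2 \<le> M^2" using M(3) by (simp add: abs_le_square_iff[symmetric])
  then show ?case using zero_le_power2[of "\<phi>1 x"] by (auto simp: abs_le_iff)
 qed
 have b: "AE x in lebesgue_on U. \<bar>?b x\<bar> \<le> 6 * M * X"
  using M(1,2) X(1)
 proof eventually_elim
  case (elim x)
  have "\<bar>\<phi>1 x + \<phi>2 x\<bar> \<le> 2 * M" using elim by linarith
  then have "\<bar>\<phi>1 x - \<phi>2 x\<bar> * \<bar>\<phi>1 x + \<phi>2 x\<bar> \<le> X * (2 * M)" using elim X by (intro mult_mono) auto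
  then show ?case by (simp add: abs_mult mult_ac)
 qed
 have A0: "0 \<le> 3 * M^2 + 1" "0 \<le> 6 * M * X" using M X by auto
 have am: "?a \<in> borel_measurable (lebesgue_on U)" "?b \<in> borel_measurable (lebesgue_on U)" by measurable
 note ba = L2_bounded_scaleR[OF am(1) a A0(1) L2_diff[OF l2(3,4)]]
 note bb = L2_bounded_scaleR[OF am(2) b A0(2) l2(4)]
 have "L2_norm U (\<lambda>x. ?a x *\<^sub>R (\<Phi>1 x - \<Phi>2 x) + ?b x *\<^sub>R \<Phi>2 x) \<le> (3 * M^2 + 1) * L2_norm U (\<lambda>x. \<Phi>1 x - \<Phi>2 x) + 6 * M * X * L2_norm U \<Phi>2"
  using L2_norm_triangle[OF ba(1) bb(1)] ba(2) bb(2) by linarith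
 then show ?thesis using that[OF h] unfolding e by blast
qed

text \<open>For two states let \<open>P\<close> be the \<open>H1\<close> distance of the phase fields, \<open>A\<close> and \<open>J\<close> the distances of the gradients of the
 potentials and of the fluxes, and \<open>k\<close> a bound on these gradients and fluxes. Then \<open>sup_fn\<close> bounds the difference of the phase
 fields pointwise, \<open>rate_fn\<close> that of their time derivatives against gradients, and \<open>nonlin_fn\<close> the gradient of the part of
 the test function for the energy that is not \<open>\<mu>1 - \<mu>2\<close>. The factor \<open>sqrt (K * k)\<close> bounds each phase field.\<close>

definition sup_fn :: "nat \<Rightarrow> real \<Rightarrow> real \<Rightarrow> real \<Rightarrow> real \<Rightarrow> real" where
 "sup_fn d K P A k = sqrt (K * (k * P^2 + P * A / k ^ (3 - d)))"

definition rate_fn :: "nat \<Rightarrow> real \<Rightarrow> real \<Rightarrow> real \<Rightarrow> real \<Rightarrow> real \<Rightarrow> real \<Rightarrow> real" where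
 "rate_fn d K \<epsilon> P A J k = \<epsilon> * A + sup_fn d K P A k * k + sqrt (K * k) * J"

definition nonlin_fn :: "nat \<Rightarrow> real \<Rightarrow> real \<Rightarrow> real \<Rightarrow> real \<Rightarrow> real \<Rightarrow> real" where
 "nonlin_fn d K \<epsilon> P A k = K * (k * P + sqrt k * sup_fn d K P A k) / \<epsilon> + P"

lemma Young: "0 < \<theta> \<Longrightarrow> x * y \<le> \<theta> / 4 * x^2 + y^2 / (\<theta> :: real)"
proof -
 assume t: "0 < \<theta>"
 have "0 \<le> (\<theta> / 2 * x - y)^2 / \<theta>" using t by simp
 also have "\<dots> = \<theta> / 4 * x^2 - x * y + y^2 / \<theta>" using t by (simp add: power2_eq_square field_simps)
 finally show ?thesis by simp
qed

definition arith_constant :: "nat \<Rightarrow> real \<Rightarrow> real \<Rightarrow> real \<Rightarrow> real \<Rightarrow> real \<Rightarrow> bool" where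
 "arith_constant d \<epsilon> \<gamma> K H C \<longleftrightarrow> 0 \<le> C \<and> (\<forall>P A J k. 0 \<le> P \<longrightarrow> P \<le> H \<longrightarrow> 0 \<le> A \<longrightarrow> A \<le> 2 * k \<longrightarrow> 0 \<le> J \<longrightarrow> J \<le> 2 * k \<longrightarrow> 1 \<le> k \<longrightarrow>
   - \<epsilon> * A^2 - J^2 / \<gamma> + sup_fn d K P A k * k * (A + J) + rate_fn d K \<epsilon> P A J k * nonlin_fn d K \<epsilon> P A k \<le> C * k ^ (d + 1) * P^2 \<and>
   (rate_fn d K \<epsilon> P A J k)^2 \<le> C * k ^ 3 \<and> (nonlin_fn d K \<epsilon> P A k)^2 \<le> C * k ^ 3)"

text \<open>With \<open>X\<close> the value of \<open>sup_fn\<close>, \<open>(X k)^2 = K (k^3 P^2 + P A k^(d-1))\<close>. Young's inequality moves the factor \<open>A\<close> of the last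
 term into the dissipation at the cost of \<open>k^(2d-2) P^2\<close>. Since \<open>3\<close> and \<open>2 d - 2\<close> are at most \<open>d + 1\<close> for \<open>d = 2, 3\<close>, the power
 \<open>k^(d+1)\<close> bounds all that remains; the bounds by \<open>k^3\<close> make the two factors square integrable in time.\<close>

lemma rate_arith:
 assumes d: "d = 2 \<or> d = 3" and \<epsilon>: "0 < \<epsilon>" and \<gamma>: "0 < \<gamma>" and K: "0 \<le> K" and H: "0 \<le> H"
 shows "\<exists>C. arith_constant d \<epsilon> \<gamma> K H C"
proof -
 define \<theta> where "\<theta> = min \<epsilon> (1 / \<gamma>)"
 have \<theta>: "0 < \<theta>" "\<theta> \<le> \<epsilon>" "\<theta> \<le> 1 / \<gamma>" using \<epsilon> \<gamma> by (auto simp: \<theta>_def)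
 define c1 where "c1 = K / \<epsilon> + 1"
 have c1: "1 \<le> c1" using K \<epsilon> by (simp add: c1_def)
 define c2 where "c2 = \<epsilon>^2 / \<theta> + K / \<theta> + 1"
 have c2: "0 \<le> c2" using K \<theta> by (simp add: c2_def)
 define c3 where "c3 = 2 / \<theta> + 1 + 2 * c1^2 * c2"
 have c3: "0 \<le> c3" using c2 \<theta> by (simp add: c3_def)
 define c4 where "c4 = c3 * K + c3 + (c3 * K)^2 / (2 * \<theta>)"
 have c4: "0 \<le> c4" using c3 K \<theta> by (simp add: c4_def)
 define x1 where "x1 = K * (H^2 + 2 * H)"
 have x1: "0 \<le> x1" using K H by (simp add: x1_def)
 define c5 where "c5 = 3 * (4 * \<epsilon>^2 + x1 + 4 * K)"
 define c6 where "c6 = 2 * c1^2 * (H^2 + x1)"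
 have main: "- \<epsilon> * A^2 - J^2 / \<gamma> + sup_fn d K P A k * k * (A + J) + rate_fn d K \<epsilon> P A J k * nonlin_fn d K \<epsilon> P A k \<le> c4 * k ^ (d + 1) * P^2"
  "(rate_fn d K \<epsilon> P A J k)^2 \<le> c5 * k ^ 3" "(nonlin_fn d K \<epsilon> P A k)^2 \<le> c6 * k ^ 3"
  if P: "0 \<le> P" "P \<le> H" and A: "0 \<le> A" "A \<le> 2 * k" and J: "0 \<le> J" "J \<le> 2 * k" and k: "1 \<le> k" for P A J k
 proof -
  define X where "X = sup_fn d K P A k"
  define N where "N = nonlin_fn d K \<epsilon> P A k"
  define M where "M = sqrt (K * k)"
  let ?r = "rate_fn d K \<epsilon> P A J k"
  have k0: "0 < k" using k by simp
  have mono_pow: "m \<le> n \<Longrightarrow> k ^ m \<le> k ^ n" for m n by (rule power_increasing[OF _ k])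
  have "k ^ 1 \<le> k^2" by (rule mono_pow) simp
  moreover have "2 * d - 2 \<le> d + 1" "3 \<le> d + 1" using d by auto
  ultimately have "k \<le> k^2" and k3: "k^3 \<le> k ^ (d + 1)" "k ^ (2 * d - 2) \<le> k ^ (d + 1)"
   using mono_pow[of 3 "d + 1"] mono_pow[of "2 * d - 2" "d + 1"] by (simp_all only: power_one_right)
  moreover have "k^2 \<le> k^3" by (rule mono_pow) simp
  ultimately have kk: "k \<le> k^2" "k^2 \<le> k^3" "k^3 \<le> k ^ (d + 1)" "k ^ (2 * d - 2) \<le> k ^ (d + 1)" by blast+
  have arg0: "0 \<le> k * P^2 + P * A / k ^ (3 - d)" using k0 P A by simp
  have X0: "0 \<le> X" and X2: "X^2 = K * (k * P^2 + P * A / k ^ (3 - d))"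
   using arg0 K by (auto simp: X_def sup_fn_def)
  have M2: "M^2 = K * k" using K k0 by (auto simp: M_def)
  have kd: "k^2 / k ^ (3 - d) = k ^ (d - 1)" using d k0 by (auto simp: power2_eq_square)
  have X2k: "X^2 * k^2 = K * (k^3 * P^2 + P * A * k ^ (d - 1))"
   unfolding X2 kd[symmetric] by (simp add: power2_eq_square power3_eq_cube algebra_simps)
  have N1: "0 \<le> N" "N \<le> c1 * (k * P + sqrt k * X)"
  proof -
   have s: "0 \<le> k * P + sqrt k * X" using k0 P X0 by simp
   show "0 \<le> N" unfolding N_def nonlin_fn_def X_def[symmetric] using s K \<epsilon> P by simp
   have "P \<le> k * P + sqrt k * X" using mult_right_mono[OF k P(1)] k0 X0 by (simp add: add_increasing2)
   then show "N \<le> c1 * (k * P + sqrt k * X)"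
    unfolding N_def nonlin_fn_def X_def[symmetric] c1_def by (simp add: distrib_right)
  qed
  have N2: "N^2 \<le> 2 * c1^2 * (k^2 * P^2 + k * X^2)"
  proof -
   have "N^2 \<le> (c1 * (k * P + sqrt k * X))^2" using N1 by (intro power_mono)
   also have "\<dots> = c1^2 * (k * P + sqrt k * X)^2" by (simp add: power_mult_distrib)
   also have "\<dots> \<le> c1^2 * (2 * (k * P)^2 + 2 * (sqrt k * X)^2)"
    using sum_squares_bound[of "k * P" "sqrt k * X"] by (intro mult_left_mono) (auto simp: power2_sum)
   also have "\<dots> = 2 * c1^2 * (k^2 * P^2 + k * X^2)" using k0 by (simp add: power_mult_distrib algebra_simps)
   finally show ?thesis .
  qed
  have c2k: "\<epsilon>^2 / \<theta> + M^2 / \<theta> + 1 \<le> c2 * k"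
  proof -
   have "\<epsilon>^2 / \<theta> + 1 \<le> (\<epsilon>^2 / \<theta> + 1) * k" using mult_left_mono[OF k, of "\<epsilon>^2 / \<theta> + 1"] \<theta> by simp
   then show ?thesis by (simp add: c2_def M2 algebra_simps)
  qed
  have "?r * N = A * (\<epsilon> * N) + (X * k) * N + J * (M * N)"
   by (simp add: rate_fn_def X_def M_def algebra_simps)
  also have "\<dots> \<le> (\<theta> / 4 * A^2 + (\<epsilon> * N)^2 / \<theta>) + ((X * k)^2 + N^2) + (\<theta> / 4 * J^2 + (M * N)^2 / \<theta>)"
  proof -
   have "(X * k) * N \<le> (X * k)^2 + N^2"
    using sum_squares_bound[of "X * k" N] mult_nonneg_nonneg[OF mult_nonneg_nonneg[OF X0 less_imp_le[OF k0]] N1(1)] by linarith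
   then show ?thesis using Young[OF \<theta>(1), of A "\<epsilon> * N"] Young[OF \<theta>(1), of J "M * N"] by linarith
  qed
  finally have r1: "?r * N \<le> \<theta> / 4 * A^2 + \<theta> / 4 * J^2 + (X * k)^2 + N^2 * (\<epsilon>^2 / \<theta> + M^2 / \<theta> + 1)"
   by (simp add: power_mult_distrib algebra_simps)
  have r2: "X * k * (A + J) \<le> \<theta> / 4 * A^2 + \<theta> / 4 * J^2 + 2 / \<theta> * (X * k)^2"
   using Young[OF \<theta>(1), of A "X * k"] Young[OF \<theta>(1), of J "X * k"] by (simp add: algebra_simps)
  have r3: "N^2 * (\<epsilon>^2 / \<theta> + M^2 / \<theta> + 1) \<le> 2 * c1^2 * c2 * (k^3 * P^2 + (X * k)^2)"
  proof -
   have "N^2 * (\<epsilon>^2 / \<theta> + M^2 / \<theta> + 1) \<le> (2 * c1^2 * (k^2 * P^2 + k * X^2)) * (c2 * k)"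
    using N2 c2k k0 \<theta> by (intro mult_mono) auto
   also have "\<dots> = 2 * c1^2 * c2 * (k^3 * P^2 + (X * k)^2)" by (simp add: power2_eq_square power3_eq_cube algebra_simps)
   finally show ?thesis .
  qed
  have eA: "\<theta> * A^2 \<le> \<epsilon> * A^2" using \<theta> by (intro mult_right_mono) auto
  have eU: "\<theta> * J^2 \<le> J^2 / \<gamma>" using mult_right_mono[OF \<theta>(3), of "J^2"] by simp
  have r4: "c3 * (X * k)^2 \<le> \<theta> / 2 * A^2 + (c3 * K + (c3 * K)^2 / (2 * \<theta>)) * k ^ (d + 1) * P^2"
  proof -
   have "c3 * (X * k)^2 = c3 * K * (k^3 * P^2) + A * (c3 * K * P * k ^ (d - 1))"
    using X2k by (simp add: power_mult_distrib algebra_simps)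
   also have "A * (c3 * K * P * k ^ (d - 1)) \<le> \<theta> / 2 * A^2 + (c3 * K * P * k ^ (d - 1))^2 / (2 * \<theta>)"
    using Young[of "2 * \<theta>" A "c3 * K * P * k ^ (d - 1)"] \<theta> by simp
   also have "(c3 * K * P * k ^ (d - 1))^2 / (2 * \<theta>) = (c3 * K)^2 / (2 * \<theta>) * (k ^ (2 * d - 2) * P^2)"
    by (simp add: power_mult_distrib diff_mult_distrib2 mult.commute flip: power_mult)
   also have "\<dots> \<le> (c3 * K)^2 / (2 * \<theta>) * (k ^ (d + 1) * P^2)"
    using \<theta> by (intro mult_left_mono mult_right_mono kk) auto
   also have "c3 * K * (k^3 * P^2) \<le> c3 * K * (k ^ (d + 1) * P^2)"
    using c3 K by (intro mult_left_mono mult_right_mono kk) auto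
   finally show ?thesis by (simp add: algebra_simps)
  qed
  have r5: "2 * c1^2 * c2 * (k^3 * P^2) \<le> c3 * (k ^ (d + 1) * P^2)"
   using c2 \<theta> k0 by (intro mult_mono mult_right_mono kk) (auto simp: c3_def)
  have c3e: "c3 * (X * k)^2 = 2 / \<theta> * (X * k)^2 + (X * k)^2 + 2 * c1^2 * c2 * (X * k)^2" by (simp add: c3_def algebra_simps)
  have "- \<epsilon> * A^2 - J^2 / \<gamma> + X * k * (A + J) + ?r * N
   \<le> (c3 * K + (c3 * K)^2 / (2 * \<theta>)) * k ^ (d + 1) * P^2 + c3 * (k ^ (d + 1) * P^2)"
   using r1 r2 r3 r4 r5 eA eU c3e mult_nonneg_nonneg[OF less_imp_le[OF \<theta>(1)] zero_le_power2[of J]] by (simp add: distrib_left)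
  also have "\<dots> = c4 * k ^ (d + 1) * P^2" by (simp add: c4_def algebra_simps)
  finally show "- \<epsilon> * A^2 - J^2 / \<gamma> + sup_fn d K P A k * k * (A + J) + ?r * nonlin_fn d K \<epsilon> P A k \<le> c4 * k ^ (d + 1) * P^2"
   by (simp add: X_def N_def)
  have X2b: "X^2 \<le> x1 * k"
  proof -
   have "P^2 \<le> H^2" using P by (intro power_mono)
   then have "k * P^2 \<le> k * H^2" using k0 by (intro mult_left_mono) auto
   moreover have "P * A / k ^ (3 - d) \<le> 2 * H * k"
   proof -
    have "P * A / k ^ (3 - d) \<le> P * A / 1" using P A k by (intro divide_left_mono one_le_power) auto
    also have "\<dots> \<le> H * (2 * k)" using P A H by (simp add: mult_mono)
    finally show ?thesis by simp
   qed
   ultimately have "k * P^2 + P * A / k ^ (3 - d) \<le> (H^2 + 2 * H) * k" unfolding distrib_right by (simp add: mult.commute[of k])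
   from mult_left_mono[OF this K] show ?thesis by (simp add: X2 x1_def mult.assoc)
  qed
  show "(?r)^2 \<le> c5 * k ^ 3"
  proof -
   have "(?r)^2 = (\<epsilon> * A + X * k + M * J)^2" by (simp add: rate_fn_def X_def M_def)
   also have "\<dots> \<le> 3 * ((\<epsilon> * A)^2 + (X * k)^2 + (M * J)^2)"
    using zero_le_power2[of "\<epsilon> * A - X * k"] zero_le_power2[of "\<epsilon> * A - M * J"] zero_le_power2[of "X * k - M * J"]
    by (simp add: power2_eq_square algebra_simps)
   also have "\<dots> \<le> 3 * (4 * \<epsilon>^2 * k^3 + x1 * k^3 + 4 * K * k^3)"
   proof (intro mult_left_mono add_mono)
    have A2: "A^2 \<le> 4 * k^2" using power_mono[OF A(2,1), of 2] by (simp add: power_mult_distrib)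
    also have "\<dots> \<le> 4 * k^3" using kk by simp
    finally have "\<epsilon>^2 * A^2 \<le> \<epsilon>^2 * (4 * k^3)" by (rule mult_left_mono) simp
    then show "(\<epsilon> * A)^2 \<le> 4 * \<epsilon>^2 * k^3" by (simp add: power_mult_distrib mult_ac)
    show "(X * k)^2 \<le> x1 * k^3"
     using mult_right_mono[OF X2b, of "k^2"] by (simp add: power_mult_distrib power2_eq_square power3_eq_cube mult_ac)
    have "J^2 \<le> 4 * k^2" using power_mono[OF J(2,1), of 2] by (simp add: power_mult_distrib)
    then have "M^2 * J^2 \<le> (K * k) * (4 * k^2)" unfolding M2 using K k0 by (intro mult_left_mono) auto
    then show "(M * J)^2 \<le> 4 * K * k^3" by (simp add: power_mult_distrib power2_eq_square power3_eq_cube mult_ac)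
   qed simp
   finally show ?thesis by (simp add: c5_def algebra_simps)
  qed
  show "(nonlin_fn d K \<epsilon> P A k)^2 \<le> c6 * k ^ 3"
  proof -
   have "k^2 * P^2 + k * X^2 \<le> k^3 * H^2 + k^3 * x1"
   proof (intro add_mono)
    show "k^2 * P^2 \<le> k^3 * H^2" using P kk k0 by (intro mult_mono power_mono) auto
    have "k * X^2 \<le> k * (x1 * k)" using X2b k0 by (intro mult_left_mono) auto
    also have "\<dots> = k^2 * x1" by (simp add: power2_eq_square)
    also have "\<dots> \<le> k^3 * x1" using kk x1 by (intro mult_right_mono) auto
    finally show "k * X^2 \<le> k^3 * x1" .
   qed
   then have "2 * c1^2 * (k^2 * P^2 + k * X^2) \<le> 2 * c1^2 * (k^3 * H^2 + k^3 * x1)" by (intro mult_left_mono) auto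
   then show ?thesis using N2 by (simp add: N_def c6_def algebra_simps)
  qed
 qed
 let ?C = "max c4 (max c5 c6)"
 have up: "c * k ^ n \<le> ?C * k ^ n" if "c \<le> ?C" "1 \<le> k" for c k :: real and n using that by (intro mult_right_mono) auto
 show ?thesis
  unfolding arith_constant_def
 proof (intro exI[of _ ?C] conjI allI impI)
  show "0 \<le> ?C" using c4 by simp
  fix P A J k :: real
  assume a: "0 \<le> P" "P \<le> H" "0 \<le> A" "A \<le> 2 * k" "0 \<le> J" "J \<le> 2 * k" "1 \<le> k"
  have "c4 * k ^ (d + 1) * P^2 \<le> ?C * k ^ (d + 1) * P^2" using up[of c4 k "d + 1"] a by (intro mult_right_mono) auto
  then show "- \<epsilon> * A^2 - J^2 / \<gamma> + sup_fn d K P A k * k * (A + J) + rate_fn d K \<epsilon> P A J k * nonlin_fn d K \<epsilon> P A k \<le> ?C * k ^ (d + 1) * P^2"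
   using main(1)[OF a] by linarith
  show "(rate_fn d K \<epsilon> P A J k)^2 \<le> ?C * k ^ 3" using main(2)[OF a] up[of c5 k 3] a by linarith
  show "(nonlin_fn d K \<epsilon> P A k)^2 \<le> ?C * k ^ 3" using main(3)[OF a] up[of c6 k 3] a by linarith
 qed
qed

definition estimate_constants :: "'a::euclidean_space set \<Rightarrow> real \<Rightarrow> real \<Rightarrow> real \<Rightarrow> real \<Rightarrow> real \<Rightarrow> bool" where
 "estimate_constants U \<gamma> \<epsilon> H K C \<longleftrightarrow> 0 \<le> K \<and> 0 \<le> C \<and> (\<forall>\<phi>1 \<Phi>1 \<mu>1 N1 R1 u1 D1 \<phi>2 \<Phi>2 \<mu>2 N2 R2 u2 D2 k P A J.
   state U \<gamma> \<epsilon> \<phi>1 \<Phi>1 \<mu>1 N1 R1 u1 D1 \<longrightarrow> state U \<gamma> \<epsilon> \<phi>2 \<Phi>2 \<mu>2 N2 R2 u2 D2 \<longrightarrow>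
   L2_norm U \<phi>1 + L2_norm U \<Phi>1 \<le> H \<longrightarrow> L2_norm U \<phi>2 + L2_norm U \<Phi>2 \<le> H \<longrightarrow>
   1 \<le> k \<longrightarrow> L2_norm U N1 \<le> k \<longrightarrow> L2_norm U N2 \<le> k \<longrightarrow> L2_norm U u1 \<le> k \<longrightarrow> L2_norm U u2 \<le> k \<longrightarrow>
   P = L2_norm U (\<lambda>x. \<phi>1 x - \<phi>2 x) + L2_norm U (\<lambda>x. \<Phi>1 x - \<Phi>2 x) \<longrightarrow> A = L2_norm U (\<lambda>x. N1 x - N2 x) \<longrightarrow>
   J = L2_norm U (\<lambda>x. u1 x - u2 x) \<longrightarrow>
   (\<forall>\<nu> G. has_grad U \<nu> G \<longrightarrow> \<bar>D1 \<nu> - D2 \<nu>\<bar> \<le> rate_fn DIM('a) K \<epsilon> P A J k * L2_norm U G) \<and>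
   (\<exists>\<Gamma>. has_grad U (\<lambda>x. f_pot (\<phi>1 x) - f_pot (\<phi>2 x)) \<Gamma> \<and> L2_norm U \<Gamma> / \<epsilon> + P \<le> nonlin_fn DIM('a) K \<epsilon> P A k) \<and>
   (D1 (\<lambda>x. \<mu>1 x - \<mu>2 x) - D2 (\<lambda>x. \<mu>1 x - \<mu>2 x)) + rate_fn DIM('a) K \<epsilon> P A J k * nonlin_fn DIM('a) K \<epsilon> P A k \<le> C * k ^ (DIM('a) + 1) * P^2 \<and>
   (rate_fn DIM('a) K \<epsilon> P A J k)^2 \<le> C * k ^ 3 \<and> (nonlin_fn DIM('a) K \<epsilon> P A k)^2 \<le> C * k ^ 3)"

text \<open>The fluxes are orthogonal to gradients, hence \<open>J^2\<close> is \<open>\<gamma>\<close> times the inner product of \<open>u = u1 - u2\<close> with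
 \<open>\<phi> N1 + \<phi>2 (N1 - N2)\<close>, where \<open>\<phi> = \<phi>1 - \<phi>2\<close>. The transport term of \<open>D1 - D2\<close> at \<open>\<mu>1 - \<mu>2\<close> contains
 the second summand; exchanging it for \<open>J^2 / \<gamma>\<close> leaves only terms with the factor \<open>\<phi>\<close>, bounded by \<open>sup_fn\<close>.\<close>

lemma state_estimate:
 fixes U :: "'a::euclidean_space set"
 assumes dim: "DIM('a) = 2 \<or> DIM('a) = 3" and dom: "bounded_lipschitz_domain U" and \<epsilon>: "0 < \<epsilon>" and \<gamma>: "0 < \<gamma>" and H: "0 \<le> H"
 shows "\<exists>K C. estimate_constants U \<gamma> \<epsilon> H K C"
proof -
 have U: "open U" and Ub: "U \<in> sets borel" using dom by (auto simp: bounded_lipschitz_domain_def)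
 obtain K0 where sup: "sup_constant U \<epsilon> H K0" using slice_sup_estimate[OF dim dom \<epsilon> H] by blast
 then have K0: "0 \<le> K0" by (simp add: sup_constant_def)
 define Km where "Km = K0 * (H^2 + H)"
 have Km: "0 \<le> Km" using K0 H by (simp add: Km_def)
 define K where "K = 3 * Km + 1 + 6 * H * (Km + 1) + K0"
 have HK: "0 \<le> H * (Km + 1)" using H Km by simp
 have K: "0 \<le> K" "K0 \<le> K" "Km \<le> K" "3 * Km + 1 \<le> K" "6 * H * (Km + 1) \<le> K"
  unfolding K_def using K0 Km HK by linarith+
 have "0 \<le> 2 * H" using H by simp
 then obtain C where arith: "arith_constant DIM('a) \<epsilon> \<gamma> K (2 * H) C" using rate_arith[OF dim \<epsilon> \<gamma> K(1)] by blast
 then have C: "0 \<le> C" by (simp add: arith_constant_def)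
 show ?thesis
 unfolding estimate_constants_def
 proof (rule exI[of _ K], rule exI[of _ C], rule conjI[OF K(1)], rule conjI[OF C], intro allI impI conjI)
  fix \<phi>1 \<Phi>1 \<mu>1 N1 R1 u1 D1 \<phi>2 \<Phi>2 \<mu>2 N2 R2 u2 D2 k P A J
  assume s1: "state U \<gamma> \<epsilon> \<phi>1 \<Phi>1 \<mu>1 N1 R1 u1 D1" and s2: "state U \<gamma> \<epsilon> \<phi>2 \<Phi>2 \<mu>2 N2 R2 u2 D2"
   and H1: "L2_norm U \<phi>1 + L2_norm U \<Phi>1 \<le> H" and H2: "L2_norm U \<phi>2 + L2_norm U \<Phi>2 \<le> H"
   and k: "1 \<le> k" and kb: "L2_norm U N1 \<le> k" "L2_norm U N2 \<le> k" "L2_norm U u1 \<le> k" "L2_norm U u2 \<le> k"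
   and P: "P = L2_norm U (\<lambda>x. \<phi>1 x - \<phi>2 x) + L2_norm U (\<lambda>x. \<Phi>1 x - \<Phi>2 x)" and A: "A = L2_norm U (\<lambda>x. N1 x - N2 x)"
   and J: "J = L2_norm U (\<lambda>x. u1 x - u2 x)"
  have sl: "slice U \<epsilon> \<phi>1 \<Phi>1 \<mu>1 N1" "slice U \<epsilon> \<phi>2 \<Phi>2 \<mu>2 N2" using s1 s2 by (auto simp: state_def)
  then have g: "has_grad U \<phi>1 \<Phi>1" "has_grad U \<phi>2 \<Phi>2" "has_grad U \<mu>1 N1" "has_grad U \<mu>2 N2" by (auto simp: slice_def)
  obtain p1 p2 where gp: "has_grad U p1 R1" "has_grad U p2 R2" using s1 s2 by (auto simp: state_def)
  have l2: "\<phi>1 \<in> L2 U" "\<Phi>1 \<in> L2 U" "N1 \<in> L2 U" "R1 \<in> L2 U" "u1 \<in> L2 U" "\<phi>2 \<in> L2 U" "\<Phi>2 \<in> L2 U" "N2 \<in> L2 U" "R2 \<in> L2 U" "u2 \<in> L2 U"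
   using g gp s1 s2 by (auto simp: has_grad_def state_def)
  note [measurable] = l2[THEN L2_borel]
  let ?\<phi> = "\<lambda>x. \<phi>1 x - \<phi>2 x" and ?N = "\<lambda>x. N1 x - N2 x" and ?u = "\<lambda>x. u1 x - u2 x"
  let ?fu = "\<lambda>x. ?\<phi> x *\<^sub>R u1 x" and ?tu = "\<lambda>x. \<phi>2 x *\<^sub>R ?u x"
  let ?r = "rate_fn DIM('a) K \<epsilon> P A J k" and ?n = "nonlin_fn DIM('a) K \<epsilon> P A k" and ?m = "\<lambda>x. \<mu>1 x - \<mu>2 x"
  have Nd: "?N \<in> L2 U" and ud: "?u \<in> L2 U" by (intro L2_diff l2)+
  have nn: "0 \<le> P" "0 \<le> A" "0 \<le> J" unfolding P A J by (intro add_nonneg_nonneg L2_norm_nonneg)+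
  have A2: "A \<le> 2 * k" using L2_norm_diff_triangle[OF l2(3,8)] kb unfolding A by linarith
  have U2: "J \<le> 2 * k" using L2_norm_diff_triangle[OF l2(5,10)] kb unfolding J by linarith
  have P2: "P \<le> 2 * H" using L2_norm_diff_triangle[OF l2(1,6)] L2_norm_diff_triangle[OF l2(2,7)] H1 H2 unfolding P by linarith
  define X where "X = sup_fn DIM('a) K P A k"
  define M where "M = sqrt (K * k)"
  have k0: "0 < k" using k by simp
  have arg0: "0 \<le> k * P^2 + P * A / k ^ (3 - DIM('a))" using k0 nn by simp
  have X0: "0 \<le> X" unfolding X_def sup_fn_def using arg0 K by simp
  have Xb: "AE x in lebesgue_on U. \<bar>?\<phi> x\<bar> \<le> X"
  proof -
   have "AE x in lebesgue_on U. (?\<phi> x)^2 \<le> K0 * (k * P^2 + P * A / k ^ (3 - DIM('a)))"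
    using sup sl H1 H2 k P A unfolding sup_constant_def by blast
   then show ?thesis
   proof eventually_elim
    case (elim x)
    also have "K0 * (k * P^2 + P * A / k ^ (3 - DIM('a))) \<le> K * (k * P^2 + P * A / k ^ (3 - DIM('a)))"
     using K arg0 by (intro mult_right_mono)
    finally have "sqrt ((?\<phi> x)^2) \<le> X" unfolding X_def sup_fn_def by (rule real_sqrt_le_mono)
    then show ?case by simp
   qed
  qed
  have single: "AE x in lebesgue_on U. \<bar>\<phi> x\<bar> \<le> sqrt (Km * k)"
   if sl: "slice U \<epsilon> \<phi> \<Phi> \<mu> N" and Hb: "L2_norm U \<phi> + L2_norm U \<Phi> \<le> H" and Nk: "L2_norm U N \<le> k" for \<phi> \<Phi> \<mu> N
  proof -
   let ?P = "L2_norm U \<phi> + L2_norm U \<Phi>"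
   have P0: "0 \<le> ?P" by (intro add_nonneg_nonneg L2_norm_nonneg)
   have "AE x in lebesgue_on U. (\<phi> x - 0)^2 \<le> K0 * (1 * ?P^2 + ?P * L2_norm U N / 1 ^ (3 - DIM('a)))"
    using sup[unfolded sup_constant_def, THEN conjunct2, rule_format, OF sl slice_zero Hb _ order_refl, of ?P "L2_norm U N"] H by simp
   then show ?thesis
   proof eventually_elim
    case (elim x)
    also have "K0 * (1 * ?P^2 + ?P * L2_norm U N / 1 ^ (3 - DIM('a))) \<le> K0 * (H^2 * k + H * k)"
    proof (intro mult_left_mono add_mono K0)
     have "1 * ?P^2 \<le> H^2" using P0 Hb by (simp add: power_mono)
     also have "\<dots> \<le> H^2 * k" using k by (simp add: mult_le_cancel_left1)
     finally show "1 * ?P^2 \<le> H^2 * k" .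
     show "?P * L2_norm U N / 1 ^ (3 - DIM('a)) \<le> H * k"
      using mult_mono[OF Hb Nk H L2_norm_nonneg] by simp
    qed
    also have "\<dots> = Km * k" by (simp add: Km_def algebra_simps)
    finally have "sqrt ((\<phi> x)^2) \<le> sqrt (Km * k)" by (intro real_sqrt_le_mono) simp
    then show ?case by simp
   qed
  qed
  define m where "m = sqrt (Km * k)"
  have m0: "0 \<le> m" and m2: "m^2 = Km * k" using Km k0 by (auto simp: m_def)
  have mM: "m \<le> M" unfolding m_def M_def using K k0 by (intro real_sqrt_le_mono mult_right_mono) auto
  have M0: "0 \<le> M" using m0 mM by linarith
  have b1: "AE x in lebesgue_on U. \<bar>\<phi>1 x\<bar> \<le> m" and b2: "AE x in lebesgue_on U. \<bar>\<phi>2 x\<bar> \<le> m"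
   unfolding m_def using single sl H1 H2 kb by blast+
  have b2M: "AE x in lebesgue_on U. \<bar>\<phi>2 x\<bar> \<le> M" using b2 by eventually_elim (use mM in linarith)
  have m\<phi>: "?\<phi> \<in> borel_measurable (lebesgue_on U)" "\<phi>2 \<in> borel_measurable (lebesgue_on U)" by measurable
  note q1 = L2_bounded_scaleR[OF m\<phi>(1) Xb X0 l2(5)]
  note q2 = L2_bounded_scaleR[OF m\<phi>(2) b2M M0 ud]
  note q3 = L2_bounded_scaleR[OF m\<phi>(1) Xb X0 l2(3)]
  note q4 = L2_bounded_scaleR[OF m\<phi>(2) b2M M0 Nd]
  have q5: "(\<lambda>x. \<phi>1 x *\<^sub>R u1 x) \<in> L2 U" by (rule L2_bounded_scaleR(1)[OF _ b1 m0 l2(5)]) measurable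
  have q6: "(\<lambda>x. \<phi>2 x *\<^sub>R u2 x) \<in> L2 U" by (rule L2_bounded_scaleR(1)[OF _ b2 m0 l2(10)]) measurable
  have fl: "\<phi>1 x *\<^sub>R u1 x - \<phi>2 x *\<^sub>R u2 x = ?\<phi> x *\<^sub>R u1 x + \<phi>2 x *\<^sub>R ?u x" for x
   by (simp add: scaleR_diff_left scaleR_diff_right)
  have D: "D1 \<nu> - D2 \<nu> = - \<epsilon> * L2_inner U ?N G - L2_inner U ?fu G - L2_inner U ?tu G"
   if h: "has_grad U \<nu> G" for \<nu> G
  proof -
   have G: "G \<in> L2 U" using h by (simp add: has_grad_def)
   have "D1 \<nu> = - \<epsilon> * L2_inner U N1 G - L2_inner U (\<lambda>x. \<phi>1 x *\<^sub>R u1 x) G" "D2 \<nu> = - \<epsilon> * L2_inner U N2 G - L2_inner U (\<lambda>x. \<phi>2 x *\<^sub>R u2 x) G"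
    using s1 s2 h by (auto simp: state_def)
   moreover have "L2_inner U ?N G = L2_inner U N1 G - L2_inner U N2 G" by (intro L2_inner_diff_left l2 G)
   moreover have "L2_inner U (\<lambda>x. \<phi>1 x *\<^sub>R u1 x) G - L2_inner U (\<lambda>x. \<phi>2 x *\<^sub>R u2 x) G = L2_inner U ?fu G + L2_inner U ?tu G"
    unfolding L2_inner_diff_left[OF q5 q6 G, symmetric] L2_inner_add_left[OF q1(1) q2(1) G, symmetric] fl ..
   ultimately show ?thesis by (simp add: right_diff_distrib)
  qed
  have arith': "- \<epsilon> * A^2 - J^2 / \<gamma> + X * k * (A + J) + ?r * ?n \<le> C * k ^ (DIM('a) + 1) * P^2"
    "(?r)^2 \<le> C * k ^ 3" "(?n)^2 \<le> C * k ^ 3"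
   using arith nn A2 U2 P2 k unfolding X_def arith_constant_def by blast+
  show "(?r)^2 \<le> C * k ^ 3" "(?n)^2 \<le> C * k ^ 3" by (rule arith')+
  show "\<bar>D1 \<nu> - D2 \<nu>\<bar> \<le> ?r * L2_norm U G" if h: "has_grad U \<nu> G" for \<nu> G
  proof -
   have G: "G \<in> L2 U" using h by (simp add: has_grad_def)
   have G0: "0 \<le> L2_norm U G" by (rule L2_norm_nonneg)
   have i1: "\<bar>\<epsilon> * L2_inner U ?N G\<bar> \<le> \<epsilon> * (A * L2_norm U G)" using L2_Cauchy_Schwarz(2)[OF Nd G] \<epsilon> by (simp add: abs_mult A)
   have "\<bar>L2_inner U ?fu G\<bar> \<le> L2_norm U ?fu * L2_norm U G" by (rule L2_Cauchy_Schwarz(2)[OF q1(1) G])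
   also have "\<dots> \<le> (X * k) * L2_norm U G" using q1(2) mult_left_mono[OF kb(3) X0] G0 by (intro mult_right_mono) auto
   finally have i2: "\<bar>L2_inner U ?fu G\<bar> \<le> (X * k) * L2_norm U G" .
   have "\<bar>L2_inner U ?tu G\<bar> \<le> L2_norm U ?tu * L2_norm U G" by (rule L2_Cauchy_Schwarz(2)[OF q2(1) G])
   also have "\<dots> \<le> (M * J) * L2_norm U G" using q2(2) G0 unfolding J by (intro mult_right_mono) auto
   finally have i3: "\<bar>L2_inner U ?tu G\<bar> \<le> (M * J) * L2_norm U G" .
   have "\<bar>D1 \<nu> - D2 \<nu>\<bar> \<le> \<epsilon> * (A * L2_norm U G) + (X * k) * L2_norm U G + (M * J) * L2_norm U G"
    unfolding D[OF h] using i1 i2 i3 by linarith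
   also have "\<dots> = ?r * L2_norm U G" by (simp add: rate_fn_def X_def M_def algebra_simps)
   finally show ?thesis .
  qed
  show "\<exists>\<Gamma>. has_grad U (\<lambda>x. f_pot (\<phi>1 x) - f_pot (\<phi>2 x)) \<Gamma> \<and> L2_norm U \<Gamma> / \<epsilon> + P \<le> ?n"
  proof -
   obtain \<Gamma> where \<Gamma>: "has_grad U (\<lambda>x. f_pot (\<phi>1 x) - f_pot (\<phi>2 x)) \<Gamma>"
    "L2_norm U \<Gamma> \<le> (3 * m^2 + 1) * L2_norm U (\<lambda>x. \<Phi>1 x - \<Phi>2 x) + 6 * m * X * L2_norm U \<Phi>2"
    using f_pot_diff_grad_bound[OF U g(1,2) b1 b2 m0 Xb X0] .
   have "(3 * m^2 + 1) * L2_norm U (\<lambda>x. \<Phi>1 x - \<Phi>2 x) \<le> (K * k) * P"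
   proof (rule mult_mono)
    have "3 * m^2 + 1 \<le> (3 * Km + 1) * k" unfolding m2 using k by (simp add: algebra_simps)
    also have "\<dots> \<le> K * k" using K k0 by (intro mult_right_mono) auto
    finally show "3 * m^2 + 1 \<le> K * k" .
    show "L2_norm U (\<lambda>x. \<Phi>1 x - \<Phi>2 x) \<le> P" unfolding P using L2_norm_nonneg[of U ?\<phi>] by simp
   qed (use K k0 L2_norm_nonneg in auto)
   moreover have "6 * m * X * L2_norm U \<Phi>2 \<le> K * (sqrt k * X)"
   proof -
    have "sqrt Km \<le> Km + 1"
    proof -
     have "Km \<le> (Km + 1)^2" using Km by (simp add: power2_sum)
     then have "sqrt Km \<le> sqrt ((Km + 1)^2)" by (rule real_sqrt_le_mono)
     then show ?thesis using Km by simp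
    qed
    moreover have "L2_norm U \<Phi>2 \<le> H" using H2 L2_norm_nonneg[of U \<phi>2] by linarith
    ultimately have "L2_norm U \<Phi>2 * sqrt Km \<le> H * (Km + 1)" using H Km by (intro mult_mono) auto
    then have "6 * (L2_norm U \<Phi>2 * sqrt Km) \<le> K" using K(5) by simp
    then have "6 * (L2_norm U \<Phi>2 * sqrt Km) * (sqrt k * X) \<le> K * (sqrt k * X)" using X0 k0 by (intro mult_right_mono) auto
    then show ?thesis by (simp add: m_def real_sqrt_mult mult_ac)
   qed
   ultimately have "L2_norm U \<Gamma> \<le> K * (k * P + sqrt k * X)" using \<Gamma>(2) by (simp add: distrib_left)
   then have "L2_norm U \<Gamma> / \<epsilon> + P \<le> ?n"
    unfolding nonlin_fn_def X_def using \<epsilon> by (simp add: divide_right_mono)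
   then show ?thesis using \<Gamma>(1) by blast
  qed
  show "(D1 ?m - D2 ?m) + ?r * ?n \<le> C * k ^ (DIM('a) + 1) * P^2"
  proof -
   have h: "has_grad U ?m ?N" by (intro has_grad_diff Ub g)
   have i1: "- L2_inner U ?fu ?N \<le> X * k * A"
   proof -
    have "- L2_inner U ?fu ?N \<le> L2_norm U ?fu * A" using L2_Cauchy_Schwarz(2)[OF q1(1) Nd] unfolding A by linarith
    also have "\<dots> \<le> (X * k) * A" using q1(2) mult_left_mono[OF kb(3) X0] nn by (intro mult_right_mono) auto
    finally show ?thesis .
   qed
   have i2: "L2_inner U ?u (\<lambda>x. ?\<phi> x *\<^sub>R N1 x) \<le> X * k * J"
   proof -
    have "L2_inner U ?u (\<lambda>x. ?\<phi> x *\<^sub>R N1 x) \<le> J * L2_norm U (\<lambda>x. ?\<phi> x *\<^sub>R N1 x)" using L2_Cauchy_Schwarz(2)[OF ud q3(1)] unfolding J by linarith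
    also have "\<dots> \<le> J * (X * k)" using q3(2) mult_left_mono[OF kb(1) X0] nn by (intro mult_left_mono) auto
    finally show ?thesis by (simp add: mult_ac)
   qed
   have i3: "L2_inner U ?tu ?N = J^2 / \<gamma> - L2_inner U ?u (\<lambda>x. ?\<phi> x *\<^sub>R N1 x)"
   proof -
    let ?w = "\<lambda>x. (R1 x - R2 x) + \<gamma> *\<^sub>R (?\<phi> x *\<^sub>R N1 x + \<phi>2 x *\<^sub>R ?N x)"
    have ae: "AE x in lebesgue_on U. ?u x = ?w x"
    proof -
     have "AE x in lebesgue_on U. u1 x = R1 x + (\<gamma> * \<phi>1 x) *\<^sub>R N1 x" "AE x in lebesgue_on U. u2 x = R2 x + (\<gamma> * \<phi>2 x) *\<^sub>R N2 x"
      using s1 s2 by (auto simp: state_def)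
     then show ?thesis
     proof eventually_elim
      case (elim x)
      show ?case unfolding elim by (simp add: scaleR_diff_left scaleR_diff_right scaleR_add_right algebra_simps)
     qed
    qed
    have w: "?w \<in> L2 U" "(\<lambda>x. ?\<phi> x *\<^sub>R N1 x + \<phi>2 x *\<^sub>R ?N x) \<in> L2 U" by (intro L2_add L2_diff L2_scaleR q3 q4 l2)+
    have RR: "(\<lambda>x. R1 x - R2 x) \<in> L2 U" by (intro L2_diff l2)
    have hp: "has_grad U (\<lambda>x. p1 x - p2 x) (\<lambda>x. R1 x - R2 x)" by (intro has_grad_diff Ub gp)
    have z: "L2_inner U ?u (\<lambda>x. R1 x - R2 x) = 0"
    proof -
     have "L2_inner U u1 (\<lambda>x. R1 x - R2 x) = 0" "L2_inner U u2 (\<lambda>x. R1 x - R2 x) = 0"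
      using s1 s2 hp unfolding state_def by blast+
     then show ?thesis by (simp add: L2_inner_diff_left l2 RR)
    qed
    have "J^2 = L2_inner U ?u ?u" unfolding J by (simp add: L2_inner_self)
    also have "\<dots> = L2_inner U ?u ?w" by (rule L2_inner_cong_AE[OF ud ud ud w(1) _ ae]) simp
    also have "\<dots> = \<gamma> * L2_inner U ?u (\<lambda>x. ?\<phi> x *\<^sub>R N1 x + \<phi>2 x *\<^sub>R ?N x)"
     by (subst L2_inner_add_right[OF RR L2_scaleR[OF w(2)] ud]) (simp add: z L2_inner_scaleR_right)
    also have "L2_inner U ?u (\<lambda>x. ?\<phi> x *\<^sub>R N1 x + \<phi>2 x *\<^sub>R ?N x) = L2_inner U ?u (\<lambda>x. ?\<phi> x *\<^sub>R N1 x) + L2_inner U ?u (\<lambda>x. \<phi>2 x *\<^sub>R ?N x)"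
     by (rule L2_inner_add_right[OF q3(1) q4(1) ud])
    also have "L2_inner U ?u (\<lambda>x. \<phi>2 x *\<^sub>R ?N x) = L2_inner U ?tu ?N" by (simp add: L2_inner_def)
    finally show ?thesis using \<gamma> by (simp add: field_simps)
   qed
   have "D1 ?m - D2 ?m \<le> - \<epsilon> * A^2 - J^2 / \<gamma> + X * k * (A + J)"
    unfolding D[OF h] i3 L2_inner_self A[symmetric] distrib_left using i1 i2 by linarith
   then show ?thesis using arith'(1) by linarith
  qed
 qed
qed

section \<open>Scalar tools for the evolution in time\<close>

text \<open>\<open>bk.avg h f t\<close> is the mean of \<open>f\<close> over \<open>[t - h, t]\<close>.\<close>

interpretation bk: averaging_kernel "indicator {-1..0} :: real \<Rightarrow> real" 1 1
proof
 show "indicat_real {- 1..0} z = 0" if "1 < norm z" for z :: real using that by (auto simp: indicator_def)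
qed auto

lemma back_avg_eq:
 assumes [measurable]: "f \<in> borel_measurable borel" and h: "h > 0"
 shows "h * bk.avg h f t = (LBINT y. indicator {t - h..t} y * f y)"
proof -
 have "(LBINT z. indicator {t - h..t} (t + h *\<^sub>R z) * f (t + h *\<^sub>R z)) = (LBINT y. indicator {t - h..t} y * f y) / h ^ DIM(real)"
  by (rule integral_scale[of "\<lambda>y. indicator {t - h..t} y * f y", OF _ h]) measurable
 moreover have "indicator {t - h..t} (t + h *\<^sub>R z) = (indicator {-1..0} z :: real)" for z
 proof -
  have "t - h \<le> t + h * z \<longleftrightarrow> - 1 \<le> z"
   using h mult_le_cancel_left_pos[OF h, of "-1" z] by simp
  moreover have "t + h * z \<le> t \<longleftrightarrow> z \<le> 0" using h by (simp add: mult_le_0_iff)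
  ultimately show ?thesis by (auto simp: indicator_def)
 qed
 ultimately show ?thesis using h by (simp add: bk.avg_def)
qed

lemma sqint_indicator_mult:
 fixes f :: "'a::euclidean_space \<Rightarrow> real"
 shows "sqint f \<Longrightarrow> S \<in> sets borel \<Longrightarrow> sqint (\<lambda>x. indicator S x * f x)"
 by (rule sqint_bounded_mult[of f _ 1]) (auto simp: indicator_def)

text \<open>Integrated over \<open>t \<le> b\<close> and divided by \<open>h\<close>, the left side telescopes to the mean of \<open>E\<close> over \<open>[b - h, b]\<close>, which tends to
 \<open>E b\<close> for almost every \<open>b\<close>; thus \<open>E\<close> is not differentiated.\<close>

lemma backward_difference_limit:
 fixes E N H :: "real \<Rightarrow> real" and e a :: "'i \<Rightarrow> real \<Rightarrow> real"
 assumes E: "sqint E" and Ei: "integrable lborel E"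
  and N: "sqint N" and H: "sqint H" and F: "finite F" and e: "\<And>v. v \<in> F \<Longrightarrow> sqint (e v)" and a: "\<And>v. v \<in> F \<Longrightarrow> sqint (a v)"
  and ineq: "\<And>h. h > 0 \<Longrightarrow> AE t in lborel. t < T \<longrightarrow> E t - E (t - h) \<le> h * ((\<Sum>v\<in>F. bk.avg h (a v) t * e v t) + bk.avg h N t * H t)"
 shows "AE b in lborel. b < T \<longrightarrow> E b \<le> (LBINT t. indicator {..b} t * ((\<Sum>v\<in>F. a v t * e v t) + N t * H t))"
proof -
 let ?e = "\<lambda>b v t. indicator {..b} t * e v t" and ?H = "\<lambda>b t. indicator {..b} t * H t"
 let ?R = "\<lambda>h b t. (\<Sum>v\<in>F. bk.avg h (a v) t * ?e b v t) + bk.avg h N t * ?H b t"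
 have T: "(\<lambda>n. 1 / real (Suc n)) \<longlonglongrightarrow> 0" by (rule LIMSEQ_inverse_real_of_nat[unfolded inverse_eq_divide])
 obtain r where r: "strict_mono r" "AE x in lborel. (\<lambda>n. bk.avg (1 / real (Suc (r n))) E x) \<longlonglongrightarrow> E x"
  using bk.avg_AE_subseq[OF E _ T] by auto
 note [measurable] = sqint_borel[OF E]
 have ind: "sqint (\<lambda>t. indicator {..b} t * f t)" if "sqint f" for b :: real and f :: "real \<Rightarrow> real"
  by (rule sqint_indicator_mult[OF that]) simp
 have bound: "bk.avg h E b \<le> (\<Sum>v\<in>F. (LBINT t. bk.avg h (a v) t * ?e b v t)) + (LBINT t. bk.avg h N t * ?H b t)"
  if h: "h > 0" and b: "b < T" for h b
 proof -
  have i1: "integrable lborel (\<lambda>t. bk.avg h (a v) t * ?e b v t)" if "v \<in> F" for v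
   by (intro sqint_mult_integrable bk.avg_L2 ind a e that h)
  have i2: "integrable lborel (\<lambda>t. bk.avg h N t * ?H b t)"
   by (intro sqint_mult_integrable bk.avg_L2 ind N H h)
  have Eh: "integrable lborel (\<lambda>t. E (t - h))"
   using lborel_integrable_real_affine[OF Ei, of 1 "- h"] by simp
  have sh: "(LBINT t. indicator {..b} t * E (t - h)) = (LBINT t. indicator {..b - h} t * E t)"
   using lborel_integral_real_affine[of 1 "\<lambda>t. indicator {..b - h} t * E t" "- h"]
   by (simp add: indicator_def)
  have int1: "integrable lborel (\<lambda>t. indicator {..c} t * E t)" for c
   using integrable_mult_indicator[OF _ Ei, of "{..c}"] by simp
  have int2: "integrable lborel (\<lambda>t. indicator {..b} t * E (t - h))"
   using integrable_mult_indicator[OF _ Eh, of "{..b}"] by simp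
  have "h * bk.avg h E b = (LBINT y. indicator {b - h..b} y * E y)" by (rule back_avg_eq[OF _ h]) measurable
  also have "\<dots> = (LBINT y. indicator {..b} y * E y - indicator {..b - h} y * E y)"
  proof (rule integral_cong_AE)
   have "AE y in lborel. y \<noteq> b - h" by (rule AE_lborel_singleton)
   then show "AE y in lborel. indicator {b - h..b} y * E y = indicator {..b} y * E y - indicator {..b - h} y * E y"
    by eventually_elim (use h in \<open>auto simp: indicator_def\<close>)
  qed measurable
  also have "\<dots> = (LBINT t. indicator {..b} t * E t) - (LBINT t. indicator {..b} t * E (t - h))"
   unfolding sh by (rule Bochner_Integration.integral_diff[OF int1 int1])
  also have "\<dots> = (LBINT t. indicator {..b} t * (E t - E (t - h)))"
   unfolding right_diff_distrib by (rule Bochner_Integration.integral_diff[OF int1 int2, symmetric])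
  also have "\<dots> \<le> (LBINT t. h * ?R h b t)"
  proof (rule integral_mono_AE)
   show "integrable lborel (\<lambda>t. indicator {..b} t * (E t - E (t - h)))"
    unfolding right_diff_distrib by (rule Bochner_Integration.integrable_diff[OF int1 int2])
   show "integrable lborel (\<lambda>t. h * ?R h b t)"
    by (intro integrable_mult_right Bochner_Integration.integrable_add Bochner_Integration.integrable_sum i1 i2)
   show "AE t in lborel. indicator {..b} t * (E t - E (t - h)) \<le> h * ?R h b t"
    using ineq[OF h]
   proof eventually_elim
    case (elim t)
    then show ?case using b by (cases "t \<le> b") auto
   qed
  qed
  also have "\<dots> = h * ((\<Sum>v\<in>F. (LBINT t. bk.avg h (a v) t * ?e b v t)) + (LBINT t. bk.avg h N t * ?H b t))"
   using i1 i2 by simp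
  finally show ?thesis using h by simp
 qed
 show ?thesis using r(2)
 proof eventually_elim
  case (elim b)
  show ?case
  proof
   assume b: "b < T"
   let ?h = "\<lambda>n. 1 / real (Suc (r n))"
   have f: "filterlim ?h (at_right 0) sequentially"
    using LIMSEQ_subseq_LIMSEQ[OF T r(1)] by (auto simp: filterlim_at comp_def intro!: always_eventually)
   have "(\<lambda>n. (\<Sum>v\<in>F. (LBINT t. bk.avg (?h n) (a v) t * ?e b v t)) + (LBINT t. bk.avg (?h n) N t * ?H b t))
    \<longlonglongrightarrow> (\<Sum>v\<in>F. (LBINT t. a v t * ?e b v t)) + (LBINT t. N t * ?H b t)"
    by (intro tendsto_add tendsto_sum filterlim_compose[OF bk.avg_tendsto_inner f] ind a e N H)
   then have "E b \<le> (\<Sum>v\<in>F. (LBINT t. a v t * ?e b v t)) + (LBINT t. N t * ?H b t)"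
    using elim bound[OF _ b] by (intro LIMSEQ_le[OF elim]) auto
   also have "\<dots> = (LBINT t. (\<Sum>v\<in>F. a v t * ?e b v t) + N t * ?H b t)"
   proof -
    have i: "integrable lborel (\<lambda>t. a v t * ?e b v t)" if "v \<in> F" for v
     by (intro sqint_mult_integrable ind a e that)
    have j: "integrable lborel (\<lambda>t. N t * ?H b t)"
     by (intro sqint_mult_integrable ind N H)
    show ?thesis
     by (simp only: Bochner_Integration.integral_add[OF Bochner_Integration.integrable_sum[OF i] j] Bochner_Integration.integral_sum[OF i])
   qed
   also have "\<dots> = (LBINT t. indicator {..b} t * ((\<Sum>v\<in>F. a v t * e v t) + N t * H t))"
    by (simp add: distrib_left sum_distrib_left mult_ac)
   finally show "E b \<le> \<dots>" .
  qed
 qed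
qed

text \<open>Let \<open>Z b\<close> be the integral on the right and \<open>c\<close> the end of the interval on which it vanishes. If \<open>c < T\<close>, the integral of
 \<open>\<kappa>\<close> over a short interval beyond \<open>c\<close> is less than \<open>1/2\<close>, so \<open>Z \<le> Z / 2\<close> at its end.\<close>

lemma Gronwall_zero:
 fixes E \<kappa> :: "real \<Rightarrow> real"
 assumes [measurable]: "E \<in> borel_measurable borel" "\<kappa> \<in> borel_measurable borel"
  and E0: "\<And>t. 0 \<le> E t" and EM: "\<And>t. E t \<le> M" and k0: "\<And>t. 0 \<le> \<kappa> t" and ki: "integrable lborel \<kappa>"
  and T: "0 < T" and z: "\<And>t. t \<le> 0 \<Longrightarrow> \<kappa> t = 0"
  and ineq: "AE b in lborel. b < T \<longrightarrow> E b \<le> (LBINT t. indicator {..b} t * (\<kappa> t * E t))"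
 shows "AE b in lborel. b < T \<longrightarrow> E b = 0"
proof -
 have M: "0 \<le> M" using E0[of 0] EM[of 0] by linarith
 have kE: "integrable lborel (\<lambda>t. \<kappa> t * E t)"
  by (rule Bochner_Integration.integrable_bound[OF integrable_mult_left[OF ki, of M]])
    (auto simp: abs_mult k0 E0 M intro!: mult_left_mono EM)
 have int: "integrable lborel (\<lambda>t. indicator {..b} t * (\<kappa> t * E t))" for b
  using integrable_mult_indicator[OF _ kE, of "{..b}"] by simp
 define Z where "Z b = (LBINT t. indicator {..b} t * (\<kappa> t * E t))" for b
 have Z0: "0 \<le> Z b" for b unfolding Z_def by (intro Bochner_Integration.integral_nonneg) (simp add: k0 E0)
 have Zmono: "Z b \<le> Z c" if "b \<le> c" for b c
  unfolding Z_def using that by (intro integral_mono int) (auto simp: indicator_def k0 E0)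
 have EZ: "AE t in lborel. t < T \<longrightarrow> E t \<le> Z t" using ineq unfolding Z_def .
 define S where "S = {b. b \<le> T \<and> Z b = 0}"
 have "(\<lambda>t. indicator {..0} t * (\<kappa> t * E t)) = (\<lambda>t. 0)" using z by (auto simp: indicator_def)
 then have "Z 0 = 0" unfolding Z_def by (simp only: Bochner_Integration.integral_zero)
 then have S0: "0 \<in> S" using T by (simp add: S_def)
 have Sb: "bdd_above S" unfolding S_def by (rule bdd_aboveI[of _ T]) auto
 define c where "c = Sup S"
 have cT: "c \<le> T" unfolding c_def using S0 by (intro cSup_least) (auto simp: S_def)
 have below: "Z t = 0" if tc: "t < c" for t
 proof -
  have "S \<noteq> {}" using S0 by blast
  then obtain b where "b \<in> S" "t < b" using less_cSupD[OF _ tc[unfolded c_def]] by blast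
  then show ?thesis using Zmono[of t b] Z0[of t] by (auto simp: S_def)
 qed
 have Ec: "AE t in lborel. t < c \<longrightarrow> E t = 0"
  using EZ by eventually_elim (use below cT E0 in \<open>auto intro: antisym\<close>)
 have "c = T"
 proof (rule ccontr)
  assume "c \<noteq> T"
  then have c: "c < T" using cT by simp
  define b where "b n = c + (T - c) / real (Suc n)" for n
  have b: "c < b n" "b n \<le> T" for n using c mult_right_mono[of c T "real n"] by (auto simp: b_def divide_simps algebra_simps)
  have "b \<longlonglongrightarrow> c + (T - c) * 0"
   unfolding b_def divide_inverse by (intro tendsto_intros LIMSEQ_inverse_real_of_nat)
  then have bc: "b \<longlonglongrightarrow> c" by simp
  have "(\<lambda>n. LBINT t. indicator {c<..b n} t * \<kappa> t) \<longlonglongrightarrow> integral\<^sup>L lborel (\<lambda>t::real. 0)"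
  proof (rule integral_dominated_convergence[OF _ _ ki])
   show "AE t in lborel. (\<lambda>n. indicator {c<..b n} t * \<kappa> t) \<longlonglongrightarrow> 0"
   proof (rule AE_I2)
    fix t
    have "\<forall>\<^sub>F n in sequentially. t > c \<longrightarrow> b n < t" using order_tendstoD(2)[OF bc, of t] by (cases "t > c") auto
    then have "\<forall>\<^sub>F n in sequentially. 0 = indicator {c<..b n} t * \<kappa> t" by eventually_elim auto
    then show "(\<lambda>n. indicator {c<..b n} t * \<kappa> t) \<longlonglongrightarrow> 0" by (rule Lim_transform_eventually[OF tendsto_const])
   qed
  qed (auto simp: indicator_def k0)
  then have "\<forall>\<^sub>F n in sequentially. (LBINT t. indicator {c<..b n} t * \<kappa> t) < 1/2" by (intro order_tendstoD(2)) auto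
  then obtain n where n: "(LBINT t. indicator {c<..b n} t * \<kappa> t) < 1/2"
   by (meson eventually_happens trivial_limit_sequentially)
  have "Z (b n) \<le> (LBINT t. (indicator {c<..b n} t * \<kappa> t) * Z (b n))"
   unfolding Z_def[of "b n"]
  proof (rule integral_mono_AE[OF int], unfold Z_def[of "b n", symmetric])
   show "integrable lborel (\<lambda>t. indicator {c<..b n} t * \<kappa> t * Z (b n))"
    using integrable_mult_indicator[OF _ ki, of "{c<..b n}"] by (intro integrable_mult_left) simp
   show "AE t in lborel. indicator {..b n} t * (\<kappa> t * E t) \<le> indicator {c<..b n} t * \<kappa> t * Z (b n)"
    using Ec EZ AE_lborel_singleton[of T] AE_lborel_singleton[of c]
   proof eventually_elim
    case (elim t)
    show ?case
    proof (cases "t \<le> b n \<and> c < t")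
     case True
     then have "E t \<le> Z (b n)" using elim b[of n] Zmono[of t "b n"] by (auto intro: order_trans)
     then show ?thesis using True by (simp add: mult_left_mono k0)
    qed (use elim in \<open>auto simp: indicator_def\<close>)
   qed
  qed
  also have "\<dots> = (LBINT t. indicator {c<..b n} t * \<kappa> t) * Z (b n)" by simp
  also have "\<dots> \<le> 1/2 * Z (b n)" using n Z0 by (intro mult_right_mono) auto
  finally have "b n \<in> S" using Z0[of "b n"] b[of n] by (simp add: S_def)
  then have "b n \<le> c" unfolding c_def by (intro cSup_upper Sb)
  with b[of n] show False by simp
 qed
 then show ?thesis using Ec by simp
qed

lemma sqint_indicator_Icc: "sqint (\<lambda>r::real. indicat_real {a..b} r)"
proof -
 have "integrable lborel (indicat_real {a..b})" by (intro integrable_real_indicator) (auto simp: emeasure_lborel_Icc_eq)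
 moreover have "(indicat_real {a..b} r)^2 = indicat_real {a..b} r" for r by (simp add: indicator_def)
 ultimately show ?thesis by (simp add: sqint_def)
qed

text \<open>A mollification of \<open>y\<close> is a primitive of that of \<open>a\<close> on intervals away from the ends; the mollification is removed first, and
 then the left end of the interval moves to \<open>0\<close>.\<close>

lemma weak_derivative_primitive:
 fixes y a :: "real \<Rightarrow> real"
 assumes wp: "weak_pair {0<..<T} y a" and c: "continuous_on {0<..<T} y" and y0: "(y \<longlongrightarrow> 0) (at_right 0)"
  and a0: "\<And>t. t \<notin> {0<..<T} \<Longrightarrow> a t = 0" and t: "0 < t" "t < T"
 shows "y t = (LBINT s. indicator {..t} s * a s)"
proof -
 have y: "sqint y" and a: "sqint a" using wp by (auto simp: weak_pair_def)
 note [measurable] = sqint_borel[OF y] sqint_borel[OF a]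
 have ct: "isCont y s" if "s \<in> {0<..<T}" for s using c that by (simp add: continuous_on_eq_continuous_at)
 have diff: "y t - y s = (LBINT r. a r * indicator {s..t} r)" if s: "0 < s" "s \<le> t" for s
 proof -
  define d0 where "d0 = min s (T - t) / 2"
  have d0: "d0 > 0" using s t by (simp add: d0_def)
  have sq: "sqint (\<lambda>r. indicat_real {s..t} r)" by (rule sqint_indicator_Icc)
  have L: "((\<lambda>d. std.avg d y t - std.avg d y s) \<longlongrightarrow> y t - y s) (at_right 0)"
   using s t by (intro tendsto_diff std.avg_tendsto_at_continuity_point y ct) auto
  have Rr: "((\<lambda>d. LBINT r. std.avg d a r * indicator {s..t} r) \<longlongrightarrow> (LBINT r. a r * indicator {s..t} r)) (at_right 0)"
   by (rule std.avg_tendsto_inner[OF a sq])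
  have "\<forall>\<^sub>F d in at_right 0. std.avg d y t - std.avg d y s = (LBINT r. std.avg d a r * indicator {s..t} r)"
  proof -
   have "\<forall>\<^sub>F d in at_right 0. d < d0" using d0 by (intro eventually_at_rightI[of 0 d0]) auto
   moreover have "\<forall>\<^sub>F d in at_right 0. (d::real) > 0" by (simp add: eventually_at_filter)
   ultimately show ?thesis
   proof eventually_elim
    case (elim d)
    have der: "(std.avg d y has_vector_derivative std.avg d a r) (at r within {s..t})" if r: "s \<le> r" "r \<le> t" for r
    proof -
     have "cball r d \<subseteq> {0<..<T}" using r elim s t d0_def by (auto simp: dist_real_def)
     from std_avg_has_derivative[OF wp elim(2) this]
     show ?thesis unfolding has_vector_derivative_def by (auto intro: has_derivative_at_withinI)
    qed
    have cont: "continuous_on {s..t} (std.avg d a)"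
     using std_avg_C_k[OF a elim(2), of 0] by (auto intro: continuous_on_subset)
    have "has_bochner_integral lborel (\<lambda>r. indicator {s..t} r *\<^sub>R std.avg d a r) (std.avg d y t - std.avg d y s)"
     by (rule has_bochner_integral_FTC_Icc[OF s(2) der cont])
    then show ?case by (simp add: has_bochner_integral_integral_eq mult.commute)
   qed
  qed
  then have "((\<lambda>d. LBINT r. std.avg d a r * indicator {s..t} r) \<longlongrightarrow> y t - y s) (at_right 0)"
   by (rule Lim_transform_eventually[OF L])
  from tendsto_unique[OF _ this Rr] show ?thesis by simp
 qed
 have sqt: "sqint (\<lambda>r. indicat_real {0..t} r)" by (rule sqint_indicator_Icc)
 have ai: "integrable lborel (\<lambda>r. a r * indicator {0..t} r)" by (rule sqint_mult_integrable[OF a sqt])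
 have "(\<lambda>n. y t - y (t / real (Suc n))) \<longlonglongrightarrow> y t - 0"
 proof (intro tendsto_diff tendsto_const filterlim_compose[OF y0])
  have "(\<lambda>n. t / real (Suc n)) \<longlonglongrightarrow> t * 0" unfolding divide_inverse by (intro tendsto_intros LIMSEQ_inverse_real_of_nat)
  then show "filterlim (\<lambda>n. t / real (Suc n)) (at_right 0) sequentially"
   using t by (auto simp: filterlim_at intro!: always_eventually)
 qed
 moreover have "(\<lambda>n. LBINT r. a r * indicator {t / real (Suc n)..t} r) \<longlonglongrightarrow> (LBINT r. a r * indicator {..t} r)"
 proof (rule integral_dominated_convergence[OF _ _ integrable_abs[OF ai]])
  show "AE r in lborel. norm (a r * indicator {t / real (Suc n)..t} r) \<le> \<bar>a r * indicator {0..t} r\<bar>" for n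
  proof (rule AE_I2)
   fix r
   have "0 \<le> t / real (Suc n)" using t by simp
   then show "norm (a r * indicator {t / real (Suc n)..t} r) \<le> \<bar>a r * indicator {0..t} r\<bar>"
    unfolding indicator_def by (cases "t / real (Suc n) \<le> r") auto
  qed
  show "AE r in lborel. (\<lambda>n. a r * indicator {t / real (Suc n)..t} r) \<longlonglongrightarrow> a r * indicator {..t} r"
  proof (rule AE_I2)
   fix r
   show "(\<lambda>n. a r * indicator {t / real (Suc n)..t} r) \<longlonglongrightarrow> a r * indicator {..t} r"
   proof (cases "r > 0")
    case True
    have "(\<lambda>n. t / real (Suc n)) \<longlonglongrightarrow> t * 0" unfolding divide_inverse by (intro tendsto_intros LIMSEQ_inverse_real_of_nat)
    then have "\<forall>\<^sub>F n in sequentially. t / real (Suc n) < r" using True by (intro order_tendstoD(2)) auto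
    then have "\<forall>\<^sub>F n in sequentially. a r * indicator {..t} r = a r * indicator {t / real (Suc n)..t} r"
     by eventually_elim (auto simp: indicator_def)
    then show ?thesis by (rule Lim_transform_eventually[OF tendsto_const])
   next
    case False then show ?thesis using a0[of r] by simp
   qed
  qed
 qed auto
 moreover have "y t - y (t / real (Suc n)) = (LBINT r. a r * indicator {t / real (Suc n)..t} r)" for n
  using t by (intro diff) (auto simp: divide_simps)
 ultimately have "y t = (LBINT r. a r * indicator {..t} r)" by (simp add: LIMSEQ_unique)
 then show ?thesis by (simp add: mult.commute)
qed

section \<open>Measurability of functions with values in Sobolev spaces\<close>

lemma borel_measurable_AE_lebesgue_on:
 fixes f g :: "real \<Rightarrow> real"
 assumes f: "f \<in> borel_measurable (dtime T)" and ae: "AE t in dtime T. f t = g t"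
 shows "g \<in> borel_measurable (dtime T)"
proof -
 let ?S = "{0<..<T}"
 have S: "?S \<in> sets lebesgue" by simp
 have "(\<lambda>t. if t \<in> ?S then f t else 0) \<in> borel_measurable lebesgue" using f borel_measurable_if[OF S] by blast
 moreover have "AE t in lebesgue. (if t \<in> ?S then f t else 0) = (if t \<in> ?S then g t else 0)"
 proof -
  have "AE t in lebesgue. t \<in> ?S \<longrightarrow> f t = g t" using ae by (subst (asm) AE_restrict_space_iff) auto
  then show ?thesis by eventually_elim simp
 qed
 ultimately have "(\<lambda>t. if t \<in> ?S then g t else 0) \<in> borel_measurable lebesgue" by (rule borel_measurable_AE)
 then show ?thesis using borel_measurable_if[OF S] by blast
qed

lemma simple_limit_measurable:
 fixes F :: "real \<Rightarrow> real"
 assumes s: "\<And>n. simple_function (dtime T) (s n)"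
  and ae: "AE t in dtime T. (\<lambda>n. g (s n t)) \<longlonglongrightarrow> F t"
 shows "F \<in> borel_measurable (dtime T)"
proof (rule borel_measurable_AE_lebesgue_on)
 have "simple_function (dtime T) (\<lambda>t. g (s n t))" for n
  using simple_function_compose[OF s, of g] by (simp add: comp_def)
 then show "(\<lambda>t. lim (\<lambda>n. g (s n t))) \<in> borel_measurable (dtime T)"
  by (intro borel_measurable_lim_metric borel_measurable_simple_function)
 show "AE t in dtime T. lim (\<lambda>n. g (s n t)) = F t"
  using ae by eventually_elim (rule limI)
qed

text \<open>Along the approximating simple functions \<open>F\<close> takes finitely many values, and by the Lipschitz bound these values
 converge to the function in question.\<close>

lemma bochner_measurable_compose2:
 fixes F :: "'b::minus \<Rightarrow> 'c::minus \<Rightarrow> real"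
 assumes u: "bochner_measurable T X N u" and v: "bochner_measurable T Y M v"
  and F: "\<And>x x' y y'. x \<in> X \<Longrightarrow> x' \<in> X \<Longrightarrow> y \<in> Y \<Longrightarrow> y' \<in> Y \<Longrightarrow> \<bar>F x' y' - F x y\<bar> \<le> c * (N (x - x') + M (y - y'))"
 shows "(\<lambda>t. F (u t) (v t)) \<in> borel_measurable (dtime T)"
proof -
 obtain s where s: "\<And>n. simple_function (dtime T) (s n)" "\<And>n. s n ` {0<..<T} \<subseteq> X"
  "AE t in dtime T. (\<lambda>n. N (u t - s n t)) \<longlonglongrightarrow> 0"
  using u unfolding bochner_measurable_def by blast
 obtain r where r: "\<And>n. simple_function (dtime T) (r n)" "\<And>n. r n ` {0<..<T} \<subseteq> Y"
  "AE t in dtime T. (\<lambda>n. M (v t - r n t)) \<longlonglongrightarrow> 0"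
  using v unfolding bochner_measurable_def by blast
 have uX: "AE t in dtime T. u t \<in> X" and vY: "AE t in dtime T. v t \<in> Y"
  using u v by (auto simp: bochner_measurable_def)
 have sp: "AE t in dtime T. t \<in> {0<..<T}" by (rule AE_I2) simp
 have "AE t in dtime T. (\<lambda>n. (\<lambda>p. F (fst p) (snd p)) (s n t, r n t)) \<longlonglongrightarrow> F (u t) (v t)"
  using s(3) r(3) uX vY sp
 proof eventually_elim
  case (elim t)
  have mem: "s n t \<in> X" "r n t \<in> Y" for n using s(2)[of n] r(2)[of n] elim(5) by blast+
  have "(\<lambda>n. F (s n t) (r n t) - F (u t) (v t)) \<longlonglongrightarrow> 0"
  proof (rule tendsto_rabs_zero_cancel, rule tendsto_sandwich[of "\<lambda>_. 0" _ _ "\<lambda>n. c * (N (u t - s n t) + M (v t - r n t))"])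
   have "(\<lambda>n. c * (N (u t - s n t) + M (v t - r n t))) \<longlonglongrightarrow> c * (0 + 0)"
    using elim by (intro tendsto_intros)
   then show "(\<lambda>n. c * (N (u t - s n t) + M (v t - r n t))) \<longlonglongrightarrow> 0" by simp
  qed (use F[OF elim(3) mem(1) elim(4) mem(2)] in auto)
  then show ?case by (simp add: LIM_zero_iff)
 qed
 then show ?thesis by (rule simple_limit_measurable[OF simple_function_Pair[OF s(1) r(1)]])
qed

lemma bochner_measurable_diff:
 fixes u v :: "real \<Rightarrow> 'a \<Rightarrow> 'b::ab_group_add"
 assumes u: "bochner_measurable T X N u" and v: "bochner_measurable T X N v"
  and X: "\<And>x y. x \<in> X \<Longrightarrow> y \<in> X \<Longrightarrow> x - y \<in> X" and N0: "\<And>x. 0 \<le> N x"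
  and N: "\<And>x y. x \<in> X \<Longrightarrow> y \<in> X \<Longrightarrow> N (x - y) \<le> c * (N x + N y)"
 shows "bochner_measurable T X N (\<lambda>t. u t - v t)"
proof -
 obtain s where s: "\<And>n. simple_function (dtime T) (s n)" "\<And>n. s n ` {0<..<T} \<subseteq> X"
  "AE t in dtime T. (\<lambda>n. N (u t - s n t)) \<longlonglongrightarrow> 0"
  using u unfolding bochner_measurable_def by blast
 obtain r where r: "\<And>n. simple_function (dtime T) (r n)" "\<And>n. r n ` {0<..<T} \<subseteq> X"
  "AE t in dtime T. (\<lambda>n. N (v t - r n t)) \<longlonglongrightarrow> 0"
  using v unfolding bochner_measurable_def by blast
 have uX: "AE t in dtime T. u t \<in> X" and vX: "AE t in dtime T. v t \<in> X"
  using u v by (auto simp: bochner_measurable_def)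
 have sp: "AE t in dtime T. t \<in> {0<..<T}" by (rule AE_I2) simp
 have "AE t in dtime T. (\<lambda>n. N ((u t - v t) - (s n t - r n t))) \<longlonglongrightarrow> 0"
  using s(3) r(3) uX vX sp
 proof eventually_elim
  case (elim t)
  have mem: "s n t \<in> X" "r n t \<in> X" for n using s(2)[of n] r(2)[of n] elim(5) by blast+
  show ?case
  proof (rule tendsto_sandwich[of "\<lambda>_. 0" _ _ "\<lambda>n. c * (N (u t - s n t) + N (v t - r n t))"])
   have "(\<lambda>n. c * (N (u t - s n t) + N (v t - r n t))) \<longlonglongrightarrow> c * (0 + 0)"
    using elim by (intro tendsto_intros)
   then show "(\<lambda>n. c * (N (u t - s n t) + N (v t - r n t))) \<longlonglongrightarrow> 0" by simp
   have "(u t - v t) - (s n t - r n t) = (u t - s n t) - (v t - r n t)" for n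
    by (simp add: fun_eq_iff)
   then show "\<forall>\<^sub>F n in sequentially. N ((u t - v t) - (s n t - r n t)) \<le> c * (N (u t - s n t) + N (v t - r n t))"
    using N[OF X[OF elim(3) mem(1)] X[OF elim(4) mem(2)]] by simp
  qed (use N0 in auto)
 qed
 moreover have "simple_function (dtime T) (\<lambda>t. s n t - r n t)" for n
  using simple_function_compose[OF simple_function_Pair[OF s(1) r(1)], of "\<lambda>p. fst p - snd p" n n] by (simp add: comp_def)
 moreover have "(\<lambda>t. s n t - r n t) ` {0<..<T} \<subseteq> X" for n using s(2)[of n] r(2)[of n] X by blast
 moreover have "AE t in dtime T. u t - v t \<in> X" using uX vX by eventually_elim (rule X)
 ultimately show ?thesis unfolding bochner_measurable_def
  by (intro conjI exI[of _ "\<lambda>n t. s n t - r n t"]) auto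
qed

lemma bochner_measurable_simple:
 assumes "simple_function (dtime T) s" "s ` {0<..<T} \<subseteq> X" "\<And>x. x \<in> X \<Longrightarrow> N (x - x) = 0"
 shows "bochner_measurable T X N s"
proof -
 have "s t \<in> X" if "t \<in> {0<..<T}" for t using assms(2) that by blast
 then have "AE t in dtime T. s t \<in> X" and "AE t in dtime T. (\<lambda>n. N (s t - s t)) \<longlonglongrightarrow> 0"
  using assms(3) by (auto intro!: AE_I2)
 then show ?thesis unfolding bochner_measurable_def using assms by (intro conjI exI[of _ "\<lambda>_. s"]) auto
qed

lemma fun_diff_eq: "f - g = (\<lambda>x. f x - g x)"
 by (rule ext) simp

lemma H1_norm_ge:
 "L2_norm U u \<le> H1_norm U u" "L2_norm U (grad U u) \<le> H1_norm U u"
 unfolding H1_norm_def by (rule real_le_rsqrt, simp)+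

lemma H1_norm_le: "H1_norm U u \<le> L2_norm U u + L2_norm U (grad U u)"
 unfolding H1_norm_def
 by (rule real_le_lsqrt) (auto simp: power2_sum L2_norm_nonneg intro!: add_nonneg_nonneg)

lemma H1_norm_nonneg: "0 \<le> H1_norm U u"
 by (simp add: H1_norm_def)

lemma H1_diff: "open U \<Longrightarrow> u \<in> H1 U \<Longrightarrow> v \<in> H1 U \<Longrightarrow> u - v \<in> H1 U"
 unfolding fun_diff_eq by (rule has_grad_H1[OF has_grad_diff[OF _ has_grad_grad has_grad_grad]]) auto

lemma grad_diff_AE:
 "open U \<Longrightarrow> u \<in> H1 U \<Longrightarrow> v \<in> H1 U \<Longrightarrow> AE x in lebesgue_on U. grad U (u - v) x = grad U u x - grad U v x"
 unfolding fun_diff_eq by (rule grad_AE[OF _ has_grad_diff[OF _ has_grad_grad has_grad_grad]]) auto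

lemma L2_norm_grad_diff:
 assumes "open U" "u \<in> H1 U" "v \<in> H1 U"
 shows "L2_norm U (grad U (u - v)) = L2_norm U (\<lambda>x. grad U u x - grad U v x)"
 using assms by (intro L2_norm_cong_AE grad_diff_AE L2_diff grad_H1 H1_diff) auto

lemma H1_norm_diff_le:
 assumes U: "open U" and u: "u \<in> H1 U" and v: "v \<in> H1 U"
 shows "H1_norm U (u - v) \<le> 2 * (H1_norm U u + H1_norm U v)"
proof -
 have arith: "x \<le> a + b \<Longrightarrow> a \<le> c + d \<Longrightarrow> b \<le> e + f \<Longrightarrow> c \<le> J \<Longrightarrow> e \<le> J \<Longrightarrow> d \<le> V \<Longrightarrow> f \<le> V \<Longrightarrow> x \<le> 2 * (J + V)"
  for x a b c d e f J V :: real
 proof -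
  assume h: "x \<le> a + b" "a \<le> c + d" "b \<le> e + f" "c \<le> J" "e \<le> J" "d \<le> V" "f \<le> V"
  have "a \<le> J + V" "b \<le> J + V" using h(2-) by linarith+
  then show "x \<le> 2 * (J + V)" using h(1) by simp
 qed
 have "H1_norm U (u - v) \<le> L2_norm U (u - v) + L2_norm U (grad U (u - v))" by (rule H1_norm_le)
 moreover have "L2_norm U (u - v) \<le> L2_norm U u + L2_norm U v"
  unfolding fun_diff_eq using u v by (intro L2_norm_diff_triangle) (auto simp: H1_def)
 moreover have "L2_norm U (grad U (u - v)) \<le> L2_norm U (grad U u) + L2_norm U (grad U v)"
  unfolding L2_norm_grad_diff[OF assms] using u v by (intro L2_norm_diff_triangle grad_H1)
 ultimately show ?thesis by (rule arith) (rule H1_norm_ge)+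
qed

lemma bochner_H1_L2:
 assumes "bochner_measurable T (H1 U) (H1_norm U) u"
 shows "bochner_measurable T (L2 U) (L2_norm U) u"
proof -
 obtain s where s: "\<And>n. simple_function (dtime T) (s n)" "\<And>n. s n ` {0<..<T} \<subseteq> H1 U"
  "AE t in dtime T. (\<lambda>n. H1_norm U (u t - s n t)) \<longlonglongrightarrow> 0" and X: "AE t in dtime T. u t \<in> H1 U"
  using assms unfolding bochner_measurable_def by blast
 have "AE t in dtime T. (\<lambda>n. L2_norm U (u t - s n t)) \<longlonglongrightarrow> 0"
  using s(3)
 proof eventually_elim
  case (elim t)
  then show ?case
   by (rule tendsto_sandwich[OF always_eventually always_eventually tendsto_const, rotated 2]) (auto simp: L2_norm_nonneg H1_norm_ge)
 qed
 moreover have "AE t in dtime T. u t \<in> L2 U" using X by eventually_elim (simp add: H1_def)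
 moreover have "s n ` {0<..<T} \<subseteq> L2 U" for n using s(2)[of n] by (auto simp: H1_def)
 ultimately show ?thesis using s(1) unfolding bochner_measurable_def by blast
qed

lemma bochner_H1_grad:
 assumes U: "open U" and u: "bochner_measurable T (H1 U) (H1_norm U) u"
 shows "bochner_measurable T (L2 U) (L2_norm U) (\<lambda>t. grad U (u t))"
proof -
 obtain s where s: "\<And>n. simple_function (dtime T) (s n)" "\<And>n. s n ` {0<..<T} \<subseteq> H1 U"
  "AE t in dtime T. (\<lambda>n. H1_norm U (u t - s n t)) \<longlonglongrightarrow> 0" and X: "AE t in dtime T. u t \<in> H1 U"
  using u unfolding bochner_measurable_def by blast
 have sp: "AE t in dtime T. t \<in> {0<..<T}" by (rule AE_I2) simp
 have "AE t in dtime T. (\<lambda>n. L2_norm U (grad U (u t) - grad U (s n t))) \<longlonglongrightarrow> 0"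
  using s(3) X sp
 proof eventually_elim
  case (elim t)
  have "s n t \<in> H1 U" for n using s(2)[of n] elim(3) by blast
  then have "L2_norm U (grad U (u t) - grad U (s n t)) = L2_norm U (grad U (u t - s n t))" for n
   using elim(2) unfolding fun_diff_eq[of "grad U (u t)"] by (simp add: L2_norm_grad_diff[OF U])
  then show ?case
   by (simp only:) (rule tendsto_sandwich[OF always_eventually always_eventually tendsto_const elim(1)], auto simp: L2_norm_nonneg H1_norm_ge)
 qed
 moreover have "AE t in dtime T. grad U (u t) \<in> L2 U" using X by eventually_elim (rule grad_H1)
 moreover have "(\<lambda>t. grad U (s n t)) ` {0<..<T} \<subseteq> L2 U" for n using s(2)[of n] grad_H1(1) by blast
 moreover have "simple_function (dtime T) (\<lambda>t. grad U (s n t))" for n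
  using simple_function_compose[OF s(1), of "grad U" n] by (simp add: comp_def)
 ultimately show ?thesis unfolding bochner_measurable_def
  by (intro conjI exI[of _ "\<lambda>n t. grad U (s n t)"]) auto
qed

lemma L2_norm_diff_measurable:
 fixes u v :: "real \<Rightarrow> 'a::euclidean_space \<Rightarrow> 'b::euclidean_space"
 assumes u: "bochner_measurable T (L2 U) (L2_norm U) u" and v: "bochner_measurable T (L2 U) (L2_norm U) v"
 shows "(\<lambda>t. L2_norm U (\<lambda>x. u t x - v t x)) \<in> borel_measurable (dtime T)"
proof (rule bochner_measurable_compose2[OF u v, of "\<lambda>f g. L2_norm U (\<lambda>x. f x - g x)" 1])
 have le: "L2_norm U (\<lambda>x. f x - g x) \<le> L2_norm U (\<lambda>x. f' x - g' x) + (L2_norm U (f - f') + L2_norm U (g - g'))"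
  if "f \<in> L2 U" "f' \<in> L2 U" "g \<in> L2 U" "g' \<in> L2 U" for f f' g g' :: "'a \<Rightarrow> 'b"
 proof -
  have e: "f x - g x = (f' x - g' x) + ((f x - f' x) - (g x - g' x))" for x by simp
  have "L2_norm U (\<lambda>x. (f' x - g' x) + ((f x - f' x) - (g x - g' x))) \<le> L2_norm U (\<lambda>x. f' x - g' x) + L2_norm U (\<lambda>x. (f x - f' x) - (g x - g' x))"
   by (intro L2_norm_triangle L2_diff that)
  moreover have "L2_norm U (\<lambda>x. (f x - f' x) - (g x - g' x)) \<le> L2_norm U (\<lambda>x. f x - f' x) + L2_norm U (\<lambda>x. g x - g' x)"
   by (intro L2_norm_diff_triangle L2_diff that)
  ultimately show ?thesis unfolding fun_diff_eq e[symmetric] by linarith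
 qed
 show "\<bar>L2_norm U (\<lambda>x. f' x - g' x) - L2_norm U (\<lambda>x. f x - g x)\<bar> \<le> 1 * (L2_norm U (f - f') + L2_norm U (g - g'))"
  if "f \<in> L2 U" "f' \<in> L2 U" "g \<in> L2 U" "g' \<in> L2 U" for f f' g g' :: "'a \<Rightarrow> 'b"
 proof -
  note l = le[OF that(1,2,3,4)] le[OF that(2,1,4,3)]
  show ?thesis using l unfolding fun_diff_eq L2_norm_diff_commute[of U f' f] L2_norm_diff_commute[of U g' g]
   by (simp add: abs_le_iff)
 qed
qed

lemma L2_norm_measurable:
 fixes u :: "real \<Rightarrow> 'a::euclidean_space \<Rightarrow> 'b::euclidean_space"
 assumes u: "bochner_measurable T (L2 U) (L2_norm U) u"
 shows "(\<lambda>t. L2_norm U (u t)) \<in> borel_measurable (dtime T)"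
proof -
 have "bochner_measurable T (L2 U) (L2_norm U) (\<lambda>t x. 0::'b)"
  by (rule bochner_measurable_simple) (auto simp: fun_diff_eq)
 from L2_norm_diff_measurable[OF u this] show ?thesis by simp
qed

lemma bochner_H1_diff:
 assumes "open U" "bochner_measurable T (H1 U) (H1_norm U) u" "bochner_measurable T (H1 U) (H1_norm U) v"
 shows "bochner_measurable T (H1 U) (H1_norm U) (\<lambda>t. u t - v t)"
 by (rule bochner_measurable_diff[OF assms(2,3) H1_diff[OF assms(1)] H1_norm_nonneg H1_norm_diff_le[OF assms(1)]])

section \<open>The dual norm\<close>

lemma H1_cmult: "open U \<Longrightarrow> u \<in> H1 U \<Longrightarrow> (\<lambda>x. c * u x) \<in> H1 U"
 by (rule has_grad_H1[OF has_grad_cmult[OF _ has_grad_grad]]) auto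

lemma H1_norm_cmult:
 assumes U: "open U" and u: "u \<in> H1 U"
 shows "H1_norm U (\<lambda>x. c * u x) = \<bar>c\<bar> * H1_norm U u"
proof -
 have Ub: "U \<in> sets borel" using U by simp
 have "L2_norm U (grad U (\<lambda>x. c * u x)) = L2_norm U (\<lambda>x. c *\<^sub>R grad U u x)"
  by (intro L2_norm_cong_AE grad_AE[OF U has_grad_cmult[OF Ub has_grad_grad[OF u]]] grad_H1 H1_cmult U u L2_scaleR)
 then have "L2_norm U (grad U (\<lambda>x. c * u x)) = \<bar>c\<bar> * L2_norm U (grad U u)" by (simp add: L2_norm_scaleR)
 moreover have "L2_norm U (\<lambda>x. c * u x) = \<bar>c\<bar> * L2_norm U u" using L2_norm_scaleR[of U c u] by simp
 ultimately have "H1_norm U (\<lambda>x. c * u x) = sqrt (\<bar>c\<bar>^2 * ((L2_norm U u)^2 + (L2_norm U (grad U u))^2))"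
  unfolding H1_norm_def by (simp only: power_mult_distrib distrib_left)
 also have "\<dots> = \<bar>c\<bar> * H1_norm U u" unfolding H1_norm_def by (simp add: real_sqrt_mult)
 finally show ?thesis .
qed

lemma H1_dual_cmult:
 assumes "l \<in> H1_dual U" "u \<in> H1 U" shows "l (\<lambda>x. c * u x) = c * l u"
proof -
 have "l (\<lambda>x. c * u x + 0 * u x) = c * l u + 0 * l u" using assms unfolding H1_dual_def by blast
 then show ?thesis by simp
qed

text \<open>An element of positive norm is scaled to the unit ball, over which the dual norm is a supremum; at an element of norm zero
 \<open>l\<close> vanishes by boundedness.\<close>

lemma H1_dual_bound:
 assumes U: "open U" and l: "l \<in> H1_dual U" and u: "u \<in> H1 U"
 shows "\<bar>l u\<bar> \<le> H1_dual_norm U l * H1_norm U u"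
proof -
 obtain C where C: "\<And>u. u \<in> H1 U \<Longrightarrow> \<bar>l u\<bar> \<le> C * H1_norm U u" using l unfolding H1_dual_def by blast
 show ?thesis
 proof (cases "H1_norm U u = 0")
  case True
  then show ?thesis using C[OF u] by simp
 next
  case False
  then have n: "H1_norm U u > 0" using H1_norm_nonneg[of U u] by linarith
  define c where "c = 1 / H1_norm U u"
  have bdd: "bdd_above ((\<lambda>u. \<bar>l u\<bar>) ` {u \<in> H1 U. H1_norm U u \<le> 1})"
  proof (rule bdd_aboveI)
   fix r assume "r \<in> (\<lambda>u. \<bar>l u\<bar>) ` {u \<in> H1 U. H1_norm U u \<le> 1}"
   then obtain v where v: "v \<in> H1 U" "H1_norm U v \<le> 1" "r = \<bar>l v\<bar>" by blast
   have "C * H1_norm U v \<le> \<bar>C\<bar> * 1" using v H1_norm_nonneg[of U v] by (intro mult_mono) auto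
   then show "r \<le> \<bar>C\<bar>" using C[OF v(1)] v(3) by simp
  qed
  have "(\<lambda>x. c * u x) \<in> {u \<in> H1 U. H1_norm U u \<le> 1}"
   using n H1_cmult[OF U u, of c] H1_norm_cmult[OF U u, of c] by (simp add: c_def)
  then have "\<bar>l (\<lambda>x. c * u x)\<bar> \<le> H1_dual_norm U l"
   unfolding H1_dual_norm_def by (intro cSUP_upper bdd)
  then have "\<bar>c\<bar> * \<bar>l u\<bar> \<le> H1_dual_norm U l" by (simp add: H1_dual_cmult[OF l u] abs_mult)
  then show ?thesis using n by (simp add: c_def field_simps)
 qed
qed

lemma H1_dual_diff:
 assumes "l \<in> H1_dual U" "m \<in> H1_dual U" shows "l - m \<in> H1_dual U"
proof -
 obtain C where C: "\<And>u. u \<in> H1 U \<Longrightarrow> \<bar>l u\<bar> \<le> C * H1_norm U u" using assms unfolding H1_dual_def by blast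
 obtain B where B: "\<And>u. u \<in> H1 U \<Longrightarrow> \<bar>m u\<bar> \<le> B * H1_norm U u" using assms unfolding H1_dual_def by blast
 have "\<bar>(l - m) u\<bar> \<le> (C + B) * H1_norm U u" if "u \<in> H1 U" for u
  using C[OF that] B[OF that] by (simp add: distrib_right)
 moreover have "(l - m) (\<lambda>x. a * u x + b * v x) = a * (l - m) u + b * (l - m) v" if "u \<in> H1 U" "v \<in> H1 U" for u v a b
 proof -
  have "l (\<lambda>x. a * u x + b * v x) = a * l u + b * l v" "m (\<lambda>x. a * u x + b * v x) = a * m u + b * m v"
   using assms that unfolding H1_dual_def by blast+
  then show ?thesis by (simp add: algebra_simps)
 qed
 ultimately show ?thesis unfolding H1_dual_def by blast
qed

lemma bochner_dual_measurable:
 assumes U: "open U" and l: "bochner_measurable T (H1_dual U) (H1_dual_norm U) l" and v: "v \<in> H1 U"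
 shows "(\<lambda>t. l t v) \<in> borel_measurable (dtime T)"
proof (rule bochner_measurable_compose2[OF l l, of "\<lambda>f g. f v" "H1_norm U v"])
 fix f f' g g' assume m: "f \<in> H1_dual U" "f' \<in> H1_dual U" "g \<in> H1_dual U" "g' \<in> H1_dual U"
 have "\<bar>(f - f') v\<bar> \<le> H1_dual_norm U (f - f') * H1_norm U v" by (rule H1_dual_bound[OF U H1_dual_diff[OF m(1,2)] v])
 moreover have "0 \<le> H1_dual_norm U (g - g') * H1_norm U v"
  using H1_dual_bound[OF U H1_dual_diff[OF m(3,4)] v] by (meson abs_ge_zero order_trans)
 ultimately show "\<bar>f' v - f v\<bar> \<le> H1_norm U v * (H1_dual_norm U (f - f') + H1_dual_norm U (g - g'))"
  by (simp add: distrib_left mult.commute abs_minus_commute)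
qed

section \<open>Increments in time\<close>

lemma test_function_deriv:
 fixes \<eta> :: "real \<Rightarrow> real"
 assumes \<eta>: "test_function S \<eta>"
 shows "fdiff \<eta> t 1 = deriv \<eta> t" and "test_function S (deriv \<eta>)"
proof -
 have d: "fdiff \<eta> t 1 = deriv \<eta> t" for t
 proof -
  have D: "(\<eta> has_derivative fdiff \<eta> t) (at t)" by (rule test_function_has_derivative[OF \<eta>])
  have "fdiff \<eta> t h = fdiff \<eta> t 1 * h" for h
   using linear_scale[OF has_derivative_linear[OF D], of h 1] by simp
  then have "fdiff \<eta> t = (\<lambda>h. fdiff \<eta> t 1 * h)" by (rule ext)
  from has_derivative_eq_rhs[OF D this]
  have "(\<eta> has_real_derivative fdiff \<eta> t 1) (at t)" by (simp add: has_field_derivative_def)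
  then show ?thesis by (rule DERIV_imp_deriv[symmetric])
 qed
 then show "fdiff \<eta> t 1 = deriv \<eta> t" .
 show "test_function S (deriv \<eta>)" using test_function_partial[OF \<eta>, of 1] by (simp add: d)
qed

text \<open>The zero value of \<open>y\<close> before time \<open>0\<close> fits the initial value, so that \<open>y\<close> is the primitive of \<open>a\<close>, extended by
 zero, also on intervals \<open>[t - h, t]\<close> that begin before \<open>0\<close>.\<close>

lemma increment_from_weak_derivative:
 fixes y b N :: "real \<Rightarrow> real"
 assumes T: "0 < T" and y: "continuous_on {0..T} y" "y 0 = 0"
  and b: "b \<in> borel_measurable (dtime T)" and N: "rep {0<..<T} N N'" "sqint N'"
  and bN: "AE t in dtime T. \<bar>b t\<bar> \<le> N t * c" and c: "0 \<le> c"
  and wd: "\<And>\<eta>. test_function {0<..<T} \<eta> \<Longrightarrow>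
    (LINT t|dtime T. b t * \<eta> t) = - (LINT t|dtime T. y t * deriv \<eta> t)"
 shows "\<exists>a. rep {0<..<T} b a \<and> sqint a \<and> (\<forall>t h. 0 < t \<longrightarrow> t < T \<longrightarrow> 0 < h \<longrightarrow>
   y t - (if t - h \<le> 0 then 0 else y (t - h)) = h * bk.avg h a t \<and>
   \<bar>y t - (if t - h \<le> 0 then 0 else y (t - h))\<bar> \<le> h * bk.avg h N' t * c)"
proof -
 let ?S = "{0<..<T}"
 have S: "?S \<in> sets borel" "open ?S" by auto
 obtain a where a: "rep ?S b a" using rep_exists_real[OF S(1) b] by blast
 define y' where "y' t = indicator ?S t * y t" for t
 have cont: "continuous_on ?S y" by (rule continuous_on_subset[OF y(1)]) auto
 have y'b [measurable]: "y' \<in> borel_measurable borel"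
 proof -
  have "(\<lambda>t. indicator ?S t *\<^sub>R y t) \<in> borel_measurable borel"
   by (rule borel_measurable_continuous_on_indicator[OF _ cont]) simp
  then show ?thesis by (simp add: y'_def[abs_def])
 qed
 have ry: "rep ?S y y'"
 proof -
  have "y \<in> borel_measurable (lebesgue_on ?S)"
   by (rule continuous_imp_measurable_on_sets_lebesgue[OF cont]) simp
  then show ?thesis unfolding rep_def by (auto simp: y'_def intro!: AE_I2)
 qed
 have a': "AE t in lborel. t \<in> ?S \<longrightarrow> b t = a t" and N': "AE t in lborel. t \<in> ?S \<longrightarrow> N t = N' t"
  using a N(1) unfolding rep_def AE_lebesgue_on_iff[OF S(1)] by auto
 have a0: "a t = 0" "N' t = 0" if "t \<notin> ?S" for t using a N(1) that by (auto simp: rep_def)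
 have aN: "AE t in lborel. \<bar>a t\<bar> \<le> c * N' t"
  using a' N' bN[unfolded AE_lebesgue_on_iff[OF S(1)]]
 proof eventually_elim
  case (elim t)
  then show ?case using a0[of t] by (cases "t \<in> ?S") (auto simp: mult.commute)
 qed
 have ab [measurable]: "a \<in> borel_measurable borel" using a by (simp add: rep_def)
 note Nb [measurable] = sqint_borel[OF N(2)]
 have sa: "sqint a"
 proof -
  have "integrable lborel (\<lambda>t. (a t)^2)"
  proof (rule Bochner_Integration.integrable_bound[OF sqint_integrable[OF sqint_cmult[OF N(2), of c]]])
   show "AE t in lborel. norm ((a t)^2) \<le> norm ((c * N' t)^2)"
    using aN by eventually_elim (simp add: abs_le_square_iff[symmetric] order_trans[OF _ abs_ge_self])
  qed measurable
  then show ?thesis by (simp add: sqint_def)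
 qed
 obtain B where B: "\<And>t. t \<in> {0..T} \<Longrightarrow> \<bar>y t\<bar> \<le> B"
 proof -
  have "bounded (y ` {0..T})" by (intro compact_imp_bounded compact_continuous_image y) simp
  then show thesis using that unfolding bounded_iff by (metis image_eqI real_norm_def)
 qed
 have sy: "sqint y'"
 proof -
  have "integrable lborel (\<lambda>t. (y' t)^2)"
  proof (rule Bochner_Integration.integrable_bound[OF sqint_integrable[OF sqint_cmult[OF sqint_indicator_Icc[of 0 T], of B]]])
   show "AE t in lborel. norm ((y' t)^2) \<le> norm ((B * indicator {0..T} t)^2)"
    using B by (intro AE_I2) (auto simp: y'_def indicator_def abs_le_square_iff[symmetric] intro: order_trans[OF _ abs_ge_self])
  qed measurable
  then show ?thesis by (simp add: sqint_def)
 qed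
 have wp: "weak_pair ?S y' a"
  unfolding weak_pair_def
 proof (intro conjI ballI allI impI)
  fix \<eta> :: "real \<Rightarrow> real" and i :: real assume \<eta>: "test_function ?S \<eta>" and i: "i \<in> Basis"
  have i1: "i = 1" using i by simp
  note d = test_function_deriv(1)[OF \<eta>]
  have m: "\<eta> \<in> borel_measurable borel" "(\<lambda>t. deriv \<eta> t) \<in> borel_measurable borel"
   using test_function_borel[OF \<eta>] test_function_borel[OF test_function_deriv(2)[OF \<eta>]] by auto
  have "(LINT t|lebesgue_on ?S. b t * \<eta> t) = (LBINT t. a t * \<eta> t)"
   by (rule rep_integral(1)[OF S(1) rep_mult_borel[OF a m(1)]])
  moreover have "(LINT t|lebesgue_on ?S. y t * deriv \<eta> t) = (LBINT t. y' t * deriv \<eta> t)"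
   by (rule rep_integral(1)[OF S(1) rep_mult_borel[OF ry m(2)]])
  ultimately show "(LBINT t. y' t * fdiff \<eta> t i) = - (LBINT t. (a t \<bullet> i) * \<eta> t)"
   using wd[OF \<eta>] by (simp add: i1 d)
 qed (use sy sa in auto)
 have cy': "continuous_on ?S y'" using cont by (rule continuous_on_cong[THEN iffD1, rotated -1]) (auto simp: y'_def)
 have y'0: "(y' \<longlongrightarrow> 0) (at_right 0)"
 proof -
  have "0 \<in> {0..T}" using T by simp
  then have "(y \<longlongrightarrow> y 0) (at 0 within {0..T})" using y(1) unfolding continuous_on_def by blast
  then have "(y \<longlongrightarrow> 0) (at 0 within {0..T})" unfolding y(2) .
  then have "(y \<longlongrightarrow> 0) (at_right 0)" using T by (simp add: at_within_Icc_at_right)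
  moreover have "\<forall>\<^sub>F t in at_right 0. y t = y' t"
   using T by (intro eventually_at_rightI[of 0 T]) (auto simp: y'_def)
  ultimately show ?thesis by (rule Lim_transform_eventually)
 qed
 have prim: "(if t \<le> 0 then 0 else y t) = (LBINT s. indicator {..t} s * a s)" if "t < T" for t
 proof (cases "t \<le> 0")
  case True
  have "(\<lambda>s. indicator {..t} s * a s) = (\<lambda>s. 0)" using True a0 by (auto simp: indicator_def)
  then show ?thesis using True by (simp only: Bochner_Integration.integral_zero if_True)
 next
  case False
  then show ?thesis using weak_derivative_primitive[OF wp cy' y'0 a0(1), of t] that by (simp add: y'_def)
 qed
 have ai: "integrable lborel a"
 proof -
  have "integrable lborel (\<lambda>t. a t * indicator {0..T} t)" by (rule sqint_mult_integrable[OF sa sqint_indicator_Icc])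
  moreover have "a t * indicator {0..T} t = a t" for t using a0(1)[of t] by (cases "t \<in> {0<..<T}") auto
  ultimately show ?thesis by simp
 qed
 have ii: "integrable lborel (\<lambda>s. indicator X s * a s)" if "X \<in> sets borel" for X
  using integrable_mult_indicator[OF _ ai, of X] that by simp
 have inc: "y t - (if t - h \<le> 0 then 0 else y (t - h)) = h * bk.avg h a t" if t: "0 < t" "t < T" and h: "0 < h" for t h
 proof -
  have "y t - (if t - h \<le> 0 then 0 else y (t - h)) = (LBINT s. indicator {..t} s * a s) - (LBINT s. indicator {..t - h} s * a s)"
   using prim[of t] prim[of "t - h"] t h by simp
  also have "\<dots> = (LBINT s. indicator {..t} s * a s - indicator {..t - h} s * a s)"
   by (rule Bochner_Integration.integral_diff[symmetric]) (auto intro: ii)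
  also have "\<dots> = (LBINT s. indicator {t - h..t} s * a s)"
  proof (rule integral_cong_AE)
   have "AE s in lborel. s \<noteq> t - h" by (rule AE_lborel_singleton)
   then show "AE s in lborel. indicator {..t} s * a s - indicator {..t - h} s * a s = indicator {t - h..t} s * a s"
    by eventually_elim (use h in \<open>auto simp: indicator_def\<close>)
  qed measurable
  also have "\<dots> = h * bk.avg h a t" by (rule back_avg_eq[symmetric, OF _ h]) measurable
  finally show ?thesis .
 qed
 have bd: "\<bar>h * bk.avg h a t\<bar> \<le> h * bk.avg h N' t * c" if h: "0 < h" for t h
 proof -
  have sq: "sqint (\<lambda>s. indicat_real {t - h..t} s)" by (rule sqint_indicator_Icc)
  have "\<bar>h * bk.avg h a t\<bar> = \<bar>(LBINT s. indicator {t - h..t} s * a s)\<bar>" by (subst back_avg_eq[OF ab h]) simp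
  also have "\<dots> \<le> (LBINT s. \<bar>indicator {t - h..t} s * a s\<bar>)" by (rule integral_abs_bound)
  also have "\<dots> \<le> (LBINT s. c * (indicator {t - h..t} s * N' s))"
  proof (rule integral_mono_AE)
   show "integrable lborel (\<lambda>s. \<bar>indicator {t - h..t} s * a s\<bar>)" by (intro integrable_abs ii) simp
   show "integrable lborel (\<lambda>s. c * (indicator {t - h..t} s * N' s))"
    by (intro integrable_mult_right sqint_mult_integrable sq N)
   show "AE s in lborel. \<bar>indicator {t - h..t} s * a s\<bar> \<le> c * (indicator {t - h..t} s * N' s)"
    using aN by eventually_elim (auto simp: indicator_def)
  qed
  also have "\<dots> = c * (LBINT s. indicator {t - h..t} s * N' s)" by simp
  also have "\<dots> = c * (h * bk.avg h N' t)" by (subst back_avg_eq[OF Nb h]) simp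
  finally show ?thesis by (simp add: mult_ac)
 qed
 show ?thesis
  using a sa inc bd by (intro exI[of _ a]) simp
qed

section \<open>The energy of the difference of two solutions\<close>

lemma half_square_increment:
 assumes f: "f \<in> L2 U" and g: "g \<in> L2 U"
 shows "(L2_norm U f)^2 / 2 - (L2_norm U g)^2 / 2 \<le> L2_inner U f (\<lambda>x. f x - g x)"
proof -
 have d: "(\<lambda>x. f x - g x) \<in> L2 U" by (rule L2_diff[OF f g])
 have "0 \<le> L2_inner U (\<lambda>x. f x - g x) (\<lambda>x. f x - g x)" by (simp add: L2_inner_self)
 also have "\<dots> = L2_inner U f f - L2_inner U f g - (L2_inner U g f - L2_inner U g g)"
  by (simp only: L2_inner_diff_left[OF f g d] L2_inner_diff_right[OF f g f] L2_inner_diff_right[OF f g g])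
 finally have "2 * L2_inner U f g \<le> L2_inner U f f + L2_inner U g g"
  by (simp add: L2_inner_commute[of U g f])
 moreover have "L2_inner U f (\<lambda>x. f x - g x) = L2_inner U f f - L2_inner U f g" by (rule L2_inner_diff_right[OF f g f])
 ultimately show ?thesis by (simp add: L2_inner_self)
qed

text \<open>A convex function lies above its tangents, and \<open>z + w\<close> is the derivative of the energy at \<open>w\<close>.\<close>

lemma energy_increment:
 assumes U: "open U" and \<epsilon>: "0 < \<epsilon>" and w: "has_grad U w W" and v: "has_grad U v V" and z: "z \<in> L2 U"
  and eq: "\<And>\<psi> \<Psi>. has_grad U \<psi> \<Psi> \<Longrightarrow> L2_inner U z \<psi> = \<epsilon> * L2_inner U W \<Psi>"
 shows "\<epsilon> / 2 * (L2_norm U W)^2 + (L2_norm U w)^2 / 2 - (\<epsilon> / 2 * (L2_norm U V)^2 + (L2_norm U v)^2 / 2)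
  \<le> L2_inner U (\<lambda>x. w x - v x) (\<lambda>x. z x + w x)"
proof -
 have l2: "w \<in> L2 U" "W \<in> L2 U" "v \<in> L2 U" "V \<in> L2 U" using w v by (auto simp: has_grad_def)
 have d: "has_grad U (\<lambda>x. w x - v x) (\<lambda>x. W x - V x)" using U by (intro has_grad_diff w v) auto
 then have dl: "(\<lambda>x. w x - v x) \<in> L2 U" by (simp add: has_grad_def)
 have "L2_inner U (\<lambda>x. w x - v x) (\<lambda>x. z x + w x) = L2_inner U (\<lambda>x. w x - v x) z + L2_inner U (\<lambda>x. w x - v x) w"
  by (rule L2_inner_add_right[OF z l2(1) dl])
 also have "L2_inner U (\<lambda>x. w x - v x) z = \<epsilon> * L2_inner U W (\<lambda>x. W x - V x)"
  using eq[OF d] by (simp add: L2_inner_commute)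
 also have "L2_inner U (\<lambda>x. w x - v x) w = L2_inner U w (\<lambda>x. w x - v x)" by (rule L2_inner_commute)
 finally have e: "L2_inner U (\<lambda>x. w x - v x) (\<lambda>x. z x + w x) = \<epsilon> * L2_inner U W (\<lambda>x. W x - V x) + L2_inner U w (\<lambda>x. w x - v x)" .
 have "\<epsilon> * ((L2_norm U W)^2 / 2 - (L2_norm U V)^2 / 2) \<le> \<epsilon> * L2_inner U W (\<lambda>x. W x - V x)"
  using \<epsilon> by (intro mult_left_mono half_square_increment l2) auto
 then show ?thesis using half_square_increment[OF l2(1,3)] unfolding e by (simp add: right_diff_distrib)
qed

lemma rep_nonneg_exists:
 fixes f :: "real \<Rightarrow> real"
 assumes f: "f \<in> borel_measurable (dtime T)" and f0: "AE t in dtime T. 0 \<le> f t"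
 obtains f' where "rep {0<..<T} f f'" "\<And>t. 0 \<le> f' t"
proof -
 have S: "{0<..<T} \<in> sets borel" by simp
 obtain g where g: "rep {0<..<T} f g" using rep_exists_real[OF S f] by blast
 have "rep {0<..<T} (\<lambda>t. max 0 (f t)) (\<lambda>t. max 0 (g t))" by (rule rep_compose[OF g]) auto
 moreover have "AE t in dtime T. max 0 (f t) = f t" using f0 by eventually_elim simp
 ultimately have "rep {0<..<T} f (\<lambda>t. max 0 (g t))" using f unfolding rep_def by auto
 then show ?thesis by (rule that) simp
qed

text \<open>An abstract form of the difference of two solutions: \<open>w\<close> is the difference of the phase fields, continuous in time, \<open>W\<close> its
 gradient, \<open>D\<close> its time derivative, \<open>m\<close> the difference of the potentials and \<open>z\<close> stands for \<open>- \<epsilon> \<Delta>w\<close>, with gradient \<open>Z\<close>. The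
 test function \<open>z + w\<close> is \<open>m\<close> up to a part whose gradient is bounded by \<open>L\<close>, and pairing that part with \<open>D\<close> costs \<open>N L\<close>.\<close>

locale difference_evolution =
 fixes U :: "'a::euclidean_space set" and T \<epsilon> B :: real
  and w m z :: "real \<Rightarrow> 'a \<Rightarrow> real" and W Z :: "real \<Rightarrow> 'a \<Rightarrow> 'a"
  and D :: "real \<Rightarrow> ('a \<Rightarrow> real) \<Rightarrow> real" and N L \<kappa> E :: "real \<Rightarrow> real"
 assumes U: "open U" and T: "0 < T" and \<epsilon>: "0 < \<epsilon>" and B: "0 \<le> B"
  and w_L2: "\<And>t. t \<in> {0..T} \<Longrightarrow> w t \<in> L2 U"
  and w_continuous: "\<And>t. t \<in> {0..T} \<Longrightarrow> ((\<lambda>s. L2_norm U (\<lambda>x. w s x - w t x)) \<longlongrightarrow> 0) (at t within {0..T})"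
  and w_initial: "AE x in lebesgue_on U. w 0 x = 0"
  and m_measurable: "bochner_measurable T (H1 U) (H1_norm U) m"
  and D_measurable: "\<And>\<nu>. \<nu> \<in> H1 U \<Longrightarrow> (\<lambda>t. D t \<nu>) \<in> borel_measurable (dtime T)"
  and N_L2: "N \<in> L2 {0<..<T}" and L_L2: "L \<in> L2 {0<..<T}" and m_L2: "(\<lambda>t. L2_norm U (grad U (m t))) \<in> L2 {0<..<T}"
  and \<kappa>: "integrable (dtime T) \<kappa>"
  and E_def: "\<And>t. E t = \<epsilon> / 2 * (L2_norm U (W t))^2 + (L2_norm U (w t))^2 / 2"
  and E_measurable: "E \<in> borel_measurable (dtime T)"
  and time_derivative: "\<And>\<nu> \<eta>. \<nu> \<in> H1 U \<Longrightarrow> test_function {0<..<T} \<eta> \<Longrightarrow>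
    (LINT t|dtime T. D t \<nu> * \<eta> t) = - (LINT t|dtime T. L2_inner U (w t) \<nu> * deriv \<eta> t)"
  and gradients: "AE t in dtime T. has_grad U (w t) (W t) \<and> has_grad U (z t) (Z t)"
  and potential: "AE t in dtime T. \<forall>\<psi> \<Psi>. has_grad U \<psi> \<Psi> \<longrightarrow> L2_inner U (z t) \<psi> = \<epsilon> * L2_inner U (W t) \<Psi>"
  and D_bound: "AE t in dtime T. 0 \<le> N t \<and> (\<forall>\<nu> G. has_grad U \<nu> G \<longrightarrow> \<bar>D t \<nu>\<bar> \<le> N t * L2_norm U G)"
  and D_diff: "AE t in dtime T. \<forall>u\<in>H1 U. \<forall>v\<in>H1 U. D t (u - v) = D t u - D t v"
  and L_bound: "AE t in dtime T. L2_norm U (\<lambda>x. grad U (m t) x - Z t x) + L2_norm U (W t) \<le> L t"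
  and dissipation: "AE t in dtime T. 0 \<le> \<kappa> t \<and> E t \<le> B \<and> D t (m t) + N t * L t \<le> \<kappa> t * E t"
begin

definition past :: "real \<Rightarrow> 'a \<Rightarrow> real" where
 "past s = (if s \<le> 0 then (\<lambda>x. 0) else w s)"

lemma w_increment:
 assumes N': "rep {0<..<T} N N'" and \<nu>: "\<nu> \<in> H1 U"
 shows "\<exists>a. rep {0<..<T} (\<lambda>t. D t \<nu>) a \<and> sqint a \<and> (\<forall>t h. 0 < t \<longrightarrow> t < T \<longrightarrow> 0 < h \<longrightarrow>
   L2_inner U (\<lambda>x. w t x - past (t - h) x) \<nu> = h * bk.avg h a t \<and>
   \<bar>L2_inner U (\<lambda>x. w t x - past (t - h) x) \<nu>\<bar> \<le> h * bk.avg h N' t * L2_norm U (grad U \<nu>))"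
proof -
 let ?y = "\<lambda>t. L2_inner U (w t) \<nu>"
 have \<nu>l: "\<nu> \<in> L2 U" using \<nu> by (simp add: H1_def)
 have cont: "continuous_on {0..T} ?y"
  unfolding continuous_on_def
 proof
  fix t assume t: "t \<in> {0..T}"
  have "((\<lambda>s. ?y s - ?y t) \<longlongrightarrow> 0) (at t within {0..T})"
  proof (rule Lim_null_comparison)
   have "((\<lambda>s. L2_norm U (\<lambda>x. w s x - w t x) * L2_norm U \<nu>) \<longlongrightarrow> 0 * L2_norm U \<nu>) (at t within {0..T})"
    by (intro tendsto_intros w_continuous t)
   then show "((\<lambda>s. L2_norm U (\<lambda>x. w s x - w t x) * L2_norm U \<nu>) \<longlongrightarrow> 0) (at t within {0..T})" by simp
   have "norm (?y s - ?y t) \<le> L2_norm U (\<lambda>x. w s x - w t x) * L2_norm U \<nu>" if s: "s \<in> {0..T}" for s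
    using L2_Cauchy_Schwarz(2)[OF L2_diff[OF w_L2[OF s] w_L2[OF t]] \<nu>l] L2_inner_diff_left[OF w_L2[OF s] w_L2[OF t] \<nu>l] by simp
   then show "\<forall>\<^sub>F s in at t within {0..T}. norm (?y s - ?y t) \<le> L2_norm U (\<lambda>x. w s x - w t x) * L2_norm U \<nu>"
    unfolding eventually_at_filter by (intro always_eventually) blast
  qed
  then show "(?y \<longlongrightarrow> ?y t) (at t within {0..T})" by (simp add: LIM_zero_iff)
 qed
 have y0: "?y 0 = 0"
 proof -
  have "?y 0 = L2_inner U (\<lambda>x. 0) \<nu>" using T by (intro L2_inner_cong_AE w_L2 \<nu>l w_initial) auto
  then show ?thesis by (simp add: L2_inner_def)
 qed
 have sN: "sqint N'" using N_L2 L2_rep_real_iff[OF _ N'] by simp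
 have bN: "AE t in dtime T. \<bar>D t \<nu>\<bar> \<le> N t * L2_norm U (grad U \<nu>)"
  using D_bound by eventually_elim (use has_grad_grad[OF \<nu>] in blast)
 obtain a where a: "rep {0<..<T} (\<lambda>t. D t \<nu>) a" "sqint a" "\<And>t h. 0 < t \<Longrightarrow> t < T \<Longrightarrow> 0 < h \<Longrightarrow>
   ?y t - (if t - h \<le> 0 then 0 else ?y (t - h)) = h * bk.avg h a t \<and>
   \<bar>?y t - (if t - h \<le> 0 then 0 else ?y (t - h))\<bar> \<le> h * bk.avg h N' t * L2_norm U (grad U \<nu>)"
  using increment_from_weak_derivative[OF T cont y0 D_measurable[OF \<nu>] N' sN bN L2_norm_nonneg time_derivative[OF \<nu>]] by blast
 have "L2_inner U (\<lambda>x. w t x - past (t - h) x) \<nu> = ?y t - (if t - h \<le> 0 then 0 else ?y (t - h))" if "0 < t" "t < T" "0 < h" for t h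
  using that L2_inner_diff_left[OF w_L2 w_L2 \<nu>l, of t "t - h"] by (auto simp: past_def)
 then show ?thesis using a by (intro exI[of _ a] conjI allI impI) (simp_all only: conjunct1[OF a(3)] conjunct2[OF a(3)])
qed

definition good :: "real \<Rightarrow> bool" where
 "good t \<longleftrightarrow> has_grad U (w t) (W t) \<and> has_grad U (z t) (Z t) \<and> m t \<in> H1 U \<and>
   (\<forall>\<psi> \<Psi>. has_grad U \<psi> \<Psi> \<longrightarrow> L2_inner U (z t) \<psi> = \<epsilon> * L2_inner U (W t) \<Psi>) \<and>
   L2_norm U (\<lambda>x. grad U (m t) x - Z t x) + L2_norm U (W t) \<le> L t \<and>
   0 \<le> N t \<and> (\<forall>\<nu> G. has_grad U \<nu> G \<longrightarrow> \<bar>D t \<nu>\<bar> \<le> N t * L2_norm U G) \<and>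
   (\<forall>u\<in>H1 U. \<forall>v\<in>H1 U. D t (u - v) = D t u - D t v) \<and>
   0 \<le> \<kappa> t \<and> E t \<le> B \<and> D t (m t) + N t * L t \<le> \<kappa> t * E t"

lemma AE_good: "AE t in dtime T. good t"
proof -
 have "AE t in dtime T. m t \<in> H1 U" using m_measurable by (simp add: bochner_measurable_def)
 with gradients potential D_bound D_diff L_bound dissipation show ?thesis
  by eventually_elim (simp add: good_def)
qed

lemma E_nonneg: "0 \<le> E t"
 unfolding E_def using \<epsilon> by simp

text \<open>One step of the energy inequality. The element \<open>v\<close> is an approximation of \<open>m t\<close> from a finite set:
 pairing with it leaves finitely many scalar increments, and the remainder is controlled by \<open>N\<close>.\<close>

lemma energy_step:
 assumes N': "rep {0<..<T} N N'" "\<And>t. 0 \<le> N' t"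
  and t: "0 < t" "t < T" "good t" and h: "0 < h" and s: "0 < t - h \<Longrightarrow> good (t - h)" and v: "v \<in> H1 U"
  and r: "L2_norm U (\<lambda>x. grad U (m t) x - grad U v x) \<le> r"
 shows "E t - (if t - h \<le> 0 then 0 else E (t - h)) \<le> L2_inner U (\<lambda>x. w t x - past (t - h) x) v + h * bk.avg h N' t * (L t + r)"
proof -
 define V where "V = (if t - h \<le> 0 then (\<lambda>x. 0) else W (t - h))"
 have Ub: "U \<in> sets borel" using U by simp
 have g: "has_grad U (w t) (W t)" "has_grad U (z t) (Z t)" "m t \<in> H1 U"
  and zp: "\<And>\<psi> \<Psi>. has_grad U \<psi> \<Psi> \<Longrightarrow> L2_inner U (z t) \<psi> = \<epsilon> * L2_inner U (W t) \<Psi>"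
  and Lb: "L2_norm U (\<lambda>x. grad U (m t) x - Z t x) + L2_norm U (W t) \<le> L t" using t(3) unfolding good_def by blast+
 have p: "has_grad U (past (t - h)) V"
  using s unfolding past_def V_def good_def by (simp add: has_grad_zero)
 have Ep: "(if t - h \<le> 0 then 0 else E (t - h)) = \<epsilon> / 2 * (L2_norm U V)^2 + (L2_norm U (past (t - h)))^2 / 2"
  unfolding past_def V_def E_def by simp
 have l2: "w t \<in> L2 U" "z t \<in> L2 U" "past (t - h) \<in> L2 U" "v \<in> L2 U" "W t \<in> L2 U" "Z t \<in> L2 U" "grad U (m t) \<in> L2 U" "grad U v \<in> L2 U"
  using g p v grad_H1(1)[OF g(3)] grad_H1(1)[OF v] by (auto simp: has_grad_def H1_def)
 let ?d = "\<lambda>x. w t x - past (t - h) x" and ?\<nu> = "\<lambda>x. (z t x + w t x) - v x" and ?G = "\<lambda>x. (Z t x + W t x) - grad U v x"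
 have \<nu>: "has_grad U ?\<nu> ?G" by (intro has_grad_diff has_grad_add Ub g has_grad_grad v)
 have dl: "?d \<in> L2 U" "?\<nu> \<in> L2 U" "?G \<in> L2 U" using L2_diff[OF l2(1,3)] \<nu> by (auto simp: has_grad_def)
 have "E t - (if t - h \<le> 0 then 0 else E (t - h)) \<le> L2_inner U ?d (\<lambda>x. z t x + w t x)"
  unfolding Ep unfolding E_def by (rule energy_increment[OF U \<epsilon> g(1) p l2(2) zp])
 also have "\<dots> = L2_inner U ?d (\<lambda>x. v x + ?\<nu> x)" by simp
 also have "\<dots> = L2_inner U ?d v + L2_inner U ?d ?\<nu>" by (rule L2_inner_add_right[OF l2(4) dl(2,1)])
 finally have 1: "E t - (if t - h \<le> 0 then 0 else E (t - h)) \<le> L2_inner U ?d v + L2_inner U ?d ?\<nu>" .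
 have "\<bar>L2_inner U ?d ?\<nu>\<bar> \<le> h * bk.avg h N' t * L2_norm U (grad U ?\<nu>)"
  using w_increment[OF N'(1) has_grad_H1[OF \<nu>]] t h by blast
 also have "L2_norm U (grad U ?\<nu>) = L2_norm U ?G"
  by (rule L2_norm_cong_AE[OF grad_H1(1)[OF has_grad_H1[OF \<nu>]] dl(3) grad_AE[OF U \<nu>]])
 also have "h * bk.avg h N' t * L2_norm U ?G \<le> h * bk.avg h N' t * (L t + r)"
 proof (rule mult_left_mono)
  let ?a = "\<lambda>x. grad U (m t) x - grad U v x" and ?b = "\<lambda>x. grad U (m t) x - Z t x"
  have ab: "?a \<in> L2 U" "?b \<in> L2 U" by (intro L2_diff l2)+
  have e: "?G = (\<lambda>x. (?a x - ?b x) + W t x)" by (simp add: fun_eq_iff)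
  have "L2_norm U ?G \<le> L2_norm U (\<lambda>x. ?a x - ?b x) + L2_norm U (W t)"
   unfolding e by (rule L2_norm_triangle[OF L2_diff[OF ab] l2(5)])
  moreover have "L2_norm U (\<lambda>x. ?a x - ?b x) \<le> L2_norm U ?a + L2_norm U ?b" by (rule L2_norm_diff_triangle[OF ab])
  ultimately show "L2_norm U ?G \<le> L t + r" using Lb r by linarith
  have "0 \<le> bk.avg h N' t" unfolding bk.avg_def by (intro Bochner_Integration.integral_nonneg) (simp add: N')
  then show "0 \<le> h * bk.avg h N' t" using h by simp
 qed
 finally show ?thesis using 1 by linarith
qed

text \<open>The part of the gradient of \<open>m\<close> that the simple function \<open>s\<close> misses; an approximation that is worse than \<open>1\<close>
 is discarded, so that the remainder has a square integrable bound independent of \<open>s\<close>.\<close>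

definition remainder :: "(real \<Rightarrow> 'a \<Rightarrow> real) \<Rightarrow> real \<Rightarrow> real" where
 "remainder s t = (let \<delta> = L2_norm U (\<lambda>x. grad U (m t) x - grad U (s t) x) in if \<delta> \<le> 1 then \<delta> else L2_norm U (grad U (m t)))"

lemma remainder_bound: "0 \<le> remainder s t" "remainder s t \<le> L2_norm U (grad U (m t)) + 1"
proof -
 show "0 \<le> remainder s t" by (simp add: remainder_def Let_def L2_norm_nonneg)
 have "x \<le> 1 \<Longrightarrow> 0 \<le> y \<Longrightarrow> x \<le> y + 1" for x y :: real by simp
 then show "remainder s t \<le> L2_norm U (grad U (m t)) + 1"
  using L2_norm_nonneg[of U "grad U (m t)"] by (simp add: remainder_def Let_def)
qed

lemma finite_time: "finite_measure (dtime T)"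
 using T by (intro finite_measureI) (simp add: emeasure_restrict_space space_restrict_space emeasure_lborel_Ioo)

lemma approximation_measurable:
 assumes s: "simple_function (dtime T) s" "s ` {0<..<T} \<subseteq> H1 U"
 shows "(\<lambda>t. L2_norm U (\<lambda>x. grad U (m t) x - grad U (s t) x)) \<in> borel_measurable (dtime T)"
proof -
 have "H1_norm U (v - v) = 0" if "v \<in> H1 U" for v
 proof -
  have "L2_norm U (v - v) = 0" by (simp add: fun_diff_eq)
  moreover have "L2_norm U (grad U (v - v)) = 0" by (simp add: L2_norm_grad_diff[OF U that that])
  ultimately show ?thesis by (simp add: H1_norm_def)
 qed
 then have "bochner_measurable T (H1 U) (H1_norm U) s" by (rule bochner_measurable_simple[OF s])
 then show ?thesis by (intro L2_norm_diff_measurable bochner_H1_grad U m_measurable)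
qed

lemma remainder_L2:
 assumes s: "simple_function (dtime T) s" "s ` {0<..<T} \<subseteq> H1 U"
 shows "remainder s \<in> L2 {0<..<T}"
proof (rule L2_norm_mono(1))
 note [measurable] = approximation_measurable[OF s] L2_borel[OF m_L2]
 show "remainder s \<in> borel_measurable (dtime T)"
  unfolding remainder_def[abs_def] Let_def by measurable
 have "(\<lambda>t. 1::real) \<in> L2 {0<..<T}" by (rule bounded_imp_L2[OF finite_time, of _ 1]) auto
 then show "(\<lambda>t. L2_norm U (grad U (m t)) + 1) \<in> L2 {0<..<T}" by (rule L2_add[OF m_L2])
 show "AE t in dtime T. norm (remainder s t) \<le> 1 * norm (L2_norm U (grad U (m t)) + 1)"
  using remainder_bound by (intro AE_I2) (auto simp: abs_of_nonneg add_nonneg_nonneg L2_norm_nonneg)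
qed auto

text \<open>At time \<open>t\<close> the element \<open>v\<close> in \<open>energy_step\<close> is \<open>s t\<close>, or \<open>0\<close> when that approximation is discarded; \<open>e v\<close> indicates the times
 with value \<open>v\<close>. In the limit the increments become \<open>D t (s t)\<close>. The error of approximation enters twice, in \<open>energy_step\<close> and in
 replacing \<open>D t (s t)\<close> by \<open>D t (m t)\<close>, whence the factor \<open>2\<close>.\<close>

lemma energy_inequality_approx:
 assumes s: "simple_function (dtime T) s" "s ` {0<..<T} \<subseteq> H1 U"
  and N': "rep {0<..<T} N N'" "\<And>t. 0 \<le> N' t" and E': "rep {0<..<T} E E'" "\<And>t. 0 \<le> E' t" "\<And>t. E' t \<le> B"
  and \<kappa>': "rep {0<..<T} \<kappa> \<kappa>'" "\<And>t. 0 \<le> \<kappa>' t"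
 shows "AE b in lborel. b < T \<longrightarrow> E' b \<le> (LBINT t. indicator {..b} t * (\<kappa>' t * E' t))
   + 2 * (LINT t|dtime T. N t * remainder s t)"
proof -
 let ?S = "{0<..<T}"
 have S: "?S \<in> sets borel" by simp
 define \<delta> where "\<delta> t = L2_norm U (\<lambda>x. grad U (m t) x - grad U (s t) x)" for t
 note [measurable] = approximation_measurable[OF s, folded \<delta>_def]
 have rem: "remainder s t = (if \<delta> t \<le> 1 then \<delta> t else L2_norm U (grad U (m t)))" for t by (simp add: remainder_def \<delta>_def Let_def)
 define V where "V = s ` ?S"
 have V: "finite V" "V \<subseteq> H1 U" using s by (auto simp: V_def simple_function_def space_restrict_space)
 have "\<exists>a. rep ?S (\<lambda>t. D t v) a \<and> sqint a \<and> (\<forall>t h. 0 < t \<longrightarrow> t < T \<longrightarrow> 0 < h \<longrightarrow>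
   L2_inner U (\<lambda>x. w t x - past (t - h) x) v = h * bk.avg h a t)" if "v \<in> V" for v
  using w_increment[OF N'(1), of v] that V by blast
 then obtain a where a: "\<And>v. v \<in> V \<Longrightarrow> rep ?S (\<lambda>t. D t v) (a v)" "\<And>v. v \<in> V \<Longrightarrow> sqint (a v)"
  "\<And>v t h. v \<in> V \<Longrightarrow> 0 < t \<Longrightarrow> t < T \<Longrightarrow> 0 < h \<Longrightarrow> L2_inner U (\<lambda>x. w t x - past (t - h) x) v = h * bk.avg h (a v) t"
  by metis
 define e where "e v t = (if s t = v \<and> \<delta> t \<le> 1 then 1 else 0 :: real)" for v t
 have eL2: "e v \<in> L2 ?S" for v
 proof (rule bounded_imp_L2[OF finite_time, of _ 1])
  have "(\<lambda>t. if s t = v then 1 else 0 :: real) \<in> borel_measurable (lebesgue_on ?S)"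
   using simple_function_compose[OF s(1), of "\<lambda>u. if u = v then 1 else 0 :: real"]
   by (intro borel_measurable_simple_function) (simp add: comp_def)
  moreover have "(\<lambda>t. if \<delta> t \<le> 1 then 1 else 0 :: real) \<in> borel_measurable (lebesgue_on ?S)" by measurable
  moreover have "e v = (\<lambda>t. (if s t = v then 1 else 0) * (if \<delta> t \<le> 1 then 1 else 0))" by (simp add: e_def fun_eq_iff)
  ultimately show "e v \<in> borel_measurable (lebesgue_on ?S)" by (simp only: borel_measurable_times)
 qed (auto simp: e_def)
 have "\<exists>e'. rep ?S (e v) e'" for v by (rule rep_exists_real[OF S L2_borel[OF eL2]])
 then obtain e' where e': "\<And>v. rep ?S (e v) (e' v)" by metis
 have se': "sqint (e' v)" for v using eL2 L2_rep_real_iff[OF S e'] by blast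
 obtain L' where L': "rep ?S L L'" using rep_exists_real[OF S L2_borel[OF L_L2]] by blast
 obtain r where r: "rep ?S (remainder s) r" "\<And>t. 0 \<le> r t"
  using rep_nonneg_exists[OF L2_borel[OF remainder_L2[OF s]]] remainder_bound(1) by (metis AE_I2)
 have sq: "sqint N'" "sqint L'" "sqint r"
  using N_L2 L_L2 remainder_L2[OF s] L2_rep_real_iff[OF S] N'(1) L' r(1) by blast+
 have sH: "sqint (\<lambda>t. L' t + r t)" by (rule sqint_add[OF sq(2,3)])
 have [measurable]: "E' \<in> borel_measurable borel" "\<kappa>' \<in> borel_measurable borel" using E' \<kappa>' by (auto simp: rep_def)
 let ?F = "\<lambda>t. (\<Sum>v\<in>V. a v t * e' v t) + N' t * (L' t + r t)" and ?I = "\<lambda>b. LBINT t. indicator {..b} t * (\<kappa>' t * E' t)"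
 have out: "E' t = 0" "\<kappa>' t = 0" "N' t = 0" "L' t = 0" "r t = 0" "e' v t = 0" if "t \<notin> ?S" for t v
  using E'(1) \<kappa>'(1) N'(1) L' r(1) e'[of v] that by (auto simp: rep_def)
 have "AE t in lborel. t \<in> ?S \<longrightarrow> (\<forall>v\<in>V. e v t = e' v t \<and> D t v = a v t)"
 proof -
  have "AE t in lborel. \<forall>v\<in>V. t \<in> ?S \<longrightarrow> e v t = e' v t \<and> D t v = a v t"
  proof (rule AE_finite_allI[OF V(1)])
   fix v assume v: "v \<in> V"
   have "AE t in lborel. t \<in> ?S \<longrightarrow> e v t = e' v t" "AE t in lborel. t \<in> ?S \<longrightarrow> D t v = a v t"
    using e'[of v] a(1)[OF v] unfolding rep_def AE_lebesgue_on_iff[OF S] by blast+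
   then show "AE t in lborel. t \<in> ?S \<longrightarrow> e v t = e' v t \<and> D t v = a v t" by eventually_elim blast
  qed
  then show ?thesis by eventually_elim blast
 qed
 moreover have "AE t in lborel. t \<in> ?S \<longrightarrow> good t" using AE_good unfolding AE_lebesgue_on_iff[OF S] .
 moreover have "AE t in lborel. t \<in> ?S \<longrightarrow> E t = E' t" "AE t in lborel. t \<in> ?S \<longrightarrow> \<kappa> t = \<kappa>' t" "AE t in lborel. t \<in> ?S \<longrightarrow> N t = N' t"
  "AE t in lborel. t \<in> ?S \<longrightarrow> L t = L' t" "AE t in lborel. t \<in> ?S \<longrightarrow> remainder s t = r t"
  using E'(1) \<kappa>'(1) N'(1) L' r(1) unfolding rep_def AE_lebesgue_on_iff[OF S] by blast+
 ultimately have ae: "AE t in lborel. t \<in> ?S \<longrightarrow> good t \<and> E t = E' t \<and> \<kappa> t = \<kappa>' t \<and> N t = N' t \<and> L t = L' t \<and> remainder s t = r t \<and>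
   (\<forall>v\<in>V. e v t = e' v t \<and> D t v = a v t)"
  by eventually_elim blast
 have sel: "(\<Sum>v\<in>V. c v * e' v t) = (if \<delta> t \<le> 1 then c (s t) else 0)"
  if "t \<in> ?S" "\<forall>v\<in>V. e v t = e' v t \<and> D t v = a v t" for c t
 proof -
  have "(\<Sum>v\<in>V. c v * e' v t) = (\<Sum>v\<in>V. if v = s t then (if \<delta> t \<le> 1 then c (s t) else 0) else 0)"
   using that by (intro sum.cong) (auto simp: e_def split: if_splits)
  also have "\<dots> = (if \<delta> t \<le> 1 then c (s t) else 0)" using that(1) V(1) by (auto simp: V_def)
  finally show ?thesis .
 qed
 have ineq: "AE t in lborel. t < T \<longrightarrow> E' t - E' (t - h) \<le> h * ((\<Sum>v\<in>V. bk.avg h (a v) t * e' v t) + bk.avg h N' t * (L' t + r t))"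
  if h: "0 < h" for h
 proof -
  have "AE t in distr lborel borel ((+) (- h)). t \<in> ?S \<longrightarrow> good t \<and> E t = E' t"
   unfolding lborel_distr_plus using ae by eventually_elim blast
  then have "AE t in lborel. - h + t \<in> ?S \<longrightarrow> good (- h + t) \<and> E (- h + t) = E' (- h + t)"
   by (rule AE_distrD[rotated]) measurable
  then have "AE t in lborel. t - h \<in> ?S \<longrightarrow> good (t - h) \<and> E (t - h) = E' (t - h)" by simp
  with ae show ?thesis
  proof eventually_elim
   case (elim t)
   show ?case
   proof
    assume tT: "t < T"
    show "E' t - E' (t - h) \<le> h * ((\<Sum>v\<in>V. bk.avg h (a v) t * e' v t) + bk.avg h N' t * (L' t + r t))"
    proof (cases "0 < t")
     case False
     then have "t \<notin> ?S" "t - h \<notin> ?S" using h by auto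
     then show ?thesis using out by simp
    next
     case True
     then have tS: "t \<in> ?S" using tT by simp
     then have g: "good t" "E t = E' t" "L t = L' t" "remainder s t = r t" and ev: "\<forall>v\<in>V. e v t = e' v t \<and> D t v = a v t" using elim(1) by blast+
     have g': "good (t - h)" if "0 < t - h" using elim(2) that h tT by simp
     have Ep: "(if t - h \<le> 0 then 0 else E (t - h)) = E' (t - h)"
      using elim(2) h tT out(1)[of "t - h"] by auto
     have st: "s t \<in> V" using tS by (simp add: V_def)
     show ?thesis
     proof (cases "\<delta> t \<le> 1")
      case True
      have "E t - E' (t - h) \<le> L2_inner U (\<lambda>x. w t x - past (t - h) x) (s t) + h * bk.avg h N' t * (L t + \<delta> t)"
       unfolding Ep[symmetric] \<delta>_def using st V(2) by (intro energy_step[OF N' \<open>0 < t\<close> tT g(1) h g']) auto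
      then show ?thesis
       using a(3)[OF st \<open>0 < t\<close> tT h] True unfolding sel[OF tS ev] g(2)[symmetric] g(3)[symmetric] g(4)[symmetric] rem
       by (simp add: distrib_left mult_ac)
     next
      case False
      have z: "L2_norm U (\<lambda>x. grad U (m t) x - grad U (\<lambda>x. 0) x) = L2_norm U (grad U (m t))"
      proof -
       have mt: "m t \<in> H1 U" using g(1) by (simp add: good_def)
       have "AE x in lebesgue_on U. grad U (\<lambda>x. 0) x = 0" by (rule grad_AE[OF U has_grad_zero])
       then have "AE x in lebesgue_on U. grad U (m t) x - grad U (\<lambda>x. 0) x = grad U (m t) x" by eventually_elim simp
       then show ?thesis by (intro L2_norm_cong_AE L2_diff grad_H1 mt has_grad_H1[OF has_grad_zero])
      qed
      have "E t - E' (t - h) \<le> L2_inner U (\<lambda>x. w t x - past (t - h) x) (\<lambda>x. 0) + h * bk.avg h N' t * (L t + L2_norm U (grad U (m t)))"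
       unfolding Ep[symmetric] by (intro energy_step[OF N' \<open>0 < t\<close> tT g(1) h g'] has_grad_H1[OF has_grad_zero]) (auto simp: z)
      moreover have "L2_inner U (\<lambda>x. w t x - past (t - h) x) (\<lambda>x. 0) = 0" by (simp add: L2_inner_def)
      ultimately show ?thesis
       using False unfolding sel[OF tS ev] g(2)[symmetric] g(3)[symmetric] g(4)[symmetric] rem
       by (simp add: distrib_left mult_ac)
     qed
    qed
   qed
  qed
 qed
 have sE: "sqint E'"
 proof -
  have "E' = (\<lambda>t. E' t * indicator {0..T} t)"
  proof
   fix t show "E' t = E' t * indicator {0..T} t" using out(1)[of t] by (cases "t \<in> ?S") auto
  qed
  moreover have "sqint (\<lambda>t. E' t * indicator {0..T} t)"
   using E'(2,3) by (intro sqint_bounded_mult[OF sqint_indicator_Icc, of _ B]) (auto simp: abs_of_nonneg)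
  ultimately show ?thesis by simp
 qed
 have Ei: "integrable lborel E'"
 proof -
  have "integrable lborel (\<lambda>t. E' t * indicator {0..T} t)" by (rule sqint_mult_integrable[OF sE sqint_indicator_Icc])
  moreover have "E' t * indicator {0..T} t = E' t" for t using out(1)[of t] by (cases "t \<in> ?S") auto
  ultimately show ?thesis by simp
 qed
 have lim: "AE b in lborel. b < T \<longrightarrow> E' b \<le> (LBINT t. indicator {..b} t * ?F t)"
  by (rule backward_difference_limit[OF sE Ei sq(1) sH V(1) se' a(2) ineq])
 have ki: "integrable lborel (\<lambda>t. \<kappa>' t * E' t)"
 proof (rule Bochner_Integration.integrable_bound)
  show "integrable lborel (\<lambda>t. \<kappa>' t * B)" using \<kappa> rep_integral(2)[OF S \<kappa>'(1)] by simp
  show "AE t in lborel. norm (\<kappa>' t * E' t) \<le> norm (\<kappa>' t * B)"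
   using B E'(2,3) \<kappa>'(2) by (intro AE_I2) (simp add: abs_mult mult_left_mono)
 qed measurable
 have nr: "integrable lborel (\<lambda>t. N' t * r t)" by (rule sqint_mult_integrable[OF sq(1,3)])
 have nr_eq: "(LBINT t. N' t * r t) = (LINT t|lebesgue_on ?S. N t * remainder s t)"
 proof (rule rep_integral(1)[OF S, symmetric])
  show "rep ?S (\<lambda>t. N t * remainder s t) (\<lambda>t. N' t * r t)"
   by (rule rep_compose2[OF N'(1) r(1), of "(*)"]) (auto intro!: continuous_intros)
 qed
 have pw: "AE t in lborel. ?F t \<le> \<kappa>' t * E' t + 2 * (N' t * r t)"
  using ae
 proof eventually_elim
  case (elim t)
  show ?case
  proof (cases "t \<in> ?S")
   case False
   then show ?thesis using out by simp
  next
   case True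
   then have g: "good t" "E t = E' t" "L t = L' t" "remainder s t = r t" "\<kappa> t = \<kappa>' t" "N t = N' t" and ev: "\<forall>v\<in>V. e v t = e' v t \<and> D t v = a v t" using elim by blast+
   have m: "m t \<in> H1 U" and Db: "\<And>\<nu> G. has_grad U \<nu> G \<Longrightarrow> \<bar>D t \<nu>\<bar> \<le> N t * L2_norm U G"
    and Dd: "\<And>u v. u \<in> H1 U \<Longrightarrow> v \<in> H1 U \<Longrightarrow> D t (u - v) = D t u - D t v" and dis: "D t (m t) + N t * L t \<le> \<kappa> t * E t"
    using g(1) unfolding good_def by blast+
   have st: "s t \<in> V" using True by (simp add: V_def)
   then have sH: "s t \<in> H1 U" using V by blast
   show ?thesis
   proof (cases "\<delta> t \<le> 1")
    case d: True
    have "\<bar>D t (m t - s t)\<bar> \<le> N t * L2_norm U (grad U (m t - s t))" by (rule Db[OF has_grad_grad[OF H1_diff[OF U m sH]]])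
    then have "D t (s t) \<le> D t (m t) + N t * \<delta> t"
     unfolding Dd[OF m sH] L2_norm_grad_diff[OF U m sH] \<delta>_def by linarith
    moreover have "a (s t) t = D t (s t)" using ev st by simp
    ultimately show ?thesis
     using dis d unfolding sel[OF True ev] g(2-6)[symmetric] rem by (simp add: distrib_left)
   next
    case d: False
    have "\<bar>D t (m t)\<bar> \<le> N t * L2_norm U (grad U (m t))" by (rule Db[OF has_grad_grad[OF m]])
    then show ?thesis
     using dis d unfolding sel[OF True ev] g(2-6)[symmetric] rem by (simp add: distrib_left)
   qed
  qed
 qed
 have bd: "(LBINT t. indicator {..b} t * ?F t)
   \<le> ?I b + 2 * (LBINT t. N' t * r t)" for b
 proof -
  have i0: "integrable lborel (\<lambda>t. indicator {..b} t * ?F t)"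
  proof -
   have "integrable lborel (\<lambda>t. ?F t)"
    by (intro Bochner_Integration.integrable_add Bochner_Integration.integrable_sum sqint_mult_integrable a(2) se' sq(1) sH)
   from integrable_mult_indicator[OF _ this, of "{..b}"] show ?thesis by simp
  qed
  have i1: "integrable lborel (\<lambda>t. indicator {..b} t * (\<kappa>' t * E' t))"
   using integrable_mult_indicator[OF _ ki, of "{..b}"] by simp
  have "(LBINT t. indicator {..b} t * ?F t)
   \<le> (LBINT t. indicator {..b} t * (\<kappa>' t * E' t) + 2 * (N' t * r t))"
  proof (rule integral_mono_AE[OF i0])
   show "integrable lborel (\<lambda>t. indicator {..b} t * (\<kappa>' t * E' t) + 2 * (N' t * r t))"
    by (intro Bochner_Integration.integrable_add i1 integrable_mult_right nr)
   show "AE t in lborel. indicator {..b} t * ?F t \<le> indicator {..b} t * (\<kappa>' t * E' t) + 2 * (N' t * r t)"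
    using pw
   proof eventually_elim
    case (elim t)
    have "0 \<le> N' t * r t" using N'(2) r(2) by simp
    with elim show ?case by (cases "t \<le> b") auto
   qed
  qed
  also have "\<dots> = ?I b + (LBINT t. 2 * (N' t * r t))"
   by (rule Bochner_Integration.integral_add[OF i1 integrable_mult_right[OF nr]])
  finally show ?thesis by simp
 qed
 show ?thesis using lim
 proof eventually_elim
  case (elim b)
  show ?case
  proof
   assume "b < T"
   with elim have "E' b \<le> (LBINT t. indicator {..b} t * ?F t)" by blast
   from order_trans[OF this bd]
   show "E' b \<le> ?I b + 2 * (LINT t|lebesgue_on ?S. N t * remainder s t)"
    unfolding nr_eq .
  qed
 qed
qed

theorem energy_zero: "AE t in dtime T. E t = 0"
proof -
 let ?S = "{0<..<T}"
 have S: "?S \<in> sets borel" by simp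
 have N0: "AE t in lebesgue_on ?S. 0 \<le> N t" and k0: "AE t in lebesgue_on ?S. 0 \<le> \<kappa> t" and EB: "AE t in lebesgue_on ?S. E t \<le> B"
  using AE_good by (auto simp: good_def elim!: eventually_mono)
 obtain N' where N': "rep ?S N N'" "\<And>t. 0 \<le> N' t" using rep_nonneg_exists[OF L2_borel[OF N_L2] N0] by blast
 obtain \<kappa>' where \<kappa>': "rep ?S \<kappa> \<kappa>'" "\<And>t. 0 \<le> \<kappa>' t" using rep_nonneg_exists[OF borel_measurable_integrable[OF \<kappa>] k0] by blast
 obtain E' where E': "rep ?S E E'" "\<And>t. 0 \<le> E' t" "\<And>t. E' t \<le> B"
 proof -
  obtain f where f: "rep ?S E f" "\<And>t. 0 \<le> f t" using rep_nonneg_exists[OF E_measurable] E_nonneg by (metis AE_I2)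
  have "rep ?S (\<lambda>t. min B (E t)) (\<lambda>t. min B (f t))" using B by (intro rep_compose[OF f(1)]) auto
  moreover have "AE t in lebesgue_on ?S. min B (E t) = E t" using EB by eventually_elim simp
  ultimately have "rep ?S E (\<lambda>t. min B (f t))" using E_measurable unfolding rep_def by auto
  then show thesis by (rule that) (use B f(2) in auto)
 qed
 obtain s where s: "\<And>n. simple_function (lebesgue_on ?S) (s n)" "\<And>n. s n ` ?S \<subseteq> H1 U"
  "AE t in lebesgue_on ?S. (\<lambda>n. H1_norm U (m t - s n t)) \<longlonglongrightarrow> 0"
  using m_measurable unfolding bochner_measurable_def by blast
 let ?I = "\<lambda>b. LBINT t. indicator {..b} t * (\<kappa>' t * E' t)"
 let ?r = "\<lambda>n. LINT t|lebesgue_on ?S. N t * remainder (s n) t"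
 have r0: "?r \<longlonglongrightarrow> (LINT t|lebesgue_on ?S. 0)"
 proof (rule integral_dominated_convergence)
  have one: "(\<lambda>t. 1::real) \<in> L2 ?S" by (rule bounded_imp_L2[OF finite_time, of _ 1]) auto
  show "integrable (lebesgue_on ?S) (\<lambda>t. N t * (L2_norm U (grad U (m t)) + 1))"
   using L2_inner_integrable(1)[OF N_L2 L2_add[OF m_L2 one]] by simp
  show "AE t in lebesgue_on ?S. norm (N t * remainder (s n) t) \<le> N t * (L2_norm U (grad U (m t)) + 1)" for n
   using N0 by eventually_elim (use remainder_bound in \<open>simp add: abs_mult mult_left_mono\<close>)
  show "(\<lambda>t. N t * remainder (s n) t) \<in> borel_measurable (lebesgue_on ?S)" for n
   using L2_borel[OF N_L2] L2_borel[OF remainder_L2[OF s(1,2)]] by simp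
  have sp: "AE t in lebesgue_on ?S. t \<in> ?S" by (rule AE_I2) simp
  show "AE t in lebesgue_on ?S. (\<lambda>n. N t * remainder (s n) t) \<longlonglongrightarrow> 0"
   using s(3) AE_good sp
  proof eventually_elim
   case (elim t)
   have mt: "m t \<in> H1 U" using elim(2) by (simp add: good_def)
   let ?\<delta> = "\<lambda>n. L2_norm U (\<lambda>x. grad U (m t) x - grad U (s n t) x)"
   have "s n t \<in> H1 U" for n using s(2)[of n] elim(3) by blast
   then have "?\<delta> n \<le> H1_norm U (m t - s n t)" for n
    using H1_norm_ge(2)[of U "m t - s n t"] L2_norm_grad_diff[OF U mt, of "s n t"] by simp
   then have \<delta>: "?\<delta> \<longlonglongrightarrow> 0"
    by (intro tendsto_sandwich[OF always_eventually always_eventually tendsto_const elim(1)]) (auto simp: L2_norm_nonneg)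
   then have "\<forall>\<^sub>F n in sequentially. ?\<delta> n < 1" by (rule order_tendstoD) simp
   then have "\<forall>\<^sub>F n in sequentially. ?\<delta> n = remainder (s n) t"
    by eventually_elim (simp add: remainder_def Let_def)
   then have "(\<lambda>n. remainder (s n) t) \<longlonglongrightarrow> 0" by (rule Lim_transform_eventually[OF \<delta>])
   then have "(\<lambda>n. N t * remainder (s n) t) \<longlonglongrightarrow> N t * 0" by (intro tendsto_intros)
   then show ?case by simp
  qed
 qed auto
 have "AE b in lborel. \<forall>n. b < T \<longrightarrow> E' b \<le> ?I b + 2 * ?r n"
  unfolding AE_all_countable using energy_inequality_approx[OF s(1,2) N' E' \<kappa>'] by blast
 then have "AE b in lborel. b < T \<longrightarrow> E' b \<le> ?I b"
 proof eventually_elim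
  case (elim b)
  show ?case
  proof
   assume "b < T"
   have "(\<lambda>n. ?I b + 2 * ?r n) \<longlonglongrightarrow> ?I b + 2 * (LINT t|lebesgue_on ?S. 0)"
    by (intro tendsto_intros r0)
   then have "E' b \<le> ?I b + 2 * (LINT t|lebesgue_on ?S. 0)"
    using elim \<open>b < T\<close> by (intro LIMSEQ_le_const) auto
   then show "E' b \<le> ?I b" by simp
  qed
 qed
 moreover have "integrable lborel \<kappa>'" using \<kappa> rep_integral(2)[OF S \<kappa>'(1)] by simp
 moreover have "\<kappa>' t = 0" if "t \<le> 0" for t using \<kappa>'(1) that by (simp add: rep_def)
 ultimately have "AE b in lborel. b < T \<longrightarrow> E' b = 0"
  using E' \<kappa>' T by (intro Gronwall_zero[of E' \<kappa>' B T]) (auto simp: rep_def)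
 moreover have "AE t in lborel. t \<in> ?S \<longrightarrow> E t = E' t" using E'(1) unfolding rep_def AE_lebesgue_on_iff[OF S] by blast
 ultimately show ?thesis unfolding AE_lebesgue_on_iff[OF S] by eventually_elim simp
qed

end

section \<open>From weak solutions to states at almost every time\<close>

lemma L2_inner_grad:
 assumes "open U" "has_grad U \<psi> \<Psi>" "f \<in> L2 U"
 shows "L2_inner U f (grad U \<psi>) = L2_inner U f \<Psi>"
 by (rule L2_inner_cong_AE[OF assms(3,3) grad_H1(1)[OF has_grad_H1[OF assms(2)]] _ _ grad_AE[OF assms(1,2)]])
  (use assms(2) in \<open>auto simp: has_grad_def\<close>)

lemma Linf_bounded:
 assumes "u \<in> Linf U" shows "\<exists>K\<ge>0. AE x in lebesgue_on U. \<bar>u x\<bar> \<le> K"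
proof -
 have fin: "esssup (lebesgue_on U) (\<lambda>x. ereal \<bar>u x\<bar>) < \<infinity>" using assms by (simp add: Linf_def)
 obtain K where K: "esssup (lebesgue_on U) (\<lambda>x. ereal \<bar>u x\<bar>) \<le> ereal K"
  using fin by (cases "esssup (lebesgue_on U) (\<lambda>x. ereal \<bar>u x\<bar>)") auto
 have "AE x in lebesgue_on U. \<bar>u x\<bar> \<le> max 0 K"
  using esssup_AE[of "\<lambda>x. ereal \<bar>u x\<bar>" "lebesgue_on U"]
 proof eventually_elim
  case (elim x)
  then have "ereal \<bar>u x\<bar> \<le> ereal K" using K by (rule order_trans)
  then show ?case by simp
 qed
 then show ?thesis by (intro exI[of _ "max 0 K"]) simp
qed

lemma bochner_Linf_bounded:
 assumes "u \<in> bochner_Linf T X N" shows "\<exists>K. AE t in dtime T. N (u t) \<le> K"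
proof -
 let ?e = "esssup (dtime T) (\<lambda>t. ereal (N (u t)))"
 have fin: "?e < \<infinity>" using assms by (simp add: bochner_Linf_def)
 obtain K where K: "?e \<le> ereal K" using fin by (cases ?e) auto
 have "AE t in dtime T. N (u t) \<le> K"
  using esssup_AE[of "\<lambda>t. ereal (N (u t))" "dtime T"]
 proof eventually_elim
  case (elim t)
  then have "ereal (N (u t)) \<le> ereal K" using K by (rule order_trans)
  then show ?case by simp
 qed
 then show ?thesis by blast
qed

lemma weak_solution_state:
 assumes U: "open U" and p: "p \<in> H1 U" and \<mu>: "\<mu> \<in> H1 U" and \<phi>: "\<phi> \<in> H1 U" "\<phi> \<in> Linf U" and u: "u \<in> L2 U"
  and ueq: "u = (\<lambda>x. grad U p x + (\<gamma> * \<phi> x) *\<^sub>R grad U \<mu> x)"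
  and eq1: "\<And>q. q \<in> H1 U \<Longrightarrow> L2_inner U u (grad U q) = 0"
  and eq2: "\<And>\<nu>. \<nu> \<in> H1 U \<Longrightarrow> l \<nu> + \<epsilon> * L2_inner U (grad U \<mu>) (grad U \<nu>) + L2_inner U (\<lambda>x. \<phi> x *\<^sub>R u x) (grad U \<nu>) = 0"
  and eq3: "\<And>\<psi>. \<psi> \<in> H1 U \<Longrightarrow> L2_inner U \<mu> \<psi> - \<epsilon> * L2_inner U (grad U \<phi>) (grad U \<psi>) - 1 / \<epsilon> * L2_inner U (\<lambda>x. f_pot (\<phi> x)) \<psi> = 0"
 shows "state U \<gamma> \<epsilon> \<phi> (grad U \<phi>) \<mu> (grad U \<mu>) (grad U p) u l"
proof -
 obtain K where K: "K \<ge> 0" "AE x in lebesgue_on U. \<bar>\<phi> x\<bar> \<le> K" using Linf_bounded[OF \<phi>(2)] by blast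
 have \<phi>m: "\<phi> \<in> borel_measurable (lebesgue_on U)" using \<phi>(1) by (simp add: H1_def L2_def)
 have \<phi>u: "(\<lambda>x. \<phi> x *\<^sub>R u x) \<in> L2 U" by (rule L2_bounded_scaleR(1)[OF \<phi>m K(2,1) u])
 note r = L2_inner_grad[OF U]
 have "slice U \<epsilon> \<phi> (grad U \<phi>) \<mu> (grad U \<mu>)"
  unfolding slice_def
 proof (intro conjI allI impI has_grad_grad \<phi> \<mu>)
  fix \<psi> \<Psi> assume h: "has_grad U \<psi> \<Psi>"
  show "L2_inner U \<mu> \<psi> - \<epsilon> * L2_inner U (grad U \<phi>) \<Psi> - 1 / \<epsilon> * L2_inner U (\<lambda>x. f_pot (\<phi> x)) \<psi> = 0"
   using eq3[OF has_grad_H1[OF h]] r[OF h grad_H1(1)[OF \<phi>(1)]] by simp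
 qed (use K in blast)
 moreover have "L2_inner U u G = 0" if h: "has_grad U q G" for q G
  using eq1[OF has_grad_H1[OF h]] r[OF h u] by simp
 moreover have "l \<nu> = - \<epsilon> * L2_inner U (grad U \<mu>) G - L2_inner U (\<lambda>x. \<phi> x *\<^sub>R u x) G" if h: "has_grad U \<nu> G" for \<nu> G
  using eq2[OF has_grad_H1[OF h]] r[OF h \<phi>u] r[OF h grad_H1(1)[OF \<mu>]] by simp
 moreover have "AE x in lebesgue_on U. u x = grad U p x + (\<gamma> * \<phi> x) *\<^sub>R grad U \<mu> x" unfolding ueq by simp
 ultimately show ?thesis unfolding state_def using has_grad_grad[OF p] u by blast
qed

text \<open>The exponent is \<open>3\<close> in dimension two and \<open>4\<close> in dimension three.\<close>

lemma powr_integrability_exponent: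
 assumes "d = 2 \<or> d = (3::nat)" "0 \<le> x" shows "x powr (12 / (6 - real d)) = x ^ (d + 1)"
proof -
 have "12 / (6 - real d) = real (d + 1)" using assms(1) by auto
 moreover have "x powr real (d + 1) = x ^ (d + 1)"
  by (cases "x = 0") (use assms(2) powr_realpow[of x "d + 1"] in auto)
 ultimately show ?thesis by (simp only:)
qed

text \<open>What is used of a solution in the class of uniqueness; \<open>l\<close> is its time derivative and \<open>w\<close> its continuous representative.\<close>

locale regular_solution =
 fixes U :: "'a::euclidean_space set" and T \<gamma> \<epsilon> H :: real and \<phi>0 :: "'a \<Rightarrow> real" and p \<mu> \<phi> :: "real \<Rightarrow> 'a \<Rightarrow> real"
  and l :: "real \<Rightarrow> ('a \<Rightarrow> real) \<Rightarrow> real" and w :: "real \<Rightarrow> 'a \<Rightarrow> real"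
 assumes time_deriv: "is_time_deriv U T \<phi> l"
  and l_Lp: "l \<in> bochner_Lp (4/3) T (H1_dual U) (H1_dual_norm U)"
  and \<phi>_measurable: "bochner_measurable T (H1 U) (H1_norm U) \<phi>"
  and \<mu>_measurable: "bochner_measurable T (H1 U) (H1_norm U) \<mu>"
  and \<mu>_integrable: "integrable (dtime T) (\<lambda>t. (H1_norm U (\<mu> t)) ^ (DIM('a) + 1))"
  and flux_measurable: "bochner_measurable T (L2 U) (L2_norm U) (flux U \<gamma> p \<mu> \<phi>)"
  and flux_integrable: "integrable (dtime T) (\<lambda>t. (L2_norm U (flux U \<gamma> p \<mu> \<phi> t)) ^ (DIM('a) + 1))"
  and state: "AE t in dtime T. state U \<gamma> \<epsilon> (\<phi> t) (grad U (\<phi> t)) (\<mu> t) (grad U (\<mu> t)) (grad U (p t)) (flux U \<gamma> p \<mu> \<phi> t) (l t)"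
  and bound: "AE t in dtime T. L2_norm U (\<phi> t) + L2_norm U (grad U (\<phi> t)) \<le> H"
  and pressure: "AE t in dtime T. p t \<in> H1 U \<inter> L2_zero_mean U"
  and w_L2: "\<And>t. t \<in> {0..T} \<Longrightarrow> w t \<in> L2 U"
  and w_continuous: "\<And>t. t \<in> {0..T} \<Longrightarrow> ((\<lambda>s. L2_norm U (w s - w t)) \<longlongrightarrow> 0) (at t within {0..T})"
  and w_eq: "AE t in dtime T. AE x in lebesgue_on U. w t x = \<phi> t x"
  and w_initial: "AE x in lebesgue_on U. w 0 x = \<phi>0 x"

lemma class_F_regular_solution:
 fixes U :: "'a::euclidean_space set"
 assumes dim: "DIM('a) = 2 \<or> DIM('a) = 3" and U: "open U"
  and F: "class_F U T \<gamma> \<epsilon> \<phi>0 p \<mu> \<phi>"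
 obtains l w H0 where "\<And>H. H0 \<le> H \<Longrightarrow> regular_solution U T \<gamma> \<epsilon> H \<phi>0 p \<mu> \<phi> l w"
proof -
 have ws: "weak_solution U T \<gamma> \<epsilon> \<phi>0 p \<mu> \<phi>"
  and fl: "flux U \<gamma> p \<mu> \<phi> \<in> bochner_Lp (12 / (6 - real DIM('a))) T (L2 U) (L2_norm U)"
  and mu: "\<mu> \<in> bochner_Lp (12 / (6 - real DIM('a))) T (H1 U) (H1_norm U)"
  using F unfolding class_F_def by blast+
 have p: "p \<in> bochner_Lp (4/3) T (H1 U \<inter> L2_zero_mean U) (H1_norm U)"
  and phi: "\<phi> \<in> bochner_Linf T (H1 U) (H1_norm U)" "\<phi> \<in> bochner_Lp 4 T (Linf U) (Linf_norm U)"
  using ws unfolding weak_solution_def by blast+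
 obtain l where l: "is_time_deriv U T \<phi> l" "l \<in> bochner_Lp (4/3) T (H1_dual U) (H1_dual_norm U)"
  and eqs: "AE t in dtime T.
      (\<forall>q\<in>H1 U. L2_inner U (flux U \<gamma> p \<mu> \<phi> t) (grad U q) = 0) \<and>
      (\<forall>\<nu>\<in>H1 U. l t \<nu> + \<epsilon> * L2_inner U (grad U (\<mu> t)) (grad U \<nu>)
        + L2_inner U (\<lambda>x. \<phi> t x *\<^sub>R flux U \<gamma> p \<mu> \<phi> t x) (grad U \<nu>) = 0) \<and>
      (\<forall>\<psi>\<in>H1 U. L2_inner U (\<mu> t) \<psi> - \<epsilon> * L2_inner U (grad U (\<phi> t)) (grad U \<psi>)
        - 1 / \<epsilon> * L2_inner U (\<lambda>x. f_pot (\<phi> t x)) \<psi> = 0)"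
  using ws unfolding weak_solution_def by blast
 obtain w where w: "\<forall>t\<in>{0..T}. w t \<in> L2 U \<and> ((\<lambda>s. L2_norm U (w s - w t)) \<longlongrightarrow> 0) (at t within {0..T})"
  "AE t in dtime T. AE x in lebesgue_on U. w t x = \<phi> t x" "AE x in lebesgue_on U. w 0 x = \<phi>0 x"
  using ws unfolding weak_solution_def has_initial_value_def by blast
 obtain K where K: "AE t in dtime T. H1_norm U (\<phi> t) \<le> K" using bochner_Linf_bounded[OF phi(1)] by blast
 have mem: "AE t in dtime T. p t \<in> H1 U \<inter> L2_zero_mean U" "AE t in dtime T. \<mu> t \<in> H1 U"
  "AE t in dtime T. flux U \<gamma> p \<mu> \<phi> t \<in> L2 U" "AE t in dtime T. \<phi> t \<in> H1 U" "AE t in dtime T. \<phi> t \<in> Linf U"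
  using p mu fl phi unfolding bochner_Lp_def bochner_Linf_def bochner_measurable_def by blast+
 have st: "AE t in dtime T. state U \<gamma> \<epsilon> (\<phi> t) (grad U (\<phi> t)) (\<mu> t) (grad U (\<mu> t)) (grad U (p t)) (flux U \<gamma> p \<mu> \<phi> t) (l t)"
  using eqs mem
 proof eventually_elim
  case (elim t)
  show ?case by (rule weak_solution_state[OF U _ elim(3,5,6,4)]) (use elim(1,2) in \<open>auto simp: flux_def\<close>)
 qed
 show thesis
 proof (rule that[of "2 * K" l w], unfold_locales)
  fix H assume H: "2 * K \<le> H"
  show "AE t in dtime T. L2_norm U (\<phi> t) + L2_norm U (grad U (\<phi> t)) \<le> H"
   using K
  proof eventually_elim
   case (elim t)
   show ?case using elim H H1_norm_ge[of U "\<phi> t"] by linarith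
  qed
 qed (use l mem(1) st w mu fl phi in \<open>simp_all add: bochner_Linf_def bochner_Lp_def
   powr_integrability_exponent[OF dim H1_norm_nonneg] powr_integrability_exponent[OF dim L2_norm_nonneg]\<close>)
qed

section \<open>The chemical potential and the pressure\<close>

text \<open>At a time where the phase fields agree, the chemical potentials agree by testing the difference of their equations with itself;
 then the fluxes differ by a gradient, to which both fluxes are orthogonal.\<close>

lemma states_agree:
 assumes U: "open U" and fin: "finite_measure (lebesgue_on U)"
  and s1: "state U \<gamma> \<epsilon> \<phi>1 \<Phi>1 \<mu>1 N1 R1 u1 D1" and s2: "state U \<gamma> \<epsilon> \<phi>2 \<Phi>2 \<mu>2 N2 R2 u2 D2"
  and eq: "AE x in lebesgue_on U. \<phi>1 x = \<phi>2 x"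
 shows "AE x in lebesgue_on U. \<mu>1 x = \<mu>2 x" "AE x in lebesgue_on U. R1 x = R2 x"
proof -
 have Ub: "U \<in> sets borel" using U by simp
 have sl: "slice U \<epsilon> \<phi>1 \<Phi>1 \<mu>1 N1" "slice U \<epsilon> \<phi>2 \<Phi>2 \<mu>2 N2" using s1 s2 by (auto simp: state_def)
 have g: "has_grad U \<phi>1 \<Phi>1" "has_grad U \<phi>2 \<Phi>2" "has_grad U \<mu>1 N1" "has_grad U \<mu>2 N2" using sl by (auto simp: slice_def)
 obtain p1 p2 where gp: "has_grad U p1 R1" "has_grad U p2 R2" using s1 s2 by (auto simp: state_def)
 have u: "u1 \<in> L2 U" "u2 \<in> L2 U" using s1 s2 by (auto simp: state_def)
 have l2: "\<phi>1 \<in> L2 U" "\<phi>2 \<in> L2 U" "\<Phi>1 \<in> L2 U" "\<Phi>2 \<in> L2 U" "\<mu>1 \<in> L2 U" "\<mu>2 \<in> L2 U" "R1 \<in> L2 U" "R2 \<in> L2 U"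
  using g gp by (auto simp: has_grad_def)
 obtain K1 K2 where K: "AE x in lebesgue_on U. \<bar>\<phi>1 x\<bar> \<le> K1" "AE x in lebesgue_on U. \<bar>\<phi>2 x\<bar> \<le> K2" using sl by (auto simp: slice_def)
 have fl: "(\<lambda>x. f_pot (\<phi>1 x)) \<in> L2 U" "(\<lambda>x. f_pot (\<phi>2 x)) \<in> L2 U"
  using f_pot_bounded_L2[OF fin L2_borel[OF l2(1)] K(1)] f_pot_bounded_L2[OF fin L2_borel[OF l2(2)] K(2)] by blast+
 have Peq: "AE x in lebesgue_on U. \<Phi>1 x = \<Phi>2 x" by (rule has_grad_unique[OF U g(1,2) eq])
 have feq: "AE x in lebesgue_on U. f_pot (\<phi>1 x) = f_pot (\<phi>2 x)" using eq by eventually_elim simp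
 let ?\<mu> = "\<lambda>x. \<mu>1 x - \<mu>2 x"
 have gm: "has_grad U ?\<mu> (\<lambda>x. N1 x - N2 x)" by (intro has_grad_diff Ub g)
 then have ml: "?\<mu> \<in> L2 U" "(\<lambda>x. N1 x - N2 x) \<in> L2 U" by (auto simp: has_grad_def)
 have "L2_inner U \<mu>1 ?\<mu> = L2_inner U \<mu>2 ?\<mu>"
 proof -
  have "L2_inner U \<mu>1 ?\<mu> - \<epsilon> * L2_inner U \<Phi>1 (\<lambda>x. N1 x - N2 x) - 1 / \<epsilon> * L2_inner U (\<lambda>x. f_pot (\<phi>1 x)) ?\<mu> = 0"
   "L2_inner U \<mu>2 ?\<mu> - \<epsilon> * L2_inner U \<Phi>2 (\<lambda>x. N1 x - N2 x) - 1 / \<epsilon> * L2_inner U (\<lambda>x. f_pot (\<phi>2 x)) ?\<mu> = 0"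
   using sl gm unfolding slice_def by blast+
  moreover have "L2_inner U \<Phi>1 (\<lambda>x. N1 x - N2 x) = L2_inner U \<Phi>2 (\<lambda>x. N1 x - N2 x)"
   by (rule L2_inner_cong_AE[OF l2(3,4) ml(2) ml(2) Peq]) simp
  moreover have "L2_inner U (\<lambda>x. f_pot (\<phi>1 x)) ?\<mu> = L2_inner U (\<lambda>x. f_pot (\<phi>2 x)) ?\<mu>"
   by (rule L2_inner_cong_AE[OF fl ml(1) ml(1) feq]) simp
  ultimately show ?thesis by simp
 qed
 then have "(L2_norm U ?\<mu>)^2 = 0"
  by (simp add: L2_inner_self[symmetric] L2_inner_diff_left[OF l2(5,6) ml(1)])
 then have "AE x in lebesgue_on U. ?\<mu> x = 0" by (intro L2_norm_eq_0_AE[OF ml(1)]) simp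
 then show mu: "AE x in lebesgue_on U. \<mu>1 x = \<mu>2 x" by eventually_elim simp
 have Neq: "AE x in lebesgue_on U. N1 x = N2 x" by (rule has_grad_unique[OF U g(3,4) mu])
 let ?R = "\<lambda>x. R1 x - R2 x" and ?u = "\<lambda>x. u1 x - u2 x"
 have hp: "has_grad U (\<lambda>x. p1 x - p2 x) ?R" by (intro has_grad_diff Ub gp)
 then have Rl: "?R \<in> L2 U" by (simp add: has_grad_def)
 have ueq: "AE x in lebesgue_on U. ?R x = ?u x"
 proof -
  have "AE x in lebesgue_on U. u1 x = R1 x + (\<gamma> * \<phi>1 x) *\<^sub>R N1 x" "AE x in lebesgue_on U. u2 x = R2 x + (\<gamma> * \<phi>2 x) *\<^sub>R N2 x"
   using s1 s2 by (auto simp: state_def)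
  then show ?thesis using Neq eq by eventually_elim simp
 qed
 have "L2_inner U u1 ?R = 0" "L2_inner U u2 ?R = 0" using s1 s2 hp unfolding state_def by blast+
 moreover have "L2_inner U ?R ?R = L2_inner U ?u ?R" by (rule L2_inner_cong_AE[OF Rl L2_diff[OF u] Rl Rl ueq]) simp
 ultimately have "(L2_norm U ?R)^2 = 0" by (simp add: L2_inner_self L2_inner_diff_left[OF u Rl])
 then have "AE x in lebesgue_on U. ?R x = 0" by (intro L2_norm_eq_0_AE[OF Rl]) simp
 then show "AE x in lebesgue_on U. R1 x = R2 x" by eventually_elim simp
qed

text \<open>On a connected domain the gradient leaves only a constant free, and the zero mean fixes it.\<close>

lemma pressure_unique:
 assumes U: "open U" "connected U" and fin: "finite_measure (lebesgue_on U)"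
  and p: "p \<in> H1 U" "q \<in> H1 U" "p \<in> L2_zero_mean U" "q \<in> L2_zero_mean U"
  and eq: "AE x in lebesgue_on U. grad U p x = grad U q x"
 shows "AE x in lebesgue_on U. p x = q x"
proof -
 interpret finite_measure "lebesgue_on U" by (rule fin)
 have Ub: "U \<in> sets borel" using U by simp
 have d: "has_grad U (\<lambda>x. p x - q x) (\<lambda>x. grad U p x - grad U q x)" by (intro has_grad_diff Ub has_grad_grad p)
 have "has_grad U (\<lambda>x. p x - q x) (\<lambda>x. 0)"
  by (rule has_grad_cong_AE[OF Ub d]) (use d eq in \<open>auto simp: has_grad_def elim!: eventually_mono\<close>)
 then obtain c where c: "AE x in lebesgue_on U. p x - q x = c" using has_grad_zero_constant[OF U] by blast
 have one: "(\<lambda>x. 1::real) \<in> L2 U" by (rule bounded_imp_L2[OF fin, of _ 1]) auto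
 have l2: "p \<in> L2 U" "q \<in> L2 U" using p by (auto simp: H1_def)
 have i: "integrable (lebesgue_on U) p" "integrable (lebesgue_on U) q"
  using L2_inner_integrable(1)[OF l2(1) one] L2_inner_integrable(1)[OF l2(2) one] by auto
 have "(LINT x|lebesgue_on U. p x - q x) = 0"
  using p(3,4) i by (simp add: L2_zero_mean_def)
 moreover have "(LINT x|lebesgue_on U. p x - q x) = (LINT x|lebesgue_on U. c)"
  using c i by (intro integral_cong_AE) auto
 ultimately have z: "c * measure (lebesgue_on U) U = 0" by (simp add: space_restrict_space mult.commute)
 have "AE x in lebesgue_on U. c = 0"
 proof (cases "c = 0")
  case False
  then have "measure (lebesgue_on U) (space (lebesgue_on U)) = 0" using z by (simp add: space_restrict_space)
  then have "emeasure (lebesgue_on U) (space (lebesgue_on U)) = 0" by (simp add: emeasure_eq_measure)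
  then show ?thesis by (intro AE_I[of _ _ "space (lebesgue_on U)"]) auto
 qed simp
 with c show ?thesis by eventually_elim simp
qed

section \<open>Uniqueness\<close>

lemma integrable_power_add:
 fixes f g :: "'b \<Rightarrow> real"
 assumes "f \<in> borel_measurable M" "g \<in> borel_measurable M" and f0: "\<And>x. 0 \<le> f x" and g0: "\<And>x. 0 \<le> g x"
  and f: "integrable M (\<lambda>x. f x ^ n)" and g: "integrable M (\<lambda>x. g x ^ n)"
 shows "integrable M (\<lambda>x. (f x + g x) ^ n)"
proof (rule Bochner_Integration.integrable_bound)
 show "integrable M (\<lambda>x. 2 ^ n * (f x ^ n + g x ^ n))" by (intro integrable_mult_right Bochner_Integration.integrable_add f g)
 show "AE x in M. norm ((f x + g x) ^ n) \<le> norm (2 ^ n * (f x ^ n + g x ^ n))"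
 proof (rule AE_I2)
  fix x
  have "(f x + g x) ^ n \<le> (2 * max (f x) (g x)) ^ n" using f0[of x] g0[of x] by (intro power_mono) auto
  also have "\<dots> = 2 ^ n * max (f x) (g x) ^ n" by (rule power_mult_distrib)
  also have "max (f x) (g x) ^ n \<le> f x ^ n + g x ^ n" using f0[of x] g0[of x] by (simp add: max_def)
  finally have "(f x + g x) ^ n \<le> 2 ^ n * (f x ^ n + g x ^ n)" by simp
  moreover have "0 \<le> (f x + g x) ^ n" "0 \<le> f x ^ n + g x ^ n" using f0[of x] g0[of x] by auto
  ultimately show "norm ((f x + g x) ^ n) \<le> norm (2 ^ n * (f x ^ n + g x ^ n))" by (simp add: abs_of_nonneg)
 qed
qed (use assms in measurable)

lemma integrable_power_bound:
 fixes f g :: "'b \<Rightarrow> real"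
 assumes "f \<in> borel_measurable M" and f: "\<And>x. 0 \<le> f x" "\<And>x. f x \<le> g x" and g: "integrable M (\<lambda>x. g x ^ n)"
 shows "integrable M (\<lambda>x. f x ^ n)"
proof (rule Bochner_Integration.integrable_bound[OF g])
 show "AE x in M. norm (f x ^ n) \<le> norm (g x ^ n)"
 proof (rule AE_I2)
  fix x
  have "0 \<le> g x" using f[of x] by linarith
  then show "norm (f x ^ n) \<le> norm (g x ^ n)" using power_mono[OF f(2) f(1), of x n] f(1)[of x] by (simp add: abs_of_nonneg)
 qed
qed (use assms in measurable)

lemma L2_inner_measurable:
 fixes u :: "real \<Rightarrow> 'a::euclidean_space \<Rightarrow> real"
 assumes u: "bochner_measurable T (L2 U) (L2_norm U) u" and v: "v \<in> L2 U"
 shows "(\<lambda>t. L2_inner U (u t) v) \<in> borel_measurable (dtime T)"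
proof (rule bochner_measurable_compose2[OF u u, of "\<lambda>f g. L2_inner U f v" "L2_norm U v"])
 fix f f' g g' :: "'a \<Rightarrow> real" assume m: "f \<in> L2 U" "f' \<in> L2 U" "g \<in> L2 U" "g' \<in> L2 U"
 have "\<bar>L2_inner U (\<lambda>x. f x - f' x) v\<bar> \<le> L2_norm U (\<lambda>x. f x - f' x) * L2_norm U v" by (rule L2_Cauchy_Schwarz(2)[OF L2_diff[OF m(1,2)] v])
 moreover have "0 \<le> L2_norm U v * L2_norm U (g - g')" by (intro mult_nonneg_nonneg L2_norm_nonneg)
 ultimately show "\<bar>L2_inner U f' v - L2_inner U f v\<bar> \<le> L2_norm U v * (L2_norm U (f - f') + L2_norm U (g - g'))"
  unfolding L2_inner_diff_left[OF m(1,2) v] by (simp add: distrib_left mult.commute abs_minus_commute fun_diff_eq)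
qed

text \<open>Pairing with a fixed element, both sides of the equation for the time derivative are integrable,
 so that the equations of two solutions may be subtracted.\<close>

lemma (in regular_solution) time_derivative_integrable:
 assumes U: "open U" and T: "finite_measure (dtime T)" and v: "v \<in> H1 U" and \<eta>: "test_function {0<..<T} \<eta>"
 shows "integrable (dtime T) (\<lambda>t. l t v * \<eta> t)" "integrable (dtime T) (\<lambda>t. L2_inner U (\<phi> t) v * deriv \<eta> t)"
proof -
 interpret finite_measure "dtime T" by (rule T)
 have vl: "v \<in> L2 U" using v by (simp add: H1_def)
 have lm: "bochner_measurable T (H1_dual U) (H1_dual_norm U) l"
  and li: "integrable (dtime T) (\<lambda>t. H1_dual_norm U (l t) powr (4/3))" using l_Lp by (auto simp: bochner_Lp_def)
 note \<eta>' = test_function_deriv(2)[OF \<eta>]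
 obtain B where B: "B > 0" "\<And>t. \<bar>\<eta> t\<bar> \<le> B" using test_function_bounded[OF \<eta>] by blast
 obtain B' where B': "B' > 0" "\<And>t. \<bar>deriv \<eta> t\<bar> \<le> B'" using test_function_bounded[OF \<eta>'] by blast
 have m: "\<eta> \<in> borel_measurable (dtime T)" "deriv \<eta> \<in> borel_measurable (dtime T)"
  using test_function_borel[OF \<eta>] test_function_borel[OF \<eta>'] by (auto intro: borel_measurable_lebesgue_on_borel)
 show "integrable (dtime T) (\<lambda>t. l t v * \<eta> t)"
 proof (rule Bochner_Integration.integrable_bound)
  show "integrable (dtime T) (\<lambda>t. (1 + H1_dual_norm U (l t) powr (4/3)) * H1_norm U v * B)"
   using li by (intro integrable_mult_left Bochner_Integration.integrable_add integrable_const)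
  show "(\<lambda>t. l t v * \<eta> t) \<in> borel_measurable (dtime T)"
   by (intro borel_measurable_times bochner_dual_measurable[OF U lm v] m)
  have "AE t in dtime T. l t \<in> H1_dual U" using lm by (simp add: bochner_measurable_def)
  then show "AE t in dtime T. norm (l t v * \<eta> t) \<le> norm ((1 + H1_dual_norm U (l t) powr (4/3)) * H1_norm U v * B)"
  proof eventually_elim
   case (elim t)
   let ?x = "H1_dual_norm U (l t)"
   have b: "\<bar>l t v\<bar> \<le> ?x * H1_norm U v" by (rule H1_dual_bound[OF U elim v])
   have "\<bar>l t v\<bar> \<le> (1 + ?x powr (4/3)) * H1_norm U v"
   proof (cases "H1_norm U v = 0")
    case False
    have "?x \<le> 1 + ?x powr (4/3)"
    proof (cases "?x \<le> 1")
     case False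
     then have "?x powr 1 \<le> ?x powr (4/3)" by (intro powr_mono) auto
     then show ?thesis using False by simp
    qed (simp add: add_increasing2)
    then have "?x * H1_norm U v \<le> (1 + ?x powr (4/3)) * H1_norm U v" by (rule mult_right_mono[OF _ H1_norm_nonneg])
    then show ?thesis using b by linarith
   qed (use b in simp)
   then have "\<bar>l t v * \<eta> t\<bar> \<le> (1 + ?x powr (4/3)) * H1_norm U v * B"
    unfolding abs_mult using B(2)[of t] H1_norm_nonneg[of U v] by (intro mult_mono) (auto intro!: mult_nonneg_nonneg add_nonneg_nonneg)
   then show ?case unfolding real_norm_def by (rule order_trans[OF _ abs_ge_self])
  qed
 qed
 show "integrable (dtime T) (\<lambda>t. L2_inner U (\<phi> t) v * deriv \<eta> t)"
 proof (rule Bochner_Integration.integrable_bound)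
  show "integrable (dtime T) (\<lambda>t. H * L2_norm U v * B')" by (rule integrable_const)
  show "(\<lambda>t. L2_inner U (\<phi> t) v * deriv \<eta> t) \<in> borel_measurable (dtime T)"
   by (intro borel_measurable_times L2_inner_measurable[OF bochner_H1_L2[OF \<phi>_measurable] vl] m)
  have "AE t in dtime T. \<phi> t \<in> L2 U" using bochner_H1_L2[OF \<phi>_measurable] by (simp add: bochner_measurable_def)
  with bound show "AE t in dtime T. norm (L2_inner U (\<phi> t) v * deriv \<eta> t) \<le> norm (H * L2_norm U v * B')"
  proof eventually_elim
   case (elim t)
   have b: "L2_norm U (\<phi> t) \<le> H" using elim(1) L2_norm_nonneg[of U "grad U (\<phi> t)"] by linarith
   then have h: "0 \<le> H" using L2_norm_nonneg[of U "\<phi> t"] by linarith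
   have "\<bar>L2_inner U (\<phi> t) v\<bar> \<le> L2_norm U (\<phi> t) * L2_norm U v" by (rule L2_Cauchy_Schwarz(2)[OF elim(2) vl])
   also have "\<dots> \<le> H * L2_norm U v" by (rule mult_right_mono[OF b L2_norm_nonneg])
   finally have "\<bar>L2_inner U (\<phi> t) v * deriv \<eta> t\<bar> \<le> H * L2_norm U v * B'"
    unfolding abs_mult using B'(2)[of t] h by (intro mult_mono) (auto intro!: mult_nonneg_nonneg L2_norm_nonneg)
   then show ?case unfolding real_norm_def by (rule order_trans[OF _ abs_ge_self])
  qed
 qed
qed

locale solution_pair =
 s1: regular_solution U T \<gamma> \<epsilon> H \<phi>0 p1 \<mu>1 \<phi>1 l1 w1 + s2: regular_solution U T \<gamma> \<epsilon> H \<phi>0 p2 \<mu>2 \<phi>2 l2 w2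
 for U :: "'a::euclidean_space set" and T \<gamma> \<epsilon> H \<phi>0 p1 \<mu>1 \<phi>1 l1 w1 p2 \<mu>2 \<phi>2 l2 w2 +
 fixes K C :: real
 assumes dim: "DIM('a) = 2 \<or> DIM('a) = 3" and dom: "bounded_lipschitz_domain U"
  and T: "0 < T" and \<gamma>: "0 < \<gamma>" and \<epsilon>: "0 < \<epsilon>" and H: "0 \<le> H" and constants: "estimate_constants U \<gamma> \<epsilon> H K C"
begin

abbreviation "S \<equiv> {0<..<T}"
abbreviation "u1 \<equiv> flux U \<gamma> p1 \<mu>1 \<phi>1"
abbreviation "u2 \<equiv> flux U \<gamma> p2 \<mu>2 \<phi>2"

text \<open>The letters have the meaning that they have in \<open>estimate_constants\<close> and \<open>difference_evolution\<close>.\<close>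

definition w where "w t x = w1 t x - w2 t x"
definition W where "W t x = grad U (\<phi>1 t) x - grad U (\<phi>2 t) x"
definition m where "m t = \<mu>1 t - \<mu>2 t"
definition z where "z t x = (\<mu>1 t x - \<mu>2 t x) - (1 / \<epsilon>) * (f_pot (\<phi>1 t x) - f_pot (\<phi>2 t x))"
definition D where "D t \<nu> = l1 t \<nu> - l2 t \<nu>"
definition P where "P t = L2_norm U (\<lambda>x. \<phi>1 t x - \<phi>2 t x) + L2_norm U (W t)"
definition A where "A t = L2_norm U (\<lambda>x. grad U (\<mu>1 t) x - grad U (\<mu>2 t) x)"
definition J where "J t = L2_norm U (\<lambda>x. u1 t x - u2 t x)"
definition k where "k t = 1 + L2_norm U (grad U (\<mu>1 t)) + L2_norm U (grad U (\<mu>2 t)) + L2_norm U (u1 t) + L2_norm U (u2 t)"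
definition E where "E t = \<epsilon> / 2 * (L2_norm U (W t))^2 + (L2_norm U (w t))^2 / 2"
definition N where "N t = rate_fn DIM('a) K \<epsilon> (P t) (A t) (J t) (k t)"
definition L where "L t = nonlin_fn DIM('a) K \<epsilon> (P t) (A t) (k t)"
definition \<kappa> where "\<kappa> t = C * (4 + 4 / \<epsilon>) * k t ^ (DIM('a) + 1)"

lemma U: "open U" "connected U" "U \<in> sets borel" and fin: "finite_measure (lebesgue_on U)"
 using dom finite_measure_domain[OF dom] by (auto simp: bounded_lipschitz_domain_def)

lemma finT: "finite_measure (lebesgue_on S)"
 using T by (intro finite_measureI) (simp add: emeasure_restrict_space space_restrict_space emeasure_lborel_Ioo)

lemma K: "0 \<le> K" and C: "0 \<le> C"
 using constants by (auto simp: estimate_constants_def)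

lemma k_ge: "1 \<le> k t" "L2_norm U (grad U (\<mu>1 t)) \<le> k t" "L2_norm U (grad U (\<mu>2 t)) \<le> k t" "L2_norm U (u1 t) \<le> k t" "L2_norm U (u2 t) \<le> k t"
proof -
 have "0 \<le> L2_norm U (grad U (\<mu>1 t))" "0 \<le> L2_norm U (grad U (\<mu>2 t))" "0 \<le> L2_norm U (u1 t)" "0 \<le> L2_norm U (u2 t)"
  by (rule L2_norm_nonneg)+
 then show "1 \<le> k t" "L2_norm U (grad U (\<mu>1 t)) \<le> k t" "L2_norm U (grad U (\<mu>2 t)) \<le> k t" "L2_norm U (u1 t) \<le> k t" "L2_norm U (u2 t) \<le> k t"
  unfolding k_def by linarith+
qed

lemma N_nonneg: "0 \<le> N t"
proof -
 have "0 \<le> k t" using k_ge(1)[of t] by linarith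
 moreover have "0 \<le> P t" "0 \<le> A t" "0 \<le> J t" unfolding P_def A_def J_def by (intro add_nonneg_nonneg L2_norm_nonneg)+
 ultimately show ?thesis unfolding N_def rate_fn_def sup_fn_def using \<epsilon> K
  by (intro add_nonneg_nonneg mult_nonneg_nonneg real_sqrt_ge_zero divide_nonneg_nonneg) auto
qed

lemma measurability [measurable]:
 "(\<lambda>t. L2_norm U (W t)) \<in> borel_measurable (lebesgue_on S)" "(\<lambda>t. L2_norm U (\<lambda>x. \<phi>1 t x - \<phi>2 t x)) \<in> borel_measurable (lebesgue_on S)"
 "P \<in> borel_measurable (lebesgue_on S)" "A \<in> borel_measurable (lebesgue_on S)" "J \<in> borel_measurable (lebesgue_on S)" "k \<in> borel_measurable (lebesgue_on S)"
proof -
 note g = bochner_H1_grad[OF U(1) s1.\<phi>_measurable] bochner_H1_grad[OF U(1) s2.\<phi>_measurable]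
  bochner_H1_grad[OF U(1) s1.\<mu>_measurable] bochner_H1_grad[OF U(1) s2.\<mu>_measurable]
 show "(\<lambda>t. L2_norm U (W t)) \<in> borel_measurable (lebesgue_on S)" unfolding W_def[abs_def] by (rule L2_norm_diff_measurable[OF g(1,2)])
 moreover show "(\<lambda>t. L2_norm U (\<lambda>x. \<phi>1 t x - \<phi>2 t x)) \<in> borel_measurable (lebesgue_on S)"
  by (intro L2_norm_diff_measurable bochner_H1_L2 s1.\<phi>_measurable s2.\<phi>_measurable)
 ultimately show "P \<in> borel_measurable (lebesgue_on S)" unfolding P_def[abs_def] by measurable
 show "A \<in> borel_measurable (lebesgue_on S)" unfolding A_def[abs_def] by (rule L2_norm_diff_measurable[OF g(3,4)])
 show "J \<in> borel_measurable (lebesgue_on S)" unfolding J_def[abs_def] by (rule L2_norm_diff_measurable[OF s1.flux_measurable s2.flux_measurable])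
 note [measurable] = L2_norm_measurable[OF g(3)] L2_norm_measurable[OF g(4)] L2_norm_measurable[OF s1.flux_measurable] L2_norm_measurable[OF s2.flux_measurable]
 show "k \<in> borel_measurable (lebesgue_on S)" unfolding k_def[abs_def] by measurable
qed

text \<open>This is where the integrability that defines the class of uniqueness enters.\<close>

lemma k_integrable: "integrable (lebesgue_on S) (\<lambda>t. k t ^ (DIM('a) + 1))"
proof -
 interpret finite_measure "lebesgue_on S" by (rule finT)
 note m1 = L2_norm_measurable[OF bochner_H1_grad[OF U(1) s1.\<mu>_measurable]] and m2 = L2_norm_measurable[OF bochner_H1_grad[OF U(1) s2.\<mu>_measurable]]
 note [measurable] = m1 m2 L2_norm_measurable[OF s1.flux_measurable] L2_norm_measurable[OF s2.flux_measurable]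
 have 1: "integrable (lebesgue_on S) (\<lambda>t. L2_norm U (grad U (\<mu>1 t)) ^ (DIM('a) + 1))" "integrable (lebesgue_on S) (\<lambda>t. L2_norm U (grad U (\<mu>2 t)) ^ (DIM('a) + 1))"
  by (rule integrable_power_bound[OF m1 L2_norm_nonneg H1_norm_ge(2) s1.\<mu>_integrable] integrable_power_bound[OF m2 L2_norm_nonneg H1_norm_ge(2) s2.\<mu>_integrable])+
 have 2: "integrable (lebesgue_on S) (\<lambda>t. 1 ^ (DIM('a) + 1) :: real)" by simp
 show ?thesis unfolding k_def
  by (intro integrable_power_add 1 2 s1.flux_integrable s2.flux_integrable) (measurable, (auto intro!: add_nonneg_nonneg L2_norm_nonneg)+)
qed

lemma L2_time:
 assumes m: "f \<in> borel_measurable (lebesgue_on S)" and b: "AE t in lebesgue_on S. (f t)^2 \<le> c * k t ^ n" and n: "n \<le> 3" and c: "0 \<le> c"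
 shows "f \<in> L2 S"
proof -
 have "integrable (lebesgue_on S) (\<lambda>t. (f t)^2)"
 proof (rule Bochner_Integration.integrable_bound[OF integrable_mult_right[OF k_integrable, of c]])
  show "AE t in lebesgue_on S. norm ((f t)^2) \<le> norm (c * k t ^ (DIM('a) + 1))"
   using b
  proof eventually_elim
   case (elim t)
   also have "c * k t ^ n \<le> c * k t ^ (DIM('a) + 1)" using k_ge(1)[of t] dim n c by (intro mult_left_mono power_increasing) auto
   finally show ?case by simp
  qed
 qed (use m in measurable)
 then show ?thesis using m by (simp add: L2_def)
qed

lemma estimates:
 "AE t in lebesgue_on S. (\<forall>\<nu> G. has_grad U \<nu> G \<longrightarrow> \<bar>D t \<nu>\<bar> \<le> N t * L2_norm U G) \<and>
   (\<exists>\<Gamma>. has_grad U (\<lambda>x. f_pot (\<phi>1 t x) - f_pot (\<phi>2 t x)) \<Gamma> \<and> L2_norm U \<Gamma> / \<epsilon> + P t \<le> L t) \<and>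
   D t (m t) + N t * L t \<le> C * k t ^ (DIM('a) + 1) * (P t)^2 \<and> (N t)^2 \<le> C * k t ^ 3 \<and> (L t)^2 \<le> C * k t ^ 3"
 using s1.state s2.state s1.bound s2.bound
proof eventually_elim
 case (elim t)
 from constants[unfolded estimate_constants_def, THEN conjunct2, THEN conjunct2, rule_format, OF elim k_ge P_def[unfolded W_def[abs_def]] A_def J_def]
 show ?case unfolding N_def L_def D_def m_def fun_diff_eq .
qed

lemma gradients: "AE t in lebesgue_on S. has_grad U (\<phi>1 t) (grad U (\<phi>1 t)) \<and> has_grad U (\<phi>2 t) (grad U (\<phi>2 t))
  \<and> has_grad U (\<mu>1 t) (grad U (\<mu>1 t)) \<and> has_grad U (\<mu>2 t) (grad U (\<mu>2 t))"
 using s1.state s2.state by eventually_elim (simp add: state_def slice_def)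

lemma w_difference: "AE t in lebesgue_on S. has_grad U (w t) (W t) \<and> (AE x in lebesgue_on U. \<phi>1 t x - \<phi>2 t x = w t x) \<and>
  L2_norm U (w t) = L2_norm U (\<lambda>x. \<phi>1 t x - \<phi>2 t x)"
proof -
 have "AE t in lebesgue_on S. t \<in> S" by (rule AE_I2) simp
 with s1.w_eq s2.w_eq gradients show ?thesis
 proof eventually_elim
  case (elim t)
  have wl: "w t \<in> L2 U" unfolding w_def[abs_def] using elim(4) by (intro L2_diff s1.w_L2 s2.w_L2) auto
  have ae: "AE x in lebesgue_on U. \<phi>1 t x - \<phi>2 t x = w t x" using elim(1,2) by eventually_elim (simp add: w_def)
  have d: "has_grad U (\<lambda>x. \<phi>1 t x - \<phi>2 t x) (W t)" unfolding W_def[abs_def] using elim(3) by (intro has_grad_diff U) auto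
  then have l: "(\<lambda>x. \<phi>1 t x - \<phi>2 t x) \<in> L2 U" "W t \<in> L2 U" by (auto simp: has_grad_def)
  show ?case using has_grad_cong_AE[OF U(3) d wl l(2) ae] ae L2_norm_cong_AE[OF l(1) wl ae] by simp
 qed
qed

lemma z_gradient: "AE t in lebesgue_on S. has_grad U (z t) (grad U (z t)) \<and>
  L2_norm U (\<lambda>x. grad U (m t) x - grad U (z t) x) + L2_norm U (W t) \<le> L t"
 using estimates gradients
proof eventually_elim
 case (elim t)
 obtain \<Gamma> where \<Gamma>: "has_grad U (\<lambda>x. f_pot (\<phi>1 t x) - f_pot (\<phi>2 t x)) \<Gamma>" "L2_norm U \<Gamma> / \<epsilon> + P t \<le> L t" using elim(1) by blast
 have gm: "has_grad U (m t) (\<lambda>x. grad U (\<mu>1 t) x - grad U (\<mu>2 t) x)"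
  unfolding m_def fun_diff_eq using elim(2) by (intro has_grad_diff U) auto
 have gz: "has_grad U (z t) (\<lambda>x. (grad U (\<mu>1 t) x - grad U (\<mu>2 t) x) - (1 / \<epsilon>) *\<^sub>R \<Gamma> x)"
  unfolding z_def[abs_def] using elim(2) \<Gamma>(1) by (intro has_grad_diff has_grad_cmult U) auto
 have \<Gamma>l: "\<Gamma> \<in> L2 U" using \<Gamma>(1) by (simp add: has_grad_def)
 have "AE x in lebesgue_on U. grad U (m t) x - grad U (z t) x = (1 / \<epsilon>) *\<^sub>R \<Gamma> x"
  using grad_AE[OF U(1) gm] grad_AE[OF U(1) gz] by eventually_elim simp
 then have "L2_norm U (\<lambda>x. grad U (m t) x - grad U (z t) x) = L2_norm U (\<lambda>x. (1 / \<epsilon>) *\<^sub>R \<Gamma> x)"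
  by (intro L2_norm_cong_AE L2_diff L2_scaleR \<Gamma>l grad_H1(1) has_grad_H1[OF gm] has_grad_H1[OF gz])
 also have "\<dots> = L2_norm U \<Gamma> / \<epsilon>" using \<epsilon> by (simp add: L2_norm_scaleR)
 finally have "L2_norm U (\<lambda>x. grad U (m t) x - grad U (z t) x) = L2_norm U \<Gamma> / \<epsilon>" .
 moreover have "L2_norm U (W t) \<le> P t" unfolding P_def by (simp add: L2_norm_nonneg)
 ultimately show ?case using \<Gamma>(2) has_grad_grad[OF has_grad_H1[OF gz]] by linarith
qed

lemma distance_le_energy: "AE t in lebesgue_on S. (P t)^2 \<le> (4 + 4 / \<epsilon>) * E t"
 using w_difference
proof eventually_elim
 case (elim t)
 define a where "a = L2_norm U (w t)"
 define b where "b = L2_norm U (W t)"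
 have "(P t)^2 = (a + b)^2" using elim by (simp add: P_def a_def b_def)
 also have "\<dots> \<le> 2 * a^2 + 2 * b^2" using sum_squares_bound[of a b] by (simp add: power2_sum)
 also have "\<dots> \<le> (4 + 4 / \<epsilon>) * (\<epsilon> / 2 * b^2 + a^2 / 2)"
 proof -
  have "(4 + 4 / \<epsilon>) * (\<epsilon> / 2 * b^2 + a^2 / 2) = 2 * a^2 + 2 * b^2 + 2 * \<epsilon> * b^2 + 2 / \<epsilon> * a^2" using \<epsilon> by (simp add: field_simps)
  moreover have "0 \<le> 2 * \<epsilon> * b^2" "0 \<le> 2 / \<epsilon> * a^2" using \<epsilon> by auto
  ultimately show ?thesis by linarith
 qed
 finally show ?case by (simp add: E_def a_def b_def)
qed

lemma w_continuous:
 assumes t: "t \<in> {0..T}"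
 shows "((\<lambda>s. L2_norm U (\<lambda>x. w s x - w t x)) \<longlongrightarrow> 0) (at t within {0..T})"
proof (rule tendsto_sandwich[OF always_eventually _ tendsto_const])
 have "((\<lambda>s. L2_norm U (w1 s - w1 t) + L2_norm U (w2 s - w2 t)) \<longlongrightarrow> 0 + 0) (at t within {0..T})"
  by (intro tendsto_add s1.w_continuous s2.w_continuous t)
 then show "((\<lambda>s. L2_norm U (w1 s - w1 t) + L2_norm U (w2 s - w2 t)) \<longlongrightarrow> 0) (at t within {0..T})" by simp
 have "L2_norm U (\<lambda>x. w s x - w t x) \<le> L2_norm U (w1 s - w1 t) + L2_norm U (w2 s - w2 t)" if s: "s \<in> {0..T}" for s
 proof -
  have "(\<lambda>x. w s x - w t x) = (\<lambda>x. (w1 s x - w1 t x) - (w2 s x - w2 t x))" by (simp add: w_def fun_eq_iff)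
  then show ?thesis unfolding fun_diff_eq
   using L2_norm_diff_triangle[OF L2_diff[OF s1.w_L2[OF s] s1.w_L2[OF t]] L2_diff[OF s2.w_L2[OF s] s2.w_L2[OF t]]] by simp
 qed
 then show "\<forall>\<^sub>F s in at t within {0..T}. L2_norm U (\<lambda>x. w s x - w t x) \<le> L2_norm U (w1 s - w1 t) + L2_norm U (w2 s - w2 t)"
  unfolding eventually_at_filter by (intro always_eventually) blast
qed (simp add: L2_norm_nonneg)

lemma time_derivative_difference:
 assumes \<nu>: "\<nu> \<in> H1 U" and \<eta>: "test_function S \<eta>"
 shows "(LINT t|lebesgue_on S. D t \<nu> * \<eta> t) = - (LINT t|lebesgue_on S. L2_inner U (w t) \<nu> * deriv \<eta> t)"
proof -
 note t1 = s1.time_derivative_integrable[OF U(1) finT \<nu> \<eta>] and t2 = s2.time_derivative_integrable[OF U(1) finT \<nu> \<eta>]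
 have \<nu>l: "\<nu> \<in> L2 U" using \<nu> by (simp add: H1_def)
 let ?y = "\<lambda>t. L2_inner U (\<phi>1 t) \<nu> * deriv \<eta> t - L2_inner U (\<phi>2 t) \<nu> * deriv \<eta> t"
 have ae: "AE t in lebesgue_on S. ?y t = L2_inner U (w t) \<nu> * deriv \<eta> t"
  using w_difference gradients
 proof eventually_elim
  case (elim t)
  have l: "\<phi>1 t \<in> L2 U" "\<phi>2 t \<in> L2 U" using elim(2) by (auto simp: has_grad_def)
  have "L2_inner U (\<lambda>x. \<phi>1 t x - \<phi>2 t x) \<nu> = L2_inner U (w t) \<nu>"
   by (rule L2_inner_cong_AE[OF L2_diff[OF l] _ \<nu>l \<nu>l]) (use elim(1) in \<open>auto simp: has_grad_def\<close>)
  then show ?case by (simp add: L2_inner_diff_left[OF l \<nu>l] left_diff_distrib[symmetric])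
 qed
 have m: "?y \<in> borel_measurable (lebesgue_on S)"
  by (rule borel_measurable_integrable[OF Bochner_Integration.integrable_diff[OF t1(2) t2(2)]])
 have "(LINT t|lebesgue_on S. D t \<nu> * \<eta> t) = (LINT t|lebesgue_on S. l1 t \<nu> * \<eta> t) - (LINT t|lebesgue_on S. l2 t \<nu> * \<eta> t)"
  unfolding D_def left_diff_distrib by (rule Bochner_Integration.integral_diff[OF t1(1) t2(1)])
 also have "\<dots> = - (LINT t|lebesgue_on S. ?y t)"
  using s1.time_deriv s2.time_deriv \<nu> \<eta> unfolding is_time_deriv_def by (simp add: Bochner_Integration.integral_diff[OF t1(2) t2(2)])
 also have "(LINT t|lebesgue_on S. ?y t) = (LINT t|lebesgue_on S. L2_inner U (w t) \<nu> * deriv \<eta> t)"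
  by (rule integral_cong_AE[OF m borel_measurable_AE_lebesgue_on[OF m ae] ae])
 finally show ?thesis .
qed

lemma potential_difference: "AE t in lebesgue_on S. \<forall>\<psi> \<Psi>. has_grad U \<psi> \<Psi> \<longrightarrow> L2_inner U (z t) \<psi> = \<epsilon> * L2_inner U (W t) \<Psi>"
 using s1.state s2.state
proof eventually_elim
 case (elim t)
 have sl: "slice U \<epsilon> (\<phi>1 t) (grad U (\<phi>1 t)) (\<mu>1 t) (grad U (\<mu>1 t))" "slice U \<epsilon> (\<phi>2 t) (grad U (\<phi>2 t)) (\<mu>2 t) (grad U (\<mu>2 t))"
  using elim by (auto simp: state_def)
 have l: "\<phi>1 t \<in> L2 U" "\<phi>2 t \<in> L2 U" "\<mu>1 t \<in> L2 U" "\<mu>2 t \<in> L2 U" "grad U (\<phi>1 t) \<in> L2 U" "grad U (\<phi>2 t) \<in> L2 U"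
  using sl by (auto simp: slice_def has_grad_def)
 have f: "(\<lambda>x. f_pot (\<phi>1 t x)) \<in> L2 U" "(\<lambda>x. f_pot (\<phi>2 t x)) \<in> L2 U"
  using sl f_pot_bounded_L2[OF fin L2_borel[OF l(1)]] f_pot_bounded_L2[OF fin L2_borel[OF l(2)]] by (auto simp: slice_def)
 show ?case
 proof (intro allI impI)
  fix \<psi> \<Psi> assume h: "has_grad U \<psi> \<Psi>"
  then have hl: "\<psi> \<in> L2 U" "\<Psi> \<in> L2 U" by (auto simp: has_grad_def)
  have e: "L2_inner U (\<mu>1 t) \<psi> - \<epsilon> * L2_inner U (grad U (\<phi>1 t)) \<Psi> - 1 / \<epsilon> * L2_inner U (\<lambda>x. f_pot (\<phi>1 t x)) \<psi> = 0"
   "L2_inner U (\<mu>2 t) \<psi> - \<epsilon> * L2_inner U (grad U (\<phi>2 t)) \<Psi> - 1 / \<epsilon> * L2_inner U (\<lambda>x. f_pot (\<phi>2 t x)) \<psi> = 0"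
   using sl h unfolding slice_def by blast+
  have "z t = (\<lambda>x. (\<mu>1 t x - \<mu>2 t x) - (1 / \<epsilon>) *\<^sub>R (f_pot (\<phi>1 t x) - f_pot (\<phi>2 t x)))" by (simp add: z_def fun_eq_iff)
  then have "L2_inner U (z t) \<psi> = (L2_inner U (\<mu>1 t) \<psi> - L2_inner U (\<mu>2 t) \<psi>) - (1 / \<epsilon>) * (L2_inner U (\<lambda>x. f_pot (\<phi>1 t x)) \<psi> - L2_inner U (\<lambda>x. f_pot (\<phi>2 t x)) \<psi>)"
   by (simp only: L2_inner_diff_left[OF L2_diff[OF l(3,4)] L2_scaleR[OF L2_diff[OF f]] hl(1)] L2_inner_diff_left[OF l(3,4) hl(1)] L2_inner_scaleR_left L2_inner_diff_left[OF f hl(1)])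
  moreover have "L2_inner U (W t) \<Psi> = L2_inner U (grad U (\<phi>1 t)) \<Psi> - L2_inner U (grad U (\<phi>2 t)) \<Psi>"
   unfolding W_def[abs_def] by (rule L2_inner_diff_left[OF l(5,6) hl(2)])
  ultimately show "L2_inner U (z t) \<psi> = \<epsilon> * L2_inner U (W t) \<Psi>" using e by (simp only: right_diff_distrib)
 qed
qed

lemma D_linear: "AE t in lebesgue_on S. \<forall>u\<in>H1 U. \<forall>v\<in>H1 U. D t (u - v) = D t u - D t v"
proof -
 have "AE t in lebesgue_on S. l1 t \<in> H1_dual U" "AE t in lebesgue_on S. l2 t \<in> H1_dual U"
  using s1.l_Lp s2.l_Lp by (auto simp: bochner_Lp_def bochner_measurable_def)
 then show ?thesis
 proof eventually_elim
  case (elim t)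
  have lin: "l (u - v) = l u - l v" if l: "l \<in> H1_dual U" and uv: "u \<in> H1 U" "v \<in> H1 U" for l u v
  proof -
   have "l (\<lambda>x. 1 * u x + (- 1) * v x) = 1 * l u + (- 1) * l v" using l uv unfolding H1_dual_def by blast
   then show ?thesis by (simp add: fun_diff_eq)
  qed
  show ?case unfolding D_def by (intro ballI) (simp only: lin[OF elim(1)] lin[OF elim(2)] diff_diff_eq2 diff_diff_eq add_ac diff_add_eq diff_right_commute)
 qed
qed

lemma m_gradient_bound: "AE t in lebesgue_on S. L2_norm U (grad U (m t)) \<le> 2 * k t"
 using gradients
proof eventually_elim
 case (elim t)
 have h: "\<mu>1 t \<in> H1 U" "\<mu>2 t \<in> H1 U" using elim has_grad_H1 by blast+
 have "L2_norm U (grad U (m t)) \<le> L2_norm U (grad U (\<mu>1 t)) + L2_norm U (grad U (\<mu>2 t))"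
  unfolding m_def L2_norm_grad_diff[OF U(1) h] by (intro L2_norm_diff_triangle grad_H1 h)
 then show ?case using k_ge(2,3)[of t] by linarith
qed

lemma energy_bounds: "AE t in lebesgue_on S. 0 \<le> \<kappa> t \<and> E t \<le> (\<epsilon> + 1) * (2 * H^2) \<and> D t (m t) + N t * L t \<le> \<kappa> t * E t"
 using estimates distance_le_energy w_difference s1.bound s2.bound gradients
proof eventually_elim
 case (elim t)
 have k0: "0 \<le> k t ^ (DIM('a) + 1)" using k_ge(1)[of t] by (intro zero_le_power) linarith
 have "0 \<le> \<kappa> t" unfolding \<kappa>_def using C \<epsilon> k0 by (intro mult_nonneg_nonneg) auto
 moreover have "C * k t ^ (DIM('a) + 1) * (P t)^2 \<le> C * k t ^ (DIM('a) + 1) * ((4 + 4 / \<epsilon>) * E t)"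
  using elim(2) C k0 by (intro mult_left_mono mult_nonneg_nonneg) auto
 then have "D t (m t) + N t * L t \<le> \<kappa> t * E t" using elim(1) by (simp add: \<kappa>_def mult_ac)
 moreover have "E t \<le> (\<epsilon> + 1) * (2 * H^2)"
 proof -
  have l: "\<phi>1 t \<in> L2 U" "\<phi>2 t \<in> L2 U" "grad U (\<phi>1 t) \<in> L2 U" "grad U (\<phi>2 t) \<in> L2 U" using elim(6) by (auto simp: has_grad_def)
  have "0 \<le> L2_norm U (\<phi>1 t)" "0 \<le> L2_norm U (\<phi>2 t)" "0 \<le> L2_norm U (grad U (\<phi>1 t))" "0 \<le> L2_norm U (grad U (\<phi>2 t))"
   by (rule L2_norm_nonneg)+
  then have b: "L2_norm U (\<phi>1 t) \<le> H" "L2_norm U (\<phi>2 t) \<le> H" "L2_norm U (grad U (\<phi>1 t)) \<le> H" "L2_norm U (grad U (\<phi>2 t)) \<le> H"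
   using elim(4,5) by linarith+
  have "L2_norm U (w t) \<le> 2 * H" using elim(3) L2_norm_diff_triangle[OF l(1,2)] b(1,2) by linarith
  moreover have "L2_norm U (W t) \<le> 2 * H"
   unfolding W_def[abs_def] using L2_norm_diff_triangle[OF l(3,4)] b(3,4) by linarith
  ultimately have sq: "(L2_norm U (w t))^2 \<le> (2 * H)^2" "(L2_norm U (W t))^2 \<le> (2 * H)^2"
   by (simp_all only: power_mono L2_norm_nonneg)
  have "E t \<le> \<epsilon> / 2 * (2 * H)^2 + (2 * H)^2 / 2"
   unfolding E_def using \<epsilon> sq by (intro add_mono mult_left_mono divide_right_mono) auto
  then show ?thesis by (simp add: power_mult_distrib distrib_right)
 qed
 ultimately show ?case by blast
qed

lemma energy_vanishes: "AE t in lebesgue_on S. E t = 0"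
proof (rule difference_evolution.energy_zero)
 show "difference_evolution U T \<epsilon> ((\<epsilon> + 1) * (2 * H^2)) w m z W (\<lambda>t. grad U (z t)) D N L \<kappa> E"
 proof
  show "w t \<in> L2 U" if "t \<in> {0..T}" for t unfolding w_def[abs_def] by (intro L2_diff s1.w_L2 s2.w_L2 that)
  show "AE x in lebesgue_on U. w 0 x = 0" using s1.w_initial s2.w_initial by eventually_elim (simp add: w_def)
  show "bochner_measurable T (H1 U) (H1_norm U) m" unfolding m_def[abs_def] by (rule bochner_H1_diff[OF U(1) s1.\<mu>_measurable s2.\<mu>_measurable])
  then have "(\<lambda>t. L2_norm U (grad U (m t))) \<in> borel_measurable (lebesgue_on S)" by (intro L2_norm_measurable bochner_H1_grad U)
  moreover have "AE t in lebesgue_on S. (L2_norm U (grad U (m t)))^2 \<le> 4 * k t ^ 2"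
   using m_gradient_bound
  proof eventually_elim
   case (elim t)
   then have "(L2_norm U (grad U (m t)))^2 \<le> (2 * k t)^2" by (rule power_mono[OF _ L2_norm_nonneg])
   then show ?case by (simp add: power_mult_distrib)
  qed
  ultimately show "(\<lambda>t. L2_norm U (grad U (m t))) \<in> L2 S" by (rule L2_time) auto
  show "(\<lambda>t. D t \<nu>) \<in> borel_measurable (lebesgue_on S)" if "\<nu> \<in> H1 U" for \<nu>
   unfolding D_def using s1.l_Lp s2.l_Lp by (intro borel_measurable_diff bochner_dual_measurable[OF U(1) _ that]) (auto simp: bochner_Lp_def)
  show "N \<in> L2 S" unfolding N_def[abs_def] rate_fn_def sup_fn_def
   by (rule L2_time[of _ C 3], measurable) (use estimates C in \<open>auto simp: N_def rate_fn_def sup_fn_def elim!: eventually_mono\<close>)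
  show "L \<in> L2 S" unfolding L_def[abs_def] nonlin_fn_def sup_fn_def
   by (rule L2_time[of _ C 3], measurable) (use estimates C in \<open>auto simp: L_def nonlin_fn_def sup_fn_def elim!: eventually_mono\<close>)
  show "integrable (lebesgue_on S) \<kappa>" unfolding \<kappa>_def[abs_def] by (intro integrable_mult_right k_integrable)
  show "E \<in> borel_measurable (lebesgue_on S)"
  proof (rule borel_measurable_AE_lebesgue_on)
   show "(\<lambda>t. \<epsilon> / 2 * (L2_norm U (W t))^2 + (L2_norm U (\<lambda>x. \<phi>1 t x - \<phi>2 t x))^2 / 2) \<in> borel_measurable (lebesgue_on S)" by measurable
   show "AE t in lebesgue_on S. \<epsilon> / 2 * (L2_norm U (W t))^2 + (L2_norm U (\<lambda>x. \<phi>1 t x - \<phi>2 t x))^2 / 2 = E t"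
    using w_difference by eventually_elim (simp add: E_def)
  qed
  show "AE t in lebesgue_on S. has_grad U (w t) (W t) \<and> has_grad U (z t) (grad U (z t))"
   using w_difference z_gradient by eventually_elim blast
  show "AE t in lebesgue_on S. 0 \<le> N t \<and> (\<forall>\<nu> G. has_grad U \<nu> G \<longrightarrow> \<bar>D t \<nu>\<bar> \<le> N t * L2_norm U G)"
   using estimates by eventually_elim (use N_nonneg in blast)
  show "AE t in lebesgue_on S. L2_norm U (\<lambda>x. grad U (m t) x - grad U (z t) x) + L2_norm U (W t) \<le> L t"
   using z_gradient by eventually_elim blast
  show "AE t in lebesgue_on S. 0 \<le> \<kappa> t \<and> E t \<le> (\<epsilon> + 1) * (2 * H^2) \<and> D t (m t) + N t * L t \<le> \<kappa> t * E t"
   by (rule energy_bounds)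
 qed (use T \<epsilon> U in \<open>simp_all add: w_continuous time_derivative_difference potential_difference D_linear E_def\<close>)
qed

lemma solutions_agree: "AE t in lebesgue_on S. AE x in lebesgue_on U. p1 t x = p2 t x \<and> \<mu>1 t x = \<mu>2 t x \<and> \<phi>1 t x = \<phi>2 t x"
 using energy_vanishes w_difference s1.state s2.state s1.pressure s2.pressure
proof eventually_elim
 case (elim t)
 have "0 \<le> \<epsilon> / 2 * (L2_norm U (W t))^2" using \<epsilon> by simp
 then have "(L2_norm U (w t))^2 \<le> 0" using elim(1) unfolding E_def by linarith
 then have "AE x in lebesgue_on U. w t x = 0" using elim(2) by (intro L2_norm_eq_0_AE) (auto simp: has_grad_def)
 moreover have "AE x in lebesgue_on U. \<phi>1 t x - \<phi>2 t x = w t x" using elim(2) by blast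
 ultimately have phi: "AE x in lebesgue_on U. \<phi>1 t x = \<phi>2 t x" by eventually_elim simp
 note st = states_agree[OF U(1) fin elim(3,4) phi]
 have "AE x in lebesgue_on U. p1 t x = p2 t x"
  using elim(5,6) by (intro pressure_unique[OF U(1,2) fin _ _ _ _ st(2)]) auto
 then show ?case using st(1) phi by eventually_elim blast
qed

end

theorem theorem2p4:
 fixes \<Omega> :: "'a::euclidean_space set"
  and T \<gamma> \<epsilon> C\<^sub>0 :: real
  and \<phi>\<^sub>0 :: "real \<Rightarrow> 'a \<Rightarrow> real"
  and p\<^sub>1 \<mu>\<^sub>1 \<phi>\<^sub>1 p\<^sub>2 \<mu>\<^sub>2 \<phi>\<^sub>2 :: "real \<Rightarrow> 'a \<Rightarrow> real"
 assumes "DIM('a) = 2 \<or> DIM('a) = 3"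
  and "bounded_lipschitz_domain \<Omega>"
  and "0 < T" and "0 < \<gamma>" and "0 < \<epsilon>" and "\<epsilon> < 1"
  and "\<And>e. 0 < e \<Longrightarrow> e < 1 \<Longrightarrow> \<phi>\<^sub>0 e \<in> H1 \<Omega> \<and> energy \<Omega> e (\<phi>\<^sub>0 e) \<le> C\<^sub>0"
  and "class_F \<Omega> T \<gamma> \<epsilon> (\<phi>\<^sub>0 \<epsilon>) p\<^sub>1 \<mu>\<^sub>1 \<phi>\<^sub>1"
  and "class_F \<Omega> T \<gamma> \<epsilon> (\<phi>\<^sub>0 \<epsilon>) p\<^sub>2 \<mu>\<^sub>2 \<phi>\<^sub>2"
 shows "AE t in lebesgue_on {0<..<T}. AE x in lebesgue_on \<Omega>.
      p\<^sub>1 t x = p\<^sub>2 t x \<and> \<mu>\<^sub>1 t x = \<mu>\<^sub>2 t x \<and> \<phi>\<^sub>1 t x = \<phi>\<^sub>2 t x"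
proof -
 note dim = assms(1) and dom = assms(2) and \<gamma> = assms(4) and \<epsilon> = assms(5)
 have \<Omega>: "open \<Omega>" using dom by (simp add: bounded_lipschitz_domain_def)
 obtain l\<^sub>1 w\<^sub>1 H\<^sub>1 where s1: "\<And>H. H\<^sub>1 \<le> H \<Longrightarrow> regular_solution \<Omega> T \<gamma> \<epsilon> H (\<phi>\<^sub>0 \<epsilon>) p\<^sub>1 \<mu>\<^sub>1 \<phi>\<^sub>1 l\<^sub>1 w\<^sub>1"
  using class_F_regular_solution[OF dim \<Omega> assms(8)] by blast
 obtain l\<^sub>2 w\<^sub>2 H\<^sub>2 where s2: "\<And>H. H\<^sub>2 \<le> H \<Longrightarrow> regular_solution \<Omega> T \<gamma> \<epsilon> H (\<phi>\<^sub>0 \<epsilon>) p\<^sub>2 \<mu>\<^sub>2 \<phi>\<^sub>2 l\<^sub>2 w\<^sub>2"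
  using class_F_regular_solution[OF dim \<Omega> assms(9)] by blast
 define H where "H = max 0 (max H\<^sub>1 H\<^sub>2)"
 have H: "0 \<le> H" "H\<^sub>1 \<le> H" "H\<^sub>2 \<le> H" by (auto simp: H_def)
 obtain K C where est: "estimate_constants \<Omega> \<gamma> \<epsilon> H K C" using state_estimate[OF dim dom \<epsilon> \<gamma> H(1)] by blast
 have "solution_pair \<Omega> T \<gamma> \<epsilon> H (\<phi>\<^sub>0 \<epsilon>) p\<^sub>1 \<mu>\<^sub>1 \<phi>\<^sub>1 l\<^sub>1 w\<^sub>1 p\<^sub>2 \<mu>\<^sub>2 \<phi>\<^sub>2 l\<^sub>2 w\<^sub>2 K C"
  unfolding solution_pair_def solution_pair_axioms_def
  using s1[OF H(2)] s2[OF H(3)] dim dom assms(3) \<gamma> \<epsilon> H(1) est by blast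
 then show ?thesis by (rule solution_pair.solutions_agree)
qed

end
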